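(* A quadrilateral tiling of a compact connected surface without boundary is the quadrilateral subdivision $T(4)$ of some tiling $T$ if and only if it is possible to label some vertices by $\bullet$ and some other vertices by $\circ$ such that every tile is of type $Q$ or $Q'$, where: a tile of type $Q$ is a non-degenerate quadrilateral with one $\bullet$-vertex, one $\circ$-vertex not adjacent to it (i.e. opposite), and two further unlabelled vertices of degree $4$; a tile of type $Q'$ is obtained from such a quadrilateral (with corners $\bullet$, $w_1$, $\circ$, $w_2$ in cyclic order) by identifying the two unlabelled corners $w_1,w_2$ into a single unlabelled vertex of degree $4$, in a twisted way, so that the union of the tile with a small disk neighborhood of that vertex is a Möbius band.
   Context: A tiling of a compact connected surface without boundary is a graph embedded in the surface such that the complementary regions (tiles) are open disks; tilings are edge-to-edge, every vertex has degree at least $3$, every tile has at least $3$ edges, and tiles may be degenerate (boundary not a simple closed curve); a polygon is non-degenerate if its boundary is a simple closed curve. A quadrilateral tiling has $4$ edges along each tile boundary. Quadrilateral subdivision: given a tiling $T$, choose a middle point on each edge and a center point in each tile, and join the center of each tile to the middle point of each edge on the tile's boundary (once for each occurrence of the edge on the boundary). The resulting quadrilateral tiling is $T(4)$ (the union of $T$ and its dual); no orientation is needed. *)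

theory Defs
  imports "HOL-Analysis.Analysis"
begin

definition closed_surface :: "'a topology \<Rightarrow> bool" where
  "closed_surface X \<longleftrightarrow>
     topspace X \<noteq> {} \<and> compact_space X \<and> connected_space X \<and> Hausdorff_space X \<and>
     (\<forall>x\<in>topspace X. \<exists>U. openin X U \<and> x \<in> U \<and>
        subtopology X U homeomorphic_space top_of_set (ball (0::complex) 1))"


text \<open>
  Graphs embedded in a space: a finite set \<open>V\<close> of points and a finite set \<open>E\<close> of edges, each edge
  being the set of all its points, including its ends. An edge may be a loop, and several edges may
  join the same vertices.
\<close>

definition edge_path :: "'a topology \<Rightarrow> 'a set \<Rightarrow> (real \<Rightarrow> 'a) \<Rightarrow> bool" where
  "edge_path X V g \<longleftrightarrow>
     pathin X g \<and> inj_on g {0<..<1} \<and> g ` {0<..<1} \<inter> V = {} \<and> g 0 \<in> V \<and> g 1 \<in> V"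

definition embedded_graph :: "'a topology \<Rightarrow> 'a set \<Rightarrow> 'a set set \<Rightarrow> bool" where
  "embedded_graph X V E \<longleftrightarrow>
     finite V \<and> V \<subseteq> topspace X \<and> finite E \<and>
     (\<forall>e\<in>E. \<exists>g. edge_path X V g \<and> e = g ` {0..1}) \<and>
     (\<forall>e\<in>E. \<forall>f\<in>E. e \<noteq> f \<longrightarrow> e \<inter> f \<subseteq> V)"

text \<open>The second summand makes a loop count twice.\<close>

definition degree :: "'a set \<Rightarrow> 'a set set \<Rightarrow> 'a \<Rightarrow> nat" where
  "degree V E v = card {e \<in> E. v \<in> e} + card {e \<in> E. e \<inter> V = {v}}"

definition tiles :: "'a topology \<Rightarrow> 'a set \<Rightarrow> 'a set set \<Rightarrow> 'a set set" where
  "tiles X V E = connected_components_of (subtopology X (topspace X - (V \<union> \<Union>E)))"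


text \<open>
  The closed unit disk serves as the standard \<open>n\<close>-gon, with the \<open>n\<close>-th roots of unity as corners.
  A polygon map exhibits a tile as an \<open>n\<close>-gon whose sides run along edges of the graph; an edge that
  occurs twice on the boundary of the tile is the image of two sides, and corners may be identified.
  Thus the tile has \<open>n\<close> edges along its boundary, counted with multiplicity, if and only if it has
  a polygon map with \<open>n\<close> sides.
\<close>

definition boundary_point :: "nat \<Rightarrow> real \<Rightarrow> complex" where
  "boundary_point n s = cis (2 * pi * s / real n)"

definition side :: "nat \<Rightarrow> (complex \<Rightarrow> 'a) \<Rightarrow> nat \<Rightarrow> real \<Rightarrow> 'a" where
  "side n \<phi> j = (\<lambda>s. \<phi> (boundary_point n (real j + s)))"

definition corner :: "nat \<Rightarrow> (complex \<Rightarrow> 'a) \<Rightarrow> nat \<Rightarrow> 'a" where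
  "corner n \<phi> j = \<phi> (boundary_point n (real j))"

definition polygon_map ::
  "'a topology \<Rightarrow> 'a set \<Rightarrow> 'a set set \<Rightarrow> 'a set \<Rightarrow> nat \<Rightarrow> (complex \<Rightarrow> 'a) \<Rightarrow> bool" where
  "polygon_map X V E t n \<phi> \<longleftrightarrow>
     0 < n \<and>
     continuous_map (top_of_set (cball 0 1)) X \<phi> \<and>
     homeomorphic_map (top_of_set (ball 0 1)) (subtopology X t) \<phi> \<and>
     (\<forall>j<n. edge_path X V (side n \<phi> j) \<and> side n \<phi> j ` {0..1} \<in> E)"

definition tiling :: "'a topology \<Rightarrow> 'a set \<Rightarrow> 'a set set \<Rightarrow> bool" where
  "tiling X V E \<longleftrightarrow>
     embedded_graph X V E \<and>
     (\<forall>v\<in>V. 3 \<le> degree V E v) \<and>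
     (\<forall>t\<in>tiles X V E. subtopology X t homeomorphic_space top_of_set (ball (0::complex) 1)) \<and>
     (\<forall>t\<in>tiles X V E. \<exists>n\<ge>3. \<exists>\<phi>. polygon_map X V E t n \<phi>)"

definition quadrilateral_tiling :: "'a topology \<Rightarrow> 'a set \<Rightarrow> 'a set set \<Rightarrow> bool" where
  "quadrilateral_tiling X V E \<longleftrightarrow>
     tiling X V E \<and> (\<forall>t\<in>tiles X V E. \<exists>\<phi>. polygon_map X V E t 4 \<phi>)"


text \<open>
  \<open>(V', E')\<close> is a quadrilateral subdivision of \<open>(V, E)\<close>. The parametrisation \<open>\<gamma> e\<close> chooses
  the middle point \<open>\<gamma> e (1/2)\<close> of the edge \<open>e\<close>; the polygon map \<open>\<phi> t\<close> chooses the center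
  \<open>\<phi> t 0\<close> of the tile \<open>t\<close> and, as the images of radii, the arcs joining the center to the middle
  points, one for each of the \<open>n t\<close> sides of \<open>t\<close>.
\<close>

definition quadrilateral_subdivision ::
  "'a topology \<Rightarrow> 'a set \<Rightarrow> 'a set set \<Rightarrow> 'a set \<Rightarrow> 'a set set \<Rightarrow> bool" where
  "quadrilateral_subdivision X V E V' E' \<longleftrightarrow>
     (\<exists>(\<gamma> :: 'a set \<Rightarrow> real \<Rightarrow> 'a) (n :: 'a set \<Rightarrow> nat) (\<phi> :: 'a set \<Rightarrow> complex \<Rightarrow> 'a).
        (\<forall>e\<in>E. edge_path X V (\<gamma> e) \<and> \<gamma> e ` {0..1} = e) \<and>
        (\<forall>t\<in>tiles X V E. polygon_map X V E t (n t) (\<phi> t) \<and>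
           (\<forall>j<n t. side (n t) (\<phi> t) j (1/2) = \<gamma> (side (n t) (\<phi> t) j ` {0..1}) (1/2))) \<and>
        V' = V \<union> {\<gamma> e (1/2) | e. e \<in> E} \<union> {\<phi> t 0 | t. t \<in> tiles X V E} \<and>
        E' = {\<gamma> e ` {0..1/2} | e. e \<in> E} \<union> {\<gamma> e ` {1/2..1} | e. e \<in> E} \<union>
             {\<phi> t ` closed_segment 0 (boundary_point (n t) (real j + 1/2)) | t j.
                t \<in> tiles X V E \<and> j < n t})"


text \<open>
  The quotient of the rectangle by the identification of \<open>(0, y)\<close> with \<open>(1, -y)\<close>, up to
  homeomorphism.
\<close>

definition moebius_band :: "'a topology \<Rightarrow> bool" where
  "moebius_band M \<longleftrightarrow>
     (\<exists>q :: real \<times> real \<Rightarrow> 'a.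
        quotient_map (top_of_set ({0..1} \<times> {-1..1})) M q \<and>
        (\<forall>x\<in>{0..1} \<times> {-1..1}. \<forall>x'\<in>{0..1} \<times> {-1..1}.
           q x = q x' \<longleftrightarrow>
             x = x' \<or> (\<exists>y. x = (0, y) \<and> x' = (1, -y) \<or> x = (1, -y) \<and> x' = (0, y))))"

definition closed_disk_nbhd :: "'a topology \<Rightarrow> 'a \<Rightarrow> 'a set \<Rightarrow> bool" where
  "closed_disk_nbhd X w D \<longleftrightarrow>
     D \<subseteq> topspace X \<and> w \<in> X interior_of D \<and>
     subtopology X D homeomorphic_space top_of_set (cball (0::complex) 1)"

text \<open>
  In both tile types \<open>B\<close> and \<open>W\<close> are the sets of vertices labelled \<open>\<bullet>\<close> and \<open>\<circ>\<close>. The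
  boundary of the tile is a simple closed curve in \<open>type_Q\<close>, and in \<open>type_Q'\<close> it is one up to
  the identification of the two opposite corners \<open>1\<close> and \<open>3\<close>. Points inside the tile need not
  be considered, since a polygon map is injective there.
\<close>

definition type_Q ::
  "'a topology \<Rightarrow> 'a set \<Rightarrow> 'a set set \<Rightarrow> 'a set \<Rightarrow> 'a set \<Rightarrow> 'a set \<Rightarrow> bool" where
  "type_Q X V E B W t \<longleftrightarrow>
     (\<exists>\<phi>. polygon_map X V E t 4 \<phi> \<and> inj_on \<phi> (sphere 0 1) \<and>
        corner 4 \<phi> 0 \<in> B \<and> corner 4 \<phi> 2 \<in> W \<and>
        (\<forall>j\<in>{1, 3}. corner 4 \<phi> j \<in> V - (B \<union> W) \<and> degree V E (corner 4 \<phi> j) = 4))"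

text \<open>
  The Moebius band here is the compact one, so the closed tile and a closed disk are used. As an
  arbitrary disk may meet the tile in a complicated set, the disk is required to exist inside every
  neighbourhood of the vertex, rather than being arbitrary.
\<close>

definition type_Q' ::
  "'a topology \<Rightarrow> 'a set \<Rightarrow> 'a set set \<Rightarrow> 'a set \<Rightarrow> 'a set \<Rightarrow> 'a set \<Rightarrow> bool" where
  "type_Q' X V E B W t \<longleftrightarrow>
     (\<exists>\<phi> w. polygon_map X V E t 4 \<phi> \<and>
        corner 4 \<phi> 0 \<in> B \<and> corner 4 \<phi> 2 \<in> W \<and>
        corner 4 \<phi> 1 = w \<and> corner 4 \<phi> 3 = w \<and>
        w \<in> V - (B \<union> W) \<and> degree V E w = 4 \<and>
        (\<forall>x\<in>sphere 0 1. \<forall>y\<in>sphere 0 1. \<phi> x = \<phi> y \<longrightarrow>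
           x = y \<or> {x, y} = {boundary_point 4 1, boundary_point 4 3}) \<and>
        (\<forall>N. openin X N \<and> w \<in> N \<longrightarrow>
           (\<exists>D. closed_disk_nbhd X w D \<and> D \<subseteq> N \<and>
                moebius_band (subtopology X (X closure_of t \<union> D)))))"

end

theory Submission
  imports Defs
begin

text \<open>
  In \<open>T(4)\<close> the tile at the corner \<open>v\<close> of a tile \<open>t\<close> of \<open>T\<close> is a sector of \<open>t\<close>; label \<open>v\<close> by
  \<open>\<bullet>\<close> and the centers by \<open>\<circ>\<close>. Two boundary points of a sector can only coincide if the two sides of
  \<open>t\<close> at \<open>v\<close> are the same edge. A fold would give \<open>v\<close> the degree \<open>1\<close>, so the edge is a loop that is
  glued with a twist, and the sector is of type \<open>Q'\<close>.

  Conversely, the quadrilaterals around a \<open>\<circ>\<close>-vertex \<open>c\<close> are distinct, since turning around \<open>c\<close> never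
  leads back to the same quadrilateral with the reversed orientation. They are therefore the sectors of
  one disk, with center \<open>c\<close>. An unlabelled vertex has degree \<open>4\<close> and lies on exactly two edges that
  come from \<open>\<bullet>\<close>, which are joined to one edge of \<open>T\<close>. All this is read off polygon maps by means of
  invariance of domain.
\<close>

section \<open>Closed surfaces\<close>

text \<open>The equivalence is combinatorial, but none of the combinatorics is given:
  \<open>tiling\<close> provides only a parametrisation of each tile by a disk. That there are
  finitely many tiles, and that exactly two sides run along each edge, has to be extracted from the
  local shape of a surface; none, one or three sides would contradict it near the middle of the
  edge. A polygon map may run along a side at any speed, and a loop cannot be inverted at its ends.
  Therefore all polygon maps are adapted to one fixed parametrisation per edge; two sides are then
  glued by \<open>s = s'\<close> or by \<open>s = 1 - s'\<close>, and this sign distinguishes folds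
  from twists. The number of sides used in a subdivision is chosen independently of the one that
  witnesses \<open>tiling\<close>; a count of sides over all edges shows that they agree. This
  excludes monogons, whose only sector would be the whole disk.\<close>

lemma closed_surfaceD:
  assumes "closed_surface X"
  shows "compact_space X" "Hausdorff_space X" "connected_space X"
  using assms by (auto simp: closed_surface_def)

lemma closed_surface_chart:
  assumes "closed_surface X" "x \<in> topspace X"
  obtains U h k where "openin X U" "x \<in> U"
    "homeomorphic_maps (subtopology X U) (top_of_set (ball (0::complex) 1)) h k"
  using assms unfolding closed_surface_def homeomorphic_space_def by blast

text \<open>Invariance of domain in the plane, transported by charts: near \<open>f z\<close> a
  chart \<open>h\<close> turns \<open>f\<close> into an injective continuous map between plane sets,
  and the inverse chart \<open>k\<close> carries its open image back to \<open>X\<close>.\<close>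

lemma closed_surface_invariance_of_domain:
  fixes U :: "complex set"
  assumes X: "closed_surface X" and U: "open U"
    and f: "continuous_map (top_of_set U) X f" and inj: "inj_on f U"
  shows "openin X (f ` U)"
  unfolding openin_subopen [of X "f ` U"]
proof (intro ballI)
  fix x assume "x \<in> f ` U"
  then obtain z where z: "z \<in> U" "x = f z" by blast
  have "f z \<in> topspace X"
    using f z by (auto simp: continuous_map_def)
  then obtain N h k where N: "openin X N" "f z \<in> N"
    and hk: "homeomorphic_maps (subtopology X N) (top_of_set (ball (0::complex) 1)) h k"
    using closed_surface_chart [OF X] by blast
  define U' where "U' = {z \<in> U. f z \<in> N}"
  have "openin (top_of_set U) U'"
    using openin_continuous_map_preimage [OF f N(1)] by (simp add: U'_def)
  then have U': "open U'"
    using U openin_open_trans by blast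
  have fU': "continuous_map (top_of_set U') (subtopology X N) f"
    using f by (auto simp: continuous_map_in_subtopology U'_def
      intro: continuous_map_from_subtopology_mono)
  have hf: "continuous_map (top_of_set U') (top_of_set (ball 0 1)) (h \<circ> f)"
    using fU' hk continuous_map_compose unfolding homeomorphic_maps_def by blast
  have Ntop: "topspace (subtopology X N) = N"
    using N(1) openin_subset by (metis topspace_subtopology_subset)
  have injh: "inj_on h N"
    using hk Ntop unfolding homeomorphic_maps_def by (metis inj_on_inverseI)
  have "inj_on (h \<circ> f) U'"
    using injh inj by (auto simp: inj_on_def U'_def)
  moreover have "continuous_on U' (h \<circ> f)"
    using hf by (simp add: continuous_map_in_subtopology)
  ultimately have opA: "open ((h \<circ> f) ` U')"
    using U' invariance_of_domain by blast
  have sub: "(h \<circ> f) ` U' \<subseteq> ball 0 1"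
    using hf by (auto simp: continuous_map_def)
  have "homeomorphic_map (top_of_set (ball 0 1)) (subtopology X N) k"
    using hk homeomorphic_maps_map homeomorphic_maps_sym by blast
  then have "openin (subtopology X N) (k ` ((h \<circ> f) ` U'))"
    using opA sub unfolding homeomorphic_eq_everything_map open_map_def
    by (metis openin_open_eq open_ball)
  moreover have "k ` ((h \<circ> f) ` U') = f ` U'"
    unfolding image_image o_def
    by (rule image_cong) (use hk Ntop in \<open>auto simp: homeomorphic_maps_def U'_def\<close>)
  ultimately have "openin X (f ` U')"
    using N(1) openin_trans_full by metis
  then show "\<exists>T. openin X T \<and> x \<in> T \<and> T \<subseteq> f ` U"
    using z N by (intro exI [of _ "f ` U'"]) (auto simp: U'_def)
qed

text \<open>A continuous map from a compact space to a Hausdorff space is closed, and closed maps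
  restrict to full preimages. Injectivity is asked only over \<open>T\<close>, because the maps in
  question identify boundary points: the ends of a loop, or sides of a polygon.\<close>

lemma homeomorphic_map_compact_preimage:
  fixes K :: "'b::t2_space set"
  assumes K: "compact K" and X: "Hausdorff_space X"
    and f: "continuous_map (top_of_set K) X f" and inj: "inj_on f {z \<in> K. f z \<in> T}"
    and T: "T \<subseteq> f ` K"
  shows "homeomorphic_map (top_of_set {z \<in> K. f z \<in> T}) (subtopology X T) f"
proof -
  have cl: "closed_map (top_of_set K) X f"
    using continuous_imp_closed_map f X K by (metis compact_space_subtopology compactin_euclidean_iff)
  have "closed_map (subtopology (top_of_set K) {z \<in> K. f z \<in> T}) (subtopology X T) f"
    by (rule closed_map_restriction [OF cl]) auto
  moreover have "subtopology (top_of_set K) {z \<in> K. f z \<in> T} = top_of_set {z \<in> K. f z \<in> T}"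
    by (simp add: subtopology_subtopology Int_absorb1 Collect_restrict)
  ultimately have "closed_map (top_of_set {z \<in> K. f z \<in> T}) (subtopology X T) f"
    by simp
  moreover have "continuous_map (top_of_set {z \<in> K. f z \<in> T}) (subtopology X T) f"
    using f by (auto simp: continuous_map_in_subtopology intro: continuous_map_from_subtopology_mono)
  moreover have "f ` {z \<in> K. f z \<in> T} = topspace (subtopology X T)"
    using T f by (auto simp: continuous_map_def)
  ultimately show ?thesis
    using inj by (simp add: bijective_closed_imp_homeomorphic_map)
qed

text \<open>Invariance of domain read backwards: over \<open>T\<close> the map is a homeomorphism,
  so charts of \<open>X\<close> followed by its inverse embed open plane sets into \<open>K\<close>.
  This refutes local models of \<open>X\<close> that are thinner than a plane disk, such as an arc
  or a half disk with its diameter.\<close>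

lemma closed_surface_open_preimage:
  fixes K :: "complex set"
  assumes X: "closed_surface X" and K: "compact K"
    and f: "continuous_map (top_of_set K) X f"
    and T: "openin X T" "T \<subseteq> f ` K" and inj: "inj_on f {z \<in> K. f z \<in> T}"
  shows "open {z \<in> K. f z \<in> T}"
proof -
  have "homeomorphic_map (top_of_set {z \<in> K. f z \<in> T}) (subtopology X T) f"
    by (rule homeomorphic_map_compact_preimage) (use assms closed_surfaceD in auto)
  then obtain g where g: "homeomorphic_maps (top_of_set {z \<in> K. f z \<in> T}) (subtopology X T) f g"
    using homeomorphic_map_maps by blast
  have Ttop: "topspace (subtopology X T) = T"
    using T(1) openin_subset by (metis topspace_subtopology_subset)
  show ?thesis
    unfolding open_subopen [of "{z \<in> K. f z \<in> T}"]
  proof (intro ballI)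
    fix z assume z: "z \<in> {z \<in> K. f z \<in> T}"
    then have "f z \<in> topspace X"
      using f by (auto simp: continuous_map_def)
    then obtain N h k where N: "openin X N" "f z \<in> N"
      and hk: "homeomorphic_maps (subtopology X N) (top_of_set (ball (0::complex) 1)) h k"
      using closed_surface_chart [OF X] by blast
    have Ntop: "topspace (subtopology X N) = N"
      using N(1) openin_subset by (metis topspace_subtopology_subset)
    define A where "A = h ` (N \<inter> T)"
    have "homeomorphic_map (subtopology X N) (top_of_set (ball 0 1)) h"
      using hk homeomorphic_maps_map by blast
    moreover have "openin (subtopology X N) (N \<inter> T)"
      using T(1) N(1) by (simp add: openin_subtopology_Int2)
    ultimately have "openin (top_of_set (ball 0 1)) A"
      unfolding A_def homeomorphic_eq_everything_map open_map_def by blast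
    then have A: "open A" "A \<subseteq> ball 0 1"
      using openin_open_trans openin_imp_subset by (blast, blast)
    have kA: "k y \<in> N \<inter> T" "h (k y) = y" if "y \<in> A" for y
      using that hk Ntop by (auto simp: A_def homeomorphic_maps_def)
    have "continuous_map (top_of_set A) (subtopology X T) k"
      using hk kA A(2) unfolding homeomorphic_maps_def
      by (auto simp: continuous_map_in_subtopology intro: continuous_map_from_subtopology_mono)
    then have "continuous_map (top_of_set A) (top_of_set {z \<in> K. f z \<in> T}) (g \<circ> k)"
      using g continuous_map_compose unfolding homeomorphic_maps_def by blast
    then have c: "continuous_on A (g \<circ> k)" and r: "(g \<circ> k) ` A \<subseteq> {z \<in> K. f z \<in> T}"
      by (auto simp: continuous_map_in_subtopology)
    have "inj_on (g \<circ> k) A"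
    proof (rule inj_on_inverseI [where g = "h \<circ> f"])
      fix y assume "y \<in> A"
      then show "(h \<circ> f) ((g \<circ> k) y) = y"
        using kA g Ttop by (auto simp: homeomorphic_maps_def)
    qed
    then have "open ((g \<circ> k) ` A)"
      using invariance_of_domain c A(1) by blast
    moreover have "z \<in> (g \<circ> k) ` A"
    proof (rule image_eqI [of _ _ "h (f z)"])
      have "k (h (f z)) = f z"
        using hk Ntop N(2) by (auto simp: homeomorphic_maps_def)
      then show "z = (g \<circ> k) (h (f z))"
        using g z by (auto simp: homeomorphic_maps_def)
      show "h (f z) \<in> A"
        using z N by (auto simp: A_def)
    qed
    ultimately show "\<exists>S. open S \<and> z \<in> S \<and> S \<subseteq> {z \<in> K. f z \<in> T}"
      using r by blast
  qed
qed

text \<open>A plane disk stays connected when its center is removed. A set that is open and closed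
  in such a punctured disk and accumulates at \<open>v\<close> must therefore fill it, which is how
  neighbourhoods of vertices are recognised.\<close>

lemma closed_surface_punctured_nbhd:
  assumes X: "closed_surface X" and v: "v \<in> topspace X" and F: "closedin X F" "v \<notin> F"
  obtains U where "openin X U" "v \<in> U" "U \<inter> F = {}" "connectedin X (U - {v})"
proof -
  obtain N h k where N: "openin X N" "v \<in> N"
    and hk: "homeomorphic_maps (subtopology X N) (top_of_set (ball (0::complex) 1)) h k"
    using closed_surface_chart [OF X v] by blast
  have Ntop: "topspace (subtopology X N) = N"
    using N(1) openin_subset by (metis topspace_subtopology_subset)
  have hmap: "homeomorphic_map (subtopology X N) (top_of_set (ball 0 1)) h"
    and kmap: "homeomorphic_map (top_of_set (ball 0 1)) (subtopology X N) k"
    using hk homeomorphic_maps_map by blast+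
  have "openin (subtopology X N) (N - F)"
    using F(1) N(1) openin_diff by (simp add: openin_open_subtopology openin_diff)
  then have "openin (top_of_set (ball 0 1)) (h ` (N - F))"
    using hmap unfolding homeomorphic_eq_everything_map open_map_def by blast
  then have "open (h ` (N - F))"
    using openin_open_trans by blast
  moreover have "h v \<in> h ` (N - F)"
    using N F by blast
  ultimately obtain e where e: "e > 0" "ball (h v) e \<subseteq> h ` (N - F)"
    using open_contains_ball by blast
  have sub: "h ` (N - F) \<subseteq> ball 0 1"
    using hk Ntop by (auto simp: homeomorphic_maps_def continuous_map_def)
  define U where "U = k ` ball (h v) e"
  have kh: "k (h x) = x" if "x \<in> N" for x
    using that hk Ntop by (auto simp: homeomorphic_maps_def)
  have UNF: "U \<subseteq> N - F"
  proof
    fix u assume "u \<in> U"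
    then obtain y where y: "y \<in> ball (h v) e" "u = k y" by (auto simp: U_def)
    then obtain x where "x \<in> N - F" "y = h x" using e by blast
    then show "u \<in> N - F" using y kh by auto
  qed
  have "openin (subtopology X N) U"
    using kmap e sub unfolding homeomorphic_eq_everything_map open_map_def U_def
    by (auto simp: openin_open_eq)
  then have op: "openin X U"
    using N(1) openin_trans_full by metis
  have vU: "v \<in> U"
    unfolding U_def using kh [OF N(2)] e(1) by (metis centre_in_ball image_eqI)
  have inj: "inj_on k (ball 0 1)"
    using hk unfolding homeomorphic_maps_def by (metis inj_on_inverseI topspace_euclidean_subtopology)
  have sub': "ball (h v) e \<subseteq> ball 0 1" using e sub by blast
  have "U - {v} = k ` (ball (h v) e - {h v})"
  proof -
    have "k ` (ball (h v) e - {h v}) = k ` ball (h v) e - k ` {h v}"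
      using inj sub' e(1) by (intro inj_on_image_set_diff [of _ "ball 0 1"])
        (use centre_in_ball in blast)+
    then show ?thesis using kh [OF N(2)] by (simp add: U_def)
  qed
  moreover have "connected (ball (h v) e - {h v})"
    using e(1) by (intro connected_punctured_convex) (auto simp: aff_dim_open)
  moreover have "continuous_map (top_of_set (ball (h v) e)) X k"
    using kmap sub' unfolding homeomorphic_eq_everything_map
    by (auto simp: continuous_map_in_subtopology intro: continuous_map_from_subtopology_mono)
  ultimately have "connectedin X (U - {v})"
    using connectedin_continuous_map_image [of "top_of_set (ball (h v) e)" X k "ball (h v) e - {h v}"]
    by (auto simp: connectedin_subtopology)
  then show ?thesis
    using op vU UNF that by blast
qed

lemma connectedin_open_disjoint:
  assumes "connectedin X S" "openin X A" "openin X B" "S \<subseteq> A \<union> B" "A \<inter> B \<inter> S = {}" "A \<inter> S \<noteq> {}"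
  shows "B \<inter> S = {}"
  using assms by (metis connectedin)

text \<open>A punctured disk neighbourhood of \<open>v\<close> that avoids \<open>F\<close> is connected, and \<open>N\<close> meets it in a
  clopen set.\<close>
lemma closed_surface_local_cover:
  assumes X: "closed_surface X" and v: "v \<in> topspace X"
    and cl: "closedin X (N \<union> F)" and F: "closedin X F" "v \<notin> F"
    and op: "openin X (N - {v})" and v_cl: "v \<in> X closure_of (N - {v})"
  obtains U where "openin X U" "v \<in> U" "U - {v} \<subseteq> N"
proof -
  obtain U where U: "openin X U" "v \<in> U" "U \<inter> F = {}" "connectedin X (U - {v})"
    using closed_surface_punctured_nbhd [OF X v F] by blast
  have "U - {v} \<subseteq> (N - {v}) \<union> (topspace X - (N \<union> F))"
    using U openin_subset by fastforce
  moreover have "(N - {v}) \<inter> (topspace X - (N \<union> F)) \<inter> (U - {v}) = {}"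
    by blast
  moreover have "(N - {v}) \<inter> (U - {v}) \<noteq> {}"
    using v_cl U by (auto simp: in_closure_of)
  ultimately have "(topspace X - (N \<union> F)) \<inter> (U - {v}) = {}"
    using connectedin_open_disjoint [OF U(4) op openin_diff [OF openin_topspace cl]] by blast
  then have "U - {v} \<subseteq> N"
    using U openin_subset by fastforce
  then show ?thesis using U that by blast
qed

text \<open>Tiles are defined as components, so the tiles of a newly built graph are identified by a
  partition of its complement. This serves for the sectors of a subdivision and for the stars of a
  reconstructed tiling.\<close>

lemma connected_components_of_eqI:
  assumes op: "\<And>u. u \<in> \<U> \<Longrightarrow> openin X u" and con: "\<And>u. u \<in> \<U> \<Longrightarrow> connectedin X u"
    and ne: "\<And>u. u \<in> \<U> \<Longrightarrow> u \<noteq> {}" and disj: "pairwise disjnt \<U>" and S: "\<Union>\<U> = S"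
  shows "connected_components_of (subtopology X S) = \<U>"
proof -
  have Stop: "topspace (subtopology X S) = S"
    using op S openin_subset by (metis Sup_le_iff topspace_subtopology_subset)
  have con': "connectedin (subtopology X S) u" if "u \<in> \<U>" for u
    using con S that by (auto simp: connectedin_subtopology)
  have comp: "u = connected_component_of_set (subtopology X S) x" if u: "u \<in> \<U>" "x \<in> u" for u x
  proof (rule antisym)
    let ?C = "connected_component_of_set (subtopology X S) x"
    show "u \<subseteq> ?C"
      by (rule connected_component_of_maximal [OF con' [OF u(1)] u(2)])
    have C: "connectedin X ?C" "?C \<subseteq> S"
      using connectedin_connected_component_of [of "subtopology X S" x]
      by (auto simp: connectedin_subtopology)
    \<comment> \<open>The other members together form one open set, so the connected component of
      \<open>x\<close> cannot leave \<open>u\<close>.\<close>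
    have "openin X (\<Union>(\<U> - {u}))"
      using op by blast
    moreover have "?C \<subseteq> u \<union> \<Union>(\<U> - {u})"
      using C S by blast
    moreover have "u \<inter> \<Union>(\<U> - {u}) \<inter> ?C = {}"
      using disj u unfolding pairwise_def disjnt_def by blast
    moreover have "x \<in> u \<inter> ?C"
      using u S Stop connected_component_of_refl by fastforce
    ultimately have "\<Union>(\<U> - {u}) \<inter> ?C = {}"
      using connectedin_open_disjoint [OF C(1) op [OF u(1)]] by blast
    then show "?C \<subseteq> u"
      using C S by blast
  qed
  show ?thesis
  proof (intro equalityI subsetI)
    fix C assume "C \<in> connected_components_of (subtopology X S)"
    then obtain x where "x \<in> S" "C = connected_component_of_set (subtopology X S) x"
      using Stop by (auto simp: connected_components_of_def)
    then show "C \<in> \<U>"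
      using comp S by blast
  next
    fix u assume u: "u \<in> \<U>"
    then obtain x where "x \<in> u" using ne by blast
    then show "u \<in> connected_components_of (subtopology X S)"
      using comp [OF u] u S Stop by (auto simp: connected_components_of_def)
  qed
qed

lemma continuous_image_compact_closedin:
  fixes K :: "'b::t2_space set"
  assumes "compact K" "Hausdorff_space X" "continuous_map (top_of_set S) X f" "K \<subseteq> S"
  shows "closedin X (f ` K)"
  using assms by (metis compactin_euclidean_iff compactin_imp_closedin compactin_subtopology
      image_compactin)

section \<open>Sectors of the unit disk\<close>

text \<open>The angle is counted in sides of the \<open>n\<close>-gon: corners lie at integers,
  middles of sides at half-integers, and a full turn is \<open>n\<close>.\<close>

definition polar :: "nat \<Rightarrow> real \<Rightarrow> real \<Rightarrow> complex" where
  "polar n r s = r *\<^sub>R boundary_point n s"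

lemma norm_boundary_point [simp]: "norm (boundary_point n s) = 1"
  by (simp add: boundary_point_def)

lemma norm_polar [simp]: "norm (polar n r s) = \<bar>r\<bar>"
  by (simp add: polar_def)

lemma polar_1 [simp]: "polar n 1 s = boundary_point n s"
  and polar_0 [simp]: "polar n 0 s = 0"
  by (simp_all add: polar_def)

lemma boundary_point_add: "boundary_point n (s + t) = boundary_point n s * boundary_point n t"
  by (simp add: boundary_point_def cis_mult add_divide_distrib distrib_left)

lemma boundary_point_0 [simp]: "boundary_point n 0 = 1"
  by (simp add: boundary_point_def)

lemma cnj_boundary_point: "cnj (boundary_point n s) = boundary_point n (- s)"
  by (simp add: boundary_point_def cis_cnj)

lemma cnj_polar: "cnj (polar n r s) = polar n r (- s)"
  by (simp add: polar_def scaleR_conv_of_real cnj_boundary_point)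

lemma boundary_point_eq_iff:
  assumes "0 < n"
  shows "boundary_point n s = boundary_point n t \<longleftrightarrow> (\<exists>k::int. s = t + of_int k * real n)"
proof -
  have "boundary_point n s = boundary_point n t \<longleftrightarrow>
      (\<exists>k::int. 2 * pi * s / real n = 2 * pi * t / real n + 2 * pi * k)"
    unfolding boundary_point_def complex_eq_iff sin_cos_eq_iff [symmetric] by auto
  also have "\<dots> \<longleftrightarrow> (\<exists>k::int. s = t + of_int k * real n)"
  proof -
    have "2 * pi * s / real n = 2 * pi * t / real n + 2 * pi * k \<longleftrightarrow> s = t + k * real n" for k
    proof -
      have "2 * pi * t / real n + 2 * pi * k = 2 * pi * (t + k * real n) / real n"
        using assms by (simp add: field_simps)
      then show ?thesis using assms by simp
    qed
    then show ?thesis by simp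
  qed
  finally show ?thesis .
qed

lemma boundary_point_add_int [simp]:
  "0 < n \<Longrightarrow> boundary_point n (s + of_int k * real n) = boundary_point n s"
  by (auto simp: boundary_point_eq_iff)

lemma boundary_point_add_period [simp]: "0 < n \<Longrightarrow> boundary_point n (s + real n) = boundary_point n s"
  using boundary_point_add_int [of n s 1] by simp

lemma boundary_point_inj:
  assumes "0 < n" "\<bar>s - t\<bar> < real n" "boundary_point n s = boundary_point n t"
  shows "s = t"
proof -
  obtain k :: int where k: "s = t + of_int k * real n"
    using assms boundary_point_eq_iff by blast
  then have "\<bar>of_int k :: real\<bar> * real n < 1 * real n"
    using assms by (simp add: abs_mult)
  then have "k = 0"
    using assms(1) by (metis mult_less_cancel_right_pos of_int_abs of_int_less_1_iff of_nat_0_less_iff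
        zabs_less_one_iff)
  then show ?thesis using k by simp
qed

lemma polar_eq_iff:
  assumes "0 < r" "0 \<le> r'"
  shows "polar n r s = polar n' r' s' \<longleftrightarrow> r = r' \<and> boundary_point n s = boundary_point n' s'"
proof
  assume eq: "polar n r s = polar n' r' s'"
  then have "r = r'"
    using assms by (metis abs_of_nonneg abs_of_pos norm_polar)
  then show "r = r' \<and> boundary_point n s = boundary_point n' s'"
    using eq assms by (simp add: polar_def)
qed (simp add: polar_def)

lemma continuous_on_boundary_point [continuous_intros]:
  "continuous_on S f \<Longrightarrow> continuous_on S (\<lambda>x. boundary_point n (f x))"
  unfolding boundary_point_def divide_inverse by (intro continuous_intros)

lemma continuous_on_polar [continuous_intros]:
  "continuous_on S f \<Longrightarrow> continuous_on S g \<Longrightarrow> continuous_on S (\<lambda>x. polar n (f x) (g x))"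
  unfolding polar_def by (intro continuous_intros)

lemma polar_exists:
  assumes "0 < n"
  obtains s where "a \<le> s" "s < a + real n" "z = polar n (norm z) s"
proof -
  define s0 where "s0 = real n * Arg z / (2 * pi)"
  \<comment> \<open>The number of full turns to be removed so that the angle enters the window that
    starts at \<open>a\<close>.\<close>
  define k where "k = \<lfloor>(s0 - a) / real n\<rfloor>"
  define s where "s = s0 + of_int (- k) * real n"
  have "of_int k \<le> (s0 - a) / real n" "(s0 - a) / real n < of_int k + 1"
    unfolding k_def by linarith+
  then have "a \<le> s" "s < a + real n"
    using assms by (auto simp: s_def field_simps)
  moreover have "z = polar n (norm z) s"
  proof -
    have "polar n (norm z) s = norm z *\<^sub>R boundary_point n s0"
      unfolding polar_def s_def using assms by (simp only: boundary_point_add_int)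
    also have "\<dots> = rcis (cmod z) (Arg z)"
      using assms by (simp add: s0_def boundary_point_def rcis_def scaleR_conv_of_real)
    finally show ?thesis by (simp add: rcis_cmod_Arg)
  qed
  ultimately show ?thesis using that by blast
qed

lemma boundary_point_exists:
  assumes "0 < n" "norm z = 1"
  obtains s where "a \<le> s" "s < a + real n" "z = boundary_point n s"
  using polar_exists [OF assms(1), of a z] assms(2) by (metis polar_1)

lemma nat_add_frac_exists:
  assumes "0 \<le> s" "s < real n"
  obtains j t where "j < n" "0 \<le> t" "t < 1" "s = real j + t"
proof (rule that [of "nat \<lfloor>s\<rfloor>" "s - of_int \<lfloor>s\<rfloor>"])
  show "nat \<lfloor>s\<rfloor> < n"
    using assms by linarith
  show "0 \<le> s - of_int \<lfloor>s\<rfloor>" "s - of_int \<lfloor>s\<rfloor> < 1"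
    by linarith+
  show "s = real (nat \<lfloor>s\<rfloor>) + (s - of_int \<lfloor>s\<rfloor>)"
    using assms by simp
qed

text \<open>The shift by \<open>1/2\<close> is there because the part of a tile that belongs to
  corner \<open>j\<close> reaches half a side in both directions.\<close>

lemma nat_near_exists:
  assumes "- 1/2 \<le> s" "s < real n - 1/2"
  obtains j t where "j < n" "- 1/2 \<le> t" "t < 1/2" "s = real j + t"
proof -
  obtain j t where "j < n" "0 \<le> t" "t < 1" "s + 1/2 = real j + t"
    using nat_add_frac_exists [of "s + 1/2" n] assms by auto
  then show ?thesis
    by (intro that [of j "t - 1/2"]) auto
qed

lemma polar_cball_exists:
  assumes "0 < n" "z \<in> cball 0 1"
  obtains r j t where "0 \<le> r" "r \<le> 1" "j < n" "- 1/2 \<le> t" "t < 1/2" "z = polar n r (real j + t)"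
proof -
  obtain s where s: "- 1/2 \<le> s" "s < - 1/2 + real n" "z = polar n (norm z) s"
    using polar_exists [OF assms(1)] by blast
  obtain j t where "j < n" "- 1/2 \<le> t" "t < 1/2" "s = real j + t"
    using nat_near_exists [of s n] s by auto
  then show ?thesis
    using s assms by (intro that [of "norm z" j t]) auto
qed

lemma nat_frac_boundary_point_eq:
  assumes "0 < n" "i < n" "j < n" "0 < s" "s < 1" "0 < t" "t < 1"
    and eq: "boundary_point n (real i + s) = boundary_point n (real j + t)"
  shows "i = j \<and> s = t"
proof -
  have "\<bar>(real i + s) - (real j + t)\<bar> < real n"
    using assms by linarith
  then have eq': "real i + s = real j + t"
    using boundary_point_inj assms by blast
  then have "real i < real (Suc j)" "real j < real (Suc i)"
    using assms by linarith+
  then have "i = j" by linarith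
  then show ?thesis
    using eq' by simp
qed

text \<open>Unbounded in the radius, so that it is an open neighbourhood in the plane even for
  points of the unit circle; its intersection with the unit ball is an open sector.\<close>

definition wedge :: "nat \<Rightarrow> real \<Rightarrow> real \<Rightarrow> complex set" where
  "wedge n a b = {polar n r s | r s. 0 < r \<and> a < s \<and> s < b}"

lemma wedgeI: "\<lbrakk>0 < r; a < s; s < b\<rbrakk> \<Longrightarrow> polar n r s \<in> wedge n a b"
  by (auto simp: wedge_def)

text \<open>Polar coordinates are injective on positive radii and an open interval of angles no
  longer than a full turn, so invariance of domain applies.\<close>

lemma open_wedge:
  assumes "0 < n" "b - a \<le> real n"
  shows "open (wedge n a b)"
proof -
  let ?U = "{z. 0 < Re z} \<inter> {z. a < Im z} \<inter> {z. Im z < b}"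
  have "open ?U"
    by (intro open_Int open_halfspace_Re_gt open_halfspace_Im_gt open_halfspace_Im_lt)
  moreover have "inj_on (\<lambda>z. polar n (Re z) (Im z)) ?U"
  proof (rule inj_onI)
    fix x y assume xy: "x \<in> ?U" "y \<in> ?U" "polar n (Re x) (Im x) = polar n (Re y) (Im y)"
    then have "\<bar>Im x - Im y\<bar> < real n"
      using assms by auto
    with xy show "x = y"
      using assms boundary_point_inj [of n "Im x" "Im y"] by (simp add: polar_eq_iff complex_eqI)
  qed
  moreover have "continuous_on ?U (\<lambda>z. polar n (Re z) (Im z))"
    by (intro continuous_intros)
  ultimately have "open ((\<lambda>z. polar n (Re z) (Im z)) ` ?U)"
    using invariance_of_domain by blast
  moreover have "(\<lambda>z. polar n (Re z) (Im z)) ` ?U = wedge n a b"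
  proof
    show "wedge n a b \<subseteq> (\<lambda>z. polar n (Re z) (Im z)) ` ?U"
    proof
      fix w assume "w \<in> wedge n a b"
      then obtain r s where "w = polar n r s" "0 < r" "a < s" "s < b" by (auto simp: wedge_def)
      then show "w \<in> (\<lambda>z. polar n (Re z) (Im z)) ` ?U"
        by (intro image_eqI [of _ _ "Complex r s"]) auto
    qed
  qed (auto simp: wedge_def)
  ultimately show ?thesis by simp
qed

text \<open>The case \<open>a = b\<close> is meaningful: it is a single radius.\<close>

definition sector :: "nat \<Rightarrow> real \<Rightarrow> real \<Rightarrow> complex set" where
  "sector n a b = {polar n r s | r s. 0 \<le> r \<and> r \<le> 1 \<and> a \<le> s \<and> s \<le> b}"

lemma sectorI: "\<lbrakk>0 \<le> r; r \<le> 1; a \<le> s; s \<le> b\<rbrakk> \<Longrightarrow> polar n r s \<in> sector n a b"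
  by (auto simp: sector_def)

lemma compact_sector: "compact (sector n a b)"
proof -
  have "sector n a b = (\<lambda>(r, s). polar n r s) ` ({0..1} \<times> {a..b})"
    by (force simp: sector_def)
  then show ?thesis
    by (auto intro!: compact_continuous_image compact_Times continuous_intros
        simp: split_beta)
qed

lemma sector_subset_cball: "sector n a b \<subseteq> cball 0 1"
  by (auto simp: sector_def)

text \<open>The circle is the quotient of \<open>{0..real n}\<close> by its two ends, since
  \<open>boundary_point n\<close> maps a compact space continuously onto a Hausdorff space.\<close>

lemma circle_map_exists:
  assumes n: "0 < n" and f: "continuous_map (top_of_set {0..real n}) X f" and ends: "f 0 = f (real n)"
  obtains g where "continuous_map (top_of_set (sphere 0 1)) X g"
    "\<And>s. \<lbrakk>0 \<le> s; s \<le> real n\<rbrakk> \<Longrightarrow> g (boundary_point n s) = f s"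
proof -
  have q: "quotient_map (top_of_set {0..real n}) (top_of_set (sphere 0 1)) (boundary_point n)"
  proof (rule continuous_imp_quotient_map)
    show "continuous_map (top_of_set {0..real n}) (top_of_set (sphere 0 1)) (boundary_point n)"
      using continuous_on_boundary_point [OF continuous_on_id, of "{0..real n}" n]
      by (auto simp: continuous_map_in_subtopology)
    show "compact_space (top_of_set {0..real n})"
      by (simp add: compact_space_subtopology)
    show "Hausdorff_space (top_of_set (sphere 0 1))"
      by (simp add: Hausdorff_space_subtopology)
    show "boundary_point n ` topspace (top_of_set {0..real n}) = topspace (top_of_set (sphere 0 1))"
    proof -
      have "z \<in> boundary_point n ` {0..real n}" if z: "norm z = 1" for z
      proof -
        obtain s where "0 \<le> s" "s < 0 + real n" "z = boundary_point n s"
          using boundary_point_exists [OF n z] by blast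
        then show ?thesis by auto
      qed
      then show ?thesis by auto
    qed
  qed
  have "f s = f t"
    if st: "s \<in> {0..real n}" "t \<in> {0..real n}" "boundary_point n s = boundary_point n t" for s t
  proof -
    consider "\<bar>s - t\<bar> < real n" | "s = 0" "t = real n" | "s = real n" "t = 0"
      using st by fastforce
    then show ?thesis
      using boundary_point_inj [OF n _ st(3)] ends by cases auto
  qed
  then obtain g where "continuous_map (top_of_set (sphere 0 1)) X g"
      "\<And>x. x \<in> topspace (top_of_set {0..real n}) \<Longrightarrow> g (boundary_point n x) = f x"
    using quotient_map_lift_exists [OF q f] by (metis topspace_euclidean_subtopology)
  then show ?thesis using that by auto
qed

lemma continuous_map_concat:
  assumes n: "0 < n" and c: "\<And>i. i < n \<Longrightarrow> continuous_map (top_of_set {0..1::real}) X (g i)"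
    and m: "\<And>i. Suc i < n \<Longrightarrow> g i 1 = g (Suc i) 0"
  obtains f where "continuous_map (top_of_set {0..real n}) X f"
    "\<And>i s. \<lbrakk>i < n; 0 \<le> s; s \<le> 1\<rbrakk> \<Longrightarrow> f (real i + s) = g i s"
proof -
  let ?T = "\<lambda>i. {real i..real i + 1}"
  have cov: "\<exists>i<n. x \<in> ?T i" if "x \<in> {0..real n}" for x
  proof (cases "x = real n")
    case True
    then show ?thesis using n by (intro exI [of _ "n - 1"]) auto
  next
    case False
    obtain j t where "j < n" "0 \<le> t" "t < 1" "x = real j + t"
      by (rule nat_add_frac_exists [of x n]) (use \<open>x \<in> {0..real n}\<close> False in auto)
    then show ?thesis by (intro exI [of _ j]) auto
  qed
  obtain f where f: "continuous_map (top_of_set {0..real n}) X f"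
    "\<And>x i. \<lbrakk>i \<in> {..<n}; x \<in> topspace (top_of_set {0..real n}) \<inter> ?T i\<rbrakk> \<Longrightarrow> f x = g i (x - real i)"
  proof (rule pasting_lemma_exists_closed [of "{..<n}" "top_of_set {0..real n}" ?T X "\<lambda>i x. g i (x - real i)"])
    show "topspace (top_of_set {0..real n}) \<subseteq> \<Union> (?T ` {..<n})"
      using cov by fastforce
    show "closedin (top_of_set {0..real n}) (?T i)" if "i \<in> {..<n}" for i
      using that by (intro closed_subset) auto
    show "continuous_map (subtopology (top_of_set {0..real n}) (?T i)) X (\<lambda>x. g i (x - real i))"
      if "i \<in> {..<n}" for i
    proof -
      have "continuous_map (top_of_set (?T i)) (top_of_set {0..1}) (\<lambda>x. x - real i)"
        by (auto simp: continuous_map_in_subtopology intro!: continuous_intros)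
      from continuous_map_compose [OF this c] that
      have "continuous_map (top_of_set (?T i)) X (\<lambda>x. g i (x - real i))"
        by (simp add: o_def)
      then show ?thesis
        by (metis continuous_map_from_subtopology inf_commute subtopology_subtopology)
    qed
    have main: "g i (x - real i) = g j (x - real j)"
      if "i < j" "j < n" "x \<in> ?T i \<inter> ?T j" for i j x
    proof -
      have "j = Suc i" "x = real j" using that by auto
      then show ?thesis using m [of i] that by simp
    qed
    then show "g i (x - real i) = g j (x - real j)"
      if "i \<in> {..<n}" "j \<in> {..<n}" "x \<in> topspace (top_of_set {0..real n}) \<inter> ?T i \<inter> ?T j" for i j x
    proof (cases i j rule: linorder_cases)
      case less
      show ?thesis by (rule main) (use less that in auto)
    next
      case greater
      show ?thesis by (rule main [symmetric]) (use greater that in auto)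
    qed simp
  qed auto
  show ?thesis
  proof (rule that [OF f(1)])
    fix i s assume "i < n" "0 \<le> s" "s \<le> (1::real)"
    then have "real i + s \<le> real n" by linarith
    then show "f (real i + s) = g i s"
      using f(2) [of i "real i + s"] \<open>i < n\<close> \<open>0 \<le> s\<close> \<open>s \<le> 1\<close> by simp
  qed
qed

section \<open>Coning a boundary curve to a map of the disk, and the sector as a
  quadrilateral\<close>

lemma convex_frontier_ray_unique:
  fixes C :: "'b::euclidean_space set"
  assumes C: "convex C" and c: "c \<in> interior C" and x: "c + r *\<^sub>R d \<in> frontier C"
    and y: "c + s *\<^sub>R d \<in> closure C" and rs: "0 < r" "r \<le> s"
  shows "r = s"
proof (rule ccontr)
  assume "r \<noteq> s"
  then have "r < s" using rs by simp
  have "d \<noteq> 0"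
    using x c by (auto simp: frontier_def)
  \<comment> \<open>For \<open>r < s\<close> the frontier point lies strictly between an interior
    point and a point of the closure, where all points are interior.\<close>
  have "c + r *\<^sub>R d \<in> open_segment c (c + s *\<^sub>R d)"
    unfolding in_segment
    using \<open>r < s\<close> rs \<open>d \<noteq> 0\<close> by (auto intro!: exI [of _ "r / s"] simp: algebra_simps)
  then have "c + r *\<^sub>R d \<in> interior C"
    using in_interior_closure_convex_segment [OF C c y] by blast
  then show False
    using x by (simp add: frontier_def)
qed

text \<open>The cone over the boundary curve with apex \<open>c\<close>: radii go affinely to
  segments from \<open>c\<close>. It is injective because a ray from an interior point of a convex
  set meets the frontier only once, and onto because every ray leaves a bounded set.\<close>

lemma radial_extension:
  fixes C :: "complex set" and g :: "complex \<Rightarrow> complex"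
  assumes C: "compact C" "convex C" and c: "c \<in> interior C"
    and g: "continuous_on (sphere 0 1) g" "inj_on g (sphere 0 1)" "g ` sphere 0 1 = frontier C"
  obtains G where "continuous_on (cball 0 1) G" "inj_on G (cball 0 1)" "G ` cball 0 1 = C"
    "G ` ball 0 1 = interior C"
    "\<And>r u. \<lbrakk>0 \<le> r; r \<le> 1; norm u = 1\<rbrakk> \<Longrightarrow> G (r *\<^sub>R u) = c + r *\<^sub>R (g u - c)"
proof -
  define G where "G z = (if z = 0 then c else c + norm z *\<^sub>R (g (z /\<^sub>R norm z) - c))" for z :: complex
  have G: "G (r *\<^sub>R u) = c + r *\<^sub>R (g u - c)" if "0 \<le> r" "norm u = 1" for r u
    using that by (auto simp: G_def)
  have dec: "\<exists>r u. z = r *\<^sub>R u \<and> norm u = 1 \<and> r = norm z" for z :: complex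
  proof (cases "z = 0")
    case True
    then show ?thesis by (intro exI [of _ 0] exI [of _ 1]) auto
  next
    case False
    then show ?thesis
      by (intro exI [of _ "norm z"] exI [of _ "z /\<^sub>R norm z"]) auto
  qed
  have fr: "g u \<in> frontier C" if "norm u = 1" for u
    using g(3) that by auto
  have cl: "closure C = C" using C by (simp add: compact_imp_closed)
  have frC: "frontier C \<subseteq> C" using C compact_imp_closed frontier_subset_closed by blast
  have gc: "g u \<noteq> c" if "norm u = 1" for u
    using fr [OF that] c by (auto simp: frontier_def)
  have inter: "c + r *\<^sub>R (g u - c) \<in> interior C" if "0 \<le> r" "r < 1" "norm u = 1" for r u
  proof (cases "r = 0")
    case False
    then have "c + r *\<^sub>R (g u - c) \<in> open_segment c (g u)"
      unfolding in_segment using that gc [of u]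
      by (auto intro!: exI [of _ r] simp: algebra_simps)
    then show ?thesis
      using in_interior_closure_convex_segment [OF C(2) c, of "g u"] fr [OF that(3)]
      by (auto simp: frontier_def)
  qed (use c in simp)
  have cont: "continuous_on (cball 0 1) G"
  proof -
    have bdd: "bounded (frontier C)"
      using C(1) frC by (meson bounded_subset compact_imp_bounded)
    then obtain M where M: "\<And>x. x \<in> frontier C \<Longrightarrow> norm (x - c) \<le> M"
      by (metis bounded_any_center dist_commute dist_norm)
    have "isCont G z \<or> continuous (at z within cball 0 1) G" if z: "z \<in> cball 0 1" for z
    proof (cases "z = 0")
      case True
      \<comment> \<open>At the apex the formula divides by \<open>norm z\<close>, but the curve is
        bounded, so \<open>G z\<close> differs from \<open>c\<close> by at most
        \<open>M * norm z\<close>.\<close>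
      have "((\<lambda>z::complex. M * norm z) \<longlongrightarrow> M * norm (0::complex)) (at 0)"
        by (rule tendsto_mult [OF tendsto_const tendsto_norm [OF tendsto_ident_at]])
      moreover have "norm (G z - c) \<le> M * norm z" for z
      proof -
        obtain r u where ru: "z = r *\<^sub>R u" "norm u = 1" "r = norm z" using dec by blast
        have "G z = c + r *\<^sub>R (g u - c)"
          unfolding ru(1) by (rule G) (use ru in auto)
        then have "norm (G z - c) = norm z * norm (g u - c)"
          using ru(3) by simp
        then show ?thesis
          using mult_left_mono [OF M [OF fr [OF ru(2)]], of "norm z"] by (simp add: mult.commute)
      qed
      ultimately have "((\<lambda>z. G z - c) \<longlongrightarrow> 0) (at 0)"
        by (intro Lim_null_comparison [OF always_eventually, of "\<lambda>z. G z - c" "\<lambda>z. M * norm z"]) simp_all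
      then have "(G \<longlongrightarrow> G 0) (at 0)"
        using LIM_zero_cancel [of G c] by (simp add: G_def)
      then show ?thesis using True by (simp add: isCont_def)
    next
      case False
      have "continuous_on (- {0}) (\<lambda>z. c + norm z *\<^sub>R (g (z /\<^sub>R norm z) - c))"
        by (intro continuous_intros continuous_on_compose2 [OF g(1)]) (auto, metis left_inverse norm_eq_zero)
      then have "continuous_on (- {0}) G"
        by (rule continuous_on_eq) (auto simp: G_def)
      then show ?thesis
        using False by (simp add: continuous_on_eq_continuous_at open_Compl)
    qed
    then show ?thesis
      using continuous_at_imp_continuous_at_within continuous_on_eq_continuous_within by blast
  qed
  have inj: "inj_on G (cball 0 1)"
  proof (rule inj_onI)
    fix x y assume xy: "x \<in> cball 0 1" "y \<in> cball 0 1" "G x = G y"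
    obtain r u where x: "x = r *\<^sub>R u" "norm u = 1" "0 \<le> r" using dec by (metis norm_ge_zero)
    obtain s v where y: "y = s *\<^sub>R v" "norm v = 1" "0 \<le> s" using dec by (metis norm_ge_zero)
    have eq: "r *\<^sub>R (g u - c) = s *\<^sub>R (g v - c)"
      using xy(3) x y G [of r u] G [of s v] by simp
    have rs: "0 \<le> r" "0 \<le> s" using x y by auto
    show "x = y"
    proof (cases "r = 0 \<or> s = 0")
      case True
      then have "r = 0 \<and> s = 0"
        using eq gc [OF x(2)] gc [OF y(2)] by auto
      then show ?thesis using x y by simp
    next
      case False
      then have pos: "0 < r" "0 < s" using rs by auto
      \<comment> \<open>If two points of the cone agree, the two points of the curve lie on one ray
        from \<open>c\<close>; there the frontier point is unique, so the ratio of their distances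
        from \<open>c\<close> is \<open>1\<close>.\<close>
      have *: "a = b" if "norm u = 1" "norm v = 1" "a *\<^sub>R (g u - c) = b *\<^sub>R (g v - c)" "0 < a" "a \<le> b"
        for a b u v
      proof -
        have e: "g u = c + (b / a) *\<^sub>R (g v - c)"
        proof -
          have "g u - c = (1 / a) *\<^sub>R (a *\<^sub>R (g u - c))"
            using that(4) by simp
          also have "\<dots> = (b / a) *\<^sub>R (g v - c)"
            unfolding that(3) by simp
          finally show ?thesis by (metis add.commute diff_add_cancel)
        qed
        have "1 = b / a"
          by (rule convex_frontier_ray_unique [OF C(2) c, of _ "g v - c"])
            (use e that fr [OF that(1)] fr [OF that(2)] frC cl in auto)
        then show ?thesis using that by simp
      qed
      have "r = s"
        using * [OF x(2) y(2) eq] * [OF y(2) x(2) eq [symmetric]] pos by linarith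
      then have "g u = g v" using eq pos by simp
      then have "u = v" using g(2) x y by (auto simp: inj_on_def)
      then show ?thesis using x y \<open>r = s\<close> by simp
    qed
  qed
  have im1: "G ` ball 0 1 \<subseteq> interior C"
  proof clarify
    fix z :: complex assume "z \<in> ball 0 1"
    then show "G z \<in> interior C"
      using dec [of z] G inter by (metis mem_ball_0 norm_ge_zero)
  qed
  have im2: "G z \<in> frontier C" if "norm z = 1" for z
    using G [of 1 z] fr that by simp
  have im3: "\<exists>r u. 0 \<le> r \<and> r \<le> 1 \<and> norm u = 1 \<and> x = c + r *\<^sub>R (g u - c)" if "x \<in> C" for x
  proof (cases "x = c")
    case True
    then show ?thesis by (intro exI [of _ 0] exI [of _ 1]) auto
  next
    case False
    then obtain d where d: "0 < d" "c + d *\<^sub>R (x - c) \<in> frontier C"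
      using ray_to_frontier [OF compact_imp_bounded [OF C(1)] c, of "x - c"] by (metis right_minus_eq)
    then obtain u where u: "norm u = 1" "g u = c + d *\<^sub>R (x - c)"
      using g(3) by force
    have "d \<ge> 1"
      using convex_frontier_ray_unique [OF C(2) c d(2), of 1] that cl d by fastforce
    then show ?thesis
      using u d by (intro exI [of _ "1/d"] exI [of _ u]) auto
  qed
  have im: "G ` cball 0 1 = C"
  proof
    show "G ` cball 0 1 \<subseteq> C"
      using im1 im2 frC interior_subset by (force simp: image_subset_iff)
    show "C \<subseteq> G ` cball 0 1"
    proof
      fix x assume "x \<in> C"
      then obtain r u where "0 \<le> r" "r \<le> 1" "norm u = 1" "x = c + r *\<^sub>R (g u - c)"
        using im3 by blast
      then show "x \<in> G ` cball 0 1"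
        using G by (intro image_eqI [of _ _ "r *\<^sub>R u"]) auto
    qed
  qed
  have "interior C \<subseteq> G ` ball 0 1"
  proof
    fix x assume x: "x \<in> interior C"
    then obtain z where z: "z \<in> cball 0 1" "x = G z"
      using im interior_subset by blast
    have "norm z \<noteq> 1"
      using im2 [of z] x z by (auto simp: frontier_def)
    then show "x \<in> G ` ball 0 1" using z by auto
  qed
  then show ?thesis
    using that [OF cont inj im] im1 G by auto
qed


text \<open>A sector of half-angle \<open>a\<close> is cut out by the lines through its two bounding
  rays; the bound \<open>a \<le> pi / 2\<close> is what makes it convex.\<close>

lemma sin_sector_iff:
  assumes "- pi \<le> \<theta>" "\<theta> < pi" "0 < a" "a \<le> pi / 2"
  shows "sin (\<theta> - a) \<le> 0 \<and> 0 \<le> sin (\<theta> + a) \<longleftrightarrow> \<bar>\<theta>\<bar> \<le> a"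
    and "sin (\<theta> - a) < 0 \<and> 0 < sin (\<theta> + a) \<longleftrightarrow> \<bar>\<theta>\<bar> < a"
proof -
  have 1: "0 < sin (\<theta> - a)" if "a < \<theta>"
    using that assms by (intro sin_gt_zero) auto
  have 2: "0 < sin (- (\<theta> + a))" if "\<theta> < - a"
    using that assms by (intro sin_gt_zero) auto
  have 3: "0 \<le> sin (- (\<theta> - a))" "0 \<le> sin (\<theta> + a)" if "\<bar>\<theta>\<bar> \<le> a"
    using that assms by (intro sin_ge_zero; linarith)+
  have 4: "0 < sin (- (\<theta> - a))" "0 < sin (\<theta> + a)" if "\<bar>\<theta>\<bar> < a"
    using that assms by (intro sin_gt_zero; linarith)+
  have eq: "sin (- (\<theta> - a)) = - sin (\<theta> - a)" "sin (- (\<theta> + a)) = - sin (\<theta> + a)"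
    by (rule sin_minus)+
  show *: "sin (\<theta> - a) \<le> 0 \<and> 0 \<le> sin (\<theta> + a) \<longleftrightarrow> \<bar>\<theta>\<bar> \<le> a"
    using 1 2 3 eq by linarith
  have "sin (\<theta> - a) = 0" if "\<theta> = a" using that by simp
  moreover have "sin (\<theta> + a) = 0" if "\<theta> = - a" using that by simp
  ultimately show "sin (\<theta> - a) < 0 \<and> 0 < sin (\<theta> + a) \<longleftrightarrow> \<bar>\<theta>\<bar> < a"
    using * 4 eq by linarith
qed

text \<open>Multiplying the direction of a ray by \<open>\<i>\<close> gives a normal; the inner
  product is the signed distance from the line through the ray.\<close>

lemma inner_boundary_point_polar:
  "inner (\<i> * boundary_point n s) (polar n r t) = r * sin (2 * pi * (t - s) / real n)"
proof -
  have "2 * pi * (t - s) / real n = 2 * pi * t / real n - 2 * pi * s / real n"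
    by (simp add: diff_divide_distrib right_diff_distrib)
  then show ?thesis
    by (simp only: sin_diff) (simp add: inner_complex_def polar_def boundary_point_def algebra_simps)
qed

text \<open>With at least two sides the opening angle \<open>2 * pi / n\<close> is at most
  \<open>pi\<close>, so a sector is the disk cut by two half-planes. This yields the convexity and
  the interior that the cone construction asks for.\<close>

lemma sector_eq_halfplanes:
  assumes n: "2 \<le> n"
  shows "sector n (c - 1/2) (c + 1/2) = cball 0 1 \<inter> {z. inner (\<i> * boundary_point n (c + 1/2)) z \<le> 0}
           \<inter> {z. inner (\<i> * boundary_point n (c - 1/2)) z \<ge> 0}" (is "?S = ?H")
    and "ball 0 1 \<inter> wedge n (c - 1/2) (c + 1/2) = ball 0 1 \<inter> {z. inner (\<i> * boundary_point n (c + 1/2)) z < 0}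
           \<inter> {z. inner (\<i> * boundary_point n (c - 1/2)) z > 0}" (is "?S' = ?H'")
proof -
  let ?a = "pi / real n"
  have a: "0 < ?a" "?a \<le> pi / 2"
    using n by (auto simp: field_simps)
  have tr: "2 * pi * (c + t - (c + 1/2)) / real n = 2 * pi * t / real n - ?a"
      "2 * pi * (c + t - (c - 1/2)) / real n = 2 * pi * t / real n + ?a" for t
    using n by (auto simp: field_simps)
  have sc: "\<bar>2 * pi * t / real n\<bar> \<le> ?a \<longleftrightarrow> \<bar>t\<bar> \<le> 1/2" "\<bar>2 * pi * t / real n\<bar> < ?a \<longleftrightarrow> \<bar>t\<bar> < 1/2" for t
    using n by (auto simp: abs_mult field_simps)
  have rng: "- pi \<le> 2 * pi * t / real n" "2 * pi * t / real n < pi"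
    if "- real n / 2 \<le> t" "t < real n / 2" for t
    using n that mult_left_mono [of "- real n" "2 * t" pi] mult_strict_left_mono [of "2 * t" "real n" pi]
    by (auto simp: field_simps)
  have iff: "inner (\<i> * boundary_point n (c + 1/2)) (polar n r (c + t)) \<le> 0 \<and>
      0 \<le> inner (\<i> * boundary_point n (c - 1/2)) (polar n r (c + t)) \<longleftrightarrow> \<bar>t\<bar> \<le> 1/2"
      "inner (\<i> * boundary_point n (c + 1/2)) (polar n r (c + t)) < 0 \<and>
      0 < inner (\<i> * boundary_point n (c - 1/2)) (polar n r (c + t)) \<longleftrightarrow> \<bar>t\<bar> < 1/2"
    if "0 < r" "- real n / 2 \<le> t" "t < real n / 2" for r t
    unfolding inner_boundary_point_polar tr
    using sin_sector_iff [OF rng [OF that(2,3)] a] sc [of t] that(1)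
    by (auto simp: mult_le_0_iff zero_le_mult_iff mult_less_0_iff zero_less_mult_iff)
  have ex: "\<exists>t. - real n / 2 \<le> t \<and> t < real n / 2 \<and> z = polar n (norm z) (c + t)" for z
  proof -
    obtain s where "c - real n / 2 \<le> s" "s < c - real n / 2 + real n" "z = polar n (norm z) s"
      using polar_exists [of n "c - real n / 2" z] n by auto
    then show ?thesis by (intro exI [of _ "s - c"]) auto
  qed
  have half: "\<bar>t\<bar> < 1/2 \<Longrightarrow> - real n / 2 \<le> t \<and> t < real n / 2" for t
    using n by auto
  show "?S = ?H"
  proof (intro equalityI subsetI)
    fix z assume "z \<in> ?S"
    then obtain r s where rs: "0 \<le> r" "r \<le> 1" "c - 1/2 \<le> s" "s \<le> c + 1/2" "z = polar n r s"
      by (auto simp: sector_def)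
    have "inner (\<i> * boundary_point n (c + 1/2)) z \<le> 0 \<and> 0 \<le> inner (\<i> * boundary_point n (c - 1/2)) z"
    proof -
      have "\<bar>2 * pi * (s - c) / real n\<bar> \<le> ?a"
        using sc(1) [of "s - c"] rs by linarith
      then have "0 \<le> sin (?a - 2 * pi * (s - c) / real n)" "0 \<le> sin (2 * pi * (s - c) / real n + ?a)"
        using a by (intro sin_ge_zero; linarith)+
      then show ?thesis
        using rs tr [of "s - c"] sin_minus [of "?a - 2 * pi * (s - c) / real n"]
        by (simp add: inner_boundary_point_polar mult_le_0_iff zero_le_mult_iff)
    qed
    then show "z \<in> ?H" using rs by simp
  next
    fix z assume z: "z \<in> ?H"
    obtain t where t: "- real n / 2 \<le> t" "t < real n / 2" "z = polar n (norm z) (c + t)"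
      using ex by blast
    show "z \<in> ?S"
    proof (cases "z = 0")
      case True
      moreover have "polar n 0 c \<in> ?S" unfolding sector_def by fastforce
      ultimately show ?thesis by simp
    next
      case False
      then have "\<bar>t\<bar> \<le> 1/2"
        using iff(1) [of "norm z" t] t z by auto
      then show ?thesis
        using z by (subst t(3)) (auto intro!: sectorI)
    qed
  qed
  show "?S' = ?H'"
  proof (intro equalityI subsetI)
    fix z assume "z \<in> ?S'"
    then obtain r s where rs: "0 < r" "r < 1" "c - 1/2 < s" "s < c + 1/2" "z = polar n r s"
      by (auto simp: wedge_def)
    then have "\<bar>s - c\<bar> < 1/2" by linarith
    then show "z \<in> ?H'"
      using iff(2) [of r "s - c"] half [of "s - c"] rs by simp
  next
    fix z assume z: "z \<in> ?H'"
    obtain t where t: "- real n / 2 \<le> t" "t < real n / 2" "z = polar n (norm z) (c + t)"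
      using ex by blast
    have "z \<noteq> 0" using z by auto
    then have "\<bar>t\<bar> < 1/2"
      using iff(2) [of "norm z" t] t z by auto
    then show "z \<in> ?S'"
      using z \<open>z \<noteq> 0\<close> by (subst t(3)) (auto intro!: wedgeI)
  qed
qed

lemma
  assumes n: "2 \<le> n"
  shows convex_sector: "convex (sector n (c - 1/2) (c + 1/2))"
    and interior_sector: "interior (sector n (c - 1/2) (c + 1/2)) = ball 0 1 \<inter> wedge n (c - 1/2) (c + 1/2)"
proof -
  show "convex (sector n (c - 1/2) (c + 1/2))"
    unfolding sector_eq_halfplanes(1) [OF n]
    by (intro convex_Int convex_cball convex_halfspace_le convex_halfspace_ge)
  have "\<i> * boundary_point n s \<noteq> 0" for s
    using norm_boundary_point [of n s] by (metis mult_eq_0_iff norm_zero zero_neq_one complex_i_not_zero)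
  then show "interior (sector n (c - 1/2) (c + 1/2)) = ball 0 1 \<inter> wedge n (c - 1/2) (c + 1/2)"
    unfolding sector_eq_halfplanes [OF n] by simp
qed

text \<open>The standard quadrilateral is mapped onto the sector around position \<open>c\<close>:
  its corner \<open>0\<close> goes to that point of the circle, \<open>1\<close> and
  \<open>3\<close> to the points half a side away, \<open>2\<close> to the center of the disk. The
  boundary formulas are exact and not up to reparametrisation, so that half-edges and radii can be
  compared point by point later.\<close>

lemma sector_map_exists:
  assumes n: "2 \<le> n"
  obtains G where "continuous_on (cball 0 1) G" "inj_on G (cball 0 1)"
    "G ` cball 0 1 = sector n (c - 1/2) (c + 1/2)"
    "G ` ball 0 1 = ball 0 1 \<inter> wedge n (c - 1/2) (c + 1/2)"
    "\<And>s. \<lbrakk>0 \<le> s; s \<le> 1\<rbrakk> \<Longrightarrow> G (boundary_point 4 s) = boundary_point n (c + s/2)"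
    "\<And>s. \<lbrakk>0 \<le> s; s \<le> 1\<rbrakk> \<Longrightarrow> G (boundary_point 4 (- s)) = boundary_point n (c - s/2)"
    "\<And>s. \<lbrakk>0 \<le> s; s \<le> 1\<rbrakk> \<Longrightarrow> G (boundary_point 4 (2 - s)) = polar n s (c + 1/2)"
    "\<And>s. \<lbrakk>0 \<le> s; s \<le> 1\<rbrakk> \<Longrightarrow> G (boundary_point 4 (2 + s)) = polar n s (c - 1/2)"
proof -
  let ?C = "sector n (c - 1/2) (c + 1/2)"
  \<comment> \<open>The boundary of the sector, closed up after \<open>4\<close> units: half a side
    forward, a radius inward, the other radius outward, half a side back to the start. Radius and
    angle are capped, so that each formula covers two of the four pieces.\<close>
  define f where "f s = (if s \<le> 2 then polar n (min 1 (2 - s)) (c + min (s/2) (1/2))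
      else polar n (min 1 (s - 2)) (c + max (- 1/2) ((s - 4)/2)))" for s
  have cf: "continuous_on {0..4} f"
    unfolding f_def
    by (rule continuous_on_cases_le) (auto intro!: continuous_intros)
  have n0: "0 < n" using n by simp
  have f04: "f 0 = f (real 4)"
    by (simp add: f_def)
  have cf4: "continuous_map (top_of_set {0..real 4}) euclidean f"
    using cf by simp
  obtain g where g: "continuous_map (top_of_set (sphere 0 1)) euclidean g"
    "\<And>s. \<lbrakk>0 \<le> s; s \<le> real 4\<rbrakk> \<Longrightarrow> g (boundary_point 4 s) = f s"
    using circle_map_exists [OF zero_less_numeral cf4 f04] by blast
  have ex: "\<exists>s. 0 \<le> s \<and> s < 4 \<and> z = boundary_point 4 s" if "norm z = 1" for z
  proof -
    obtain s where "0 \<le> s" "s < 0 + real 4" "z = boundary_point 4 s"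
      by (rule boundary_point_exists [of 4 z 0]) (use \<open>norm z = 1\<close> in simp_all)
    then show ?thesis by auto
  qed
  have inj: "inj_on g (sphere 0 1)"
  proof (rule inj_onI)
    fix x y assume xy: "x \<in> sphere 0 1" "y \<in> sphere 0 1" "g x = g y"
    obtain s where s: "0 \<le> s" "s < 4" "x = boundary_point 4 s" using ex [of x] xy by auto
    obtain t where t: "0 \<le> t" "t < 4" "y = boundary_point 4 t" using ex [of y] xy by auto
    have eq: "f s = f t" using g(2) s t xy by auto
    \<comment> \<open>Radius and angle of the curve determine the parameter: on the arc the angle
      does, on the two radii the radius together with the sign of the angle.\<close>
    define \<rho> where "\<rho> s = min 1 \<bar>2 - s\<bar>" for s :: real
    define \<tau> where "\<tau> s = (if s \<le> 2 then min (s/2) (1/2) else max (- 1/2) ((s - 4)/2))" for s :: real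
    have f: "f s = polar n (\<rho> s) (c + \<tau> s)" for s
      by (simp add: f_def \<rho>_def \<tau>_def)
    have "0 \<le> \<rho> s" for s by (simp add: \<rho>_def)
    then have \<rho>: "\<rho> s = \<rho> t"
      using arg_cong [OF eq, of norm] unfolding f by simp
    have "s = t"
    proof (cases "\<rho> s = 0")
      case True
      then show ?thesis using \<rho> by (simp add: \<rho>_def)
    next
      case False
      then have "boundary_point n (c + \<tau> s) = boundary_point n (c + \<tau> t)"
        using eq \<open>\<And>s. 0 \<le> \<rho> s\<close> [of s] \<rho> unfolding f by (subst (asm) polar_eq_iff) auto
      moreover have "\<bar>(c + \<tau> s) - (c + \<tau> t)\<bar> < real n"
      proof -
        have "\<bar>\<tau> s\<bar> \<le> 1/2" "\<bar>\<tau> t\<bar> \<le> 1/2"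
          using s t by (auto simp: \<tau>_def min_def max_def abs_if)
        then show ?thesis using n by linarith
      qed
      ultimately have "\<tau> s = \<tau> t"
        using boundary_point_inj [OF n0] by fastforce
      then show ?thesis
        using \<rho> s t False by (auto simp: \<tau>_def \<rho>_def min_def max_def abs_if split: if_splits)
    qed
    then show "x = y" using s t by simp
  qed
  have fr: "frontier ?C = ?C - (ball 0 1 \<inter> wedge n (c - 1/2) (c + 1/2))"
    by (simp add: frontier_def interior_sector [OF n] compact_imp_closed compact_sector)
  have im: "g ` sphere 0 1 = frontier ?C"
  proof (intro equalityI subsetI)
    fix w assume "w \<in> g ` sphere 0 1"
    then obtain z where "norm z = 1" "w = g z" by auto
    then obtain s where s: "0 \<le> s" "s < 4" "w = f s" using ex [of z] g(2) by auto
    have "w \<in> ?C"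
    proof (cases "s \<le> 2")
      case True
      have "polar n (min 1 (2 - s)) (c + min (s/2) (1/2)) \<in> ?C"
        using True s(1,2) by (intro sectorI) auto
      then show ?thesis using True s(3) by (simp add: f_def)
    next
      case False
      have "polar n (min 1 (s - 2)) (c + max (- 1/2) ((s - 4)/2)) \<in> ?C"
        using False s(1,2) by (intro sectorI) (auto simp: min_def max_def)
      then show ?thesis using False s(3) by (simp add: f_def)
    qed
    moreover have "w \<notin> ball 0 1 \<inter> wedge n (c - 1/2) (c + 1/2)"
    proof
      assume "w \<in> ball 0 1 \<inter> wedge n (c - 1/2) (c + 1/2)"
      then obtain r t where rt: "0 < r" "r < 1" "c - 1/2 < t" "t < c + 1/2" "w = polar n r t"
        by (auto simp: wedge_def)
      then have "1 < s" "s < 3" and rs: "r = \<bar>2 - s\<bar>"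
      proof -
        have "norm w = r" using rt by simp
        moreover have "norm w = min 1 \<bar>2 - s\<bar>" using s by (auto simp: f_def)
        ultimately show "1 < s" "s < 3" "r = \<bar>2 - s\<bar>" using rt(2) by linarith+
      qed
      then obtain d where d: "w = polar n r (c + d)" "\<bar>d\<bar> = 1/2"
      proof (cases "s \<le> 2")
        case True
        show thesis
          by (rule that [of "1/2"]) (use True \<open>1 < s\<close> s rs in \<open>simp_all add: f_def\<close>)
      next
        case False
        show thesis
          by (rule that [of "- 1/2"]) (use False \<open>s < 3\<close> s rs in \<open>simp_all add: f_def max_def\<close>)
      qed
      then have "boundary_point n t = boundary_point n (c + d)"
        using rt by (metis polar_eq_iff order_less_imp_le)
      then have "t = c + d"
        using boundary_point_inj [OF n0, of t "c + d"] rt d(2) n by linarith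
      then show False using rt d(2) by linarith
    qed
    ultimately show "w \<in> frontier ?C" using fr by blast
  next
    fix w assume w: "w \<in> frontier ?C"
    then obtain r t where rt: "0 \<le> r" "r \<le> 1" "c - 1/2 \<le> t" "t \<le> c + 1/2" "w = polar n r t"
      unfolding fr by (auto simp: sector_def)
    have "\<not> (0 < r \<and> r < 1 \<and> c - 1/2 < t \<and> t < c + 1/2)"
      using w rt(5) wedgeI [of r "c - 1/2" t "c + 1/2" n] unfolding fr by force
    then consider "r = 0" | "r = 1" "t \<ge> c" | "r = 1" "t < c" | "t = c + 1/2" | "0 < r" "t = c - 1/2"
      using rt by linarith
    then obtain s where "0 \<le> s" "s \<le> 4" "w = f s"
    proof cases
      case 1 then show ?thesis using that [of 2] rt by (simp add: f_def)
    next
      case 2 then show ?thesis using that [of "2 * (t - c)"] rt by (simp add: f_def min_def diff_divide_distrib)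
    next
      case 3 then show ?thesis using that [of "4 + 2 * (t - c)"] rt by (simp add: f_def min_def max_def diff_divide_distrib)
    next
      case 4 then show ?thesis using that [of "2 - r"] rt by (simp add: f_def min_def)
    next
      case 5 then show ?thesis using that [of "2 + r"] rt by (simp add: f_def min_def max_def)
    qed
    then show "w \<in> g ` sphere 0 1"
      using g(2) [of s] by (intro image_eqI [of _ _ "boundary_point 4 s"]) auto
  qed
  have "polar n (1/2) c \<in> interior ?C"
    by (force simp: interior_sector [OF n] wedge_def)
  moreover have "continuous_on (sphere 0 1) g" using g(1) by simp
  ultimately obtain G where G: "continuous_on (cball 0 1) G" "inj_on G (cball 0 1)" "G ` cball 0 1 = ?C"
    "G ` ball 0 1 = interior ?C"
    "\<And>r u. \<lbrakk>0 \<le> r; r \<le> 1; norm u = 1\<rbrakk> \<Longrightarrow>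
       G (r *\<^sub>R u) = polar n (1/2) c + r *\<^sub>R (g u - polar n (1/2) c)"
    using radial_extension [OF compact_sector convex_sector [OF n] _ _ inj im] by blast
  have Gg: "G u = g u" if "norm u = 1" for u
    using G(5) [of 1 u] that by simp
  have GF: "G (boundary_point 4 s) = f s" if "0 \<le> s" "s \<le> 4" for s
    using Gg g(2) that by simp
  have per: "boundary_point 4 (- s) = boundary_point 4 (4 - s)" for s
    using boundary_point_add_period [of 4 "- s"] by simp
  show ?thesis
  proof (rule that [OF G(1-3) G(4) [unfolded interior_sector [OF n]]])
    fix s :: real assume s: "0 \<le> s" "s \<le> 1"
    show "G (boundary_point 4 s) = boundary_point n (c + s/2)"
      using GF [of s] s by (simp add: f_def min_def)
    show "G (boundary_point 4 (- s)) = boundary_point n (c - s/2)"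
      unfolding per using GF [of "4 - s"] s by (simp add: f_def min_def max_def)
    show "G (boundary_point 4 (2 - s)) = polar n s (c + 1/2)"
      using GF [of "2 - s"] s by (simp add: f_def min_def)
    show "G (boundary_point 4 (2 + s)) = polar n s (c - 1/2)"
      using GF [of "2 + s"] s by (auto simp: f_def min_def max_def)
  qed
qed

section \<open>Reparametrisation of edges and polygons\<close>

lemma edge_path_reverse: "edge_path X V g \<Longrightarrow> edge_path X V (\<lambda>s. g (1 - s))"
proof -
  assume g: "edge_path X V g"
  have "continuous_map (top_of_set {0..1::real}) (top_of_set {0..1::real}) (\<lambda>s. 1 - s)"
    by (auto simp: continuous_map_in_subtopology intro!: continuous_intros)
  then have "pathin X (g \<circ> (\<lambda>s. 1 - s))"
    using g continuous_map_compose unfolding edge_path_def pathin_def by blast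
  moreover have "inj_on (\<lambda>s. g (1 - s)) {0<..<1}"
  proof (rule inj_onI)
    fix x y :: real assume xy: "x \<in> {0<..<1}" "y \<in> {0<..<1}" "g (1 - x) = g (1 - y)"
    then have "1 - x = 1 - y"
      using g by (intro inj_onD [of g "{0<..<1}"]) (auto simp: edge_path_def)
    then show "x = y" by simp
  qed
  moreover have "(\<lambda>s. g (1 - s)) ` {0<..<1} \<subseteq> g ` {0<..<1}"
    by auto
  ultimately show ?thesis
    using g by (auto simp: edge_path_def o_def)
qed

lemma image_reverse_unit: "(\<lambda>s. g (1 - s)) ` {0..1::real} = g ` {0..1}"
proof -
  have "(\<lambda>s. 1 - s) ` {0..1::real} = {0..1}"
    by simp
  then show ?thesis by (metis image_image)
qed

lemma edge_path_interior:
  assumes "edge_path X V g"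
  shows "g ` {0<..<1} = g ` {0..1} - V"
proof -
  have "{0..1::real} = insert 0 (insert 1 {0<..<1})" by auto
  then show ?thesis
    using assms unfolding edge_path_def by auto
qed

text \<open>Continued by the identity, \<open>\<tau>\<close> becomes a monotone surjection of the
  real line and is thus continuous. At the ends, which a loop identifies, the equation follows
  because the open interval is dense and \<open>X\<close> is Hausdorff.\<close>

lemma edge_path_reparam_mono:
  assumes X: "Hausdorff_space X" and g: "pathin X g" and h: "pathin X h"
    and \<tau>: "strict_mono_on {0<..<1} \<tau>" "\<tau> ` {0<..<1} = {0<..<1::real}"
    and eq: "\<And>s. \<lbrakk>0 < s; s < 1\<rbrakk> \<Longrightarrow> h (\<tau> s) = g s"
  obtains \<sigma> where "continuous_on {0..1} \<sigma>" "inj_on \<sigma> {0..1}" "\<sigma> 0 = 0" "\<sigma> 1 = (1::real)"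
    "\<sigma> ` {0..1} = {0..1}" "\<And>s. \<lbrakk>0 \<le> s; s \<le> 1\<rbrakk> \<Longrightarrow> h (\<sigma> s) = g s"
proof -
  define \<sigma> where "\<sigma> s = (if 0 < s \<and> s < 1 then \<tau> s else s)" for s :: real
  have in01: "0 < \<tau> s \<and> \<tau> s < 1" if "0 < s" "s < 1" for s
    using \<tau>(2) that by (metis greaterThanLessThan_iff imageI)
  have mono: "\<sigma> x < \<sigma> y" if "x < y" for x y
    using that in01 [of x] in01 [of y] \<tau>(1) by (auto simp: \<sigma>_def strict_mono_on_def)
  have surj: "\<exists>x. y = \<sigma> x" for y
  proof (cases "0 < y \<and> y < 1")
    case True
    then obtain x where "0 < x" "x < 1" "\<tau> x = y"
      using \<tau>(2) by (metis greaterThanLessThan_iff imageE)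
    then show ?thesis by (auto simp: \<sigma>_def)
  next
    case False
    then show ?thesis by (intro exI [of _ y]) (auto simp: \<sigma>_def)
  qed
  then have "range \<sigma> = UNIV" by (metis surjI surj_def)
  then have cont: "continuous_on UNIV \<sigma>"
    using mono by (intro continuous_onI_mono) (auto simp: le_less)
  then have cont': "continuous_on {0..1} \<sigma>"
    using continuous_on_subset by blast
  have \<sigma>01: "\<sigma> 0 = 0" "\<sigma> 1 = 1" by (auto simp: \<sigma>_def)
  have sub: "\<sigma> ` {0..1} \<subseteq> {0..1}"
    using in01 by (force simp: \<sigma>_def)
  have im: "\<sigma> ` {0..1} = {0..1}"
  proof (rule antisym [OF sub], rule subsetI)
    fix y :: real assume y: "y \<in> {0..1}"
    obtain x where x: "y = \<sigma> x" using surj by blast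
    have "0 \<le> x" using y x mono [of x 0] \<sigma>01 by fastforce
    moreover have "x \<le> 1" using y x mono [of 1 x] \<sigma>01 by fastforce
    ultimately show "y \<in> \<sigma> ` {0..1}" using x by auto
  qed
  have inj: "inj_on \<sigma> {0..1}"
  proof (rule inj_onI)
    fix x y assume "\<sigma> x = \<sigma> y"
    then show "x = y" using mono [of x y] mono [of y x] by (cases x y rule: linorder_cases) auto
  qed
  have c1: "continuous_map (top_of_set {0..1}) X (h \<circ> \<sigma>)"
    using cont' sub h unfolding pathin_def
    by (intro continuous_map_compose [of _ "top_of_set {0..1}"]) (auto simp: continuous_map_in_subtopology)
  have c2: "continuous_map (top_of_set {0..1}) X g"
    using g by (simp add: pathin_def)
  have c3: "s \<in> (top_of_set {0..1}) closure_of {0<..<1}" if "0 \<le> s" "s \<le> 1" for s :: real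
    using that by (simp add: closure_of_subtopology Int_absorb1 subset_iff)
  have c4: "(h \<circ> \<sigma>) s = g s" if "s \<in> {0<..<1}" for s
    using that eq by (simp add: \<sigma>_def)
  have "(h \<circ> \<sigma>) s = g s" if "0 \<le> s" "s \<le> 1" for s
    by (rule forall_in_closure_of_eq [OF c3 [OF that] X c1 c2 c4])
  then show ?thesis
    using that [OF cont' inj \<sigma>01 im] by auto
qed

text \<open>\<open>h\<close> can be inverted only on the open edge, as the ends of a loop coincide.
  There the inverse of \<open>h\<close> after \<open>g\<close> is continuous and injective on an
  interval, hence monotone. A decreasing change is turned into a reversal of \<open>g\<close>, so
  \<open>\<sigma>\<close> always increases; applied to the sides of a polygon it keeps the corners
  in place.\<close>

lemma edge_path_reparam:
  assumes X: "Hausdorff_space X" and g: "edge_path X V g" and h: "edge_path X V h"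
    and im: "g ` {0..1} = h ` {0..1}"
  obtains \<sigma> where "continuous_on {0..1} \<sigma>" "inj_on \<sigma> {0..1}" "\<sigma> 0 = 0" "\<sigma> 1 = (1::real)"
    "\<sigma> ` {0..1} = {0..1}"
    "(\<forall>s\<in>{0..1}. h (\<sigma> s) = g s) \<or> (\<forall>s\<in>{0..1}. h (\<sigma> s) = g (1 - s))"
proof -
  let ?I = "{0<..<1::real}"
  have gI: "g ` ?I = h ` ?I"
    using edge_path_interior [OF g] edge_path_interior [OF h] im by simp
  have pre: "{s \<in> {0..1}. h s \<in> h ` ?I} = ?I"
  proof -
    have no: "h s \<notin> h ` ?I" if "s = 0 \<or> s = 1" for s
      using h that unfolding edge_path_def by blast
    show ?thesis
    proof (intro equalityI subsetI)
      fix s assume s: "s \<in> {s \<in> {0..1}. h s \<in> h ` ?I}"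
      then have "s \<noteq> 0" "s \<noteq> 1" using no by auto
      then show "s \<in> ?I" using s by simp
    qed auto
  qed
  have "homeomorphic_map (top_of_set {s \<in> {0..1}. h s \<in> h ` ?I}) (subtopology X (h ` ?I)) h"
  proof (rule homeomorphic_map_compact_preimage [OF compact_Icc X])
    show "continuous_map (top_of_set {0..1}) X h"
      using h by (simp add: edge_path_def pathin_def)
    show "inj_on h {s \<in> {0..1}. h s \<in> h ` ?I}"
      unfolding pre using h by (simp add: edge_path_def)
    show "h ` ?I \<subseteq> h ` {0..1}" by (intro image_mono) auto
  qed
  then obtain k where k: "homeomorphic_maps (top_of_set ?I) (subtopology X (h ` ?I)) h k"
    unfolding pre using homeomorphic_map_maps by blast
  have htop: "topspace (subtopology X (h ` ?I)) = h ` ?I"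
    using h by (auto simp: edge_path_def pathin_def continuous_map_def)
  have hk: "h (k x) = x" "k x \<in> ?I" if "x \<in> h ` ?I" for x
    using k that htop by (auto simp: homeomorphic_maps_def continuous_map_def)
  have kh: "k (h s) = s" if "s \<in> ?I" for s
    using k that by (auto simp: homeomorphic_maps_def)
  define \<tau> where "\<tau> = k \<circ> g"
  have "continuous_map (top_of_set ?I) (subtopology X (h ` ?I)) g"
    using g gI unfolding edge_path_def pathin_def
    by (auto simp: continuous_map_in_subtopology intro: continuous_map_from_subtopology_mono)
  then have "continuous_map (top_of_set ?I) (top_of_set ?I) \<tau>"
    using k continuous_map_compose unfolding \<tau>_def homeomorphic_maps_def by blast
  then have c\<tau>: "continuous_on ?I \<tau>"
    by (simp add: continuous_map_in_subtopology)
  have h\<tau>: "h (\<tau> s) = g s" if "s \<in> ?I" for s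
    using hk(1) [of "g s"] imageI [OF that, of g] gI by (simp add: \<tau>_def)
  have "inj_on \<tau> ?I"
    using g h\<tau> unfolding edge_path_def by (metis inj_on_def)
  have \<tau>I: "\<tau> ` ?I = ?I"
  proof
    show "\<tau> ` ?I \<subseteq> ?I" using hk(2) gI unfolding \<tau>_def image_comp [symmetric] by blast
    show "?I \<subseteq> \<tau> ` ?I"
    proof
      fix s assume s: "s \<in> ?I"
      then obtain r where "r \<in> ?I" "h s = g r" using gI by (metis imageE imageI)
      then show "s \<in> \<tau> ` ?I" using kh [OF s] by (auto simp: \<tau>_def intro!: image_eqI [of _ _ r])
    qed
  qed
  have "strict_mono_on ?I \<tau> \<or> strict_antimono_on ?I \<tau>"
    using injective_eq_monotone_map [of ?I \<tau>] c\<tau> \<open>inj_on \<tau> ?I\<close> by (simp add: is_interval_convex)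
  then show ?thesis
  proof
    assume m: "strict_mono_on ?I \<tau>"
    obtain \<sigma> where "continuous_on {0..1} \<sigma>" "inj_on \<sigma> {0..1}" "\<sigma> 0 = 0" "\<sigma> 1 = (1::real)"
      "\<sigma> ` {0..1} = {0..1}" "\<And>s. \<lbrakk>0 \<le> s; s \<le> 1\<rbrakk> \<Longrightarrow> h (\<sigma> s) = g s"
      by (rule edge_path_reparam_mono [OF X _ _ m \<tau>I, of g h])
        (use g h h\<tau> in \<open>auto simp: edge_path_def\<close>)
    then show ?thesis using that by auto
  next
    assume m: "strict_antimono_on ?I \<tau>"
    have r: "(\<lambda>s. 1 - s) ` ?I = ?I"
    proof (intro equalityI subsetI)
      fix x assume "x \<in> ?I"
      then show "x \<in> (\<lambda>s. 1 - s) ` ?I" by (intro image_eqI [of _ _ "1 - x"]) auto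
    qed auto
    have m': "strict_mono_on ?I (\<lambda>s. \<tau> (1 - s))"
      using m unfolding monotone_on_def by auto
    have i': "(\<lambda>s. \<tau> (1 - s)) ` ?I = ?I"
      using \<tau>I r by (metis image_image)
    obtain \<sigma> where "continuous_on {0..1} \<sigma>" "inj_on \<sigma> {0..1}" "\<sigma> 0 = 0" "\<sigma> 1 = (1::real)"
      "\<sigma> ` {0..1} = {0..1}" "\<And>s. \<lbrakk>0 \<le> s; s \<le> 1\<rbrakk> \<Longrightarrow> h (\<sigma> s) = g (1 - s)"
      by (rule edge_path_reparam_mono [OF X _ _ m' i', of "\<lambda>s. g (1 - s)" h])
        (use edge_path_reverse [OF g] h h\<tau> in \<open>auto simp: edge_path_def\<close>)
    then show ?thesis using that by auto
  qed
qed

lemma polygon_mapD: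
  assumes "polygon_map X V E t n \<phi>"
  shows "0 < n" "continuous_map (top_of_set (cball 0 1)) X \<phi>" "\<phi> ` ball 0 1 = topspace X \<inter> t"
    "inj_on \<phi> (ball 0 1)" "j < n \<Longrightarrow> edge_path X V (side n \<phi> j)" "j < n \<Longrightarrow> side n \<phi> j ` {0..1} \<in> E"
  using assms by (auto simp: polygon_map_def homeomorphic_eq_everything_map)

lemma homeomorphic_map_disk_part:
  assumes \<phi>: "homeomorphic_map (top_of_set (ball 0 1)) (subtopology X t) \<phi>"
    and G: "continuous_on (cball 0 1) G" "inj_on G (cball (0::complex) 1)"
    and sub: "G ` ball 0 1 \<subseteq> ball (0::complex) 1"
  shows "homeomorphic_map (top_of_set (ball 0 1)) (subtopology X (\<phi> ` G ` ball 0 1)) (\<phi> \<circ> G)"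
proof (rule homeomorphic_map_compose)
  let ?S = "G ` ball 0 1"
  have pre: "{z \<in> cball 0 1. G z \<in> ?S} = ball 0 1"
  proof (intro equalityI subsetI)
    fix z assume "z \<in> {z \<in> cball 0 1. G z \<in> ?S}"
    then obtain y where y: "z \<in> cball 0 1" "y \<in> ball 0 1" "G z = G y" by auto
    then have "z = y" using G(2) ball_subset_cball by (metis inj_onD subsetD)
    then show "z \<in> ball 0 1" using y by simp
  qed auto
  have "homeomorphic_map (top_of_set {z \<in> cball 0 1. G z \<in> ?S}) (subtopology euclidean ?S) G"
    by (rule homeomorphic_map_compact_preimage)
      (use G in \<open>auto simp: inj_on_def\<close>)
  then show "homeomorphic_map (top_of_set (ball 0 1)) (top_of_set ?S) G"
    by (simp only: pre)
  have im: "\<phi> ` ball 0 1 = topspace X \<inter> t"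
    using \<phi> by (auto simp: homeomorphic_eq_everything_map)
  have "homeomorphic_map (subtopology (top_of_set (ball 0 1)) ?S) (subtopology (subtopology X t) (\<phi> ` ?S)) \<phi>"
    by (rule homeomorphic_map_subtopologies [OF \<phi>]) (use sub im in auto)
  moreover have "subtopology (top_of_set (ball 0 1)) ?S = top_of_set ?S"
    using sub by (simp add: subtopology_subtopology Int_absorb1)
  moreover have "subtopology (subtopology X t) (\<phi> ` ?S) = subtopology X (\<phi> ` ?S)"
  proof -
    have "\<phi> ` ?S \<subseteq> t" using sub im by blast
    then show ?thesis by (simp add: subtopology_subtopology Int_absorb1)
  qed
  ultimately show "homeomorphic_map (top_of_set ?S) (subtopology X (\<phi> ` ?S)) \<phi>"
    by simp
qed

text \<open>The changes of parameter on the single sides fix the ends, so they fit together to a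
  homeomorphism of the circle, which is coned to the disk. The center and the corners stay. The last
  clause keeps the edges of a subdivision: where the middle of a side is the prescribed one, its
  radius is unchanged.\<close>

lemma polygon_map_normalise:
  assumes X: "Hausdorff_space X" and \<phi>: "polygon_map X V E t n \<phi>"
    and \<gamma>: "\<And>e. e \<in> E \<Longrightarrow> edge_path X V (\<gamma> e) \<and> \<gamma> e ` {0..1} = e"
  obtains \<phi>' where "polygon_map X V E t n \<phi>'"
    "\<And>j. j < n \<Longrightarrow> side n \<phi>' j ` {0..1} = side n \<phi> j ` {0..1}"
    "\<And>j. j < n \<Longrightarrow> (\<forall>s\<in>{0..1}. side n \<phi>' j s = \<gamma> (side n \<phi> j ` {0..1}) s) \<or>
                (\<forall>s\<in>{0..1}. side n \<phi>' j s = \<gamma> (side n \<phi> j ` {0..1}) (1 - s))"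
    "\<phi>' 0 = \<phi> 0" "\<And>z. z \<in> sphere 0 1 \<Longrightarrow> \<exists>z'\<in>sphere 0 1. \<phi>' z = \<phi> z'"
    "\<And>j. j < n \<Longrightarrow> corner n \<phi>' j = corner n \<phi> j"
    "\<And>j r. \<lbrakk>j < n; side n \<phi> j (1/2) = \<gamma> (side n \<phi> j ` {0..1}) (1/2); 0 \<le> r; r \<le> 1\<rbrakk> \<Longrightarrow>
        \<phi>' (polar n r (real j + 1/2)) = \<phi> (polar n r (real j + 1/2))"
proof -
  note \<phi>D = polygon_mapD [OF \<phi>]
  have n: "0 < n" by (rule \<phi>D)
  define P where "P j \<sigma> \<longleftrightarrow> continuous_on {0..1} \<sigma> \<and> inj_on \<sigma> {0..1} \<and> \<sigma> 0 = 0 \<and> \<sigma> 1 = (1::real) \<and>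
      \<sigma> ` {0..1} = {0..1} \<and>
      ((\<forall>s\<in>{0..1}. side n \<phi> j (\<sigma> s) = \<gamma> (side n \<phi> j ` {0..1}) s) \<or>
       (\<forall>s\<in>{0..1}. side n \<phi> j (\<sigma> s) = \<gamma> (side n \<phi> j ` {0..1}) (1 - s)))" for j \<sigma>
  have "\<exists>\<sigma>. P j \<sigma>" if "j < n" for j
  proof -
    have e: "edge_path X V (\<gamma> (side n \<phi> j ` {0..1}))"
        "\<gamma> (side n \<phi> j ` {0..1}) ` {0..1} = side n \<phi> j ` {0..1}"
      using \<gamma> \<phi>D(6) [OF that] by auto
    show ?thesis
      unfolding P_def by (rule edge_path_reparam [OF X e(1) \<phi>D(5) [OF that] e(2)]) blast
  qed
  then obtain \<sigma> where "\<And>j. j < n \<Longrightarrow> P j (\<sigma> j)" by metis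
  then have \<sigma>: "\<And>j. j < n \<Longrightarrow> continuous_on {0..1} (\<sigma> j)" "\<And>j. j < n \<Longrightarrow> inj_on (\<sigma> j) {0..1}"
      "\<And>j. j < n \<Longrightarrow> \<sigma> j 0 = 0" "\<And>j. j < n \<Longrightarrow> \<sigma> j 1 = (1::real)" "\<And>j. j < n \<Longrightarrow> \<sigma> j ` {0..1} = {0..1}"
      "\<And>j. j < n \<Longrightarrow> (\<forall>s\<in>{0..1}. side n \<phi> j (\<sigma> j s) = \<gamma> (side n \<phi> j ` {0..1}) s) \<or>
       (\<forall>s\<in>{0..1}. side n \<phi> j (\<sigma> j s) = \<gamma> (side n \<phi> j ` {0..1}) (1 - s))"
    for j
    unfolding P_def by (iprover)+
  \<comment> \<open>The lift of the circle homeomorphism to \<open>{0..real n}\<close>: on the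
    \<open>j\<close>-th unit interval it is \<open>\<sigma> j\<close>.\<close>
  obtain T where T: "continuous_map (top_of_set {0..real n}) euclideanreal T"
      "\<And>j s. \<lbrakk>j < n; 0 \<le> s; s \<le> 1\<rbrakk> \<Longrightarrow> T (real j + s) = real j + \<sigma> j s"
    by (rule continuous_map_concat [OF n, of euclideanreal "\<lambda>j s. real j + \<sigma> j s"])
      (use \<sigma> in \<open>auto intro!: continuous_intros\<close>)
  have T0: "T 0 = 0" and Tn: "T (real n) = real n"
    using T(2) [of 0 0] T(2) [of "n - 1" 1] \<sigma>(3) [of 0] \<sigma>(4) [of "n - 1"] n by (auto simp: of_nat_diff)
  have "continuous_map (top_of_set {0..real n}) euclidean (\<lambda>s. boundary_point n (T s))"
    using T(1) by (auto intro!: continuous_intros)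
  moreover have "boundary_point n (T 0) = boundary_point n (T (real n))"
    unfolding T0 Tn using boundary_point_add_period [OF n, of 0] by simp
  ultimately obtain k where k: "continuous_map (top_of_set (sphere 0 1)) euclidean k"
      "\<And>s. \<lbrakk>0 \<le> s; s \<le> real n\<rbrakk> \<Longrightarrow> k (boundary_point n s) = boundary_point n (T s)"
    using circle_map_exists [OF n] by blast
  have kj: "k (boundary_point n (real j + s)) = boundary_point n (real j + \<sigma> j s)"
    if "j < n" "0 \<le> s" "s \<le> 1" for j s
    using k(2) [of "real j + s"] T(2) [OF that] that by simp
  have ex: "\<exists>j s. j < n \<and> 0 \<le> s \<and> s < 1 \<and> z = boundary_point n (real j + s)" if z: "norm z = 1" for z
  proof -
    obtain s where "0 \<le> s" "s < 0 + real n" "z = boundary_point n s"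
      using boundary_point_exists [OF n z] by blast
    moreover from this obtain j t where "j < n" "0 \<le> t" "t < 1" "s = real j + t"
      using nat_add_frac_exists [of s n] by (metis add_0)
    ultimately show ?thesis by blast
  qed
  have \<sigma>lt: "0 \<le> \<sigma> j s \<and> \<sigma> j s < 1" if "j < n" "0 \<le> s" "s < 1" for j s
  proof -
    have "\<sigma> j s \<in> {0..1}" using \<sigma>(5) [OF that(1)] that by (metis atLeastAtMost_iff imageI less_imp_le)
    moreover have "\<sigma> j s \<noteq> 1"
      using \<sigma>(2) [OF that(1)] \<sigma>(4) [OF that(1)] that by (metis atLeastAtMost_iff inj_onD less_imp_le order_less_irrefl zero_le_one order_refl)
    ultimately show ?thesis by auto
  qed
  have inj: "inj_on k (sphere 0 1)"
  proof (rule inj_onI)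
    fix x y assume xy: "x \<in> sphere 0 1" "y \<in> sphere 0 1" "k x = k y"
    obtain i s where i: "i < n" "0 \<le> s" "s < 1" "x = boundary_point n (real i + s)" using ex xy by force
    obtain j t where j: "j < n" "0 \<le> t" "t < 1" "y = boundary_point n (real j + t)" using ex xy by force
    have "boundary_point n (real i + \<sigma> i s) = boundary_point n (real j + \<sigma> j t)"
      using kj i j xy(3) by simp
    moreover have "\<bar>(real i + \<sigma> i s) - (real j + \<sigma> j t)\<bar> < real n"
      using \<sigma>lt [OF i(1-3)] \<sigma>lt [OF j(1-3)] i(1) j(1) by linarith
    ultimately have eq: "real i + \<sigma> i s = real j + \<sigma> j t"
      using boundary_point_inj [OF n] by blast
    then have "real i < real (Suc j)" "real j < real (Suc i)"
      using \<sigma>lt [OF i(1-3)] \<sigma>lt [OF j(1-3)] by linarith+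
    then have "i = j" by linarith
    then have "s = t"
      using eq \<sigma>(2) [OF i(1)] i(2,3) j(2,3) by (auto simp: inj_on_def)
    then show "x = y" using i j \<open>i = j\<close> by simp
  qed
  have kim: "k ` sphere 0 1 = frontier (cball 0 1)"
  proof (intro equalityI subsetI)
    fix z assume "z \<in> k ` sphere 0 1"
    then obtain x where "norm x = 1" "z = k x" by auto
    then show "z \<in> frontier (cball 0 1)" using ex [of x] kj by force
  next
    fix z :: complex assume "z \<in> frontier (cball 0 1)"
    then have "norm z = 1" by simp
    then obtain j t where j: "j < n" "0 \<le> t" "t < 1" "z = boundary_point n (real j + t)" using ex by blast
    then obtain s where "0 \<le> s" "s \<le> 1" "t = \<sigma> j s"
      using \<sigma>(5) [OF j(1)] by (metis atLeastAtMost_iff imageE less_imp_le)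
    then show "z \<in> k ` sphere 0 1"
      using kj [OF j(1), of s] j by (intro image_eqI [of _ _ "boundary_point n (real j + s)"]) auto
  qed
  have "continuous_on (sphere 0 1) k" using k(1) by simp
  then obtain G where G: "continuous_on (cball 0 1) G" "inj_on G (cball 0 1)" "G ` cball 0 1 = cball 0 1"
    "G ` ball 0 1 = interior (cball 0 1)"
    "\<And>r u. \<lbrakk>0 \<le> r; r \<le> 1; norm u = 1\<rbrakk> \<Longrightarrow> G (r *\<^sub>R u) = 0 + r *\<^sub>R (k u - 0)"
    using radial_extension [OF compact_cball convex_cball _ _ inj kim, of 0] by auto
  have Gp: "G (polar n r (real j + s)) = polar n r (real j + \<sigma> j s)"
    if "j < n" "0 \<le> s" "s \<le> 1" "0 \<le> r" "r \<le> 1" for j r s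
    using G(5) [OF that(4,5), of "boundary_point n (real j + s)"] kj [OF that(1-3)]
    by (simp add: polar_def)
  have Gball: "G ` ball 0 1 = ball 0 1" using G(4) by simp
  define \<phi>' where "\<phi>' = \<phi> \<circ> G"
  have sd: "side n \<phi>' j s = side n \<phi> j (\<sigma> j s)" if "j < n" "0 \<le> s" "s \<le> 1" for j s
    using Gp [OF that, of 1] by (simp add: \<phi>'_def side_def)
  have sdim: "side n \<phi>' j ` {0..1} = side n \<phi> j ` {0..1}" if "j < n" for j
  proof -
    have "side n \<phi>' j ` {0..1} = side n \<phi> j ` \<sigma> j ` {0..1}"
      unfolding image_image by (rule image_cong) (use sd that in auto)
    then show ?thesis using \<sigma>(5) [OF that] by simp
  qed
  have sd2: "(\<forall>s\<in>{0..1}. side n \<phi>' j s = \<gamma> (side n \<phi> j ` {0..1}) s) \<or>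
                (\<forall>s\<in>{0..1}. side n \<phi>' j s = \<gamma> (side n \<phi> j ` {0..1}) (1 - s))" if "j < n" for j
    using \<sigma>(6) [OF that] sd [OF that] by auto
  have c\<phi>': "continuous_map (top_of_set (cball 0 1)) X \<phi>'"
    unfolding \<phi>'_def using G(1,3) \<phi>D(2)
    by (intro continuous_map_compose [of _ "top_of_set (cball 0 1)"]) (auto simp: continuous_map_in_subtopology)
  have sdp: "edge_path X V (side n \<phi>' j)" if "j < n" for j
  proof -
    define e where "e = side n \<phi> j ` {0..1}"
    have e: "edge_path X V (\<gamma> e)" using \<gamma> \<phi>D(6) [OF that] e_def by blast
    have "continuous_map (top_of_set {0..1}) (top_of_set (cball 0 1)) (\<lambda>s. boundary_point n (real j + s))"
      by (auto simp: continuous_map_in_subtopology intro!: continuous_intros)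
    from continuous_map_compose [OF this c\<phi>'] have pth: "pathin X (side n \<phi>' j)"
      by (simp add: pathin_def o_def side_def)
    have *: "edge_path X V f" if "\<forall>s\<in>{0..1}. f s = g s" "edge_path X V g" "pathin X f" for f g
    proof -
      have "f ` {0<..<1} = g ` {0<..<1}"
        using that(1) by (intro image_cong) auto
      moreover have "inj_on f {0<..<1}"
        using that(1,2) by (auto simp: edge_path_def inj_on_def)
      ultimately show ?thesis
        using that by (simp add: edge_path_def)
    qed
    show ?thesis
      using sd2 [OF that] * [OF _ e pth] * [OF _ edge_path_reverse [OF e] pth] unfolding e_def by blast
  qed
  have "\<phi> ` G ` ball 0 1 = topspace X \<inter> t"
    unfolding Gball by (rule \<phi>D(3))
  then have "homeomorphic_map (top_of_set (ball 0 1)) (subtopology X t) \<phi>'"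
    using homeomorphic_map_disk_part [of X t \<phi> G] \<phi> G(1,2) Gball
    by (simp add: \<phi>'_def polygon_map_def subtopology_restrict)
  then have "polygon_map X V E t n \<phi>'"
    unfolding polygon_map_def using n c\<phi>' sdp sdim \<phi>D(6) by simp
  moreover have "\<phi>' 0 = \<phi> 0"
    using G(5) [of 0 1] by (simp add: \<phi>'_def)
  moreover have "\<exists>z'\<in>sphere 0 1. \<phi>' z = \<phi> z'" if "z \<in> sphere 0 1" for z
    using G(5) [of 1 z] that kim by (auto simp: \<phi>'_def)
  moreover have "corner n \<phi>' j = corner n \<phi> j" if "j < n" for j
    using Gp [OF that, of 0 1] \<sigma>(3) [OF that] by (simp add: \<phi>'_def corner_def)
  moreover have "\<phi>' (polar n r (real j + 1/2)) = \<phi> (polar n r (real j + 1/2))"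
    if j: "j < n" and mid: "side n \<phi> j (1/2) = \<gamma> (side n \<phi> j ` {0..1}) (1/2)" and r: "0 \<le> r" "r \<le> 1" for j r
  proof -
    have "\<sigma> j (1/2) \<in> \<sigma> j ` {0..1}" by (rule imageI) simp
    then have in01: "\<sigma> j (1/2) \<in> {0..1}" using \<sigma>(5) [OF j] by simp
    \<comment> \<open>Both directions give the same equation, as
      \<open>1 - 1/2 = 1/2\<close>.\<close>
    have e1: "side n \<phi> j (\<sigma> j (1/2)) = side n \<phi> j (1/2)"
      using \<sigma>(6) [OF j] mid by auto
    have "side n \<phi> j (1/2) \<in> side n \<phi> j ` {0<..<1}"
      by (rule imageI) simp
    then have V: "side n \<phi> j (1/2) \<notin> V"
      using \<phi>D(5) [OF j] unfolding edge_path_def by blast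
    have "\<sigma> j (1/2) \<noteq> 0" "\<sigma> j (1/2) \<noteq> 1"
      using \<phi>D(5) [OF j] e1 V unfolding edge_path_def by (metis, metis)
    then have "\<sigma> j (1/2) \<in> {0<..<1}" using in01 by auto
    then have "\<sigma> j (1/2) = 1/2"
      using \<phi>D(5) [OF j] e1 inj_onD [of "side n \<phi> j" "{0<..<1}" "\<sigma> j (1/2)" "1/2"]
      unfolding edge_path_def by simp
    then show ?thesis
      using Gp [OF j, of "1/2" r] r unfolding \<open>\<sigma> j (1/2) = 1/2\<close> by (simp add: \<phi>'_def)
  qed
  ultimately show ?thesis
    using that sdim sd2 by blast
qed

lemma embedded_graph_closedin:
  assumes "embedded_graph X V E" "Hausdorff_space X"
  shows "closedin X V" "e \<in> E \<Longrightarrow> closedin X e" "closedin X (V \<union> \<Union>E)"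
proof -
  show V: "closedin X V"
    using assms Hausdorff_imp_t1_space closedin_t1_singleton
    by (metis embedded_graph_def t1_space_closedin_finite)
  have e: "closedin X e" if "e \<in> E" for e
    using that assms continuous_image_compact_closedin [of "{0..1::real}" X "{0..1}"]
    by (force simp: embedded_graph_def edge_path_def pathin_def)
  then show "e \<in> E \<Longrightarrow> closedin X e" .
  show "closedin X (V \<union> \<Union>E)"
    using V e assms by (intro closedin_Un closedin_Union) (auto simp: embedded_graph_def)
qed

section \<open>Tilings by parametrised polygons\<close>

text \<open>\<open>normal\<close> says that every side follows the fixed parametrisation of its
  edge, up to direction. Two sides along one edge are thus glued by \<open>s = s'\<close> or by
  \<open>s = 1 - s'\<close>; both signs occur since the surface may be non-orientable.\<close>

locale polygon_family =
  fixes X :: "'a topology" and V :: "'a set" and E :: "'a set set"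
    and \<gamma> :: "'a set \<Rightarrow> real \<Rightarrow> 'a" and n :: "'a set \<Rightarrow> nat" and \<phi> :: "'a set \<Rightarrow> complex \<Rightarrow> 'a"
  assumes X: "closed_surface X" and graph: "embedded_graph X V E"
    and edge: "\<And>e. e \<in> E \<Longrightarrow> edge_path X V (\<gamma> e)" "\<And>e. e \<in> E \<Longrightarrow> \<gamma> e ` {0..1} = e"
    and poly: "\<And>t. t \<in> tiles X V E \<Longrightarrow> polygon_map X V E t (n t) (\<phi> t)"
    and normal: "\<And>t j. \<lbrakk>t \<in> tiles X V E; j < n t\<rbrakk> \<Longrightarrow>
       (\<forall>s\<in>{0..1}. side (n t) (\<phi> t) j s = \<gamma> (side (n t) (\<phi> t) j ` {0..1}) s) \<or>
       (\<forall>s\<in>{0..1}. side (n t) (\<phi> t) j s = \<gamma> (side (n t) (\<phi> t) j ` {0..1}) (1 - s))"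
begin

lemma Haus: "Hausdorff_space X"
  using X closed_surfaceD by blast

abbreviation "T \<equiv> tiles X V E"

abbreviation "bside t j \<equiv> side (n t) (\<phi> t) j ` {0..1}"

lemma Union_tiles: "\<Union>T = topspace X - (V \<union> \<Union>E)"
  unfolding tiles_def Union_connected_components_of by auto

lemma tile_subset: "t \<in> T \<Longrightarrow> t \<subseteq> topspace X" "t \<in> T \<Longrightarrow> t \<inter> (V \<union> \<Union>E) = {}"
  using Union_tiles by blast+

lemma tile_disjoint: "\<lbrakk>t \<in> T; t' \<in> T; x \<in> t; x \<in> t'\<rbrakk> \<Longrightarrow> t = t'"
  using connected_components_of_overlap [of t "subtopology X (topspace X - (V \<union> \<Union>E))" t']
  unfolding tiles_def by blast

lemma n_pos [simp]: "t \<in> T \<Longrightarrow> 0 < n t"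
  using poly polygon_mapD(1) by blast

lemma continuous_\<phi>: "t \<in> T \<Longrightarrow> continuous_map (top_of_set (cball 0 1)) X (\<phi> t)"
  using poly polygon_mapD(2) by blast

lemma tile_image: "t \<in> T \<Longrightarrow> \<phi> t ` ball 0 1 = t"
  using poly polygon_mapD(3) tile_subset(1) by (metis inf.absorb2)

lemma \<phi>_inj: "\<lbrakk>t \<in> T; norm z < 1; norm w < 1; \<phi> t z = \<phi> t w\<rbrakk> \<Longrightarrow> z = w"
  using poly polygon_mapD(4) by (metis inj_on_def mem_ball_0)

lemma open_tile:
  assumes "t \<in> T" "open S" "S \<subseteq> ball 0 1"
  shows "openin X (\<phi> t ` S)"
proof (rule closed_surface_invariance_of_domain [OF X assms(2)])
  have "S \<subseteq> cball 0 1" using assms(3) ball_subset_cball by blast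
  then show "continuous_map (top_of_set S) X (\<phi> t)"
    using continuous_\<phi> [OF assms(1)] continuous_map_from_subtopology_mono by blast
  show "inj_on (\<phi> t) S"
    using poly [OF assms(1)] polygon_mapD(4) assms(3) inj_on_subset by blast
qed

lemma bside: "\<lbrakk>t \<in> T; j < n t\<rbrakk> \<Longrightarrow> bside t j \<in> E"
  using poly polygon_mapD(6) by blast

lemma edge_V:
  assumes "e \<in> E"
  shows "\<lbrakk>0 < s; s < 1\<rbrakk> \<Longrightarrow> \<gamma> e s \<notin> V" "\<gamma> e 0 \<in> V" "\<gamma> e 1 \<in> V"
proof -
  have e: "\<gamma> e ` {0<..<1} \<inter> V = {}" "\<gamma> e 0 \<in> V" "\<gamma> e 1 \<in> V"
    using edge(1) [OF assms] by (auto simp: edge_path_def)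
  then show "\<gamma> e 0 \<in> V" "\<gamma> e 1 \<in> V" by blast+
  assume "0 < s" "s < 1"
  then have "\<gamma> e s \<in> \<gamma> e ` {0<..<1}" by (intro imageI) simp
  then show "\<gamma> e s \<notin> V" using e(1) by blast
qed

lemma edge_mem: "\<lbrakk>e \<in> E; 0 \<le> s; s \<le> 1\<rbrakk> \<Longrightarrow> \<gamma> e s \<in> e"
  using edge(2) [of e] by auto

lemma edge_cases:
  assumes "e \<in> E" "x \<in> e"
  obtains s where "0 \<le> s" "s \<le> 1" "x = \<gamma> e s"
  using edge(2) [OF assms(1)] assms(2) by (metis atLeastAtMost_iff imageE)

lemma edge_cases_nonvertex:
  assumes "e \<in> E" "x \<in> e" "x \<notin> V"
  obtains s where "0 < s" "s < 1" "x = \<gamma> e s"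
proof -
  obtain s where s: "0 \<le> s" "s \<le> 1" "x = \<gamma> e s"
    using edge_cases [OF assms(1,2)] by metis
  have "s \<noteq> 0" "s \<noteq> 1"
    using edge_V(2,3) [OF assms(1)] assms(3) s(3) by auto
  then show ?thesis using that [of s] s by simp
qed

lemma edge_inj: "\<lbrakk>e \<in> E; 0 < s; s < 1; 0 < s'; s' < 1; \<gamma> e s = \<gamma> e s'\<rbrakk> \<Longrightarrow> s = s'"
  using edge(1) [of e] unfolding edge_path_def inj_on_def by auto

lemma edge_unique: "\<lbrakk>e \<in> E; f \<in> E; x \<in> e; x \<in> f; x \<notin> V\<rbrakk> \<Longrightarrow> e = f"
  using graph unfolding embedded_graph_def by blast

lemma side_param:
  assumes "t \<in> T" "j < n t"
  obtains a where "a = (\<lambda>s. real j + s) \<or> a = (\<lambda>s. real j + 1 - s)"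
    "\<And>s. \<lbrakk>0 \<le> s; s \<le> 1\<rbrakk> \<Longrightarrow> \<phi> t (boundary_point (n t) (a s)) = \<gamma> (bside t j) s"
  using normal [OF assms]
proof
  assume "\<forall>s\<in>{0..1}. side (n t) (\<phi> t) j s = \<gamma> (bside t j) s"
  then show ?thesis by (intro that [of "\<lambda>s. real j + s"]) (auto simp: side_def)
next
  assume *: "\<forall>s\<in>{0..1}. side (n t) (\<phi> t) j s = \<gamma> (bside t j) (1 - s)"
  have "\<phi> t (boundary_point (n t) (real j + 1 - s)) = \<gamma> (bside t j) s" if "0 \<le> s" "s \<le> 1" for s
    using *[rule_format, of "1 - s"] that by (simp add: side_def add_diff_eq)
  then show ?thesis by (intro that [of "\<lambda>s. real j + 1 - s"]) auto
qed

lemma side_in: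
  assumes "t \<in> T" "j < n t" "0 \<le> s" "s \<le> 1"
  shows "\<phi> t (boundary_point (n t) (real j + s)) \<in> bside t j"
  using assms by (auto simp: side_def)

lemma side_nonvertex:
  assumes "t \<in> T" "j < n t" "0 < s" "s < 1"
  shows "\<phi> t (boundary_point (n t) (real j + s)) \<notin> V"
proof -
  have "side (n t) (\<phi> t) j s \<in> side (n t) (\<phi> t) j ` {0<..<1}"
    using assms(3,4) by (intro imageI) simp
  then show ?thesis
    using polygon_mapD(5) [OF poly [OF assms(1)] assms(2)] unfolding edge_path_def side_def by blast
qed

lemma side_vertex:
  assumes "t \<in> T" "j < n t"
  shows "\<phi> t (boundary_point (n t) (real j)) \<in> V"
  using polygon_mapD(5) [OF poly [OF assms(1)] assms(2)]
  unfolding edge_path_def side_def by simp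

lemma side_inj:
  assumes "t \<in> T" "j < n t" "0 < s" "s < 1" "0 < s'" "s' < 1"
    "\<phi> t (boundary_point (n t) (real j + s)) = \<phi> t (boundary_point (n t) (real j + s'))"
  shows "s = s'"
  using polygon_mapD(5) [OF poly [OF assms(1)] assms(2)] assms(3-)
  unfolding edge_path_def side_def inj_on_def by simp

lemma sphere_cases:
  assumes "t \<in> T" "norm z = 1"
  obtains j s where "j < n t" "0 \<le> s" "s < 1" "z = boundary_point (n t) (real j + s)"
proof -
  obtain s where s: "0 \<le> s" "s < 0 + real (n t)" "z = boundary_point (n t) s"
    using boundary_point_exists [OF n_pos [OF assms(1)] assms(2)] by blast
  then obtain j s' where "j < n t" "0 \<le> s'" "s' < 1" "s = real j + s'"
    using nat_add_frac_exists [of s "n t"] by (metis add_0)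
  then show ?thesis using that s by blast
qed

lemma sphere_graph: "\<lbrakk>t \<in> T; norm z = 1\<rbrakk> \<Longrightarrow> \<phi> t z \<in> V \<union> \<Union>E"
proof -
  assume t: "t \<in> T" "norm z = 1"
  obtain j s where j: "j < n t" "0 \<le> s" "s < 1" "z = boundary_point (n t) (real j + s)"
    using sphere_cases [OF t] by metis
  then show ?thesis
    using side_in [OF t(1) j(1), of s] bside [OF t(1) j(1)] by auto
qed

lemma tile_iff:
  assumes "t \<in> T" "norm z \<le> 1"
  shows "\<phi> t z \<in> t \<longleftrightarrow> norm z < 1"
proof
  show "\<phi> t z \<in> t" if "norm z < 1"
    using tile_image [OF assms(1)] that by (metis imageI mem_ball_0)
  show "norm z < 1" if "\<phi> t z \<in> t"
  proof (rule ccontr)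
    assume "\<not> norm z < 1"
    then have "\<phi> t z \<in> V \<union> \<Union>E" using sphere_graph [OF assms(1), of z] assms(2) by simp
    then show False using tile_subset(2) [OF assms(1)] that by blast
  qed
qed

lemma tile_unique:
  assumes "t \<in> T" "t' \<in> T" "norm z < 1" "norm w \<le> 1" "\<phi> t z = \<phi> t' w"
  shows "t = t' \<and> z = w"
proof -
  have z: "\<phi> t z \<in> t" using tile_iff [OF assms(1), of z] assms(3) by simp
  have "norm w \<noteq> 1"
    using sphere_graph [OF assms(2), of w] tile_subset(2) [OF assms(1)] z assms(5) by auto
  then have "norm w < 1" using assms(4) by simp
  then have "t = t'"
    using tile_iff [OF assms(2), of w] assms z tile_disjoint [OF assms(1,2)] by metis
  then show ?thesis using \<phi>_inj assms \<open>norm w < 1\<close> by blast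
qed

text \<open>Along a common boundary path \<open>\<phi> t\<^sub>1 \<circ> boundary_point \<circ> a\<^sub>1 = \<phi> t\<^sub>2 \<circ> boundary_point \<circ> a\<^sub>2\<close> two half
  disks are glued to a disk.\<close>
lemma open_glued:
  fixes a1 a2 :: "real \<Rightarrow> real"
  assumes t: "t1 \<in> T" "t2 \<in> T"
    and a: "continuous_on {p<..<q} a1" "continuous_on {p<..<q} a2"
    and eq: "\<And>s. \<lbrakk>p < s; s < q\<rbrakk> \<Longrightarrow>
      \<phi> t1 (boundary_point (n t1) (a1 s)) = \<phi> t2 (boundary_point (n t2) (a2 s))"
    and inj: "inj_on (\<lambda>s. \<phi> t1 (boundary_point (n t1) (a1 s))) {p<..<q}"
    and disj: "\<And>s s'. \<lbrakk>t1 = t2; p < s; s < q; p < s'; s' < q\<rbrakk> \<Longrightarrow>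
      boundary_point (n t1) (a1 s) \<noteq> boundary_point (n t1) (a2 s')"
  shows "openin X ({\<phi> t1 (polar (n t1) r (a1 s)) | r s. 0 < r \<and> r \<le> 1 \<and> p < s \<and> s < q} \<union>
                   {\<phi> t2 (polar (n t2) r (a2 s)) | r s. 0 < r \<and> r \<le> 1 \<and> p < s \<and> s < q})"
proof -
  define U where "U = {z. p < Re z} \<inter> {z. Re z < q} \<inter> {z. - 1 < Im z} \<inter> {z. Im z < 1}"
  \<comment> \<open>The real coordinate of the strip runs along the common boundary path, the
    imaginary one across it: the lower half goes into \<open>t1\<close>, the upper half into
    \<open>t2\<close>, with radius \<open>1 - \<bar>Im z\<bar>\<close>.\<close>
  define F where "F z = (if Im z \<le> 0 then \<phi> t1 (polar (n t1) (1 + Im z) (a1 (Re z)))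
      else \<phi> t2 (polar (n t2) (1 - Im z) (a2 (Re z))))" for z
  have "open U"
    unfolding U_def
    by (intro open_Int open_halfspace_Re_gt open_halfspace_Re_lt open_halfspace_Im_gt open_halfspace_Im_lt)
  have cont: "continuous_map (top_of_set U) X F"
    unfolding F_def
  proof (rule continuous_map_cases_le)
    have c: "continuous_on {x \<in> U. P x} (\<lambda>z. a (Re z))" if "continuous_on {p<..<q} a" for a P
      by (rule continuous_on_compose2 [OF that]) (auto intro!: continuous_intros simp: U_def)
    have "continuous_map (top_of_set {x \<in> U. Im x \<le> 0}) (top_of_set (cball 0 1))
        (\<lambda>z. polar (n t1) (1 + Im z) (a1 (Re z)))"
      using c [OF a(1)] by (auto simp: continuous_map_in_subtopology U_def intro!: continuous_intros)
    from continuous_map_compose [OF this continuous_\<phi> [OF t(1)]]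
    show "continuous_map (subtopology (top_of_set U) {x \<in> topspace (top_of_set U). Im x \<le> 0}) X
        (\<lambda>x. \<phi> t1 (polar (n t1) (1 + Im x) (a1 (Re x))))"
      by (simp add: subtopology_subtopology o_def Int_absorb1 Collect_restrict)
    have "continuous_map (top_of_set {x \<in> U. 0 \<le> Im x}) (top_of_set (cball 0 1))
        (\<lambda>z. polar (n t2) (1 - Im z) (a2 (Re z)))"
      using c [OF a(2)] by (auto simp: continuous_map_in_subtopology U_def intro!: continuous_intros)
    from continuous_map_compose [OF this continuous_\<phi> [OF t(2)]]
    show "continuous_map (subtopology (top_of_set U) {x \<in> topspace (top_of_set U). 0 \<le> Im x}) X
        (\<lambda>x. \<phi> t2 (polar (n t2) (1 - Im x) (a2 (Re x))))"
      by (simp add: subtopology_subtopology o_def Int_absorb1 Collect_restrict)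
  qed (use eq in \<open>auto simp: U_def intro!: continuous_intros\<close>)
  have 1: "z = w" if "t \<in> T" "norm x < 1" "norm y \<le> 1" "\<phi> t x = \<phi> t y" "x = polar (n t) r (a (Re z))"
    "y = polar (n t) r' (a (Re w))" "z \<in> U" "w \<in> U" "0 < r" "0 < r'" "r = r' \<longrightarrow> Im z = Im w"
    "inj_on (\<lambda>s. \<phi> t (boundary_point (n t) (a s))) {p<..<q}" for t x y z w r r' a
  proof -
    have "x = y" using tile_unique that(1-4) by blast
    then have "r = r'" "boundary_point (n t) (a (Re z)) = boundary_point (n t) (a (Re w))"
      using that polar_eq_iff [of r r'] by auto
    then have "Re z = Re w"
      using that(7,8) by (intro inj_onD [OF that(12)]) (auto simp: U_def)
    then show ?thesis
      using that(11) \<open>r = r'\<close> by (simp add: complex_eqI)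
  qed
  \<comment> \<open>For \<open>t1 = t2\<close> both half disks lie in one tile, and
    \<open>disj\<close> keeps them apart.\<close>
  have 2: False if "norm x < 1" "norm y \<le> 1" "\<phi> t1 x = \<phi> t2 y" "x = polar (n t1) r (a1 (Re z))"
    "y = polar (n t2) r' (a2 (Re w))" "z \<in> U" "w \<in> U" "0 < r" "0 < r'" for x y z w r r'
  proof -
    have "t1 = t2" "x = y" using tile_unique t that(1-3) by blast+
    then have "boundary_point (n t1) (a1 (Re z)) = boundary_point (n t1) (a2 (Re w))"
      using that polar_eq_iff [of r r'] by auto
    then show ?thesis
      using disj [OF \<open>t1 = t2\<close>, of "Re z" "Re w"] that by (auto simp: U_def)
  qed
  have inj2: "inj_on (\<lambda>s. \<phi> t2 (boundary_point (n t2) (a2 s))) {p<..<q}"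
    using inj eq by (simp add: inj_on_def)
  have injF: "inj_on F U"
  proof (rule inj_onI)
    fix z w assume zw: "z \<in> U" "w \<in> U" "F z = F w"
    have I: "- 1 < Im z" "Im z < 1" "- 1 < Im w" "Im w < 1" using zw by (auto simp: U_def)
    have main: "z = w" if zw: "z \<in> U" "w \<in> U" "F z = F w" and le: "Im z \<le> Im w"
      and I: "- 1 < Im z" "Im z < 1" "- 1 < Im w" "Im w < 1" for z w
    proof -
      consider "Im w < 0" | "Im z < 0" "Im w = 0" | "Im z < 0" "0 < Im w" | "Im z = 0" "Im w = 0" | "Im z = 0" "0 < Im w" | "0 < Im z"
        using le by linarith
      then show ?thesis
      proof cases
        case c1: 1
        show ?thesis
          by (rule 1 [OF t(1) _ _ _ refl refl zw(1,2) _ _ _ inj, of "1 + Im z" "1 + Im w"])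
            (use zw(3) c1 I le in \<open>auto simp: F_def\<close>)
      next
        case 2
        show ?thesis
          by (rule 1 [OF t(1) _ _ _ refl refl zw(1,2) _ _ _ inj, of "1 + Im z" "1 + Im w"])
            (use zw(3) 2 I le in \<open>auto simp: F_def\<close>)
      next
        case 3
        show ?thesis
          by (rule FalseE, rule 2 [OF _ _ _ refl refl zw(1,2), of "1 + Im z" "1 - Im w"])
            (use zw(3) 3 I le in \<open>auto simp: F_def\<close>)
      next
        case 4
        then have "Re z = Re w"
          using zw inj_onD [OF inj, of "Re z" "Re w"] by (auto simp: F_def U_def)
        then show ?thesis using 4 by (simp add: complex_eq_iff)
      next
        case 5
        have "w = z"
          by (rule 1 [OF t(2) _ _ _ refl refl zw(2,1) _ _ _ inj2, of "1 - Im w" "1 - Im z"])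
            (use zw 5 I le eq [of "Re z"] in \<open>auto simp: F_def U_def\<close>)
        then show ?thesis by simp
      next
        case 6
        show ?thesis
          by (rule 1 [OF t(2) _ _ _ refl refl zw(1,2) _ _ _ inj2, of "1 - Im z" "1 - Im w"])
            (use zw(3) 6 I le in \<open>auto simp: F_def\<close>)
      qed
    qed
    show "z = w"
    proof (cases "Im z \<le> Im w")
      case True
      show ?thesis by (rule main [OF zw True I])
    next
      case False
      then have "Im w \<le> Im z" by simp
      from main [OF zw(2,1) zw(3)[symmetric] this I(3,4,1,2)] show ?thesis by simp
    qed
  qed
  have "openin X (F ` U)"
    by (rule closed_surface_invariance_of_domain [OF X \<open>open U\<close> cont injF])
  moreover have "F ` U = {\<phi> t1 (polar (n t1) r (a1 s)) | r s. 0 < r \<and> r \<le> 1 \<and> p < s \<and> s < q} \<union>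
                   {\<phi> t2 (polar (n t2) r (a2 s)) | r s. 0 < r \<and> r \<le> 1 \<and> p < s \<and> s < q}" (is "_ = ?A \<union> ?B")
  proof (intro equalityI subsetI)
    fix x assume "x \<in> F ` U"
    then obtain z where z: "z \<in> U" "x = F z" by auto
    show "x \<in> ?A \<union> ?B"
    proof (cases "Im z \<le> 0")
      case True
      then have "x = \<phi> t1 (polar (n t1) (1 + Im z) (a1 (Re z)))" using z by (simp add: F_def)
      moreover have "0 < 1 + Im z \<and> 1 + Im z \<le> 1 \<and> p < Re z \<and> Re z < q" using z True by (auto simp: U_def)
      ultimately show ?thesis by blast
    next
      case False
      then have "x = \<phi> t2 (polar (n t2) (1 - Im z) (a2 (Re z)))" using z by (simp add: F_def)
      moreover have "0 < 1 - Im z \<and> 1 - Im z \<le> 1 \<and> p < Re z \<and> Re z < q" using z False by (auto simp: U_def)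
      ultimately show ?thesis by blast
    qed
  next
    fix x assume "x \<in> ?A \<union> ?B"
    then show "x \<in> F ` U"
    proof
      assume "x \<in> ?A"
      then obtain r s where "0 < r" "r \<le> 1" "p < s" "s < q" "x = \<phi> t1 (polar (n t1) r (a1 s))" by blast
      then show ?thesis
        by (intro image_eqI [of _ _ "Complex s (r - 1)"]) (auto simp: F_def U_def)
    next
      assume "x \<in> ?B"
      then obtain r s where "0 < r" "r \<le> 1" "p < s" "s < q" "x = \<phi> t2 (polar (n t2) r (a2 s))" by blast
      then show ?thesis
        using eq [of s]
        by (intro image_eqI [of _ _ "Complex s (1 - r)"]) (auto simp: F_def U_def)
    qed
  qed
  ultimately show ?thesis by simp
qed

end

text \<open>Continuity at a boundary point of a tile: a neighbourhood of its image contains images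
  of nearby points of \<open>D\<close>, typically interior points of the tile, and \<open>C\<close>
  confines them to a chosen sector.\<close>

lemma continuous_map_near_point:
  assumes f: "continuous_map (top_of_set K) X f" and S: "openin X S" "f x \<in> S"
    and x: "x \<in> K" "x \<in> closure D" and C: "open C" "x \<in> C" and D: "D \<subseteq> K"
  shows "\<exists>y\<in>D \<inter> C. f y \<in> S"
proof -
  have "openin (top_of_set K) {y \<in> K. f y \<in> S}"
    using openin_continuous_map_preimage [OF f S(1)] by simp
  then obtain W where W: "open W" "{y \<in> K. f y \<in> S} = K \<inter> W"
    by (auto simp: openin_open)
  have "x \<in> W \<inter> C"
    using W x S C by blast
  then have "W \<inter> C \<inter> D \<noteq> {}"
    using x(2) W(1) C(1) open_Int_closure_eq_empty [of "W \<inter> C" D] by blast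
  then show ?thesis
    using W(2) D by blast
qed

lemma finite_card_le_2:
  assumes "\<And>x y z. \<lbrakk>x \<in> A; y \<in> A; z \<in> A; x \<noteq> y; x \<noteq> z; y \<noteq> z\<rbrakk> \<Longrightarrow> False"
  shows "finite A \<and> card A \<le> 2"
proof (rule ccontr)
  assume "\<not> (finite A \<and> card A \<le> 2)"
  then obtain B where "B \<subseteq> A" "card B = 3"
    by (metis infinite_arbitrarily_large obtain_subset_with_card_n not_less_eq_eq numeral_2_eq_2
        numeral_3_eq_3)
  then show False
    using assms by (metis card_3_iff insert_subset)
qed

lemma wedge_disjoint:
  assumes "0 < n" "i < n" "j < n" "z \<in> wedge n (real i) (real i + 1)" "z \<in> wedge n (real j) (real j + 1)"
  shows "i = j"
proof -
  obtain r s where s: "0 < r" "real i < s" "s < real i + 1" "z = polar n r s"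
    using assms(4) by (auto simp: wedge_def)
  obtain r' s' where s': "0 < r'" "real j < s'" "s' < real j + 1" "z = polar n r' s'"
    using assms(5) by (auto simp: wedge_def)
  have "boundary_point n (real i + (s - real i)) = boundary_point n (real j + (s' - real j))"
    using s s' polar_eq_iff [of r r' n s n s'] by simp
  then show ?thesis
    using nat_frac_boundary_point_eq [OF assms(1-3), of "s - real i" "s' - real j"] s s' by simp
qed

section \<open>Exactly two sides along each edge\<close>

context polygon_family
begin

text \<open>A tile that borders \<open>e\<close> twice contributes two pairs.\<close>

definition sides :: "'a set \<Rightarrow> ('a set \<times> nat) set" where
  "sides e = {(t, j). t \<in> T \<and> j < n t \<and> bside t j = e}"

lemma side_in_sides_interior:
  assumes "e \<in> E" "(t, j) \<in> sides e" "0 < s" "s < 1"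
  shows "\<phi> t (boundary_point (n t) (real j + s)) \<in> \<gamma> e ` {0<..<1}"
proof -
  have t: "t \<in> T" "j < n t" "bside t j = e" using assms by (auto simp: sides_def)
  then show ?thesis
    using edge_cases_nonvertex [OF assms(1) _ side_nonvertex [OF t(1,2) assms(3,4)]]
      side_in [OF t(1,2), of s] assms(3,4) by (metis greaterThanLessThan_iff imageI less_imp_le)
qed

text \<open>Two different sides along \<open>e\<close> already glue to an open set around the open
  edge. The upper bound for this set is the point: it leaves no room for a further side.\<close>

lemma glued_sides:
  assumes e: "e \<in> E" and s: "(t1, j1) \<in> sides e" "(t2, j2) \<in> sides e" "(t1, j1) \<noteq> (t2, j2)"
  obtains S where "openin X S" "\<gamma> e ` {0<..<1} \<subseteq> S"
    "S \<subseteq> \<gamma> e ` {0<..<1} \<union> \<phi> t1 ` (ball 0 1 \<inter> wedge (n t1) (real j1) (real j1 + 1))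
           \<union> \<phi> t2 ` (ball 0 1 \<inter> wedge (n t2) (real j2) (real j2 + 1))"
proof -
  have t: "t1 \<in> T" "j1 < n t1" "bside t1 j1 = e" "t2 \<in> T" "j2 < n t2" "bside t2 j2 = e"
    using s by (auto simp: sides_def)
  obtain a1 where a1: "a1 = (\<lambda>s. real j1 + s) \<or> a1 = (\<lambda>s. real j1 + 1 - s)"
    "\<And>s. \<lbrakk>0 \<le> s; s \<le> 1\<rbrakk> \<Longrightarrow> \<phi> t1 (boundary_point (n t1) (a1 s)) = \<gamma> e s"
    using side_param [OF t(1,2)] t(3) by metis
  obtain a2 where a2: "a2 = (\<lambda>s. real j2 + s) \<or> a2 = (\<lambda>s. real j2 + 1 - s)"
    "\<And>s. \<lbrakk>0 \<le> s; s \<le> 1\<rbrakk> \<Longrightarrow> \<phi> t2 (boundary_point (n t2) (a2 s)) = \<gamma> e s"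
    using side_param [OF t(4,5)] t(6) by metis
  have r1: "real j1 < a1 s \<and> a1 s < real j1 + 1" if "0 < s" "s < 1" for s
    using a1(1) that by auto
  have r2: "real j2 < a2 s \<and> a2 s < real j2 + 1" if "0 < s" "s < 1" for s
    using a2(1) that by auto
  let ?S = "{\<phi> t1 (polar (n t1) r (a1 s)) | r s. 0 < r \<and> r \<le> 1 \<and> 0 < s \<and> s < 1} \<union>
                   {\<phi> t2 (polar (n t2) r (a2 s)) | r s. 0 < r \<and> r \<le> 1 \<and> 0 < s \<and> s < 1}"
  have "openin X ?S"
  proof (rule open_glued [OF t(1,4)])
    show "continuous_on {0<..<1} a1" "continuous_on {0<..<1} a2"
      using a1(1) a2(1) by (auto intro!: continuous_intros)
    show "\<phi> t1 (boundary_point (n t1) (a1 s)) = \<phi> t2 (boundary_point (n t2) (a2 s))"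
      if "0 < s" "s < 1" for s using a1(2) a2(2) that by simp
    show "inj_on (\<lambda>s. \<phi> t1 (boundary_point (n t1) (a1 s))) {0<..<1}"
    proof (rule inj_onI)
      fix x y assume "x \<in> {0<..<1::real}" "y \<in> {0<..<1}"
        "\<phi> t1 (boundary_point (n t1) (a1 x)) = \<phi> t1 (boundary_point (n t1) (a1 y))"
      then show "x = y" using a1(2) [of x] a1(2) [of y] edge_inj [OF e, of x y] by auto
    qed
    show "boundary_point (n t1) (a1 s) \<noteq> boundary_point (n t1) (a2 s')"
      if "t1 = t2" "0 < s" "s < 1" "0 < s'" "s' < 1" for s s'
    proof
      assume eq: "boundary_point (n t1) (a1 s) = boundary_point (n t1) (a2 s')"
      have "j1 = j2"
        by (rule wedge_disjoint [of "n t1" _ _ "boundary_point (n t1) (a1 s)"])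
          (use t that r1 [of s] r2 [of s'] wedgeI [of 1 _ "a1 s" _ "n t1"] wedgeI [of 1 _ "a2 s'" _ "n t1"] eq n_pos in auto)
      then show False using s(3) that(1) by simp
    qed
  qed
  moreover have "\<gamma> e ` {0<..<1} \<subseteq> ?S"
  proof clarify
    fix s :: real assume "s \<in> {0<..<1}" "\<nexists>r s'. \<gamma> e s = \<phi> t2 (polar (n t2) r (a2 s')) \<and> 0 < r \<and> r \<le> 1 \<and> 0 < s' \<and> s' < 1"
    then show "\<exists>r s'. \<gamma> e s = \<phi> t1 (polar (n t1) r (a1 s')) \<and> 0 < r \<and> r \<le> 1 \<and> 0 < s' \<and> s' < 1"
      using a1(2) [of s] by (intro exI [of _ 1] exI [of _ s]) auto
  qed
  moreover have "?S \<subseteq> \<gamma> e ` {0<..<1} \<union> \<phi> t1 ` (ball 0 1 \<inter> wedge (n t1) (real j1) (real j1 + 1))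
           \<union> \<phi> t2 ` (ball 0 1 \<inter> wedge (n t2) (real j2) (real j2 + 1))" (is "_ \<subseteq> ?G \<union> ?A \<union> ?B")
  proof -
    have *: "\<phi> t (polar (n t) r (a s)) \<in> ?G \<union> \<phi> t ` (ball 0 1 \<inter> wedge (n t) (real j) (real j + 1))"
      if "0 < r" "r \<le> 1" "0 < s" "s < 1" "\<phi> t (boundary_point (n t) (a s)) = \<gamma> e s"
        "real j < a s \<and> a s < real j + 1" for t j a r s
    proof (cases "r = 1")
      case True
      then show ?thesis using that by auto
    next
      case False
      then have "polar (n t) r (a s) \<in> ball 0 1 \<inter> wedge (n t) (real j) (real j + 1)"
        using that by (auto intro: wedgeI)
      then show ?thesis by blast
    qed
    show ?thesis
    proof
      fix x assume "x \<in> ?S"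
      then consider r s where "0 < r" "r \<le> 1" "0 < s" "s < 1" "x = \<phi> t1 (polar (n t1) r (a1 s))"
        | r s where "0 < r" "r \<le> 1" "0 < s" "s < 1" "x = \<phi> t2 (polar (n t2) r (a2 s))" by blast
      then show "x \<in> ?G \<union> ?A \<union> ?B"
      proof cases
        case 1
        then show ?thesis using * [of r s t1 a1 j1] a1(2) [of s] r1 [of s] by auto
      next
        case 2
        then show ?thesis using * [of r s t2 a2 j2] a2(2) [of s] r2 [of s] by auto
      qed
    qed
  qed
  ultimately show ?thesis using that by blast
qed

text \<open>A third side would have interior points of its tile arbitrarily close to the middle of
  \<open>e\<close>, hence inside the neighbourhood formed by the other two; but the sectors over
  distinct sides have disjoint images.\<close>

lemma sides_no_three:
  assumes e: "e \<in> E" and s: "p1 \<in> sides e" "p2 \<in> sides e" "p3 \<in> sides e" "p1 \<noteq> p2" "p1 \<noteq> p3" "p2 \<noteq> p3"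
  shows False
proof -
  obtain t1 j1 t2 j2 t3 j3 where p: "p1 = (t1, j1)" "p2 = (t2, j2)" "p3 = (t3, j3)"
    by (metis surj_pair)
  obtain S where S: "openin X S" "\<gamma> e ` {0<..<1} \<subseteq> S"
    "S \<subseteq> \<gamma> e ` {0<..<1} \<union> \<phi> t1 ` (ball 0 1 \<inter> wedge (n t1) (real j1) (real j1 + 1))
           \<union> \<phi> t2 ` (ball 0 1 \<inter> wedge (n t2) (real j2) (real j2 + 1))"
    using glued_sides [OF e] s p by metis
  have t3: "t3 \<in> T" "j3 < n t3" using s p by (auto simp: sides_def)
  let ?z = "boundary_point (n t3) (real j3 + 1/2)"
  have zS: "\<phi> t3 ?z \<in> S"
    using side_in_sides_interior [OF e, of t3 j3 "1/2"] s p S(2) by auto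
  have "?z \<in> wedge (n t3) (real j3) (real j3 + 1)"
    using wedgeI [of 1 "real j3" "real j3 + 1/2" "real j3 + 1" "n t3"] by simp
  moreover have "open (wedge (n t3) (real j3) (real j3 + 1))"
    using open_wedge [of "n t3"] n_pos [OF t3(1)] by simp
  ultimately obtain w where w: "w \<in> ball 0 1" "w \<in> wedge (n t3) (real j3) (real j3 + 1)" "\<phi> t3 w \<in> S"
    using continuous_map_near_point [OF continuous_\<phi> [OF t3(1)] S(1) zS, of "ball 0 1" "wedge (n t3) (real j3) (real j3 + 1)"]
    by auto
  have *: "t = t3 \<and> j = j3" if h: "(t, j) \<in> sides e" "\<phi> t3 w \<in> \<phi> t ` (ball 0 1 \<inter> wedge (n t) (real j) (real j + 1))" for t j
  proof -
    obtain w' where w': "norm w' < 1" "w' \<in> wedge (n t) (real j) (real j + 1)" "\<phi> t3 w = \<phi> t w'"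
      using h(2) by auto
    have "t \<in> T" "j < n t" using h(1) by (auto simp: sides_def)
    then have "t3 = t \<and> w = w'"
      using tile_unique [OF t3(1) \<open>t \<in> T\<close>, of w w'] w w' by simp
    then show ?thesis
      using wedge_disjoint w w' t3 \<open>j < n t\<close> n_pos by blast
  qed
  have "\<phi> t3 w \<notin> \<gamma> e ` {0<..<1}"
    using tile_iff [OF t3(1), of w] tile_subset(2) [OF t3(1)] w(1) edge(2) [OF e] e by fastforce
  then show False
    using * s p S(3) w(3) by blast
qed

lemma finite_sides: "e \<in> E \<Longrightarrow> finite (sides e)" and card_sides_le: "e \<in> E \<Longrightarrow> card (sides e) \<le> 2"
  using finite_card_le_2 sides_no_three by (metis, metis)

text \<open>Every tile has a side \<open>0\<close> along one of the finitely many edges, and at most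
  two sides share an edge.\<close>

lemma finite_T: "finite T"
proof -
  have "T \<subseteq> fst ` (\<Union>e\<in>E. sides e)"
  proof
    fix t assume "t \<in> T"
    then have "(t, 0) \<in> sides (bside t 0)" "bside t 0 \<in> E"
      using bside by (auto simp: sides_def)
    then show "t \<in> fst ` (\<Union>e\<in>E. sides e)" by force
  qed
  then show ?thesis
    using finite_sides graph by (meson embedded_graph_def finite_UN finite_imageI finite_subset)
qed

text \<open>All that is away from \<open>e\<close> is closed: the rest of the graph, and in each
  tile the part of the closed disk outside the open wedges over the sides along \<open>e\<close>.
  With finitely many tiles the union is closed, too.\<close>

lemma edge_point_nbhd:
  assumes e: "e \<in> E"
  obtains S where "openin X S" "\<gamma> e (1/2) \<in> S"
    "S \<subseteq> \<gamma> e ` {0<..<1} \<union> (\<Union>(t, j)\<in>sides e. \<phi> t ` ball 0 1)"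
proof -
  define C where "C t = cball 0 1 - (\<Union>j\<in>{j. (t, j) \<in> sides e}. wedge (n t) (real j) (real j + 1))" for t
  define F where "F = V \<union> \<Union>(E - {e}) \<union> (\<Union>t\<in>T. \<phi> t ` C t)"
  have "closedin X (\<phi> t ` C t)" if t: "t \<in> T" for t
  proof -
    have "compact (C t)"
      unfolding C_def using n_pos [OF t] by (intro compact_diff compact_cball open_UN ballI open_wedge) auto
    then show ?thesis
      using continuous_image_compact_closedin [OF _ Haus continuous_\<phi> [OF t]] by (auto simp: C_def)
  qed
  then have "closedin X F"
    unfolding F_def using graph embedded_graph_closedin [OF graph Haus] finite_T
    by (intro closedin_Un closedin_Union) (auto simp: embedded_graph_def)
  then have S: "openin X (topspace X - F)" by blast
  have "\<gamma> e (1/2) \<notin> \<phi> t ` C t" if t: "t \<in> T" for t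
  proof
    assume "\<gamma> e (1/2) \<in> \<phi> t ` C t"
    then obtain z where z: "z \<in> C t" "\<gamma> e (1/2) = \<phi> t z" by blast
    have "\<gamma> e (1/2) \<notin> t" using tile_subset(2) [OF t] edge_mem [OF e, of "1/2"] e by auto
    then have "norm z = 1" using z tile_iff [OF t, of z] by (force simp: C_def)
    then obtain j s where j: "j < n t" "0 \<le> s" "s < 1" "z = boundary_point (n t) (real j + s)"
      using sphere_cases [OF t] by blast
    have "s \<noteq> 0" using edge_V(1) [OF e, of "1/2"] z j side_vertex [OF t j(1)] by auto
    then have "z \<in> wedge (n t) (real j) (real j + 1)"
      using wedgeI [of 1 "real j" "real j + s" "real j + 1" "n t"] j by simp
    moreover have "(t, j) \<in> sides e"
      using edge_unique [OF e bside [OF t j(1)], of "\<gamma> e (1/2)"] edge_mem [OF e, of "1/2"] edge_V(1) [OF e, of "1/2"]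
        side_in [OF t j(1), of s] j z t by (auto simp: sides_def)
    ultimately show False using z(1) by (auto simp: C_def)
  qed
  moreover have "\<gamma> e (1/2) \<notin> \<Union>(E - {e})"
    using edge_unique [OF e] edge_mem [OF e, of "1/2"] edge_V(1) [OF e, of "1/2"] by auto
  moreover have "\<gamma> e (1/2) \<in> topspace X"
    using edge(1) [OF e] unfolding edge_path_def pathin_def continuous_map_def by auto
  ultimately have "\<gamma> e (1/2) \<in> topspace X - F"
    using edge_V(1) [OF e, of "1/2"] by (auto simp: F_def)
  moreover have "topspace X - F \<subseteq> \<gamma> e ` {0<..<1} \<union> (\<Union>(t, j)\<in>sides e. \<phi> t ` ball 0 1)"
  proof
    fix x assume x: "x \<in> topspace X - F"
    show "x \<in> \<gamma> e ` {0<..<1} \<union> (\<Union>(t, j)\<in>sides e. \<phi> t ` ball 0 1)"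
    proof (cases "x \<in> V \<union> \<Union>E")
      case True
      then have "x \<in> e" "x \<notin> V" using x by (auto simp: F_def)
      then obtain s where "0 < s" "s < 1" "x = \<gamma> e s"
        using edge_cases_nonvertex [OF e] by blast
      then show ?thesis by auto
    next
      case False
      then obtain t where t: "t \<in> T" "x \<in> t" using Union_tiles x by blast
      then obtain z where z: "z \<in> ball 0 1" "x = \<phi> t z" using tile_image by blast
      then have "z \<notin> C t" using x t by (auto simp: F_def)
      then obtain j where "(t, j) \<in> sides e" using z by (auto simp: C_def)
      then show ?thesis using z by blast
    qed
  qed
  ultimately show ?thesis using that S by blast
qed

text \<open>Without an adjacent tile the edge alone would contain a neighbourhood of its middle, and
  a segment in the plane would have interior points.\<close>

lemma sides_nonempty:
  assumes e: "e \<in> E"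
  shows "sides e \<noteq> {}"
proof
  assume em: "sides e = {}"
  obtain S where S: "openin X S" "\<gamma> e (1/2) \<in> S" "S \<subseteq> \<gamma> e ` {0<..<1}"
    using edge_point_nbhd [OF e] em by auto
  \<comment> \<open>The unit interval is placed in the plane, where preimages are known to be
    open.\<close>
  let ?K = "complex_of_real ` {0..1}"
  let ?Z = "{z \<in> ?K. (\<gamma> e \<circ> Re) z \<in> S}"
  have "open ?Z"
  proof (rule closed_surface_open_preimage [OF X _ _ S(1)])
    show "compact ?K"
      by (intro compact_continuous_image continuous_intros compact_Icc)
    have "continuous_map (top_of_set ?K) (top_of_set {0..1}) Re"
      by (auto simp: continuous_map_in_subtopology intro!: continuous_intros)
    then show "continuous_map (top_of_set ?K) X (\<gamma> e \<circ> Re)"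
      using edge(1) [OF e] continuous_map_compose unfolding edge_path_def pathin_def by blast
    show "S \<subseteq> (\<gamma> e \<circ> Re) ` ?K"
    proof
      fix x assume "x \<in> S"
      then have "x \<in> \<gamma> e ` {0<..<1}" using S(3) by blast
      then obtain s where "0 < s" "s < 1" "x = \<gamma> e s" by auto
      then show "x \<in> (\<gamma> e \<circ> Re) ` ?K" by (intro image_eqI [of _ _ "of_real s"]) auto
    qed
    show "inj_on (\<gamma> e \<circ> Re) ?Z"
    proof (rule inj_onI)
      have *: "0 < Re z \<and> Re z < 1 \<and> Im z = 0" if z: "z \<in> ?Z" for z
      proof -
        obtain s where "0 \<le> s" "s \<le> 1" "z = of_real s" "\<gamma> e s \<in> S"
          using z by auto
        moreover from this have "\<gamma> e s \<notin> V" using subsetD [OF S(3), of "\<gamma> e s"] edge_V(1) [OF e] by auto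
        then have "s \<noteq> 0" "s \<noteq> 1" using edge_V(2,3) [OF e] by auto
        ultimately show ?thesis by auto
      qed
      fix z w assume zw: "z \<in> ?Z" "w \<in> ?Z" "(\<gamma> e \<circ> Re) z = (\<gamma> e \<circ> Re) w"
      show "z = w"
        using * [OF zw(1)] * [OF zw(2)] zw(3) edge_inj [OF e, of "Re z" "Re w"] by (simp add: complex_eq_iff)
    qed
  qed
  moreover have "of_real (1/2) \<in> ?Z" using S(2) by (intro CollectI conjI imageI) auto
  ultimately obtain \<epsilon> where \<epsilon>: "\<epsilon> > 0" "ball (of_real (1/2)) \<epsilon> \<subseteq> ?Z"
    by (meson open_contains_ball)
  then have "Complex (1/2) (\<epsilon>/2) \<in> ?Z"
    by (intro subsetD [OF \<epsilon>(2)]) (simp add: dist_norm complex_norm cmod_def)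
  then obtain x where "Complex (1/2) (\<epsilon>/2) = of_real x" by auto
  from arg_cong [OF this, of Im] show False using \<epsilon>(1) by simp
qed

text \<open>With a single adjacent side a neighbourhood of the middle of \<open>e\<close> would be
  covered injectively by the closed disk, and a point of the unit circle would be interior to the
  closed disk.\<close>

lemma sides_not_single:
  assumes e: "e \<in> E"
  shows "sides e \<noteq> {p}"
proof
  assume "sides e = {p}"
  then obtain t j where sd: "sides e = {(t, j)}" by (metis surj_pair)
  then have "(t, j) \<in> sides e" by simp
  then have t: "t \<in> T" "j < n t" "bside t j = e" unfolding sides_def by simp_all
  obtain S where S: "openin X S" "\<gamma> e (1/2) \<in> S"
      "S \<subseteq> \<gamma> e ` {0<..<1} \<union> (\<Union>(t, j)\<in>sides e. \<phi> t ` ball 0 1)"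
    using edge_point_nbhd [OF e] by metis
  then have S3: "S \<subseteq> \<gamma> e ` {0<..<1} \<union> \<phi> t ` ball 0 1" by (simp add: sd)
  obtain a where a: "a = (\<lambda>s. real j + s) \<or> a = (\<lambda>s. real j + 1 - s)"
    "\<And>s. \<lbrakk>0 \<le> s; s \<le> 1\<rbrakk> \<Longrightarrow> \<phi> t (boundary_point (n t) (a s)) = \<gamma> e s"
    using side_param [OF t(1,2)] t(3) by metis
  let ?Z = "{z \<in> cball 0 1. \<phi> t z \<in> S}"
  have "open ?Z"
  proof (rule closed_surface_open_preimage [OF X compact_cball continuous_\<phi> [OF t(1)] S(1)])
    show "S \<subseteq> \<phi> t ` cball 0 1"
    proof
      fix x assume "x \<in> S"
      then have "x \<in> \<gamma> e ` {0<..<1} \<or> x \<in> \<phi> t ` ball 0 1" using S3 by blast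
      then consider s where "0 < s" "s < 1" "x = \<gamma> e s" | "x \<in> \<phi> t ` ball 0 1"
        by auto
      then show "x \<in> \<phi> t ` cball 0 1"
      proof cases
        case 1
        then show ?thesis
          using a(2) [of s] by (intro image_eqI [of _ _ "boundary_point (n t) (a s)"]) auto
      next
        case 2 then show ?thesis using ball_subset_cball by blast
      qed
    qed
    show "inj_on (\<phi> t) ?Z"
    proof (rule inj_onI)
      have *: "\<exists>s. 0 < s \<and> s < 1 \<and> z = boundary_point (n t) (real j + s)" if z: "z \<in> ?Z" "norm z = 1" for z
      proof -
        obtain i s where i: "i < n t" "0 \<le> s" "s < 1" "z = boundary_point (n t) (real i + s)"
          using sphere_cases [OF t(1) z(2)] by blast
        have "\<phi> t z \<notin> \<phi> t ` ball 0 1"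
          using tile_image [OF t(1)] tile_iff [OF t(1), of z] z by simp
        then have g: "\<phi> t z \<in> \<gamma> e ` {0<..<1}" using S3 z by blast
        then have nV: "\<phi> t z \<notin> V" using edge_V(1) [OF e] by auto
        then have "s \<noteq> 0" using side_vertex [OF t(1) i(1)] i(4) by auto
        moreover have "bside t i = e"
        proof (rule edge_unique [OF bside [OF t(1) i(1)] e _ _ nV])
          show "\<phi> t z \<in> bside t i"
            unfolding i(4) by (rule side_in [OF t(1) i(1)]) (use i in auto)
          show "\<phi> t z \<in> e"
            using g edge_mem [OF e] by auto
        qed
        then have "(t, i) \<in> sides e" unfolding sides_def using t(1) i(1) by simp
        then have "i = j" unfolding sd by simp
        ultimately show ?thesis using i(2-4) by (intro exI [of _ s]) simp
      qed
      fix z w assume zw: "z \<in> ?Z" "w \<in> ?Z" "\<phi> t z = \<phi> t w"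
      consider "norm z < 1" | "norm w < 1" | "norm z = 1" "norm w = 1" using zw by force
      then show "z = w"
      proof cases
        case 1
        moreover have "norm w \<le> 1" using zw(2) by simp
        ultimately show ?thesis using tile_unique [OF t(1) t(1)] zw(3) by blast
      next
        case 2
        moreover have "norm z \<le> 1" using zw(1) by simp
        ultimately show ?thesis using tile_unique [OF t(1) t(1)] zw(3) [symmetric] by blast
      next
        case 3
        then show ?thesis using * [OF zw(1)] * [OF zw(2)] zw(3) side_inj [OF t(1,2)] by metis
      qed
    qed
  qed
  then have sub: "?Z \<subseteq> interior (cball 0 1)"
    by (intro interior_maximal) auto
  have mem: "boundary_point (n t) (a (1/2)) \<in> ?Z"
    using a(2) [of "1/2"] S(2) by simp
  from subsetD [OF sub mem] show False by simp
qed

lemma card_sides: "e \<in> E \<Longrightarrow> card (sides e) = 2"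
  using card_sides_le [of e] sides_nonempty [of e] sides_not_single [of e] finite_sides [of e]
  by (metis One_nat_def card_0_eq card_1_singletonE le_SucE le_zero_eq numeral_2_eq_2)

section \<open>Corners glued around a vertex\<close>

lemma boundary_int_frac:
  assumes "t \<in> T" "of_int m < x" "x < of_int m + 1"
  obtains j where "j < n t" "\<And>y. boundary_point (n t) y = boundary_point (n t) (real j + (y - of_int m))"
proof -
  \<comment> \<open>Positions may be negative: the side that ends at corner \<open>0\<close> starts
    at \<open>- 1\<close>.\<close>
  define j where "j = nat (m mod int (n t))"
  have j: "int j = m mod int (n t)" using n_pos [OF assms(1)] by (simp add: j_def)
  then have "j < n t" using n_pos [OF assms(1)] by (metis of_nat_0_less_iff of_nat_less_iff pos_mod_bound)
  moreover have "boundary_point (n t) y = boundary_point (n t) (real j + (y - of_int m))" for y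
  proof -
    have "m = int j + (m div int (n t)) * int (n t)" using j by simp
    then have "(of_int m :: real) = real j + of_int (m div int (n t)) * real (n t)"
      by (metis of_int_add of_int_mult of_int_of_nat_eq)
    then have "y = (real j + (y - of_int m)) + of_int (m div int (n t)) * real (n t)" by simp
    then show ?thesis using boundary_point_add_int [OF n_pos [OF assms(1)]] by metis
  qed
  ultimately show ?thesis using that by blast
qed

lemma boundary_nonvertex:
  assumes "t \<in> T" "of_int m < x" "x < of_int m + 1"
  shows "\<phi> t (boundary_point (n t) x) \<notin> V"
  using boundary_int_frac [OF assms] side_nonvertex [OF assms(1), of _ "x - of_int m"] assms(2,3)
  by (metis add.commute diff_gt_0_iff_gt diff_less_eq)

lemma boundary_inj:
  assumes "t \<in> T" "of_int m < x" "x < of_int m + 1" "of_int m < y" "y < of_int m + 1"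
    "\<phi> t (boundary_point (n t) x) = \<phi> t (boundary_point (n t) y)"
  shows "x = y"
proof -
  obtain j where "j < n t" "\<And>y. boundary_point (n t) y = boundary_point (n t) (real j + (y - of_int m))"
    using boundary_int_frac [OF assms(1-3)] by blast
  then show ?thesis
    using side_inj [OF assms(1), of j "x - of_int m" "y - of_int m"] assms(2-) by (metis add.commute diff_gt_0_iff_gt diff_less_eq diff_add_cancel)
qed

text \<open>If finitely many corners at \<open>v\<close> are glued to each other along all their sides, then they
  fill up a neighbourhood of \<open>v\<close>.\<close>
lemma corner_fan:
  assumes K: "finite K" "K \<noteq> {}"
    "\<And>t j. (t, j) \<in> K \<Longrightarrow> t \<in> T \<and> j < n t \<and> \<phi> t (boundary_point (n t) (real j)) = v"
    and partner: "\<And>t j \<epsilon>. \<lbrakk>(t, j) \<in> K; \<epsilon> = 1 \<or> \<epsilon> = - 1\<rbrakk> \<Longrightarrow>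
      \<exists>t' j' \<epsilon>'. (t', j') \<in> K \<and> (\<epsilon>' = 1 \<or> \<epsilon>' = - 1) \<and> (t', j', \<epsilon>') \<noteq> (t, j, \<epsilon>) \<and>
        (\<forall>s. 0 < s \<and> s < 1/2 \<longrightarrow> \<phi> t (boundary_point (n t) (real j + \<epsilon> * s)) =
                                \<phi> t' (boundary_point (n t') (real j' + \<epsilon>' * s)))"
    and f: "f \<in> E" "v \<in> f"
  obtains t j s where "(t, j) \<in> K" "s \<noteq> 0" "- 1/2 < s" "s < 1/2" "\<phi> t (boundary_point (n t) (real j + s)) \<in> f"
proof -
  \<comment> \<open>\<open>N\<close> is the union of the corners in \<open>K\<close>, each reaching
    half a side in both directions; \<open>F\<close> is the union of the radii that cut them off
    from their tiles. \<open>F\<close> and \<open>N \<union> F\<close> are closed and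
    \<open>N\<close> is open away from \<open>v\<close>, so \<open>N\<close> covers a punctured
    neighbourhood of \<open>v\<close>.\<close>
  define N where "N = {\<phi> t (polar (n t) r (real j + s)) | t j r s. (t, j) \<in> K \<and> 0 < r \<and> r \<le> 1 \<and> - 1/2 < s \<and> s < 1/2}"
  define F where "F = (\<Union>(t, j)\<in>K. \<phi> t ` (sector (n t) (real j - 1/2) (real j - 1/2) \<union> sector (n t) (real j + 1/2) (real j + 1/2)))"
  have cl: "closedin X (\<phi> t ` C)" if "t \<in> T" "compact C" "C \<subseteq> cball 0 1" for t C
    using continuous_image_compact_closedin [OF that(2) Haus continuous_\<phi> [OF that(1)] that(3)] .
  have sc: "sector n a b \<subseteq> cball 0 1" for n a b by (rule sector_subset_cball)
  have clF: "closedin X F"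
    unfolding F_def
  proof (intro closedin_Union)
    fix A assume "A \<in> (\<lambda>(t, j). \<phi> t ` (sector (n t) (real j - 1/2) (real j - 1/2) \<union> sector (n t) (real j + 1/2) (real j + 1/2))) ` K"
    then obtain t j where "(t, j) \<in> K" "A = \<phi> t ` (sector (n t) (real j - 1/2) (real j - 1/2) \<union> sector (n t) (real j + 1/2) (real j + 1/2))"
      by auto
    then show "closedin X A"
      using K(3) cl [OF _ compact_Un [OF compact_sector compact_sector] Un_least [OF sc sc]] by blast
  qed (use K in auto)
  have NF: "N \<union> F = (\<Union>(t, j)\<in>K. \<phi> t ` sector (n t) (real j - 1/2) (real j + 1/2))"
  proof (intro equalityI subsetI)
    fix x assume "x \<in> N \<union> F"
    then consider t j r s where "(t, j) \<in> K" "0 < r" "r \<le> 1" "- 1/2 < s" "s < 1/2" "x = \<phi> t (polar (n t) r (real j + s))"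
      | t j z where "(t, j) \<in> K" "z \<in> sector (n t) (real j - 1/2) (real j - 1/2) \<union> sector (n t) (real j + 1/2) (real j + 1/2)" "x = \<phi> t z"
      unfolding N_def F_def by blast
    then show "x \<in> (\<Union>(t, j)\<in>K. \<phi> t ` sector (n t) (real j - 1/2) (real j + 1/2))"
    proof cases
      case 1
      have "polar (n t) r (real j + s) \<in> sector (n t) (real j - 1/2) (real j + 1/2)"
        using 1 by (intro sectorI) auto
      then show ?thesis using 1 by blast
    next
      case 2
      then have "z \<in> sector (n t) (real j - 1/2) (real j + 1/2)"
        by (fastforce simp: sector_def)
      then show ?thesis using 2 by blast
    qed
  next
    fix x assume "x \<in> (\<Union>(t, j)\<in>K. \<phi> t ` sector (n t) (real j - 1/2) (real j + 1/2))"
    then obtain t j r s where x: "(t, j) \<in> K" "0 \<le> r" "r \<le> 1" "real j - 1/2 \<le> s" "s \<le> real j + 1/2" "x = \<phi> t (polar (n t) r s)"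
      by (auto simp: sector_def)
    show "x \<in> N \<union> F"
    proof (cases "0 < r \<and> real j - 1/2 < s \<and> s < real j + 1/2")
      case True
      then have "x = \<phi> t (polar (n t) r (real j + (s - real j))) \<and> (t, j) \<in> K \<and> 0 < r \<and> r \<le> 1 \<and> - 1/2 < s - real j \<and> s - real j < 1/2"
        using x by auto
      then show ?thesis unfolding N_def by blast
    next
      case False
      then consider "r = 0" | "s = real j - 1/2" | "s = real j + 1/2" using x by linarith
      then have "polar (n t) r s \<in> sector (n t) (real j - 1/2) (real j - 1/2) \<union> sector (n t) (real j + 1/2) (real j + 1/2)"
      proof cases
        case 1
        have "polar (n t) 0 (real j - 1/2) \<in> sector (n t) (real j - 1/2) (real j - 1/2)" by (intro sectorI) auto
        then show ?thesis using 1 by simp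
      qed (use x in \<open>auto intro: sectorI\<close>)
      then show ?thesis using x unfolding F_def by blast
    qed
  qed
  have clNF: "closedin X (N \<union> F)"
    unfolding NF using K by (intro closedin_Union) (auto intro!: cl compact_sector sc)
  have vV: "v \<in> V" using K(2,3) side_vertex by (metis ex_in_conv surj_pair)
  have inside: "\<phi> t z \<noteq> v" if "t \<in> T" "norm z < 1" for t z
    using tile_iff [OF that(1), of z] that tile_subset(2) [OF that(1)] vV by fastforce
  have half: "\<phi> t (boundary_point (n t) (real j + s)) \<notin> V" if "t \<in> T" "s \<noteq> 0" "\<bar>s\<bar> < 1" for t j s
  proof (cases "s > 0")
    case True then show ?thesis using boundary_nonvertex [OF that(1), of "int j" "real j + s"] that by simp
  next
    case False then show ?thesis using boundary_nonvertex [OF that(1), of "int j - 1" "real j + s"] that by simp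
  qed
  have vF: "v \<notin> F"
  proof
    assume "v \<in> F"
    then obtain t j z where z: "(t, j) \<in> K" "v = \<phi> t z"
      "z \<in> sector (n t) (real j - 1/2) (real j - 1/2) \<union> sector (n t) (real j + 1/2) (real j + 1/2)"
      unfolding F_def by blast
    then obtain r s' where rs: "0 \<le> r" "r \<le> 1" "s' = real j - 1/2 \<or> s' = real j + 1/2" "z = polar (n t) r s'"
      unfolding sector_def by force
    obtain s where x: "(t, j) \<in> K" "0 \<le> r" "r \<le> 1" "s = - 1/2 \<or> s = 1/2" "v = \<phi> t (polar (n t) r (real j + s))"
    proof (rule that [of "s' - real j"])
      show "s' - real j = - 1/2 \<or> s' - real j = 1/2" using rs(3) by auto
    qed (use z rs in auto)
    have t: "t \<in> T" using x K by blast
    have "r = 1" using inside [OF t, of "polar (n t) r (real j + s)"] x by fastforce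
    then show False using half [OF t, of s j] x(4,5) vV by auto
  qed
  have opN: "openin X (N - {v})"
  proof (subst openin_subopen, intro ballI)
    fix x assume x: "x \<in> N - {v}"
    then obtain t j r s where *: "(t, j) \<in> K" "0 < r" "r \<le> 1" "- 1/2 < s" "s < 1/2" "x = \<phi> t (polar (n t) r (real j + s))"
      unfolding N_def by blast
    have t: "t \<in> T" "j < n t" "\<phi> t (boundary_point (n t) (real j)) = v" using K * by blast+
    show "\<exists>A. openin X A \<and> x \<in> A \<and> A \<subseteq> N - {v}"
    proof (cases "r < 1")
      case True
      let ?C = "ball 0 1 \<inter> wedge (n t) (real j - 1/2) (real j + 1/2)"
      have "openin X (\<phi> t ` ?C)"
        using n_pos [OF t(1)] by (intro open_tile [OF t(1)] open_Int open_wedge) auto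
      moreover have "polar (n t) r (real j + s) \<in> ?C"
        using * True by (auto intro!: wedgeI)
      then have "x \<in> \<phi> t ` ?C" using * by blast
      moreover have "\<phi> t ` ?C \<subseteq> N - {v}"
      proof
        fix y assume "y \<in> \<phi> t ` ?C"
        then obtain r' s' where y: "0 < r'" "real j - 1/2 < s'" "s' < real j + 1/2" "norm (polar (n t) r' s') < 1" "y = \<phi> t (polar (n t) r' s')"
          by (auto simp: wedge_def)
        then have "y = \<phi> t (polar (n t) r' (real j + (s' - real j))) \<and> (t, j) \<in> K \<and> 0 < r' \<and> r' \<le> 1 \<and> - 1/2 < s' - real j \<and> s' - real j < 1/2"
          using * by auto
        then have "y \<in> N" unfolding N_def by blast
        then show "y \<in> N - {v}" using y inside [OF t(1) y(4)] by blast
      qed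
      ultimately show ?thesis by blast
    next
      case False
      \<comment> \<open>A point on a side has one half disk in this corner and one in the partner
        corner; they are glued along the half-side.\<close>
      then have "r = 1" using * by simp
      then have "s \<noteq> 0" using * x t by auto
      define \<epsilon> :: real where "\<epsilon> = sgn s"
      have \<epsilon>: "\<epsilon> = 1 \<or> \<epsilon> = - 1" "s = \<epsilon> * \<bar>s\<bar>" using \<open>s \<noteq> 0\<close> by (auto simp: \<epsilon>_def sgn_real_def)
      obtain t' j' \<epsilon>' where p: "(t', j') \<in> K" "\<epsilon>' = 1 \<or> \<epsilon>' = - 1" "(t', j', \<epsilon>') \<noteq> (t, j, \<epsilon>)"
        "\<And>s. \<lbrakk>0 < s; s < 1/2\<rbrakk> \<Longrightarrow> \<phi> t (boundary_point (n t) (real j + \<epsilon> * s)) =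
                                \<phi> t' (boundary_point (n t') (real j' + \<epsilon>' * s))"
        using partner [OF *(1) \<epsilon>(1)] by blast
      have t': "t' \<in> T" "j' < n t'" using K p by blast+
      let ?A = "{\<phi> t (polar (n t) r (real j + \<epsilon> * s)) | r s. 0 < r \<and> r \<le> 1 \<and> 0 < s \<and> s < 1/2} \<union>
                {\<phi> t' (polar (n t') r (real j' + \<epsilon>' * s)) | r s. 0 < r \<and> r \<le> 1 \<and> 0 < s \<and> s < 1/2}"
      have "openin X ?A"
      proof (rule open_glued [OF t(1) t'(1)])
        show "continuous_on {0<..<1/2} (\<lambda>s. real j + \<epsilon> * s)" "continuous_on {0<..<1/2} (\<lambda>s. real j' + \<epsilon>' * s)"
          by (intro continuous_intros)+
        show "\<phi> t (boundary_point (n t) (real j + \<epsilon> * s)) = \<phi> t' (boundary_point (n t') (real j' + \<epsilon>' * s))"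
          if "0 < s" "s < 1/2" for s using p(4) that .
        show "inj_on (\<lambda>s. \<phi> t (boundary_point (n t) (real j + \<epsilon> * s))) {0<..<1/2}"
        proof (rule inj_onI)
          fix x y assume xy: "x \<in> {0<..<1/2::real}" "y \<in> {0<..<1/2::real}"
            "\<phi> t (boundary_point (n t) (real j + \<epsilon> * x)) = \<phi> t (boundary_point (n t) (real j + \<epsilon> * y))"
          have "real j + \<epsilon> * x = real j + \<epsilon> * y"
            using \<epsilon>(1) xy boundary_inj [OF t(1), of "int j" "real j + \<epsilon> * x" "real j + \<epsilon> * y"]
               boundary_inj [OF t(1), of "int j - 1" "real j + \<epsilon> * x" "real j + \<epsilon> * y"] by auto
          then show "x = y" using \<epsilon>(1) by auto
        qed
        show "boundary_point (n t) (real j + \<epsilon> * s) \<noteq> boundary_point (n t) (real j' + \<epsilon>' * s')"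
          if "t = t'" "0 < s" "s < 1/2" "0 < s'" "s' < 1/2" for s s'
        proof
          assume eq: "boundary_point (n t) (real j + \<epsilon> * s) = boundary_point (n t) (real j' + \<epsilon>' * s')"
          have "\<bar>\<epsilon> * s\<bar> < 1/2" "\<bar>\<epsilon>' * s'\<bar> < 1/2" using that \<epsilon>(1) p(2) by auto
          moreover have "\<bar>real j - real j'\<bar> \<le> real (n t) - 1"
          proof -
            have "j < n t" "j' < n t" using t(2) t'(2) that(1) by auto
            then have "real j + 1 \<le> real (n t)" "real j' + 1 \<le> real (n t)" by linarith+
            then show ?thesis by linarith
          qed
          ultimately have "\<bar>(real j + \<epsilon> * s) - (real j' + \<epsilon>' * s')\<bar> < real (n t)" by linarith
          then have e: "real j + \<epsilon> * s = real j' + \<epsilon>' * s'"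
            using boundary_point_inj [OF n_pos [OF t(1)]] eq by blast
          then have "real j < real (Suc j')" "real j' < real (Suc j)"
            using \<open>\<bar>\<epsilon> * s\<bar> < 1/2\<close> \<open>\<bar>\<epsilon>' * s'\<bar> < 1/2\<close> by linarith+
          then have "j = j'" by linarith
          then have "\<epsilon> = \<epsilon>'" using e \<epsilon>(1) p(2) that by auto
          then show False using p(3) \<open>j = j'\<close> that(1) by simp
        qed
      qed
      moreover have "x \<in> ?A"
      proof -
        have "x = \<phi> t (polar (n t) r (real j + \<epsilon> * \<bar>s\<bar>)) \<and> 0 < r \<and> r \<le> 1 \<and> 0 < \<bar>s\<bar> \<and> \<bar>s\<bar> < 1/2"
          using * \<open>s \<noteq> 0\<close> \<epsilon>(2) by auto
        then show ?thesis by blast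
      qed
      moreover have "?A \<subseteq> N - {v}"
      proof -
        have A: "\<phi> t (polar (n t) r (real j + \<epsilon> * s)) \<in> N - {v}"
          if "(t, j) \<in> K" "\<epsilon> = 1 \<or> \<epsilon> = - 1" "0 < r" "r \<le> 1" "0 < s" "s < 1/2" for t j \<epsilon> r s
        proof -
          have "\<phi> t (polar (n t) r (real j + \<epsilon> * s)) \<in> N"
          proof -
            have "- 1/2 < \<epsilon> * s \<and> \<epsilon> * s < 1/2" using that(2,5,6) by auto
            then show ?thesis unfolding N_def using that(1,3,4) by blast
          qed
          moreover have "\<phi> t (polar (n t) r (real j + \<epsilon> * s)) \<noteq> v"
          proof (cases "r = 1")
            case True
            then show ?thesis
            proof -
              have "t \<in> T" using K(3) [OF that(1)] by blast
              moreover have "\<epsilon> * s \<noteq> 0" "\<bar>\<epsilon> * s\<bar> < 1" using that(2,5,6) by auto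
              ultimately have "\<phi> t (boundary_point (n t) (real j + \<epsilon> * s)) \<notin> V" by (rule half)
              then show ?thesis using True vV by auto
            qed
          next
            case False
            then show ?thesis using inside [of t "polar (n t) r (real j + \<epsilon> * s)"] that K(3) by auto
          qed
          ultimately show ?thesis by blast
        qed
        show ?thesis using A [OF *(1) \<epsilon>(1)] A [OF p(1,2)] by blast
      qed
      ultimately show ?thesis by blast
    qed
  qed
  have vcl: "v \<in> X closure_of (N - {v})"
  proof -
    obtain t j where tj: "(t, j) \<in> K" using K(2) by auto
    then have t: "t \<in> T" "j < n t" "\<phi> t (boundary_point (n t) (real j)) = v" using K by blast+
    have "v \<in> topspace X" using vV graph by (auto simp: embedded_graph_def)
    moreover have "\<exists>y. y \<in> N - {v} \<and> y \<in> S" if S: "v \<in> S" "openin X S" for S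
    proof -
      have "boundary_point (n t) (real j) \<in> wedge (n t) (real j - 1/2) (real j + 1/2)"
        using wedgeI [of 1 "real j - 1/2" "real j" "real j + 1/2" "n t"] by simp
      then obtain w where w: "w \<in> ball 0 1" "w \<in> wedge (n t) (real j - 1/2) (real j + 1/2)" "\<phi> t w \<in> S"
        using continuous_map_near_point [OF continuous_\<phi> [OF t(1)] S(2), of "boundary_point (n t) (real j)" "ball 0 1" "wedge (n t) (real j - 1/2) (real j + 1/2)"]
          S(1) t n_pos [OF t(1)] open_wedge [of "n t" "real j + 1/2" "real j - 1/2"] by auto
      then obtain r s where rs: "0 < r" "real j - 1/2 < s" "s < real j + 1/2" "w = polar (n t) r s" by (auto simp: wedge_def)
      have "\<phi> t w = \<phi> t (polar (n t) r (real j + (s - real j))) \<and> (t, j) \<in> K \<and> 0 < r \<and> r \<le> 1 \<and> - 1/2 < s - real j \<and> s - real j < 1/2"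
        using rs w tj by auto
      then have "\<phi> t w \<in> N" unfolding N_def by blast
      then show ?thesis using inside [OF t(1), of w] w by auto
    qed
    ultimately show ?thesis by (simp add: in_closure_of)
  qed
  obtain U where U: "openin X U" "v \<in> U" "U - {v} \<subseteq> N"
    using closed_surface_local_cover [OF X _ clNF clF vF opN vcl] vV graph
    by (metis embedded_graph_def subsetD)
  \<comment> \<open>The edge \<open>f\<close> leaves \<open>v\<close> through the neighbourhood just
    found. As it avoids the interiors of the tiles, it meets a half-side of one of the
    corners.\<close>
  obtain s0 where s0: "0 \<le> s0" "s0 \<le> 1" "v = \<gamma> f s0" using edge_cases [OF f] by blast
  have c: "continuous_map (top_of_set {0..1}) X (\<gamma> f)"
    using edge(1) [OF f(1)] by (simp add: edge_path_def pathin_def)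
  have "\<exists>y\<in>{0<..<1} \<inter> UNIV. \<gamma> f y \<in> U"
    by (rule continuous_map_near_point [OF c U(1), of s0]) (use U s0 in auto)
  then obtain s where s: "0 < s" "s < 1" "\<gamma> f s \<in> U" by auto
  then have "\<gamma> f s \<in> N"
    using U(3) edge_V(1) [OF f(1) s(1,2)] vV by blast
  then obtain t j r s' where *: "(t, j) \<in> K" "0 < r" "r \<le> 1" "- 1/2 < s'" "s' < 1/2" "\<gamma> f s = \<phi> t (polar (n t) r (real j + s'))"
    unfolding N_def by blast
  have t: "t \<in> T" "\<phi> t (boundary_point (n t) (real j)) = v" using K * by blast+
  have ff: "\<gamma> f s \<in> f" using edge_mem [OF f(1)] s by simp
  have "r = 1"
  proof (rule ccontr)
    assume "r \<noteq> 1"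
    then have "\<gamma> f s \<in> t" using tile_iff [OF t(1), of "polar (n t) r (real j + s')"] * by simp
    then show False using ff f(1) tile_subset(2) [OF t(1)] by blast
  qed
  moreover have "s' \<noteq> 0"
    using * \<open>r = 1\<close> t(2) vV edge_V(1) [OF f(1) s(1,2)] by auto
  ultimately show ?thesis using that [OF *(1) _ *(4,5)] * ff by simp
qed

end

section \<open>Normalised families and the number of sides of a tile\<close>

lemma polygon_family_exists:
  assumes X: "closed_surface X" and graph: "embedded_graph X V E"
    and edge: "\<And>e. e \<in> E \<Longrightarrow> edge_path X V (\<gamma> e) \<and> \<gamma> e ` {0..1} = e"
    and poly: "\<And>t. t \<in> tiles X V E \<Longrightarrow> polygon_map X V E t (n t) (\<phi> t)"
  obtains \<phi>' where "polygon_family X V E \<gamma> n \<phi>'"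
    "\<And>t. t \<in> tiles X V E \<Longrightarrow> \<phi>' t 0 = \<phi> t 0"
    "\<And>t z. \<lbrakk>t \<in> tiles X V E; z \<in> sphere 0 1\<rbrakk> \<Longrightarrow> \<exists>z'\<in>sphere 0 1. \<phi>' t z = \<phi> t z'"
    "\<And>t j. \<lbrakk>t \<in> tiles X V E; j < n t\<rbrakk> \<Longrightarrow> side (n t) (\<phi>' t) j ` {0..1} = side (n t) (\<phi> t) j ` {0..1}"
    "\<And>t j. \<lbrakk>t \<in> tiles X V E; j < n t\<rbrakk> \<Longrightarrow> corner (n t) (\<phi>' t) j = corner (n t) (\<phi> t) j"
    "\<And>t j r. \<lbrakk>t \<in> tiles X V E; j < n t;
        side (n t) (\<phi> t) j (1/2) = \<gamma> (side (n t) (\<phi> t) j ` {0..1}) (1/2); 0 \<le> r; r \<le> 1\<rbrakk> \<Longrightarrow>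
        \<phi>' t (polar (n t) r (real j + 1/2)) = \<phi> t (polar (n t) r (real j + 1/2))"
proof -
  define P where "P t \<phi>' \<longleftrightarrow> polygon_map X V E t (n t) \<phi>' \<and>
    (\<forall>j<n t. side (n t) \<phi>' j ` {0..1} = side (n t) (\<phi> t) j ` {0..1}) \<and>
    (\<forall>j<n t. (\<forall>s\<in>{0..1}. side (n t) \<phi>' j s = \<gamma> (side (n t) (\<phi> t) j ` {0..1}) s) \<or>
             (\<forall>s\<in>{0..1}. side (n t) \<phi>' j s = \<gamma> (side (n t) (\<phi> t) j ` {0..1}) (1 - s))) \<and>
    \<phi>' 0 = \<phi> t 0 \<and> (\<forall>z\<in>sphere 0 1. \<exists>z'\<in>sphere 0 1. \<phi>' z = \<phi> t z') \<and>
    (\<forall>j<n t. corner (n t) \<phi>' j = corner (n t) (\<phi> t) j) \<and>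
    (\<forall>j r. j < n t \<and> side (n t) (\<phi> t) j (1/2) = \<gamma> (side (n t) (\<phi> t) j ` {0..1}) (1/2) \<and> 0 \<le> r \<and> r \<le> 1 \<longrightarrow>
        \<phi>' (polar (n t) r (real j + 1/2)) = \<phi> t (polar (n t) r (real j + 1/2)))" for t \<phi>'
  have "\<exists>\<phi>'. P t \<phi>'" if t: "t \<in> tiles X V E" for t
    unfolding P_def
    by (rule polygon_map_normalise [OF closed_surfaceD(2) [OF X] poly [OF t] edge], assumption) blast
  then obtain \<phi>' where P: "\<And>t. t \<in> tiles X V E \<Longrightarrow> P t (\<phi>' t)"
    by metis
  have "polygon_family X V E \<gamma> n \<phi>'"
  proof
    show "closed_surface X" "embedded_graph X V E" by (fact X, fact graph)
    show "edge_path X V (\<gamma> e)" "\<gamma> e ` {0..1} = e" if "e \<in> E" for e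
      using edge [OF that] by auto
    show "polygon_map X V E t (n t) (\<phi>' t)" if "t \<in> tiles X V E" for t
      using P [OF that] by (simp add: P_def)
    show "(\<forall>s\<in>{0..1}. side (n t) (\<phi>' t) j s = \<gamma> (side (n t) (\<phi>' t) j ` {0..1}) s) \<or>
          (\<forall>s\<in>{0..1}. side (n t) (\<phi>' t) j s = \<gamma> (side (n t) (\<phi>' t) j ` {0..1}) (1 - s))"
      if "t \<in> tiles X V E" "j < n t" for t j
      using P [OF that(1)] that(2) unfolding P_def by metis
  qed
  then show ?thesis
    using that P unfolding P_def by blast
qed

lemma embedded_graph_edge_param:
  assumes "embedded_graph X V E"
  obtains \<gamma> where "\<And>e. e \<in> E \<Longrightarrow> edge_path X V (\<gamma> e) \<and> \<gamma> e ` {0..1} = e"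
  using assms unfolding embedded_graph_def by metis

text \<open>Running along an edge depends only on the image of a side, so the count for a normalised
  family holds for arbitrary polygon maps.\<close>

lemma card_sides_eq_2:
  assumes X: "closed_surface X" and graph: "embedded_graph X V E"
    and poly: "\<And>t. t \<in> tiles X V E \<Longrightarrow> polygon_map X V E t (n t) (\<phi> t)" and e: "e \<in> E"
  shows "card {(t, j). t \<in> tiles X V E \<and> j < n t \<and> side (n t) (\<phi> t) j ` {0..1} = e} = 2"
proof -
  obtain \<gamma> where \<gamma>: "\<And>e. e \<in> E \<Longrightarrow> edge_path X V (\<gamma> e) \<and> \<gamma> e ` {0..1} = e"
    using embedded_graph_edge_param [OF graph] by metis
  obtain \<phi>' where f: "polygon_family X V E \<gamma> n \<phi>'"
    and s: "\<And>t j. \<lbrakk>t \<in> tiles X V E; j < n t\<rbrakk> \<Longrightarrow> side (n t) (\<phi>' t) j ` {0..1} = side (n t) (\<phi> t) j ` {0..1}"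
    using polygon_family_exists [OF X graph \<gamma> poly] by metis
  have "{(t, j). t \<in> tiles X V E \<and> j < n t \<and> side (n t) (\<phi> t) j ` {0..1} = e} =
      polygon_family.sides X V E n \<phi>' e"
  proof -
    have "(t \<in> tiles X V E \<and> j < n t \<and> side (n t) (\<phi> t) j ` {0..1} = e) \<longleftrightarrow>
        (t \<in> tiles X V E \<and> j < n t \<and> side (n t) (\<phi>' t) j ` {0..1} = e)" for t j
      using s by metis
    then show ?thesis
      unfolding polygon_family.sides_def [OF f] by simp
  qed
  then show ?thesis
    using polygon_family.card_sides [OF f e] by simp
qed

text \<open>The number of sides of a tile is the number of sides of all tiles along all edges minus
  those of the other tiles.\<close>
lemma polygon_map_sides_unique:
  assumes X: "closed_surface X" and graph: "embedded_graph X V E"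
    and poly: "\<And>t. t \<in> tiles X V E \<Longrightarrow> polygon_map X V E t (n t) (\<phi> t)"
    and t: "t \<in> tiles X V E" and \<psi>: "polygon_map X V E t m \<psi>"
  shows "n t = m"
proof -
  let ?T = "tiles X V E"
  define n' where "n' = n(t := m)"
  define \<phi>' where "\<phi>' = \<phi>(t := \<psi>)"
  have poly': "polygon_map X V E u (n' u) (\<phi>' u)" if "u \<in> ?T" for u
    using poly that \<psi> by (simp add: n'_def \<phi>'_def)
  define A where "A n \<phi> e = {(u, j). u \<in> ?T \<and> j < n u \<and> side (n u) (\<phi> u) j ` {0..1} = e}" for n :: "'a set \<Rightarrow> nat" and \<phi> :: "'a set \<Rightarrow> complex \<Rightarrow> 'a" and e
  define C where "C n \<phi> e = {j. j < n t \<and> side (n t) (\<phi> t) j ` {0..1} = e}" for n :: "'a set \<Rightarrow> nat" and \<phi> :: "'a set \<Rightarrow> complex \<Rightarrow> 'a" and e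
  have fin: "finite E" using graph by (simp add: embedded_graph_def)
  have cA: "card (A n \<phi> e) = 2" "card (A n' \<phi>' e) = 2" if "e \<in> E" for e
    unfolding A_def
    by (rule card_sides_eq_2 [OF X graph _ that], erule poly,
        rule card_sides_eq_2 [OF X graph _ that], erule poly')
  have split: "card (A n \<phi> e) = card (A n \<phi> e - {t} \<times> UNIV) + card (C n \<phi> e)"
    if "card (A n \<phi> e) = 2" for n :: "'a set \<Rightarrow> nat" and \<phi> :: "'a set \<Rightarrow> complex \<Rightarrow> 'a" and e
  proof -
    have "finite (A n \<phi> e)" using that card.infinite by fastforce
    moreover have "A n \<phi> e = (A n \<phi> e - {t} \<times> UNIV) \<union> {t} \<times> C n \<phi> e"
      using t by (auto simp: A_def C_def)
    moreover have "(A n \<phi> e - {t} \<times> UNIV) \<inter> {t} \<times> C n \<phi> e = {}" by auto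
    ultimately have "card (A n \<phi> e) = card (A n \<phi> e - {t} \<times> UNIV) + card ({t} \<times> C n \<phi> e)"
      by (metis card_Un_disjoint finite_Un)
    then show ?thesis by (simp add: card_cartesian_product_singleton)
  qed
  have "A n \<phi> e - {t} \<times> UNIV = A n' \<phi>' e - {t} \<times> UNIV" for e
  proof -
    have "(u, j) \<in> A n \<phi> e \<longleftrightarrow> (u, j) \<in> A n' \<phi>' e" if "u \<noteq> t" for u j
      using that by (simp add: A_def n'_def \<phi>'_def)
    then show ?thesis by (intro set_eqI) (simp add: split_paired_all mem_Times_iff, metis)
  qed
  then have CC: "card (C n \<phi> e) = card (C n' \<phi>' e)" if "e \<in> E" for e
    using split [OF cA(1) [OF that]] split [OF cA(2) [OF that]] cA [OF that] by simp
  have sum: "n t = (\<Sum>e\<in>E. card (C n \<phi> e))" if "\<And>j. j < n t \<Longrightarrow> side (n t) (\<phi> t) j ` {0..1} \<in> E"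
    for n :: "'a set \<Rightarrow> nat" and \<phi> :: "'a set \<Rightarrow> complex \<Rightarrow> 'a"
  proof -
    have "{..<n t} = (\<Union>e\<in>E. C n \<phi> e)" using that by (auto simp: C_def)
    moreover have "card (\<Union>e\<in>E. C n \<phi> e) = (\<Sum>e\<in>E. card (C n \<phi> e))"
      using fin by (intro card_UN_disjoint) (auto simp: C_def)
    ultimately show ?thesis by (metis card_lessThan)
  qed
  have "n t = n' t"
    using sum [of n \<phi>] sum [of n' \<phi>'] CC polygon_mapD(6) [OF poly [OF t]] polygon_mapD(6) [OF poly' [OF t]]
    by simp
  then show ?thesis by (simp add: n'_def)
qed

section \<open>The subdivided tiling\<close>

lemma wedge_half_disjoint:
  assumes "0 < n" "i < n" "j < n" "z \<in> wedge n (real i - 1/2) (real i + 1/2)" "z \<in> wedge n (real j - 1/2) (real j + 1/2)"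
  shows "i = j"
proof -
  obtain r s where s: "0 < r" "real i - 1/2 < s" "s < real i + 1/2" "z = polar n r s"
    using assms(4) by (auto simp: wedge_def)
  obtain r' s' where s': "0 < r'" "real j - 1/2 < s'" "s' < real j + 1/2" "z = polar n r' s'"
    using assms(5) by (auto simp: wedge_def)
  have "boundary_point n s = boundary_point n s'"
    using s s' polar_eq_iff [of r r' n s n s'] by simp
  \<comment> \<open>Shifted by half a side, the sectors begin at integers.\<close>
  then have "boundary_point n (1/2 + s) = boundary_point n (1/2 + s')"
    by (simp add: boundary_point_add)
  then have "boundary_point n (real i + (1/2 + s - real i)) = boundary_point n (real j + (1/2 + s' - real j))"
    by simp
  then show ?thesis
    using nat_frac_boundary_point_eq [OF assms(1-3), of "1/2 + s - real i" "1/2 + s' - real j"] s s' by simp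
qed

text \<open>Modulo \<open>n\<close> no half-integer lies strictly between
  \<open>real j - 1/2\<close> and \<open>real j + 1/2\<close>: otherwise an integer would lie
  strictly between \<open>j\<close> and \<open>j + 1\<close>. So the radii to middles of sides avoid
  all open sectors.\<close>

lemma polar_half_notin_wedge:
  assumes "0 < n" "0 \<le> r"
  shows "polar n r (real i + 1/2) \<notin> wedge n (real j - 1/2) (real j + 1/2)"
proof
  assume "polar n r (real i + 1/2) \<in> wedge n (real j - 1/2) (real j + 1/2)"
  then obtain r' s where s: "0 < r'" "real j - 1/2 < s" "s < real j + 1/2" "polar n r' s = polar n r (real i + 1/2)"
    by (auto simp: wedge_def)
  then have "boundary_point n s = boundary_point n (real i + 1/2)"
    using polar_eq_iff [of r' r n s n "real i + 1/2"] assms by simp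
  then obtain k :: int where k: "s = real i + 1/2 + of_int k * real n"
    using boundary_point_eq_iff [OF assms(1)] by blast
  then have "real_of_int (int j) < of_int (int i + 1 + k * int n)" "real_of_int (int i + 1 + k * int n) < of_int (int j + 1)"
    using s by simp_all
  then show False unfolding of_int_less_iff by linarith
qed

lemma closed_segment_polar: "closed_segment 0 (boundary_point n s) = {polar n r s | r. 0 \<le> r \<and> r \<le> 1}"
  by (auto simp: closed_segment_def polar_def)

text \<open>The cyclic predecessor: the number of the side that ends at corner
  \<open>j\<close>.\<close>

definition pred_mod :: "nat \<Rightarrow> nat \<Rightarrow> nat" where
  "pred_mod n j = (if j = 0 then n - 1 else j - 1)"

lemma pred_mod:
  assumes "j < n"
  shows "pred_mod n j < n" "boundary_point n (real j - s) = boundary_point n (real (pred_mod n j) + 1 - s)"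
    "polar n r (real j - s) = polar n r (real (pred_mod n j) + 1 - s)"
proof -
  show "pred_mod n j < n" using assms by (auto simp: pred_mod_def)
  show *: "boundary_point n (real j - s) = boundary_point n (real (pred_mod n j) + 1 - s)"
  proof (cases "j = 0")
    case True
    have "boundary_point n (- s) = boundary_point n (- s + real n)"
      using assms by (subst boundary_point_add_period) auto
    then show ?thesis using True assms by (simp add: pred_mod_def of_nat_diff add.commute)
  next
    case False
    then show ?thesis by (simp add: pred_mod_def of_nat_diff)
  qed
  then show "polar n r (real j - s) = polar n r (real (pred_mod n j) + 1 - s)"
    by (simp add: polar_def)
qed

context polygon_family
begin

definition subV :: "'a set" where
  "subV = V \<union> {\<gamma> e (1/2) | e. e \<in> E} \<union> {\<phi> t 0 | t. t \<in> T}"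

definition subE :: "'a set set" where
  "subE = {\<gamma> e ` {0..1/2} | e. e \<in> E} \<union> {\<gamma> e ` {1/2..1} | e. e \<in> E} \<union>
     {\<phi> t ` closed_segment 0 (boundary_point (n t) (real j + 1/2)) | t j. t \<in> T \<and> j < n t}"

definition radius :: "'a set \<Rightarrow> nat \<Rightarrow> 'a set" where
  "radius t j = \<phi> t ` closed_segment 0 (boundary_point (n t) (real j + 1/2))"

text \<open>The tile of the subdivision at corner \<open>j\<close> of \<open>t\<close>.\<close>

definition piece :: "'a set \<Rightarrow> nat \<Rightarrow> 'a set" where
  "piece t j = \<phi> t ` (ball 0 1 \<inter> wedge (n t) (real j - 1/2) (real j + 1/2))"

lemma radius_eq: "radius t j = {\<phi> t (polar (n t) r (real j + 1/2)) | r. 0 \<le> r \<and> r \<le> 1}"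
  by (auto simp: radius_def closed_segment_polar)

lemma side_mid: "\<lbrakk>t \<in> T; j < n t\<rbrakk> \<Longrightarrow> \<phi> t (boundary_point (n t) (real j + 1/2)) = \<gamma> (bside t j) (1/2)"
  using normal [of t j] by (force simp: side_def)

lemma edge_halves: "e \<in> E \<Longrightarrow> e = \<gamma> e ` {0..1/2} \<union> \<gamma> e ` {1/2..1}"
proof -
  assume e: "e \<in> E"
  have "{0..1} = {0..1/2} \<union> {1/2..1::real}" by auto
  then show ?thesis using edge(2) [OF e] by (metis image_Un)
qed

lemma inside_not_graph: "\<lbrakk>t \<in> T; norm z < 1\<rbrakk> \<Longrightarrow> \<phi> t z \<notin> V \<union> \<Union>E"
  using tile_iff [of t z] tile_subset(2) [of t] by auto

text \<open>The radii to the middles of the sides cut each disk into sectors, one for each corner.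
  These have open, connected and disjoint images, and what remains of the surface is the new
  graph.\<close>

lemma tiles_sub: "tiles X subV subE = {piece t j | t j. t \<in> T \<and> j < n t}"
  unfolding tiles_def [of X subV subE]
proof (rule connected_components_of_eqI)
  fix u assume "u \<in> {piece t j | t j. t \<in> T \<and> j < n t}"
  then obtain t j where t: "t \<in> T" "j < n t" "u = piece t j" by blast
  let ?C = "ball 0 1 \<inter> wedge (n t) (real j - 1/2) (real j + 1/2)"
  show "openin X u"
    unfolding t(3) piece_def
    using n_pos [OF t(1)] by (intro open_tile [OF t(1)] open_Int open_wedge) auto
  have "polar (n t) (1/2) (real j) \<in> ?C" by (auto intro: wedgeI)
  then show "u \<noteq> {}" unfolding t(3) piece_def by blast
  have "?C = (\<lambda>(r, s). polar (n t) r s) ` ({0<..<1} \<times> {real j - 1/2<..<real j + 1/2})"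
    by (force simp: wedge_def)
  moreover have "connected ((\<lambda>(r, s). polar (n t) r s) ` ({0<..<1} \<times> {real j - 1/2<..<real j + 1/2}))"
    by (intro connected_continuous_image connected_Times) (auto intro!: continuous_intros simp: split_beta)
  ultimately have "connected ?C" by simp
  moreover have "?C \<subseteq> cball 0 1" by auto
  ultimately show "connectedin X u"
    unfolding t(3) piece_def
    using connectedin_continuous_map_image [OF continuous_\<phi> [OF t(1)], of ?C]
    by (simp add: connectedin_subtopology)
next
  show "pairwise disjnt {piece t j | t j. t \<in> T \<and> j < n t}"
  proof -
    have "piece t j = piece t' j'" if t: "t \<in> T" "j < n t" "t' \<in> T" "j' < n t'" and x: "x \<in> piece t j" "x \<in> piece t' j'" for t j t' j' x
    proof -
      obtain z where z: "norm z < 1" "z \<in> wedge (n t) (real j - 1/2) (real j + 1/2)" "x = \<phi> t z" using x(1) by (auto simp: piece_def)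
      obtain z' where z': "norm z' < 1" "z' \<in> wedge (n t') (real j' - 1/2) (real j' + 1/2)" "x = \<phi> t' z'" using x(2) by (auto simp: piece_def)
      have "t = t' \<and> z = z'" using tile_unique [OF t(1,3), of z z'] z z' by simp
      then show ?thesis using wedge_half_disjoint [of "n t" j j' z] z z' t n_pos by simp
    qed
    then show ?thesis unfolding pairwise_def disjnt_iff by blast
  qed
next
  show "\<Union>{piece t j | t j. t \<in> T \<and> j < n t} = topspace X - (subV \<union> \<Union>subE)"
  proof (intro equalityI subsetI)
    fix x assume "x \<in> \<Union>{piece t j | t j. t \<in> T \<and> j < n t}"
    then obtain t j z where t: "t \<in> T" "j < n t" and z: "norm z < 1" "z \<in> wedge (n t) (real j - 1/2) (real j + 1/2)" "x = \<phi> t z"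
      by (auto simp: piece_def)
    have xt: "x \<in> t" using tile_iff [OF t(1), of z] z by simp
    have ng: "x \<notin> V \<union> \<Union>E" using inside_not_graph [OF t(1) z(1)] z(3) by simp
    have nr: "x \<notin> radius t' j'" if t': "t' \<in> T" "j' < n t'" for t' j'
    proof
      assume "x \<in> radius t' j'"
      then obtain r where r: "0 \<le> r" "r \<le> 1" "x = \<phi> t' (polar (n t') r (real j' + 1/2))" by (auto simp: radius_eq)
      then have "t = t' \<and> z = polar (n t') r (real j' + 1/2)"
        using tile_unique [OF t(1) t'(1) z(1), of "polar (n t') r (real j' + 1/2)"] z(3) by simp
      then show False
        using polar_half_notin_wedge [of "n t" r j' j] z(2) r n_pos [OF t(1)] by simp
    qed
    have n0: "x \<noteq> \<phi> t' 0" if t': "t' \<in> T" for t'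
    proof -
      have "polar (n t') 0 (real 0 + 1/2) = 0" by simp
      then have "\<phi> t' 0 \<in> radius t' 0" unfolding radius_eq by (metis (mono_tags, lifting) mem_Collect_eq order_refl zero_le_one)
      then show ?thesis using nr [OF t', of 0] n_pos [OF t'] by auto
    qed
    have "\<gamma> e ` {0..1/2} \<subseteq> \<Union>E" "\<gamma> e ` {1/2..1} \<subseteq> \<Union>E" "\<gamma> e (1/2) \<in> \<Union>E" if "e \<in> E" for e
    proof -
      have "\<gamma> e (1/2) \<in> e" using edge_mem [OF that, of "1/2"] by simp
      then show "\<gamma> e (1/2) \<in> \<Union>E" using that by blast
      show "\<gamma> e ` {0..1/2} \<subseteq> \<Union>E" "\<gamma> e ` {1/2..1} \<subseteq> \<Union>E"
        using edge_halves [OF that] that by blast+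
    qed
    note E = this
    have "x \<notin> subV"
    proof
      assume "x \<in> subV"
      then consider "x \<in> V" | e where "e \<in> E" "x = \<gamma> e (1/2)" | t where "t \<in> T" "x = \<phi> t 0"
        unfolding subV_def by blast
      then show False
      proof cases
        case 2 then show ?thesis using E(3) [OF 2(1)] ng by simp
      qed (use ng n0 in simp_all)
    qed
    moreover have "x \<notin> f" if "f \<in> subE" for f
    proof -
      consider e where "e \<in> E" "f = \<gamma> e ` {0..1/2} \<or> f = \<gamma> e ` {1/2..1}" | t j where "t \<in> T" "j < n t" "f = radius t j"
        using \<open>f \<in> subE\<close> unfolding subE_def radius_def by blast
      then show ?thesis
      proof cases
        case 1 then show ?thesis using ng E(1,2) [OF 1(1)] by blast
      next
        case 2 then show ?thesis using nr by simp
      qed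
    qed
    ultimately have "x \<notin> subV \<union> \<Union>subE" by blast
    then show "x \<in> topspace X - (subV \<union> \<Union>subE)" using xt tile_subset(1) [OF t(1)] by blast
  next
    fix x assume x: "x \<in> topspace X - (subV \<union> \<Union>subE)"
    have "V \<subseteq> subV" by (auto simp: subV_def)
    moreover have "e \<subseteq> \<Union>subE" if "e \<in> E" for e
    proof -
      have "\<gamma> e ` {0..1/2} \<in> subE" "\<gamma> e ` {1/2..1} \<in> subE"
        unfolding subE_def using that by blast+
      then show ?thesis using edge_halves [OF that] by blast
    qed
    ultimately have "x \<in> topspace X - (V \<union> \<Union>E)" using x by blast
    then obtain t where t: "t \<in> T" "x \<in> t" using Union_tiles by blast
    then obtain z where z: "z \<in> ball 0 1" "x = \<phi> t z" using tile_image by blast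
    then obtain r j u where r: "0 \<le> r" "r \<le> 1" "j < n t" "- 1/2 \<le> u" "u < 1/2" "z = polar (n t) r (real j + u)"
      using polar_cball_exists [OF n_pos [OF t(1)] subsetD [OF ball_subset_cball z(1)]] by metis
    have "r \<noteq> 0"
    proof
      assume "r = 0"
      then have "x = \<phi> t 0" using z r by simp
      then have "x \<in> subV" using t unfolding subV_def by blast
      then show False using x by blast
    qed
    \<comment> \<open>The angle \<open>- 1/2\<close> belongs to the radius of the preceding
      side.\<close>
    moreover have "u \<noteq> - 1/2"
    proof
      assume "u = - 1/2"
      then have "z = polar (n t) r (real (pred_mod (n t) j) + 1/2)"
        using r pred_mod(3) [OF r(3), of r "1/2"] by (simp add: add.commute)
      then have "x \<in> radius t (pred_mod (n t) j)" using z r by (auto simp: radius_eq)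
      moreover have "radius t (pred_mod (n t) j) \<in> subE"
        unfolding subE_def radius_def using t pred_mod(1) [OF r(3)] by blast
      ultimately show False using x by blast
    qed
    ultimately have "z \<in> wedge (n t) (real j - 1/2) (real j + 1/2)"
      using r by (auto intro: wedgeI)
    then show "x \<in> \<Union>{piece t j | t j. t \<in> T \<and> j < n t}" using z t r unfolding piece_def by blast
  qed
qed

text \<open>A radius meets the old graph only at its outer end.\<close>

lemma mid_in_radius:
  assumes "e \<in> E" "t \<in> T" "j < n t"
  shows "\<gamma> e (1/2) \<in> radius t j \<longleftrightarrow> (t, j) \<in> sides e"
proof
  assume "(t, j) \<in> sides e"
  then have "\<phi> t (polar (n t) 1 (real j + 1/2)) = \<gamma> e (1/2)"
    using side_mid by (simp add: sides_def)
  then show "\<gamma> e (1/2) \<in> radius t j" unfolding radius_eq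
    by (metis (mono_tags, lifting) mem_Collect_eq order_refl zero_le_one)
next
  assume "\<gamma> e (1/2) \<in> radius t j"
  then obtain r where r: "0 \<le> r" "r \<le> 1" "\<gamma> e (1/2) = \<phi> t (polar (n t) r (real j + 1/2))" by (auto simp: radius_eq)
  have me: "\<gamma> e (1/2) \<in> e" using edge_mem [OF assms(1)] by simp
  have "r = 1"
    using inside_not_graph [OF assms(2), of "polar (n t) r (real j + 1/2)"] r me assms(1) by fastforce
  then have "\<gamma> e (1/2) \<in> bside t j"
    using r side_in [OF assms(2,3), of "1/2"] by simp
  then have "bside t j = e"
    using edge_unique [OF bside [OF assms(2,3)] assms(1) _ me] edge_V(1) [OF assms(1), of "1/2"] by simp
  then show "(t, j) \<in> sides e" using assms by (simp add: sides_def)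
qed

text \<open>The point halfway along a radius is interior to its tile and lies on no other
  radius.\<close>

lemma radius_inj:
  assumes "t \<in> T" "j < n t" "t' \<in> T" "j' < n t'" "radius t j = radius t' j'"
  shows "t = t' \<and> j = j'"
proof -
  have "\<phi> t (polar (n t) (1/2) (real j + 1/2)) \<in> radius t j"
    unfolding radius_eq by (intro CollectI exI [of _ "1/2"]) simp
  then have "\<phi> t (polar (n t) (1/2) (real j + 1/2)) \<in> radius t' j'"
    using assms(5) by simp
  then obtain r where r: "0 \<le> r" "r \<le> 1" "\<phi> t (polar (n t) (1/2) (real j + 1/2)) = \<phi> t' (polar (n t') r (real j' + 1/2))"
    by (auto simp: radius_eq)
  have c: "norm (polar (n t) (1/2) (real j + 1/2)) < 1" "norm (polar (n t') r (real j' + 1/2)) \<le> 1"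
    using r(1,2) by simp_all
  have e: "t = t' \<and> polar (n t) (1/2) (real j + 1/2) = polar (n t') r (real j' + 1/2)"
    by (rule tile_unique [OF assms(1,3) c r(3)])
  then have tt: "t = t'" by blast
  have "boundary_point (n t) (real j + 1/2) = boundary_point (n t') (real j' + 1/2)"
    using conjunct2 [OF e] r(1) by (subst (asm) polar_eq_iff) auto
  then have bp: "boundary_point (n t) (real j + 1/2) = boundary_point (n t) (real j' + 1/2)"
    using tt by metis
  have "j = j'"
    by (rule conjunct1 [OF nat_frac_boundary_point_eq [OF n_pos [OF assms(1)] assms(2) _ _ _ _ _ bp]])
      (use assms(4) tt in simp_all)
  then show ?thesis using tt by blast
qed

text \<open>The two halves of \<open>e\<close>, and one radius for each of the two sides along
  \<open>e\<close>. None of them is a loop, since the other end is an old vertex or a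
  center.\<close>

lemma degree_mid:
  assumes e: "e \<in> E"
  shows "degree subV subE (\<gamma> e (1/2)) = 4"
proof -
  let ?m = "\<gamma> e (1/2)"
  have mV: "?m \<notin> V" using edge_V(1) [OF e] by simp
  have me: "?m \<in> e" using edge_mem [OF e] by simp
  have other: "f = e" if "f \<in> E" "?m \<in> \<gamma> f ` {0..1/2} \<or> ?m \<in> \<gamma> f ` {1/2..1}" for f
    using edge_unique [OF that(1) e _ me mV] edge_halves [OF that(1)] that(2) by blast
  let ?R = "(\<lambda>(t, j). radius t j) ` sides e"
  have eq: "{f \<in> subE. ?m \<in> f} = {\<gamma> e ` {0..1/2}, \<gamma> e ` {1/2..1}} \<union> ?R"
  proof (intro equalityI subsetI)
    fix f assume "f \<in> {f \<in> subE. ?m \<in> f}"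
    then have f: "f \<in> subE" "?m \<in> f" by auto
    then consider g where "g \<in> E" "f = \<gamma> g ` {0..1/2}" | g where "g \<in> E" "f = \<gamma> g ` {1/2..1}"
      | t j where "t \<in> T" "j < n t" "f = radius t j"
      unfolding subE_def radius_def by blast
    then show "f \<in> {\<gamma> e ` {0..1/2}, \<gamma> e ` {1/2..1}} \<union> ?R"
    proof cases
      case 1 then show ?thesis using other f by blast
    next
      case 2 then show ?thesis using other f by blast
    next
      case 3 then show ?thesis using mid_in_radius [OF e 3(1,2)] f by force
    qed
  next
    fix f assume "f \<in> {\<gamma> e ` {0..1/2}, \<gamma> e ` {1/2..1}} \<union> ?R"
    then consider "f = \<gamma> e ` {0..1/2}" | "f = \<gamma> e ` {1/2..1}" | t j where "(t, j) \<in> sides e" "f = radius t j" by auto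
    then show "f \<in> {f \<in> subE. ?m \<in> f}"
    proof cases
      case 1 then show ?thesis using e unfolding subE_def by auto
    next
      case 2 then show ?thesis using e unfolding subE_def by auto
    next
      case 3
      then have "t \<in> T" "j < n t" by (auto simp: sides_def)
      then show ?thesis using mid_in_radius [OF e] 3 unfolding subE_def radius_def by blast
    qed
  qed
  have "card ?R = 2"
  proof -
    have "inj_on (\<lambda>(t, j). radius t j) (sides e)"
    proof (rule inj_onI, clarify)
      fix t j t' j'
      assume "(t, j) \<in> sides e" "(t', j') \<in> sides e" "radius t j = radius t' j'"
      then show "t = t' \<and> j = j'"
        using radius_inj unfolding sides_def by blast
    qed
    then show ?thesis using card_sides [OF e] by (simp add: card_image)
  qed
  moreover have "\<gamma> e ` {0..1/2} \<noteq> \<gamma> e ` {1/2..1}"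
  proof
    assume "\<gamma> e ` {0..1/2} = \<gamma> e ` {1/2..1}"
    moreover have "\<gamma> e (1/4) \<in> \<gamma> e ` {0..1/2}" by (rule imageI) simp
    ultimately obtain s where s: "1/2 \<le> s" "s \<le> 1" "\<gamma> e (1/4) = \<gamma> e s" by auto
    have "s \<noteq> 1" using edge_V(1) [OF e, of "1/4"] edge_V(3) [OF e] s(3) by auto
    then show False using edge_inj [OF e, of "1/4" s] s by simp
  qed
  moreover have "{\<gamma> e ` {0..1/2}, \<gamma> e ` {1/2..1}} \<inter> ?R = {}"
  proof -
    have "\<phi> t 0 \<in> radius t j" for t j
      using radius_eq [of t j] by force
    moreover have "\<phi> t 0 \<notin> \<Union>E" if "t \<in> T" for t using inside_not_graph [OF that, of 0] by simp
    moreover have "\<gamma> e ` {0..1/2} \<subseteq> \<Union>E" "\<gamma> e ` {1/2..1} \<subseteq> \<Union>E" using edge_mem [OF e] e by auto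
    moreover have "t \<in> T" if "(t, j) \<in> sides e" for t j using that unfolding sides_def by blast
    ultimately have ne: "radius t j \<noteq> \<gamma> e ` {0..1/2} \<and> radius t j \<noteq> \<gamma> e ` {1/2..1}" if "(t, j) \<in> sides e" for t j
      using that by (metis subsetD)
    show ?thesis
    proof (rule equals0I)
      fix f assume "f \<in> {\<gamma> e ` {0..1/2}, \<gamma> e ` {1/2..1}} \<inter> ?R"
      then have "f \<in> ?R" "f = \<gamma> e ` {0..1/2} \<or> f = \<gamma> e ` {1/2..1}" by auto
      moreover from this obtain t j where "(t, j) \<in> sides e" "f = radius t j" by auto
      ultimately show False using ne by metis
    qed
  qed
  moreover have "finite ?R" using finite_sides [OF e] by simp
  ultimately have "card {f \<in> subE. ?m \<in> f} = 4"
    unfolding eq by (subst card_Un_disjoint) auto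
  moreover have "{f \<in> subE. f \<inter> subV = {?m}} = {}"
  proof -
    have False if f: "f \<in> subE" "f \<inter> subV = {?m}" for f
    proof -
      consider g where "g \<in> E" "f = \<gamma> g ` {0..1/2}" | g where "g \<in> E" "f = \<gamma> g ` {1/2..1}"
        | t j where "t \<in> T" "j < n t" "f = radius t j"
        using f(1) unfolding subE_def radius_def by blast
      then show False
      proof cases
        case 1
        then have "\<gamma> g 0 \<in> f \<inter> subV" using edge_V(2) [OF 1(1)] by (auto simp: subV_def)
        then show False using f(2) mV edge_V(2) [OF 1(1)] by auto
      next
        case 2
        then have "\<gamma> g 1 \<in> f \<inter> subV" using edge_V(3) [OF 2(1)] by (auto simp: subV_def)
        then show False using f(2) mV edge_V(3) [OF 2(1)] by auto
      next
        case 3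
        then have "\<phi> t 0 \<in> f \<inter> subV" using radius_eq [of t j] by (force simp: subV_def)
        then show False using f(2) inside_not_graph [OF 3(1), of 0] me e by auto
      qed
    qed
    then show ?thesis by blast
  qed
  ultimately show ?thesis by (simp only: degree_def card.empty add_0_right)
qed

end

section \<open>Moebius bands\<close>

definition square :: "real \<Rightarrow> complex set" where
  "square \<delta> = {z. \<bar>Re z\<bar> \<le> \<delta> \<and> \<bar>Im z\<bar> \<le> \<delta>}"

lemma compact_square: "compact (square \<delta>)" and convex_square: "convex (square \<delta>)"
proof -
  have "square \<delta> = cbox (Complex (- \<delta>) (- \<delta>)) (Complex \<delta> \<delta>)"
    by (auto simp: square_def in_cbox_complex_iff abs_le_iff)
  then show "compact (square \<delta>)" "convex (square \<delta>)"
    by (simp_all add: convex_box)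
qed

text \<open>Flaps outside the unit disk in the strip \<open>\<bar>Re z\<bar> \<le> \<delta>\<close> are mapped onto the second and fourth
  quadrants of a square: on the unit circle to the axes, and on the lines \<open>Im z = 1\<close> and
  \<open>Im z = - 1\<close> to the antidiagonal, in such a way that \<open>z\<close> and \<open>- z\<close> have the same image there.\<close>
definition flap :: "complex \<Rightarrow> complex" where
  "flap z = sgn (Im z) *\<^sub>R Complex (max (Re z) (- sqrt ((norm z)\<^sup>2 - 1))) (max (- Re z) (- sqrt ((norm z)\<^sup>2 - 1)))"

text \<open>The part outside the open disk of the rectangle
  \<open>\<bar>Re z\<bar> \<le> \<delta>\<close>, \<open>\<bar>Im z\<bar> \<le> 1\<close>: thin
  pieces next to \<open>\<i>\<close> and \<open>- \<i>\<close>.\<close>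

definition flaps :: "real \<Rightarrow> complex set" where
  "flaps \<delta> = {z. 1 \<le> norm z \<and> \<bar>Re z\<bar> \<le> \<delta> \<and> \<bar>Im z\<bar> \<le> 1}"

text \<open>\<open>u\<close> is the length of a tangent from \<open>z\<close> to the unit circle. It
  vanishes on the circle, and \<open>\<bar>Im z\<bar> \<le> 1\<close> bounds it by
  \<open>\<bar>Re z\<bar>\<close>, with equality on the lines
  \<open>\<bar>Im z\<bar> = 1\<close>.\<close>

lemma flaps_sqrt:
  assumes "z \<in> flaps \<delta>"
  defines "u \<equiv> sqrt ((norm z)\<^sup>2 - 1)"
  shows "0 \<le> u" "u\<^sup>2 = (Re z)\<^sup>2 + (Im z)\<^sup>2 - 1" "u \<le> \<bar>Re z\<bar>" "norm z = 1 \<longleftrightarrow> u = 0"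
proof -
  have n: "1 \<le> norm z" "\<bar>Im z\<bar> \<le> 1" using assms by (auto simp: flaps_def)
  have "1 \<le> (norm z)\<^sup>2" using n(1) by (simp add: one_le_power)
  then show "0 \<le> u" "u\<^sup>2 = (Re z)\<^sup>2 + (Im z)\<^sup>2 - 1"
    by (auto simp: u_def cmod_power2)
  moreover have "(Im z)\<^sup>2 \<le> 1" using n(2) by (simp add: abs_square_le_1)
  ultimately have "u\<^sup>2 \<le> \<bar>Re z\<bar>\<^sup>2" by simp
  then show "u \<le> \<bar>Re z\<bar>" by (rule power2_le_imp_le) simp
  show "norm z = 1 \<longleftrightarrow> u = 0" using n(1) by (auto simp: u_def power2_eq_1_iff)
qed

lemma flaps_Im:
  assumes "z \<in> flaps \<delta>" "\<delta> < 1"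
  shows "Im z \<noteq> 0"
proof
  assume "Im z = 0"
  then have "norm z = \<bar>Re z\<bar>" by (simp add: cmod_def)
  then show False using assms by (auto simp: flaps_def)
qed

text \<open>The two maxima select one of two branches. Together with the sign of \<open>Im z\<close>
  this gives four triangles, two in the second and two in the fourth quadrant, which meet along the
  antidiagonal.\<close>

lemma flap_cases:
  assumes "z \<in> flaps \<delta>"
  defines "u \<equiv> sqrt ((norm z)\<^sup>2 - 1)"
  shows "0 \<le> Re z \<Longrightarrow> flap z = sgn (Im z) *\<^sub>R Complex (Re z) (- u)"
    "Re z \<le> 0 \<Longrightarrow> flap z = sgn (Im z) *\<^sub>R Complex (- u) (- Re z)"
proof -
  note u = flaps_sqrt [OF assms(1), folded u_def]
  show "flap z = sgn (Im z) *\<^sub>R Complex (Re z) (- u)" if "0 \<le> Re z"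
  proof -
    have "max (Re z) (- u) = Re z" "max (- Re z) (- u) = - u" using u that by auto
    then show ?thesis by (simp only: flap_def u_def [symmetric])
  qed
  show "flap z = sgn (Im z) *\<^sub>R Complex (- u) (- Re z)" if "Re z \<le> 0"
  proof -
    have "max (Re z) (- u) = - u" "max (- Re z) (- u) = - Re z" using u that by auto
    then show ?thesis by (simp only: flap_def u_def [symmetric])
  qed
qed

lemma flap_in_square:
  assumes z: "z \<in> flaps \<delta>"
  shows "flap z \<in> square \<delta>"
proof -
  define u where "u = sqrt ((norm z)\<^sup>2 - 1)"
  note u = flaps_sqrt [OF z, folded u_def] and f = flap_cases [OF z, folded u_def]
  have "\<bar>u\<bar> \<le> \<delta>" "\<bar>Re z\<bar> \<le> \<delta>" using u z by (auto simp: flaps_def)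
  then show ?thesis
    using f by (cases "0 \<le> Re z") (auto simp: square_def sgn_real_def)
qed

lemma flap_quadrant:
  assumes "z \<in> flaps \<delta>" "\<delta> < 1" "norm z \<noteq> 1"
  shows "Re (flap z) * Im (flap z) < 0"
proof -
  define u where "u = sqrt ((norm z)\<^sup>2 - 1)"
  note u = flaps_sqrt [OF assms(1), folded u_def] and f = flap_cases [OF assms(1), folded u_def]
  have u0: "0 < u" using u(1,4) assms(3) by simp
  have p: "0 < u * \<bar>Re z\<bar>" using u0 u(3) by (intro mult_pos_pos) auto
  have s: "sgn (Im z) = 1 \<or> sgn (Im z) = - 1" using flaps_Im [OF assms(1,2)] by (auto simp: sgn_real_def)
  show ?thesis
  proof (cases "0 \<le> Re z")
    case True
    then show ?thesis using f(1) s p by (auto simp: mult.commute)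
  next
    case False
    then show ?thesis using f(2) s p by (auto simp: mult.commute)
  qed
qed

text \<open>The image determines \<open>u\<close> and \<open>\<bar>Re z\<bar>\<close>, and these
  determine \<open>\<bar>Im z\<bar>\<close>. Points with opposite signs of \<open>Im\<close> go to
  different triangles, which share only the antidiagonal; there \<open>u = \<bar>Re z\<bar>\<close>,
  that is \<open>\<bar>Im z\<bar> = 1\<close>.\<close>

lemma flap_eq:
  assumes z: "z \<in> flaps \<delta>" and w: "w \<in> flaps \<delta>" and \<delta>: "\<delta> < 1" and eq: "flap z = flap w"
  shows "z = w \<or> (\<bar>Im z\<bar> = 1 \<and> w = - z)"
proof -
  define u where "u = sqrt ((norm z)\<^sup>2 - 1)"
  define v where "v = sqrt ((norm w)\<^sup>2 - 1)"
  note uz = flaps_sqrt [OF z, folded u_def] and vw = flaps_sqrt [OF w, folded v_def]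
  note fz = flap_cases [OF z, folded u_def] and fw = flap_cases [OF w, folded v_def]
  have Im: "Im z \<noteq> 0" "Im w \<noteq> 0" using flaps_Im \<delta> z w by auto
  have Re: "Re z = sgn (Im z) * sgn (Im w) * Re w \<and> u = v \<and> (sgn (Im z) \<noteq> sgn (Im w) \<longrightarrow> \<bar>Re z\<bar> = u)"
  proof -
    consider "0 \<le> Re z" "0 \<le> Re w" | "0 \<le> Re z" "Re w \<le> 0" | "Re z \<le> 0" "0 \<le> Re w" | "Re z \<le> 0" "Re w \<le> 0"
      by linarith
    then show ?thesis
    proof cases
      case 1
      then show ?thesis using eq fz(1) fw(1) uz vw Im by (auto simp: sgn_real_def complex_eq_iff)
    next
      case 2
      then show ?thesis using eq fz(1) fw(2) uz vw Im by (auto simp: sgn_real_def complex_eq_iff)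
    next
      case 3
      then show ?thesis using eq fz(2) fw(1) uz vw Im by (auto simp: sgn_real_def complex_eq_iff)
    next
      case 4
      then show ?thesis using eq fz(2) fw(2) uz vw Im by (auto simp: sgn_real_def complex_eq_iff)
    qed
  qed
  have "(Re z)\<^sup>2 = (Re w)\<^sup>2"
    using Re Im by (auto simp: sgn_real_def split: if_splits)
  then have I2: "(Im z)\<^sup>2 = (Im w)\<^sup>2" using uz(2) vw(2) Re by simp
  show ?thesis
  proof (cases "sgn (Im z) = sgn (Im w)")
    case True
    then have "Re z = Re w" using Re Im by (auto simp: sgn_real_def split: if_splits)
    moreover have "Im z = Im w" using I2 True Im
      by (auto simp: sgn_real_def power2_eq_iff split: if_splits)
    ultimately show ?thesis by (simp add: complex_eq_iff)
  next
    case False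
    then have "Re w = - Re z" using Re Im by (auto simp: sgn_real_def split: if_splits)
    moreover have "Im w = - Im z" using I2 False Im by (auto simp: power2_eq_iff)
    moreover have "u\<^sup>2 = (Re z)\<^sup>2" using Re False by (metis power2_abs)
    then have "(Im z)\<^sup>2 = 1" using uz(2) by simp
    then have "Im z = 1 \<or> Im z = - 1" by (simp add: power2_eq_1_iff)
    then have "\<bar>Im z\<bar> = 1" by auto
    ultimately show ?thesis by (auto simp: complex_eq_iff)
  qed
qed

lemma flap_neg:
  assumes "\<bar>Im z\<bar> = 1"
  shows "flap (- z) = flap z"
proof -
  have "(Im z)\<^sup>2 = 1" using assms by (metis one_power2 power2_abs)
  then have u: "sqrt ((norm z)\<^sup>2 - 1) = \<bar>Re z\<bar>" by (simp add: cmod_power2)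
  then show ?thesis by (simp add: flap_def u sgn_real_def abs_if max_def complex_eq_iff)
qed

lemma flap_surj:
  assumes w: "w \<in> square \<delta>" and neg: "Re w * Im w < 0" and \<delta>: "\<delta> < 1"
  obtains z where "z \<in> flaps \<delta>" "flap z = w"
proof -
  define a b where "a = \<bar>Re w\<bar>" and "b = \<bar>Im w\<bar>"
  have ab: "0 < a" "0 < b" "a \<le> \<delta>" "b \<le> \<delta>"
    using w neg by (auto simp: a_def b_def square_def)
  have sg: "(Re w = a \<and> Im w = - b) \<or> (Re w = - a \<and> Im w = b)"
    using neg by (auto simp: a_def b_def mult_less_0_iff)
  \<comment> \<open>The height of the point of a flap with abscissa \<open>x\<close> and tangent
    length \<open>u\<close>: positive since \<open>x < 1\<close>, at most \<open>1\<close> since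
    \<open>u \<le> x\<close>.\<close>
  have key: "\<exists>y. 0 < y \<and> y \<le> 1 \<and> x\<^sup>2 + y\<^sup>2 = 1 + u\<^sup>2" if "0 \<le> u" "u \<le> x" "x \<le> \<delta>" for x u
  proof (intro exI conjI)
    let ?y = "sqrt (1 + u\<^sup>2 - x\<^sup>2)"
    have "x\<^sup>2 < 1" using that \<delta> by (simp add: abs_square_less_1)
    moreover have "0 \<le> u\<^sup>2" by simp
    ultimately have p: "0 < 1 + u\<^sup>2 - x\<^sup>2" by linarith
    then show "0 < ?y" by simp
    have "u\<^sup>2 \<le> x\<^sup>2" using that by (simp add: power_mono)
    then show "?y \<le> 1" by simp
    show "x\<^sup>2 + ?y\<^sup>2 = 1 + u\<^sup>2" using p by simp
  qed
  have mem: "Complex x y \<in> flaps \<delta> \<and> sqrt ((norm (Complex x y))\<^sup>2 - 1) = u"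
    if "0 \<le> u" "\<bar>x\<bar> \<le> \<delta>" "\<bar>y\<bar> \<le> 1" "x\<^sup>2 + y\<^sup>2 = 1 + u\<^sup>2" for x y u
  proof -
    have "(norm (Complex x y))\<^sup>2 = 1 + u\<^sup>2" using that by (simp add: cmod_power2)
    moreover then have "1 \<le> norm (Complex x y)"
      by (metis le_add_same_cancel1 norm_ge_zero one_power2 power2_le_imp_le zero_le_power2)
    ultimately show ?thesis using that by (simp add: flaps_def)
  qed
  show ?thesis
  proof (cases "b \<le> a")
    case True
    then obtain y where y: "0 < y" "y \<le> 1" "a\<^sup>2 + y\<^sup>2 = 1 + b\<^sup>2" using key [of b a] ab by auto
    from sg show ?thesis
    proof
      assume s: "Re w = a \<and> Im w = - b"
      have m: "Complex a y \<in> flaps \<delta> \<and> sqrt ((norm (Complex a y))\<^sup>2 - 1) = b"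
        using mem [of b a y] y ab by simp
      then have "flap (Complex a y) = w"
        using flap_cases(1) [of "Complex a y" \<delta>] y ab s by (auto simp: complex_eq_iff)
      then show ?thesis using that m by blast
    next
      assume s: "Re w = - a \<and> Im w = b"
      have m: "Complex a (- y) \<in> flaps \<delta> \<and> sqrt ((norm (Complex a (- y)))\<^sup>2 - 1) = b"
        using mem [of b a "- y"] y ab by simp
      then have "flap (Complex a (- y)) = w"
        using flap_cases(1) [of "Complex a (- y)" \<delta>] y ab s by (auto simp: complex_eq_iff)
      then show ?thesis using that m by blast
    qed
  next
    case False
    then obtain y where y: "0 < y" "y \<le> 1" "b\<^sup>2 + y\<^sup>2 = 1 + a\<^sup>2" using key [of a b] ab by auto
    from sg show ?thesis
    proof
      assume s: "Re w = a \<and> Im w = - b"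
      have m: "Complex (- b) (- y) \<in> flaps \<delta> \<and> sqrt ((norm (Complex (- b) (- y)))\<^sup>2 - 1) = a"
        using mem [of a "- b" "- y"] y ab by simp
      then have "flap (Complex (- b) (- y)) = w"
        using flap_cases(2) [of "Complex (- b) (- y)" \<delta>] y ab s by (auto simp: complex_eq_iff)
      then show ?thesis using that m by blast
    next
      assume s: "Re w = - a \<and> Im w = b"
      have m: "Complex (- b) y \<in> flaps \<delta> \<and> sqrt ((norm (Complex (- b) y))\<^sup>2 - 1) = a"
        using mem [of a "- b" y] y ab by simp
      then have "flap (Complex (- b) y) = w"
        using flap_cases(2) [of "Complex (- b) y" \<delta>] y ab s by (auto simp: complex_eq_iff)
      then show ?thesis using that m by blast
    qed
  qed
qed

lemma continuous_on_flap:
  assumes "\<delta> < 1"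
  shows "continuous_on (flaps \<delta>) flap"
proof -
  have "continuous_on (flaps \<delta>) (\<lambda>z. sgn (Im z))"
    using flaps_Im assms by (intro continuous_on_sgn continuous_intros) auto
  moreover have "continuous_on (flaps \<delta>)
      (\<lambda>z. Complex (max (Re z) (- sqrt ((norm z)\<^sup>2 - 1))) (max (- Re z) (- sqrt ((norm z)\<^sup>2 - 1))))"
    unfolding Complex_eq by (intro continuous_intros)
  ultimately show ?thesis
    unfolding flap_def by (rule continuous_on_scaleR)
qed

text \<open>\<open>\<psi>\<close> is the closed tile, a disk with \<open>\<i>\<close> and
  \<open>- \<i>\<close> identified, and \<open>d\<close> is a square around the resulting vertex.
  The half-axes of the square are the four boundary arcs of the tile at that vertex, and its first
  and third quadrants lie in the tile. Cutting the other two quadrants along the antidiagonal and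
  attaching the halves to the disk as flaps gives \<open>M\<close>, a deformed rectangle whose top
  and bottom are identified by \<open>w = - z\<close>.\<close>

lemma moebius_band_criterion:
  fixes \<psi> d :: "complex \<Rightarrow> 'a"
  assumes X: "Hausdorff_space X" and \<delta>: "0 < \<delta>" "\<delta> < 1"
    and \<psi>: "continuous_map (top_of_set (cball 0 1)) X \<psi>"
    and \<psi>_inj: "\<And>x y. \<lbrakk>x \<in> cball 0 1; y \<in> cball 0 1; \<psi> x = \<psi> y\<rbrakk> \<Longrightarrow> x = y \<or> {x, y} = {\<i>, - \<i>}"
    and d: "continuous_map (top_of_set (square \<delta>)) X d" and d_inj: "inj_on d (square \<delta>)"
    and axes: "\<And>x. \<lbrakk>0 \<le> x; x \<le> \<delta>\<rbrakk> \<Longrightarrow> d (Complex x 0) = \<psi> (Complex x (sqrt (1 - x\<^sup>2)))"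
      "\<And>x. \<lbrakk>0 \<le> x; x \<le> \<delta>\<rbrakk> \<Longrightarrow> d (Complex 0 x) = \<psi> (Complex (- x) (sqrt (1 - x\<^sup>2)))"
      "\<And>x. \<lbrakk>0 \<le> x; x \<le> \<delta>\<rbrakk> \<Longrightarrow> d (Complex (- x) 0) = \<psi> (Complex x (- sqrt (1 - x\<^sup>2)))"
      "\<And>x. \<lbrakk>0 \<le> x; x \<le> \<delta>\<rbrakk> \<Longrightarrow> d (Complex 0 (- x)) = \<psi> (Complex (- x) (- sqrt (1 - x\<^sup>2)))"
    and q13: "\<And>z. \<lbrakk>z \<in> square \<delta>; 0 \<le> Re z * Im z\<rbrakk> \<Longrightarrow> d z \<in> \<psi> ` cball 0 1"
    and q24: "\<And>z. \<lbrakk>z \<in> square \<delta>; Re z * Im z < 0\<rbrakk> \<Longrightarrow> d z \<notin> \<psi> ` cball 0 1"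
  shows "moebius_band (subtopology X (\<psi> ` cball 0 1 \<union> d ` square \<delta>))"
proof -
  define M where "M = cball 0 1 \<union> flaps \<delta>"
  define Q where "Q z = (if norm z \<le> 1 then \<psi> z else d (flap z))" for z
  have Qflap: "Q z = d (flap z)" if z: "z \<in> flaps \<delta>" for z
  proof (cases "norm z = 1")
    case True
    then have u: "sqrt ((norm z)\<^sup>2 - 1) = 0" by simp
    have y: "(Im z)\<^sup>2 = 1 - (Re z)\<^sup>2" using True cmod_power2 [of z] by simp
    have zI: "z = Complex (Re z) (sqrt (1 - (Re z)\<^sup>2))" if "0 < Im z"
      using that y by (metis complex_surj less_imp_le real_sqrt_abs abs_of_nonneg)
    have zI': "z = Complex (Re z) (- sqrt (1 - (Re z)\<^sup>2))" if "Im z < 0"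
      using that y by (metis complex_surj abs_of_neg minus_minus real_sqrt_abs)
    have x: "\<bar>Re z\<bar> \<le> \<delta>" using z by (simp add: flaps_def)
    have Im: "Im z \<noteq> 0" using flaps_Im z \<delta> by blast
    have "d (flap z) = \<psi> z"
    proof (cases "0 \<le> Re z")
      case True
      show ?thesis
      proof (cases "0 < Im z")
        case pos: True
        then have "flap z = Complex (Re z) 0"
          using flap_cases(1) [OF z True] u by (simp add: complex_eq_iff)
        then show ?thesis using axes(1) [of "Re z"] True x zI [OF pos] by simp
      next
        case neg: False
        then have "flap z = Complex (- Re z) 0"
          using flap_cases(1) [OF z True] u Im by (simp add: complex_eq_iff sgn_real_def)
        then show ?thesis using axes(3) [of "Re z"] True x zI' neg Im by simp
      qed
    next
      case False
      have "- Complex 0 (- Re z) = Complex 0 (Re z)" by (simp add: complex_eq_iff)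
      with False show ?thesis
        using flap_cases(2) [OF z] u axes(2) [of "- Re z"] axes(4) [of "- Re z"] x Im zI zI'
        by (cases "0 < Im z") auto
    qed
    then show ?thesis using True by (simp add: Q_def)
  next
    case False
    then show ?thesis using z by (simp add: Q_def flaps_def)
  qed
  have cl: "closed (flaps \<delta>)"
  proof -
    have "flaps \<delta> = {z. 1 \<le> norm z} \<inter> {z. \<bar>Re z\<bar> \<le> \<delta>} \<inter> {z. \<bar>Im z\<bar> \<le> 1}" by (auto simp: flaps_def)
    then show ?thesis by (auto intro!: closed_Int closed_Collect_le continuous_intros)
  qed
  have contQ: "continuous_map (top_of_set M) X Q"
  proof (rule pasting_lemma_closed [of "{True, False}" _ "\<lambda>b. if b then cball 0 1 else flaps \<delta>" X "\<lambda>b. if b then \<psi> else d \<circ> flap"])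
    fix b :: bool
    show "closedin (top_of_set M) (if b then cball 0 1 else flaps \<delta>)"
      using cl by (auto simp: M_def intro: closed_subset)
    have "continuous_map (top_of_set (flaps \<delta>)) (top_of_set (square \<delta>)) flap"
      using continuous_on_flap [OF \<delta>(2)] flap_in_square by (auto simp: continuous_map_in_subtopology)
    then have "continuous_map (top_of_set (flaps \<delta>)) X (d \<circ> flap)"
      using d continuous_map_compose by blast
    then show "continuous_map (subtopology (top_of_set M) (if b then cball 0 1 else flaps \<delta>)) X (if b then \<psi> else d \<circ> flap)"
      using \<psi> by (simp add: subtopology_subtopology M_def Int_absorb1)
  next
    fix b c :: bool and x assume "x \<in> topspace (top_of_set M) \<inter> (if b then cball 0 1 else flaps \<delta>) \<inter> (if c then cball 0 1 else flaps \<delta>)"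
    then show "(if b then \<psi> else d \<circ> flap) x = (if c then \<psi> else d \<circ> flap) x"
      using Qflap [of x] by (auto simp: Q_def split: if_splits)
  next
    fix x assume "x \<in> topspace (top_of_set M)"
    then show "\<exists>j. j \<in> {True, False} \<and> x \<in> (if j then cball 0 1 else flaps \<delta>) \<and> Q x = (if j then \<psi> else d \<circ> flap) x"
      by (auto simp: M_def Q_def)
  qed simp
  have d0: "\<psi> \<i> = \<psi> (- \<i>)"
  proof -
    have "Complex 0 1 = \<i>" "Complex 0 (- 1) = - \<i>" by (simp_all add: complex_eq_iff)
    then show ?thesis using axes(1) [of 0] axes(3) [of 0] \<delta> by simp
  qed
  have kerQ: "Q z = Q w \<longleftrightarrow> z = w \<or> (\<bar>Im z\<bar> = 1 \<and> w = - z)" if zw: "z \<in> M" "w \<in> M" for z w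
  proof
    assume eq: "Q z = Q w"
    have no: False if "norm z > 1" "norm w \<le> 1" "Q z = Q w" "z \<in> M" for z w
    proof -
      have z: "z \<in> flaps \<delta>" using that by (auto simp: M_def)
      then have "d (flap z) \<notin> \<psi> ` cball 0 1"
        using q24 [OF flap_in_square [OF z] flap_quadrant [OF z \<delta>(2)]] that(1) by simp
      then show False using that by (auto simp: Q_def)
    qed
    consider "norm z \<le> 1" "norm w \<le> 1" | "norm z > 1" "norm w > 1"
      using no [of z w] no [of w z] eq zw by fastforce
    then show "z = w \<or> (\<bar>Im z\<bar> = 1 \<and> w = - z)"
    proof cases
      case 1
      then have "z = w \<or> {z, w} = {\<i>, - \<i>}"
        using \<psi>_inj [of z w] eq by (simp add: Q_def)
      then show ?thesis by (auto simp: doubleton_eq_iff)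
    next
      case 2
      then have f: "z \<in> flaps \<delta>" "w \<in> flaps \<delta>" using zw by (auto simp: M_def)
      then have "flap z = flap w"
        using inj_onD [OF d_inj, of "flap z" "flap w"] eq 2 flap_in_square by (simp add: Q_def)
      then show ?thesis using flap_eq [OF f \<delta>(2)] by blast
    qed
  next
    assume "z = w \<or> (\<bar>Im z\<bar> = 1 \<and> w = - z)"
    then show "Q z = Q w"
    proof
      assume *: "\<bar>Im z\<bar> = 1 \<and> w = - z"
      have "z \<in> flaps \<delta>"
      proof (cases "z \<in> cball 0 1")
        case True
        then have "(Re z)\<^sup>2 + (Im z)\<^sup>2 \<le> 1" using cmod_power2 [of z] power_le_one [of "norm z" 2] by simp
        moreover have "(Im z)\<^sup>2 = 1" using * by (metis one_power2 power2_abs)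
        moreover from calculation have "Re z = 0" by simp
        ultimately show ?thesis using * \<delta> by (simp add: flaps_def cmod_def)
      qed (use zw in \<open>simp add: M_def\<close>)
      moreover then have "w \<in> flaps \<delta>" using * by (simp add: flaps_def)
      ultimately show ?thesis using Qflap flap_neg * by simp
    qed simp
  qed
  \<comment> \<open>Half the width of \<open>M\<close> at height \<open>y\<close>; with it
    \<open>R\<close> stretches the rectangle to \<open>M\<close>, the first coordinate becoming the
    height.\<close>
  define f where "f y = max (sqrt (1 - y\<^sup>2)) \<delta>" for y :: real
  define R where "R = (\<lambda>(x, y). Complex (y * f (2 * x - 1)) (2 * x - 1))"
  let ?rect = "{0..1::real} \<times> {-1..1::real}"
  have f0: "0 < f y" for y using \<delta> by (simp add: f_def)
  have R_im: "R ` ?rect = M"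
  proof (intro equalityI subsetI)
    fix z assume "z \<in> R ` ?rect"
    then obtain x y where xy: "0 \<le> x" "x \<le> 1" "-1 \<le> y" "y \<le> 1" "z = Complex (y * f (2 * x - 1)) (2 * x - 1)"
      by (auto simp: R_def)
    have I: "\<bar>Im z\<bar> \<le> 1" using xy by (auto simp: abs_le_iff)
    have "\<bar>Re z\<bar> \<le> f (Im z)"
      using xy f0 [of "2 * x - 1"] mult_right_mono [of "\<bar>y\<bar>" 1 "f (2 * x - 1)"] by (simp add: abs_mult)
    then consider "\<bar>Re z\<bar> \<le> \<delta>" | "\<bar>Re z\<bar> \<le> sqrt (1 - (Im z)\<^sup>2)" by (auto simp: f_def max_def split: if_splits)
    then show "z \<in> M"
    proof cases
      case 1
      then show ?thesis using I by (cases "norm z \<le> 1") (auto simp: M_def flaps_def)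
    next
      case 2
      have "(Im z)\<^sup>2 \<le> 1" using I by (simp add: abs_square_le_1)
      then have "(Re z)\<^sup>2 \<le> 1 - (Im z)\<^sup>2"
        using 2 by (metis abs_ge_zero diff_ge_0_iff_ge power2_abs power_mono real_sqrt_pow2)
      then have "norm z \<le> 1" by (simp add: cmod_def)
      then show ?thesis by (simp add: M_def)
    qed
  next
    fix z assume z: "z \<in> M"
    have I: "\<bar>Im z\<bar> \<le> 1"
      using z abs_Im_le_cmod [of z] by (auto simp: M_def flaps_def)
    have "\<bar>Re z\<bar> \<le> f (Im z)"
    proof (cases "z \<in> cball 0 1")
      case True
      then have "(Re z)\<^sup>2 + (Im z)\<^sup>2 \<le> 1" using cmod_power2 [of z] power_le_one [of "norm z" 2] by simp
      then have "\<bar>Re z\<bar> \<le> sqrt (1 - (Im z)\<^sup>2)" by (intro real_le_rsqrt) simp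
      then show ?thesis by (simp add: f_def)
    next
      case False
      then show ?thesis using z by (simp add: M_def flaps_def f_def le_max_iff_disj)
    qed
    then have "\<bar>Re z / f (Im z)\<bar> \<le> 1"
      using f0 [of "Im z"] by (metis abs_div_pos divide_le_eq_1_pos)
    then have mem: "((Im z + 1) / 2, Re z / f (Im z)) \<in> ?rect"
      using I unfolding abs_le_iff by simp
    have "2 * ((Im z + 1) / 2) - 1 = Im z" by (simp add: field_simps)
    then have "R ((Im z + 1) / 2, Re z / f (Im z)) = z"
      using f0 [of "Im z"] by (simp only: R_def prod.case) (simp add: complex_eq_iff)
    then show "z \<in> R ` ?rect" using mem by (metis imageI)
  qed
  have R_inj: "p = p'" if "p \<in> ?rect" "p' \<in> ?rect" "R p = R p'" for p p'
    using that f0 by (auto simp: R_def complex_eq_iff less_le)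
  have R_cont: "continuous_on ?rect R"
    unfolding R_def split_beta Complex_eq f_def by (intro continuous_intros)
  \<comment> \<open>Opposite points of the top and the bottom of \<open>M\<close> correspond to
    \<open>(0, y)\<close> and \<open>(1, - y)\<close>.\<close>
  have R_ends: "R (0, y) = - R (1, - y)" "\<bar>Im (R (0, y))\<bar> = 1" for y
    by (simp_all add: R_def f_def complex_eq_iff)
  define q where "q = Q \<circ> R"
  let ?Y = "\<psi> ` cball 0 1 \<union> d ` square \<delta>"
  have Q_im: "Q ` M = ?Y"
  proof (intro equalityI subsetI)
    fix x assume "x \<in> Q ` M"
    then show "x \<in> ?Y" using flap_in_square by (auto simp: M_def Q_def)
  next
    fix x assume "x \<in> ?Y"
    then consider z where "z \<in> cball 0 1" "x = \<psi> z" | z where "z \<in> square \<delta>" "Re z * Im z < 0" "x = d z"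
      using q13 by (metis Un_iff imageE not_le)
    then show "x \<in> Q ` M"
    proof cases
      case 1
      then show ?thesis by (intro image_eqI [of _ _ z]) (auto simp: Q_def M_def)
    next
      case 2
      then obtain w where "w \<in> flaps \<delta>" "flap w = z" using flap_surj \<delta> by blast
      then show ?thesis using Qflap 2 by (intro image_eqI [of _ _ w]) (auto simp: M_def)
    qed
  qed
  have q_im: "q ` ?rect = ?Y"
    unfolding q_def image_comp [symmetric] R_im Q_im ..
  have "continuous_map (top_of_set ?rect) (top_of_set M) R"
    using R_cont R_im by (simp add: continuous_map_in_subtopology image_subset_iff_funcset [symmetric])
  then have q_cont: "continuous_map (top_of_set ?rect) X q"
    unfolding q_def using contQ continuous_map_compose by blast
  have "quotient_map (top_of_set ?rect) (subtopology X ?Y) q"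
  proof (rule continuous_imp_quotient_map)
    show "continuous_map (top_of_set ?rect) (subtopology X ?Y) q"
      using q_cont q_im by (simp add: continuous_map_in_subtopology image_subset_iff_funcset [symmetric])
    show "compact_space (top_of_set ?rect)"
      by (simp add: compact_space_subtopology compact_Times)
    show "Hausdorff_space (subtopology X ?Y)" using X by (rule Hausdorff_space_subtopology)
    show "q ` topspace (top_of_set ?rect) = topspace (subtopology X ?Y)"
    proof -
      have "q ` ?rect \<subseteq> topspace X" using q_cont by (auto simp: continuous_map_def)
      then show ?thesis using q_im by auto
    qed
  qed
  moreover have "q p = q p' \<longleftrightarrow> p = p' \<or> (\<exists>y. p = (0, y) \<and> p' = (1, -y) \<or> p = (1, -y) \<and> p' = (0, y))"
    if p: "p \<in> ?rect" "p' \<in> ?rect" for p p'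
  proof -
    have RM: "R p \<in> M" "R p' \<in> M" using p R_im by blast+
    have "q p = q p' \<longleftrightarrow> R p = R p' \<or> (\<bar>Im (R p)\<bar> = 1 \<and> R p' = - R p)"
      unfolding q_def o_def by (rule kerQ [OF RM])
    also have "\<dots> \<longleftrightarrow> p = p' \<or> (\<exists>y. p = (0, y) \<and> p' = (1, -y) \<or> p = (1, -y) \<and> p' = (0, y))"
    proof
      assume "R p = R p' \<or> (\<bar>Im (R p)\<bar> = 1 \<and> R p' = - R p)"
      then show "p = p' \<or> (\<exists>y. p = (0, y) \<and> p' = (1, -y) \<or> p = (1, -y) \<and> p' = (0, y))"
      proof
        assume *: "\<bar>Im (R p)\<bar> = 1 \<and> R p' = - R p"
        obtain x y where pp: "p = (x, y)" by (metis surj_pair)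
        have "\<bar>2 * x - 1\<bar> = 1" using * pp by (simp add: R_def)
        then consider "x = 0" | "x = 1" by linarith
        then show ?thesis
        proof cases
          case 1
          then have "R p' = R (1, - y)" using * pp R_ends(1) [of y] by simp
          then have "p' = (1, - y)" using R_inj [OF p(2), of "(1, - y)"] p(1) pp by auto
          then show ?thesis using 1 pp by blast
        next
          case 2
          then have "R p' = R (0, - y)" using * pp R_ends(1) [of "- y"] by simp
          then have "p' = (0, - y)" using R_inj [OF p(2), of "(0, - y)"] p(1) pp by auto
          then show ?thesis using 2 pp by (metis minus_minus)
        qed
      qed (use R_inj p in blast)
    next
      assume "p = p' \<or> (\<exists>y. p = (0, y) \<and> p' = (1, -y) \<or> p = (1, -y) \<and> p' = (0, y))"
      moreover have "\<bar>Im (R (1, - y))\<bar> = 1" for y by (simp add: R_def)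
      ultimately show "R p = R p' \<or> (\<bar>Im (R p)\<bar> = 1 \<and> R p' = - R p)"
        using R_ends by (metis minus_minus)
    qed
    finally show ?thesis .
  qed
  ultimately show ?thesis unfolding moebius_band_def by blast
qed

lemma edge_path_cong:
  assumes "edge_path X V g" "\<And>s. \<lbrakk>0 \<le> s; s \<le> 1\<rbrakk> \<Longrightarrow> f s = g s"
  shows "edge_path X V f" "f ` {0..1} = g ` {0..1}"
proof -
  show "f ` {0..1} = g ` {0..1}" using assms(2) by (intro image_cong) auto
  have "f ` {0<..<1} = g ` {0<..<1}" using assms(2) by (intro image_cong) auto
  moreover have "inj_on f {0<..<1}"
    using assms by (auto simp: edge_path_def inj_on_def)
  moreover have "pathin X f"
    using assms unfolding edge_path_def pathin_def by (auto intro: continuous_map_eq)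
  ultimately show "edge_path X V f"
    using assms by (simp add: edge_path_def)
qed

section \<open>Types of the tiles of a subdivision\<close>

context polygon_family
begin

text \<open>Both sides at corner \<open>j\<close> are read away from the corner; comparing their
  directions along a common edge separates folds from twists.\<close>

lemma corner_sides:
  assumes "t \<in> T" "j < n t"
  shows "(\<forall>s\<in>{0..1}. \<phi> t (boundary_point (n t) (real j + s)) = \<gamma> (bside t j) s) \<or>
         (\<forall>s\<in>{0..1}. \<phi> t (boundary_point (n t) (real j + s)) = \<gamma> (bside t j) (1 - s))"
    and "(\<forall>s\<in>{0..1}. \<phi> t (boundary_point (n t) (real j - s)) = \<gamma> (bside t (pred_mod (n t) j)) s) \<or>
         (\<forall>s\<in>{0..1}. \<phi> t (boundary_point (n t) (real j - s)) = \<gamma> (bside t (pred_mod (n t) j)) (1 - s))"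
proof -
  show "(\<forall>s\<in>{0..1}. \<phi> t (boundary_point (n t) (real j + s)) = \<gamma> (bside t j) s) \<or>
         (\<forall>s\<in>{0..1}. \<phi> t (boundary_point (n t) (real j + s)) = \<gamma> (bside t j) (1 - s))"
    using normal [OF assms] by (simp add: side_def)
  obtain a where a: "a = (\<lambda>s. real (pred_mod (n t) j) + s) \<or> a = (\<lambda>s. real (pred_mod (n t) j) + 1 - s)"
    "\<And>s. \<lbrakk>0 \<le> s; s \<le> 1\<rbrakk> \<Longrightarrow> \<phi> t (boundary_point (n t) (a s)) = \<gamma> (bside t (pred_mod (n t) j)) s"
    using side_param [OF assms(1) pred_mod(1) [OF assms(2)]] by metis
  from a(1) show "(\<forall>s\<in>{0..1}. \<phi> t (boundary_point (n t) (real j - s)) = \<gamma> (bside t (pred_mod (n t) j)) s) \<or>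
         (\<forall>s\<in>{0..1}. \<phi> t (boundary_point (n t) (real j - s)) = \<gamma> (bside t (pred_mod (n t) j)) (1 - s))"
  proof
    assume "a = (\<lambda>s. real (pred_mod (n t) j) + 1 - s)"
    then show ?thesis using a(2) unfolding pred_mod(2) [OF assms(2)] by simp
  next
    assume a': "a = (\<lambda>s. real (pred_mod (n t) j) + s)"
    have "\<phi> t (boundary_point (n t) (real j - s)) = \<gamma> (bside t (pred_mod (n t) j)) (1 - s)" if "s \<in> {0..1}" for s
      using a(2) [of "1 - s"] that unfolding pred_mod(2) [OF assms(2)] a' by (simp add: add_diff_eq)
    then show ?thesis by blast
  qed
qed

text \<open>Both halves are parametrised from an old vertex to the middle, the second one therefore
  backwards.\<close>

lemma half_edge_path:
  assumes e: "e \<in> E"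
  shows "edge_path X subV (\<lambda>s. \<gamma> e (s/2))" "(\<lambda>s. \<gamma> e (s/2)) ` {0..1} = \<gamma> e ` {0..1/2}"
    "edge_path X subV (\<lambda>s. \<gamma> e (1 - s/2))" "(\<lambda>s. \<gamma> e (1 - s/2)) ` {0..1} = \<gamma> e ` {1/2..1}"
proof -
  have nsub: "\<gamma> e s \<notin> subV" if h: "0 < s" "s < 1" "s \<noteq> 1/2" for s
  proof
    assume "\<gamma> e s \<in> subV"
    then consider f where "f \<in> E" "\<gamma> e s = \<gamma> f (1/2)" | t where "t \<in> T" "\<gamma> e s = \<phi> t 0"
      using edge_V(1) [OF e h(1,2)] unfolding subV_def by blast
    then show False
    proof cases
      case 1
      have "f = e"
        using edge_unique [OF 1(1) e _ _ edge_V(1) [OF e h(1,2)]] edge_mem [OF e, of s] edge_mem [OF 1(1), of "1/2"] h 1(2) by simp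
      then show False using edge_inj [OF e h(1,2), of "1/2"] 1(2) h(3) by simp
    next
      case 2
      then show False using inside_not_graph [OF 2(1), of 0] edge_mem [OF e, of s] e h by auto
    qed
  qed
  have sub: "\<gamma> e 0 \<in> subV" "\<gamma> e 1 \<in> subV" "\<gamma> e (1/2) \<in> subV"
    using edge_V(2,3) [OF e] e by (auto simp: subV_def)
  have path: "pathin X (\<lambda>s. \<gamma> e (a + b * s))" if "\<And>s. s \<in> {0..1} \<Longrightarrow> a + b * s \<in> {0..1}" for a b :: real
  proof -
    have "continuous_map (top_of_set {0..1}) (top_of_set {0..1}) (\<lambda>s. a + b * s)"
      using that by (auto simp: continuous_map_in_subtopology intro!: continuous_intros)
    then have "continuous_map (top_of_set {0..1}) X (\<gamma> e \<circ> (\<lambda>s. a + b * s))"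
      using edge(1) [OF e] continuous_map_compose unfolding edge_path_def pathin_def by blast
    then show ?thesis by (simp add: pathin_def o_def)
  qed
  have inj: "inj_on (\<lambda>s. \<gamma> e (a + b * s)) {0<..<1}" if "\<And>s. s \<in> {0<..<1} \<Longrightarrow> a + b * s \<in> {0<..<1}" "b \<noteq> 0" for a b :: real
  proof (rule inj_onI)
    fix x y assume xy: "x \<in> {0<..<1}" "y \<in> {0<..<1}" "\<gamma> e (a + b * x) = \<gamma> e (a + b * y)"
    then have "a + b * x = a + b * y" using edge_inj [OF e, of "a + b * x" "a + b * y"] that by auto
    then show "x = y" using that(2) by simp
  qed
  show "edge_path X subV (\<lambda>s. \<gamma> e (s/2))"
    unfolding edge_path_def using path [of 0 "1/2"] inj [of 0 "1/2"] nsub sub by auto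
  show "edge_path X subV (\<lambda>s. \<gamma> e (1 - s/2))"
    unfolding edge_path_def using path [of 1 "- 1/2"] inj [of 1 "- 1/2"] nsub sub by auto
  have "(\<lambda>s. s/2) ` {0..1} = {0..1/2::real}"
    by (auto intro!: image_eqI [of _ _ "2 * x" for x])
  then show "(\<lambda>s. \<gamma> e (s/2)) ` {0..1} = \<gamma> e ` {0..1/2}"
    by (metis image_image)
  have "(\<lambda>s. 1 - s/2) ` {0..1} = {1/2..1::real}"
    by (auto intro!: image_eqI [of _ _ "2 * (1 - x)" for x] simp: field_simps)
  then show "(\<lambda>s. \<gamma> e (1 - s/2)) ` {0..1} = \<gamma> e ` {1/2..1}"
    by (metis image_image)
qed

lemma half_side_path:
  assumes e: "e \<in> E" and h: "(\<forall>s\<in>{0..1}. h s = \<gamma> e s) \<or> (\<forall>s\<in>{0..1}. h s = \<gamma> e (1 - s))"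
  shows "edge_path X subV (\<lambda>s. h (s/2))" "(\<lambda>s. h (s/2)) ` {0..1} \<in> subE"
proof -
  have "edge_path X subV (\<lambda>s. h (s/2)) \<and> (\<lambda>s. h (s/2)) ` {0..1} \<in> subE"
    using h
  proof
    assume *: "\<forall>s\<in>{0..1}. h s = \<gamma> e s"
    then have "edge_path X subV (\<lambda>s. h (s/2))" "(\<lambda>s. h (s/2)) ` {0..1} = \<gamma> e ` {0..1/2}"
      using edge_path_cong [OF half_edge_path(1) [OF e], of "\<lambda>s. h (s/2)"] half_edge_path(2) [OF e] by auto
    then show ?thesis using e unfolding subE_def by blast
  next
    assume *: "\<forall>s\<in>{0..1}. h s = \<gamma> e (1 - s)"
    then have "edge_path X subV (\<lambda>s. h (s/2))" "(\<lambda>s. h (s/2)) ` {0..1} = \<gamma> e ` {1/2..1}"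
      using edge_path_cong [OF half_edge_path(3) [OF e], of "\<lambda>s. h (s/2)"] half_edge_path(4) [OF e] by auto
    then show ?thesis using e unfolding subE_def by blast
  qed
  then show "edge_path X subV (\<lambda>s. h (s/2))" "(\<lambda>s. h (s/2)) ` {0..1} \<in> subE" by auto
qed

lemma radius_path:
  assumes t: "t \<in> T" "j < n t"
  shows "edge_path X subV (\<lambda>s. \<phi> t (polar (n t) s (real j + 1/2)))"
    "(\<lambda>s. \<phi> t (polar (n t) s (real j + 1/2))) ` {0..1} \<in> subE"
proof -
  have "continuous_map (top_of_set {0..1}) (top_of_set (cball 0 1)) (\<lambda>s. polar (n t) s (real j + 1/2))"
    by (auto simp: continuous_map_in_subtopology intro!: continuous_intros)
  from continuous_map_compose [OF this continuous_\<phi> [OF t(1)]]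
  have p: "pathin X (\<lambda>s. \<phi> t (polar (n t) s (real j + 1/2)))" by (simp add: pathin_def o_def)
  have i: "inj_on (\<lambda>s. \<phi> t (polar (n t) s (real j + 1/2))) {0<..<1}"
  proof (rule inj_onI)
    fix x y assume xy: "x \<in> {0<..<1::real}" "y \<in> {0<..<1}" "\<phi> t (polar (n t) x (real j + 1/2)) = \<phi> t (polar (n t) y (real j + 1/2))"
    then have "polar (n t) x (real j + 1/2) = polar (n t) y (real j + 1/2)"
      using \<phi>_inj [OF t(1), of "polar (n t) x (real j + 1/2)" "polar (n t) y (real j + 1/2)"] by simp
    then show "x = y" using xy polar_eq_iff [of x y] by simp
  qed
  have "\<phi> t (polar (n t) s (real j + 1/2)) \<notin> subV" if s: "0 < s" "s < 1" for s
  proof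
    assume "\<phi> t (polar (n t) s (real j + 1/2)) \<in> subV"
    moreover have "\<phi> t (polar (n t) s (real j + 1/2)) \<notin> V \<union> \<Union>E"
      by (rule inside_not_graph [OF t(1)]) (use s in simp)
    moreover have "\<gamma> e (1/2) \<in> V \<union> \<Union>E" if "e \<in> E" for e
      using edge_mem [OF that, of "1/2"] that by auto
    ultimately obtain t' where t': "t' \<in> T" "\<phi> t (polar (n t) s (real j + 1/2)) = \<phi> t' 0"
      unfolding subV_def by (smt (verit) Un_iff mem_Collect_eq)
    have "t = t' \<and> polar (n t) s (real j + 1/2) = 0"
      by (rule tile_unique [OF t(1) t'(1) _ _ t'(2)]) (use s in simp_all)
    then have "norm (polar (n t) s (real j + 1/2)) = norm (0 :: complex)" by metis
    then show False using s by simp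
  qed
  moreover have "\<phi> t (polar (n t) 0 (real j + 1/2)) \<in> subV"
    using t by (auto simp: subV_def)
  moreover have "\<phi> t (polar (n t) 1 (real j + 1/2)) \<in> subV"
    using side_mid [OF t] bside [OF t] by (auto simp: subV_def)
  ultimately show "edge_path X subV (\<lambda>s. \<phi> t (polar (n t) s (real j + 1/2)))"
    using p i unfolding edge_path_def by auto
  have "(\<lambda>s. \<phi> t (polar (n t) s (real j + 1/2))) ` {0..1} = radius t j"
    unfolding radius_eq by auto
  then show "(\<lambda>s. \<phi> t (polar (n t) s (real j + 1/2))) ` {0..1} \<in> subE"
    unfolding radius_def subE_def using t by auto
qed

text \<open>If two consecutive sides are glued by a fold, then a neighbourhood of their common corner lies
  in the tile and that edge.\<close>
lemma fold_degree:
  assumes t: "t \<in> T" "j < n t"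
    and fold: "\<And>s. \<lbrakk>0 < s; s < 1/2\<rbrakk> \<Longrightarrow>
      \<phi> t (boundary_point (n t) (real j + s)) = \<phi> t (boundary_point (n t) (real j - s))"
  shows "degree V E (\<phi> t (boundary_point (n t) (real j))) \<le> 2"
proof -
  let ?v = "\<phi> t (boundary_point (n t) (real j))"
  have one: "f = bside t j" if f: "f \<in> E" "?v \<in> f" for f
  proof -
    obtain t' j' s where s: "(t', j') \<in> {(t, j)}" "s \<noteq> 0" "- 1/2 < s" "s < 1/2" "\<phi> t' (boundary_point (n t') (real j' + s)) \<in> f"
    proof (rule corner_fan [of "{(t, j)}" ?v f])
      show "\<exists>t'' j'' \<epsilon>'. (t'', j'') \<in> {(t, j)} \<and> (\<epsilon>' = 1 \<or> \<epsilon>' = - 1) \<and> (t'', j'', \<epsilon>') \<noteq> (t', j', \<epsilon>) \<and>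
          (\<forall>s. 0 < s \<and> s < 1/2 \<longrightarrow> \<phi> t' (boundary_point (n t') (real j' + \<epsilon> * s)) = \<phi> t'' (boundary_point (n t'') (real j'' + \<epsilon>' * s)))"
        if "(t', j') \<in> {(t, j)}" "\<epsilon> = 1 \<or> \<epsilon> = - 1" for t' j' and \<epsilon> :: real
        using that fold by (intro exI [of _ t] exI [of _ j] exI [of _ "- \<epsilon>"]) auto
    qed (use t f in auto)
    define s' where "s' = \<bar>s\<bar>"
    have s': "0 < s'" "s' < 1/2" using s by (auto simp: s'_def)
    have "\<phi> t (boundary_point (n t) (real j + s)) = \<phi> t (boundary_point (n t) (real j + s'))"
      using fold [OF s'] by (auto simp: s'_def abs_if)
    then have "\<phi> t (boundary_point (n t) (real j + s')) \<in> f" using s by simp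
    then show ?thesis
      using edge_unique [OF f(1) bside [OF t] _ side_in [OF t, of s'] side_nonvertex [OF t, of s']] s' by simp
  qed
  have "{e \<in> E. ?v \<in> e} \<subseteq> {bside t j}" "{e \<in> E. e \<inter> V = {?v}} \<subseteq> {bside t j}"
    using one by auto
  then have "card {e \<in> E. ?v \<in> e} \<le> card {bside t j}" "card {e \<in> E. e \<inter> V = {?v}} \<le> card {bside t j}"
    by (intro card_mono; simp)+
  then show ?thesis by (simp add: degree_def)
qed

text \<open>The polygon map of \<open>t\<close> after the sector map: its sides are a half-side, two
  radii through the center, and a half-side of the cyclic predecessor.\<close>

lemma piece_polygon:
  assumes t: "t \<in> T" "j < n t" "2 \<le> n t"
  obtains G where "continuous_on (cball 0 1) G" "inj_on G (cball 0 1)"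
    "G ` cball 0 1 = sector (n t) (real j - 1/2) (real j + 1/2)"
    "G ` ball 0 1 = ball 0 1 \<inter> wedge (n t) (real j - 1/2) (real j + 1/2)"
    "\<And>s. \<lbrakk>0 \<le> s; s \<le> 1\<rbrakk> \<Longrightarrow> G (boundary_point 4 s) = boundary_point (n t) (real j + s/2)"
    "\<And>s. \<lbrakk>0 \<le> s; s \<le> 1\<rbrakk> \<Longrightarrow> G (boundary_point 4 (- s)) = boundary_point (n t) (real j - s/2)"
    "\<And>s. \<lbrakk>0 \<le> s; s \<le> 1\<rbrakk> \<Longrightarrow> G (boundary_point 4 (2 - s)) = polar (n t) s (real j + 1/2)"
    "\<And>s. \<lbrakk>0 \<le> s; s \<le> 1\<rbrakk> \<Longrightarrow> G (boundary_point 4 (2 + s)) = polar (n t) s (real j - 1/2)"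
    "polygon_map X subV subE (piece t j) 4 (\<phi> t \<circ> G)"
proof -
  obtain G where G: "continuous_on (cball 0 1) G" "inj_on G (cball 0 1)"
    "G ` cball 0 1 = sector (n t) (real j - 1/2) (real j + 1/2)"
    "G ` ball 0 1 = ball 0 1 \<inter> wedge (n t) (real j - 1/2) (real j + 1/2)"
    "\<And>s. \<lbrakk>0 \<le> s; s \<le> 1\<rbrakk> \<Longrightarrow> G (boundary_point 4 s) = boundary_point (n t) (real j + s/2)"
    "\<And>s. \<lbrakk>0 \<le> s; s \<le> 1\<rbrakk> \<Longrightarrow> G (boundary_point 4 (- s)) = boundary_point (n t) (real j - s/2)"
    "\<And>s. \<lbrakk>0 \<le> s; s \<le> 1\<rbrakk> \<Longrightarrow> G (boundary_point 4 (2 - s)) = polar (n t) s (real j + 1/2)"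
    "\<And>s. \<lbrakk>0 \<le> s; s \<le> 1\<rbrakk> \<Longrightarrow> G (boundary_point 4 (2 + s)) = polar (n t) s (real j - 1/2)"
    by (rule sector_map_exists [OF t(3), of "real j"], rule that)
  let ?p = "pred_mod (n t) j"
  have p: "?p < n t" using pred_mod(1) [OF t(2)] .
  have "polygon_map X subV subE (piece t j) 4 (\<phi> t \<circ> G)"
    unfolding polygon_map_def
  proof (intro conjI allI impI)
    show "continuous_map (top_of_set (cball 0 1)) X (\<phi> t \<circ> G)"
    proof (rule continuous_map_compose [OF _ continuous_\<phi> [OF t(1)]])
      have "G ` cball 0 1 \<subseteq> cball 0 1" unfolding G(3) by (rule sector_subset_cball)
      then show "continuous_map (top_of_set (cball 0 1)) (top_of_set (cball 0 1)) G"
        using G(1) by (simp add: continuous_map_in_subtopology image_subset_iff_funcset [symmetric])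
    qed
    have "homeomorphic_map (top_of_set (ball 0 1)) (subtopology X t) (\<phi> t)"
      using poly [OF t(1)] by (simp add: polygon_map_def)
    then show "homeomorphic_map (top_of_set (ball 0 1)) (subtopology X (piece t j)) (\<phi> t \<circ> G)"
      using homeomorphic_map_disk_part [OF _ G(1,2)] G(4) unfolding piece_def by simp
  next
    fix k :: nat assume "k < 4"
    have "edge_path X subV (side 4 (\<phi> t \<circ> G) k) \<and> side 4 (\<phi> t \<circ> G) k ` {0..1} \<in> subE"
    proof -
      have *: "edge_path X subV (side 4 (\<phi> t \<circ> G) k) \<and> side 4 (\<phi> t \<circ> G) k ` {0..1} \<in> subE"
        if "edge_path X subV h" "h ` {0..1} \<in> subE" "\<And>s. \<lbrakk>0 \<le> s; s \<le> 1\<rbrakk> \<Longrightarrow> side 4 (\<phi> t \<circ> G) k s = h s" for h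
        using edge_path_cong [OF that(1), of "side 4 (\<phi> t \<circ> G) k"] that by simp
      have r: "edge_path X subV (\<lambda>s. h (1 - s)) \<and> (\<lambda>s. h (1 - s)) ` {0..1} \<in> subE"
        if "edge_path X subV h" "h ` {0..1} \<in> subE" for h :: "real \<Rightarrow> 'a"
        using edge_path_reverse [OF that(1)] that(2) by (simp add: image_reverse_unit)
      note h0 = half_side_path [OF bside [OF t(1,2)] corner_sides(1) [OF t(1,2)]]
      note h3 = half_side_path [OF bside [OF t(1) p] corner_sides(2) [OF t(1,2)]]
      note r1 = radius_path [OF t(1,2)]
      note r2 = radius_path [OF t(1) p]
      consider "k = 0" | "k = 1" | "k = 2" | "k = 3" using \<open>k < 4\<close> by linarith
      then show ?thesis
      proof cases
        case 1
        show ?thesis by (rule * [OF h0]) (use G(5) 1 in \<open>simp add: side_def\<close>)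
      next
        case 2
        have "side 4 (\<phi> t \<circ> G) k s = \<phi> t (polar (n t) (1 - s) (real j + 1/2))" if "0 \<le> s" "s \<le> 1" for s
          using G(7) [of "1 - s"] that 2 by (simp add: side_def)
        then show ?thesis using * [OF conjunct1 [OF r [OF r1]] conjunct2 [OF r [OF r1]]] by blast
      next
        case 3
        have "side 4 (\<phi> t \<circ> G) k s = \<phi> t (polar (n t) s (real ?p + 1/2))" if "0 \<le> s" "s \<le> 1" for s
          using G(8) [of s] that 3 pred_mod(3) [OF t(2), of s "1/2"] by (simp add: side_def add.commute)
        then show ?thesis using * [OF r2] by blast
      next
        case 4
        have "side 4 (\<phi> t \<circ> G) k s = \<phi> t (boundary_point (n t) (real j - (1 - s)/2))" if "0 \<le> s" "s \<le> 1" for s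
        proof -
          \<comment> \<open>Side \<open>3\<close> leads back to corner \<open>0\<close>, and the
            sector map is described by negative positions there; hence the shift by a full
            turn.\<close>
          have "boundary_point 4 (3 + s) = boundary_point 4 (- (1 - s))"
            using boundary_point_add_period [of 4 "- (1 - s)"] by simp
          then show ?thesis using G(6) [of "1 - s"] that 4 by (simp add: side_def)
        qed
        then show ?thesis using * [OF conjunct1 [OF r [OF h3]] conjunct2 [OF r [OF h3]]] by blast
      qed
    qed
    then show "edge_path X subV (side 4 (\<phi> t \<circ> G) k)" "side 4 (\<phi> t \<circ> G) k ` {0..1} \<in> subE" by auto
  qed simp
  then show ?thesis using that G by blast
qed

text \<open>Points on different half-sides can only agree if both belong to one edge. Of the four
  combinations of directions two are folds, which the degree excludes. In the other two the
  parameters, both at most \<open>1/2\<close>, add up to \<open>1\<close>; so only the ends of the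
  arc are identified, and side \<open>j\<close> repeats side \<open>j - 1\<close> in the same
  direction.\<close>

lemma arc_cases:
  assumes t: "t \<in> T" "j < n t" and x: "\<bar>x\<bar> \<le> 1/2" "\<bar>y\<bar> \<le> 1/2" and deg: "3 \<le> degree V E (\<phi> t (boundary_point (n t) (real j)))"
    and eq: "\<phi> t (boundary_point (n t) (real j + x)) = \<phi> t (boundary_point (n t) (real j + y))"
  shows "x = y \<or> ({x, y} = {1/2, - 1/2} \<and> bside t (pred_mod (n t) j) = bside t j \<and>
    (\<forall>s\<in>{0..1}. \<phi> t (boundary_point (n t) (real j + s)) = \<phi> t (boundary_point (n t) (real j - 1 + s))))"
proof -
  let ?h = "\<lambda>x. \<phi> t (boundary_point (n t) (real j + x))"
  let ?p = "pred_mod (n t) j"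
  have p: "?p < n t" using pred_mod(1) [OF t(2)] .
  have 0: "?h 0 \<in> V" using side_vertex [OF t] by simp
  have nV: "?h x \<notin> V" if "x \<noteq> 0" "\<bar>x\<bar> \<le> 1/2" for x
    using boundary_nonvertex [OF t(1), of "int j" "real j + x"] boundary_nonvertex [OF t(1), of "int j - 1" "real j + x"] that
    by (cases "0 < x") auto
  have main: "{x, y} = {1/2, - 1/2} \<and> bside t ?p = bside t j \<and>
    (\<forall>s\<in>{0..1}. ?h s = \<phi> t (boundary_point (n t) (real j - 1 + s)))"
    if xy: "0 < x" "x \<le> 1/2" "- 1/2 \<le> y" "y < 0" "?h x = ?h y" for x y
  proof -
    have "?h x \<in> bside t j" using side_in [OF t, of x] xy by simp
    moreover have "?h y \<in> bside t ?p"
      using side_in [OF t(1) p, of "1 + y"] xy pred_mod(2) [OF t(2), of "- y"] by (simp add: add.assoc)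
    ultimately have e: "bside t ?p = bside t j"
      using edge_unique [OF bside [OF t(1) p] bside [OF t]] nV [of x] xy by simp
    let ?e = "bside t j"
    have eE: "?e \<in> E" using bside [OF t] .
    from corner_sides [OF t, unfolded e]
    consider "\<forall>s\<in>{0..1}. ?h s = \<gamma> ?e s" "\<forall>s\<in>{0..1}. \<phi> t (boundary_point (n t) (real j - s)) = \<gamma> ?e s"
      | "\<forall>s\<in>{0..1}. ?h s = \<gamma> ?e (1 - s)" "\<forall>s\<in>{0..1}. \<phi> t (boundary_point (n t) (real j - s)) = \<gamma> ?e (1 - s)"
      | "\<forall>s\<in>{0..1}. ?h s = \<gamma> ?e s" "\<forall>s\<in>{0..1}. \<phi> t (boundary_point (n t) (real j - s)) = \<gamma> ?e (1 - s)"
      | "\<forall>s\<in>{0..1}. ?h s = \<gamma> ?e (1 - s)" "\<forall>s\<in>{0..1}. \<phi> t (boundary_point (n t) (real j - s)) = \<gamma> ?e s"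
      by blast
    then show ?thesis
    proof cases
      case 1
      then have "degree V E (?h 0) \<le> 2" using fold_degree [OF t] by simp
      then show ?thesis using deg by simp
    next
      case 2
      then have "degree V E (?h 0) \<le> 2" using fold_degree [OF t] by simp
      then show ?thesis using deg by simp
    next
      case 3
      have "\<gamma> ?e x = \<gamma> ?e (1 + y)" using bspec [OF 3(1), of x] bspec [OF 3(2), of "- y"] xy by simp
      then have "x = 1 + y" using edge_inj [OF eE, of x "1 + y"] xy by simp
      then have "x = 1/2 \<and> y = - 1/2" using xy by auto
      moreover have "?h s = \<phi> t (boundary_point (n t) (real j - 1 + s))" if "s \<in> {0..1}" for s
        using bspec [OF 3(1) that] bspec [OF 3(2), of "1 - s"] that by (simp add: diff_diff_eq2 algebra_simps)
      ultimately show ?thesis using e by blast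
    next
      case 4
      have "\<gamma> ?e (1 - x) = \<gamma> ?e (- y)" using bspec [OF 4(1), of x] bspec [OF 4(2), of "- y"] xy by simp
      then have "1 - x = - y" using edge_inj [OF eE, of "1 - x" "- y"] xy by simp
      then have "x = 1/2 \<and> y = - 1/2" using xy by auto
      moreover have "?h s = \<phi> t (boundary_point (n t) (real j - 1 + s))" if "s \<in> {0..1}" for s
        using bspec [OF 4(1) that] bspec [OF 4(2), of "1 - s"] that by (simp add: diff_diff_eq2 algebra_simps)
      ultimately show ?thesis using e by blast
    qed
  qed
  consider "x = 0" | "y = 0" | "0 < x" "0 < y" | "x < 0" "y < 0" | "0 < x" "y < 0" | "x < 0" "0 < y" by linarith
  then show ?thesis
  proof cases
    case 1
    then show ?thesis using 0 nV [of y] x eq by auto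
  next
    case 2
    then show ?thesis using 0 nV [of x] x eq by auto
  next
    case 3
    then show ?thesis using side_inj [OF t, of x y] x eq by auto
  next
    case 4
    then show ?thesis using boundary_inj [OF t(1), of "int j - 1" "real j + x" "real j + y"] x eq by auto
  next
    case 5
    then show ?thesis using main [of x y] x eq by auto
  next
    case 6
    then show ?thesis using main [of y x] x eq by (auto simp: insert_commute)
  qed
qed

text \<open>The image of a compact sector is closed, and each of its points is a limit of images of
  interior points.\<close>

lemma closure_piece:
  assumes t: "t \<in> T" "j < n t" "2 \<le> n t"
  shows "X closure_of piece t j = \<phi> t ` sector (n t) (real j - 1/2) (real j + 1/2)"
proof -
  obtain G where G: "continuous_on (cball 0 1) G"
    "G ` cball 0 1 = sector (n t) (real j - 1/2) (real j + 1/2)"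
    "G ` ball 0 1 = ball 0 1 \<inter> wedge (n t) (real j - 1/2) (real j + 1/2)"
    "polygon_map X subV subE (piece t j) 4 (\<phi> t \<circ> G)"
    using piece_polygon [OF t] by metis
  have im: "\<phi> t ` sector (n t) (real j - 1/2) (real j + 1/2) = (\<phi> t \<circ> G) ` cball 0 1"
    "piece t j = (\<phi> t \<circ> G) ` ball 0 1"
    unfolding piece_def G(2) [symmetric] G(3) [symmetric] by (simp_all only: image_comp)
  have c: "continuous_map (top_of_set (cball 0 1)) X (\<phi> t \<circ> G)"
    using polygon_mapD(2) [OF G(4)] .
  show ?thesis
    unfolding im
  proof (rule antisym)
    show "X closure_of ((\<phi> t \<circ> G) ` ball 0 1) \<subseteq> (\<phi> t \<circ> G) ` cball 0 1"
      using continuous_image_compact_closedin [OF compact_cball Haus c order_refl]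
      by (intro closure_of_minimal image_mono ball_subset_cball)
    show "(\<phi> t \<circ> G) ` cball 0 1 \<subseteq> X closure_of ((\<phi> t \<circ> G) ` ball 0 1)"
    proof
      fix x assume "x \<in> (\<phi> t \<circ> G) ` cball 0 1"
      then obtain z where z: "z \<in> cball 0 1" "x = (\<phi> t \<circ> G) z" by blast
      have "x \<in> topspace X" using c z by (auto simp: continuous_map_def)
      moreover have "\<exists>y\<in>ball 0 1 \<inter> UNIV. (\<phi> t \<circ> G) y \<in> S" if "x \<in> S" "openin X S" for S
        by (rule continuous_map_near_point [OF c that(2), of z]) (use z that in auto)
      ultimately show "x \<in> X closure_of ((\<phi> t \<circ> G) ` ball 0 1)"
        unfolding in_closure_of by blast
    qed
  qed
qed

end

text \<open>A side of the standard 4-gon is a quarter turn, so \<open>q\<close> is the arcsine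
  measured in sides; the points are those of the unit circle with abscissa \<open>x\<close> or
  \<open>- x\<close>.\<close>

lemma cis_complement:
  assumes "\<bar>x\<bar> \<le> 1"
  defines "q \<equiv> 2 / pi * arcsin x"
  shows "boundary_point 4 (1 - q) = Complex x (sqrt (1 - x\<^sup>2))"
    "boundary_point 4 (2 - (1 - q)) = Complex (- x) (sqrt (1 - x\<^sup>2))"
    "boundary_point 4 (- (1 - q)) = Complex x (- sqrt (1 - x\<^sup>2))"
    "boundary_point 4 (2 + (1 - q)) = Complex (- x) (- sqrt (1 - x\<^sup>2))"
proof -
  have sc: "sin (arcsin x) = x" "cos (arcsin x) = sqrt (1 - x\<^sup>2)"
    using assms by (auto simp: cos_arcsin abs_le_iff)
  have a: "2 * pi * (1 - q) / real 4 = pi/2 - arcsin x" "2 * pi * (2 - (1 - q)) / real 4 = pi/2 + arcsin x"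
    "2 * pi * (- (1 - q)) / real 4 = - (pi/2 - arcsin x)" "2 * pi * (2 + (1 - q)) / real 4 = pi + (pi/2 - arcsin x)"
    by (simp_all add: q_def field_simps)
  have cp: "cis (pi + y) = - cis y" for y
    by (simp add: complex_eq_iff cos_add sin_add)
  show "boundary_point 4 (1 - q) = Complex x (sqrt (1 - x\<^sup>2))"
    "boundary_point 4 (2 - (1 - q)) = Complex (- x) (sqrt (1 - x\<^sup>2))"
    "boundary_point 4 (- (1 - q)) = Complex x (- sqrt (1 - x\<^sup>2))"
    "boundary_point 4 (2 + (1 - q)) = Complex (- x) (- sqrt (1 - x\<^sup>2))"
    unfolding boundary_point_def a cp
    by (simp_all add: complex_eq_iff sin_diff cos_diff sin_add cos_add sc)
qed

context polygon_family
begin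

text \<open>Coordinates around the identified middle point: \<open>Re z\<close> runs along the
  common edge, the upper half of the square enters the tile at side \<open>j\<close>, the lower half
  at side \<open>j - 1\<close>, and the twist makes them agree on the real axis. The sector ends at
  this point from opposite directions on the two sides, so it fills the first and the third
  quadrant.\<close>

lemma twisted_moebius:
  assumes t: "t \<in> T" "j < n t" "2 \<le> n t"
    and twist: "\<And>s. \<lbrakk>0 \<le> s; s \<le> 1\<rbrakk> \<Longrightarrow>
      \<phi> t (boundary_point (n t) (real j + s)) = \<phi> t (boundary_point (n t) (real j - 1 + s))"
    and G: "continuous_on (cball 0 1) G" "inj_on G (cball 0 1)"
    "G ` cball 0 1 = sector (n t) (real j - 1/2) (real j + 1/2)"
    "\<And>s. \<lbrakk>0 \<le> s; s \<le> 1\<rbrakk> \<Longrightarrow> G (boundary_point 4 s) = boundary_point (n t) (real j + s/2)"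
    "\<And>s. \<lbrakk>0 \<le> s; s \<le> 1\<rbrakk> \<Longrightarrow> G (boundary_point 4 (- s)) = boundary_point (n t) (real j - s/2)"
    "\<And>s. \<lbrakk>0 \<le> s; s \<le> 1\<rbrakk> \<Longrightarrow> G (boundary_point 4 (2 - s)) = polar (n t) s (real j + 1/2)"
    "\<And>s. \<lbrakk>0 \<le> s; s \<le> 1\<rbrakk> \<Longrightarrow> G (boundary_point 4 (2 + s)) = polar (n t) s (real j - 1/2)"
    and inj: "\<And>x y. \<lbrakk>x \<in> cball 0 1; y \<in> cball 0 1; (\<phi> t \<circ> G) x = (\<phi> t \<circ> G) y\<rbrakk> \<Longrightarrow> x = y \<or> {x, y} = {\<i>, - \<i>}"
    and c\<psi>: "continuous_map (top_of_set (cball 0 1)) X (\<phi> t \<circ> G)"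
    and N: "openin X N" "\<phi> t (boundary_point (n t) (real j + 1/2)) \<in> N"
  shows "\<exists>D. closed_disk_nbhd X (\<phi> t (boundary_point (n t) (real j + 1/2))) D \<and> D \<subseteq> N \<and>
      moebius_band (subtopology X (X closure_of piece t j \<union> D))"
proof -
  \<comment> \<open>The arcsine converts the abscissa on the unit circle to a position along a side,
    which makes the half-axes match the arcs required for the Moebius band.\<close>
  define q where "q x = 2 / pi * arcsin x" for x
  have q0: "q 0 = 0" by (simp add: q_def)
  have qm: "q (- x) = - q x" if "\<bar>x\<bar> < 1" for x using that by (simp add: q_def arcsin_minus abs_less_iff)
  have qb: "\<bar>q x\<bar> < 1" if "\<bar>x\<bar> < 1" for x
    using arcsin_lt_bounded [of x] that by (auto simp: q_def abs_less_iff field_simps)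
  have qle: "q x < q y" if "\<bar>x\<bar> < 1" "\<bar>y\<bar> < 1" "x < y" for x y
    using that by (simp add: q_def arcsin_less_mono divide_strict_right_mono)
  have qpos: "0 < q x" if "0 < x" "x < 1" for x using qle [of 0 x] that q0 by simp
  have qnn: "0 \<le> q x" if "0 \<le> x" "x < 1" for x using qpos [of x] that q0 by (cases "x = 0") auto
  have qinj: "x = y" if "\<bar>x\<bar> < 1" "\<bar>y\<bar> < 1" "q x = q y" for x y
    using qle [of x y] qle [of y x] that by (cases x y rule: linorder_cases) auto
  have qc: "continuous_on S (\<lambda>x. q (f x))" if "continuous_on S f" "\<And>x. x \<in> S \<Longrightarrow> \<bar>f x\<bar> < 1" for S and f :: "complex \<Rightarrow> real"
    unfolding q_def using that by (intro continuous_intros) (auto simp: abs_less_iff less_imp_le)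
  define D where "D z = (if 0 \<le> Im z then polar (n t) (1 - q (Im z)) (real j + 1/2 - q (Re z) / 2)
      else polar (n t) (1 - q (- Im z)) (real j - 1/2 - q (Re z) / 2))" for z
  define d where "d z = \<phi> t (D z)" for z
  have n0: "0 < n t" using t by simp
  have tw0: "\<phi> t (boundary_point (n t) (real j + 1/2 - q x / 2)) = \<phi> t (boundary_point (n t) (real j - 1/2 - q x / 2))"
    if "\<bar>x\<bar> < 1" for x
    using twist [of "1/2 - q x / 2"] qb [OF that] by (simp add: abs_less_iff algebra_simps)
  define S where "S = {z. \<bar>Re z\<bar> < 1 \<and> \<bar>Im z\<bar> < 1}"
  have nD: "norm (D z) = 1 - q \<bar>Im z\<bar>" if "z \<in> S" for z
    using qb [of "Im z"] qm [of "Im z"] that by (auto simp: D_def S_def abs_less_iff)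
  have dc: "continuous_map (top_of_set S) X d"
  proof -
    have "continuous_map (top_of_set S) X (\<lambda>z. if 0 \<le> Im z then \<phi> t (polar (n t) (1 - q (Im z)) (real j + 1/2 - q (Re z) / 2))
        else \<phi> t (polar (n t) (1 - q (- Im z)) (real j - 1/2 - q (Re z) / 2)))"
    proof (rule continuous_map_cases_le)
      have "continuous_map (top_of_set {z \<in> S. 0 \<le> Im z}) (top_of_set (cball 0 1)) (\<lambda>z. polar (n t) (1 - q (Im z)) (real j + 1/2 - q (Re z) / 2))"
        using qb qnn by (auto simp: continuous_map_in_subtopology S_def abs_less_iff less_imp_le intro!: continuous_intros qc)
      from continuous_map_compose [OF this continuous_\<phi> [OF t(1)]]
      show "continuous_map (subtopology (top_of_set S) {z \<in> topspace (top_of_set S). 0 \<le> Im z}) X (\<lambda>z. \<phi> t (polar (n t) (1 - q (Im z)) (real j + 1/2 - q (Re z) / 2)))"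
        by (simp add: subtopology_subtopology o_def Int_absorb1 Collect_restrict)
      have "continuous_map (top_of_set {z \<in> S. Im z \<le> 0}) (top_of_set (cball 0 1)) (\<lambda>z. polar (n t) (1 - q (- Im z)) (real j - 1/2 - q (Re z) / 2))"
        using qb qnn by (auto simp: continuous_map_in_subtopology S_def abs_less_iff less_imp_le intro!: continuous_intros qc)
      from continuous_map_compose [OF this continuous_\<phi> [OF t(1)]]
      show "continuous_map (subtopology (top_of_set S) {z \<in> topspace (top_of_set S). Im z \<le> 0}) X (\<lambda>z. \<phi> t (polar (n t) (1 - q (- Im z)) (real j - 1/2 - q (Re z) / 2)))"
        by (simp add: subtopology_subtopology o_def Int_absorb1 Collect_restrict)
      show "\<phi> t (polar (n t) (1 - q (Im z)) (real j + 1/2 - q (Re z) / 2)) = \<phi> t (polar (n t) (1 - q (- Im z)) (real j - 1/2 - q (Re z) / 2))"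
        if "z \<in> topspace (top_of_set S)" "0 = Im z" for z
        using that(2) [symmetric] tw0 [of "Re z"] that(1) by (simp add: S_def q0)
    qed (auto intro!: continuous_intros)
    then show ?thesis by (simp add: d_def [abs_def] D_def if_distrib [of "\<phi> t"])
  qed
  have d_inj: "inj_on d S"
  proof (rule inj_onI)
    fix z w assume zw: "z \<in> S" "w \<in> S" "d z = d w"
    have b: "\<bar>q (Re z)\<bar> < 1" "\<bar>q (Re w)\<bar> < 1" "\<bar>q (Im z)\<bar> < 1" "\<bar>q (Im w)\<bar> < 1" using zw qb by (auto simp: S_def)
    have S: "\<bar>Re z\<bar> < 1" "\<bar>Re w\<bar> < 1" "\<bar>Im z\<bar> < 1" "\<bar>Im w\<bar> < 1" using zw by (auto simp: S_def)
    have nz: "norm (D z) \<le> 1" "norm (D w) \<le> 1" using nD zw qnn S by (auto simp: abs_less_iff)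
    have lt: "norm (D z) < 1 \<longleftrightarrow> Im z \<noteq> 0" if "z \<in> S" for z
      using nD [OF that] qpos [of "\<bar>Im z\<bar>"] that q0 by (auto simp: S_def abs_if split: if_splits)
    show "z = w"
    proof (cases "Im z = 0 \<and> Im w = 0")
      case True
      then have "\<phi> t (boundary_point (n t) (real j + 1/2 - q (Re z) / 2)) = \<phi> t (boundary_point (n t) (real j + 1/2 - q (Re w) / 2))"
        using zw(3) by (simp add: d_def D_def q0)
      then have "real j + 1/2 - q (Re z) / 2 = real j + 1/2 - q (Re w) / 2"
        by (intro boundary_inj [OF t(1), of "int j"]) (use b in \<open>auto simp: abs_less_iff\<close>)
      then have "q (Re z) = q (Re w)" by simp
      then show ?thesis using qinj [OF S(1,2)] True by (simp add: complex_eq_iff)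
    next
      case False
      then have DD: "D z = D w"
        using tile_unique [OF t(1,1), of "D z" "D w"] tile_unique [OF t(1,1), of "D w" "D z"] zw(3) lt [OF zw(1)] lt [OF zw(2)] nz
        unfolding d_def by metis
      have "q \<bar>Im z\<bar> = q \<bar>Im w\<bar>" using nD [OF zw(1)] nD [OF zw(2)] DD by simp
      then have Imabs: "\<bar>Im z\<bar> = \<bar>Im w\<bar>" using qinj [of "\<bar>Im z\<bar>" "\<bar>Im w\<bar>"] S by simp
      define \<alpha> where "\<alpha> z = (if 0 \<le> Im z then real j + 1/2 - q (Re z) / 2 else real j - 1/2 - q (Re z) / 2)" for z
      have Dp: "D z = polar (n t) (1 - q \<bar>Im z\<bar>) (\<alpha> z)" for z by (simp add: D_def \<alpha>_def)
      have "boundary_point (n t) (\<alpha> z) = boundary_point (n t) (\<alpha> w)"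
        using DD b(3,4) qb [of "\<bar>Im z\<bar>"] S unfolding Dp Imabs by (simp add: polar_eq_iff abs_less_iff)
      moreover have "\<bar>\<alpha> z - \<alpha> w\<bar> < real (n t)"
      proof -
        have "real j - 1 < \<alpha> z \<and> \<alpha> z < real j + 1"
          using b(1) by (cases "0 \<le> Im z") (auto simp: \<alpha>_def abs_less_iff)
        moreover have "real j - 1 < \<alpha> w \<and> \<alpha> w < real j + 1"
          using b(2) by (cases "0 \<le> Im w") (auto simp: \<alpha>_def abs_less_iff)
        ultimately have "\<bar>\<alpha> z - \<alpha> w\<bar> < 2" by linarith
        then show ?thesis using t(3) by linarith
      qed
      ultimately have \<alpha>: "\<alpha> z = \<alpha> w" using boundary_point_inj [OF n0] by blast
      then have "(0 \<le> Im z) = (0 \<le> Im w) \<and> q (Re z) = q (Re w)"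
        using b unfolding \<alpha>_def by (auto simp: abs_less_iff split: if_splits)
      then show ?thesis using qinj [OF S(1,2)] Imabs by (auto simp: complex_eq_iff abs_if split: if_splits)
    qed
  qed
  let ?w = "\<phi> t (boundary_point (n t) (real j + 1/2))"
  have d0: "d 0 = ?w" by (simp add: d_def D_def q0)
  have "openin (top_of_set S) {z \<in> S. d z \<in> N}"
    using openin_continuous_map_preimage [OF dc N(1)] by simp
  moreover have Sop: "open S"
  proof -
    have "S = {z. \<bar>Re z\<bar> < 1} \<inter> {z. \<bar>Im z\<bar> < 1}" by (auto simp: S_def)
    then show ?thesis by (auto intro!: open_Int open_Collect_less continuous_intros)
  qed
  ultimately have "open {z \<in> S. d z \<in> N}" using openin_open_trans by blast
  moreover have "0 \<in> {z \<in> S. d z \<in> N}" using d0 N(2) by (simp add: S_def)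
  ultimately obtain e where e: "e > 0" "ball 0 e \<subseteq> {z \<in> S. d z \<in> N}" by (meson open_contains_ball)
  \<comment> \<open>Points of the square have norm at most \<open>2 * \<delta>\<close>, which is
    below \<open>e\<close>; the bound \<open>1/2\<close> ensures
    \<open>\<delta> < 1\<close>.\<close>
  define \<delta> where "\<delta> = min (1/2) (e/3)"
  have \<delta>: "0 < \<delta>" "\<delta> < 1" using e by (auto simp: \<delta>_def)
  have sqN: "square \<delta> \<subseteq> {z \<in> S. d z \<in> N}"
  proof
    fix z assume "z \<in> square \<delta>"
    then have "norm z \<le> \<delta> + \<delta>"
      using cmod_le [of z] by (simp add: square_def)
    then have "norm z < e" using e(1) by (simp add: \<delta>_def min_def split: if_splits)
    then show "z \<in> {z \<in> S. d z \<in> N}" using e(2) by auto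
  qed
  have sqS: "square \<delta> \<subseteq> S" using sqN by blast
  have dc': "continuous_map (top_of_set (square \<delta>)) X d"
    using dc sqS continuous_map_from_subtopology_mono by blast
  have d_inj': "inj_on d (square \<delta>)" using d_inj sqS inj_on_subset by blast
  have cl: "X closure_of piece t j = (\<phi> t \<circ> G) ` cball 0 1"
    using closure_piece [OF t] by (simp only: G(3) [symmetric] image_comp)
  \<comment> \<open>Positions just beyond the bounding radii do not re-enter the closed sector: all
    positions compared differ by less than \<open>2\<close>, which is at most a full turn.\<close>
  have cone_no: False if h: "polar (n t) r s0 \<in> sector (n t) (real j - 1/2) (real j + 1/2)" "0 < r"
    "(real j + 1/2 < s0 \<and> s0 < real j + 1) \<or> (real j - 1 < s0 \<and> s0 < real j - 1/2)" for r s0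
  proof -
    obtain r' s where s: "0 \<le> r'" "real j - 1/2 \<le> s" "s \<le> real j + 1/2" "polar (n t) r s0 = polar (n t) r' s"
      using h(1) unfolding sector_def by blast
    then have "boundary_point (n t) s0 = boundary_point (n t) s"
      using polar_eq_iff [of r r' "n t" s0 "n t" s] h(2) by simp
    moreover have "\<bar>s0 - s\<bar> < real (n t)"
    proof -
      have "\<bar>s0 - s\<bar> < 2" using s h(3) by (auto simp: abs_if)
      then show ?thesis using t(3) by linarith
    qed
    ultimately have "s0 = s" using boundary_point_inj [OF n0] by blast
    then show False using s h(3) by auto
  qed
  have mb: "moebius_band (subtopology X ((\<phi> t \<circ> G) ` cball 0 1 \<union> d ` square \<delta>))"
  proof (rule moebius_band_criterion [OF Haus \<delta> c\<psi> inj dc' d_inj'])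
    fix x assume x: "0 \<le> x" "x \<le> \<delta>"
    then have x1: "\<bar>x\<bar> < 1" "\<bar>x\<bar> \<le> 1" using \<delta> by auto
    have qx: "0 \<le> q x" "q x < 1" using qnn [of x] qb [of x] x x1 \<delta> by (auto simp: abs_less_iff)
    note c = cis_complement [OF x1(2), folded q_def]
    show "d (Complex x 0) = (\<phi> t \<circ> G) (Complex x (sqrt (1 - x\<^sup>2)))"
      unfolding c(1) [symmetric] using G(4) [of "1 - q x"] qx by (simp add: d_def D_def q0 add_diff_eq diff_divide_distrib)
    show "d (Complex 0 x) = (\<phi> t \<circ> G) (Complex (- x) (sqrt (1 - x\<^sup>2)))"
      unfolding c(2) [symmetric] using G(6) [of "1 - q x"] qx x by (simp add: d_def D_def q0)
    have dx: "d (Complex (- x) 0) = \<phi> t (boundary_point (n t) (real j - 1/2 - q (- x) / 2))"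
      using tw0 [of "- x"] x1 by (simp add: d_def D_def q0)
    show "d (Complex (- x) 0) = (\<phi> t \<circ> G) (Complex x (- sqrt (1 - x\<^sup>2)))"
    proof -
      have ar: "real j - (1 - q x) / 2 = real j - 1/2 - q (- x) / 2"
        using qm [OF x1(1)] by (simp add: field_simps)
      have "0 \<le> 1 - q x" "1 - q x \<le> 1" using qx by simp_all
      from G(5) [OF this] have "G (boundary_point 4 (- (1 - q x))) = boundary_point (n t) (real j - 1/2 - q (- x) / 2)"
        unfolding ar .
      then show ?thesis
        using dx unfolding c(3) [symmetric] o_def by (simp only:)
    qed
    show "d (Complex 0 (- x)) = (\<phi> t \<circ> G) (Complex (- x) (- sqrt (1 - x\<^sup>2)))"
    \<comment> \<open>For \<open>x = 0\<close> the point belongs to the upper branch of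
      \<open>D\<close>, and the twist is needed to reach side \<open>j - 1\<close>.\<close>
    proof (cases "x = 0")
      case True
      have "d 0 = \<phi> t (boundary_point (n t) (real j - 1/2))"
        using d0 tw0 [of 0] by (simp add: q0)
      then show ?thesis
        unfolding c(4) [symmetric] using G(7) [of "1 - q x"] True q0 by (simp add: zero_complex.code [symmetric] del: complex_of_real_code)
    next
      case False
      then show ?thesis
        unfolding c(4) [symmetric] using G(7) [of "1 - q x"] qx x by (simp add: d_def D_def q0)
    qed
  next
    fix z assume z: "z \<in> square \<delta>" "0 \<le> Re z * Im z"
    have zS: "\<bar>Re z\<bar> < 1" "\<bar>Im z\<bar> < 1" using sqS z(1) by (auto simp: S_def)
    have b: "\<bar>q (Re z)\<bar> < 1" "\<bar>q (Im z)\<bar> < 1" using qb zS by auto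
    consider "0 \<le> Re z" "0 \<le> Im z" | "Re z \<le> 0" "Im z < 0" | "Re z \<le> 0" "Im z = 0"
    proof (cases "Im z = 0")
      case True
      then show ?thesis using that by (cases "0 \<le> Re z") auto
    next
      case False
      then show ?thesis using that z(2) by (cases "0 \<le> Im z") (auto simp: zero_le_mult_iff)
    qed
    then have "d z \<in> \<phi> t ` sector (n t) (real j - 1/2) (real j + 1/2)"
    proof cases
      case 1
      have "0 \<le> q (Re z)" "0 \<le> q (Im z)" "q (Im z) < 1" "q (Re z) < 1"
        using qnn [of "Re z"] qnn [of "Im z"] zS b 1 by (simp_all add: abs_less_iff)
      then have "polar (n t) (1 - q (Im z)) (real j + 1/2 - q (Re z) / 2) \<in> sector (n t) (real j - 1/2) (real j + 1/2)"
        by (intro sectorI) auto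
      then show ?thesis using 1 by (simp add: d_def D_def)
    next
      case 2
      have "0 \<le> - q (Re z)" using qnn [of "- Re z"] qm [of "Re z"] zS 2 by (simp add: abs_less_iff)
      moreover have "0 \<le> q (- Im z)" "q (- Im z) < 1" using qnn [of "- Im z"] qb [of "- Im z"] zS 2 by (auto simp: abs_less_iff)
      ultimately have "polar (n t) (1 - q (- Im z)) (real j - 1/2 - q (Re z) / 2) \<in> sector (n t) (real j - 1/2) (real j + 1/2)"
        using b(1) by (intro sectorI) (auto simp: abs_less_iff)
      then show ?thesis using 2 by (simp add: d_def D_def)
    next
      case 3
      have "0 \<le> - q (Re z)" using qnn [of "- Re z"] qm [of "Re z"] zS 3 by (simp add: abs_less_iff)
      then have "polar (n t) 1 (real j - 1/2 - q (Re z) / 2) \<in> sector (n t) (real j - 1/2) (real j + 1/2)"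
        using b by (intro sectorI) (auto simp: abs_less_iff)
      moreover have "d z = \<phi> t (polar (n t) 1 (real j - 1/2 - q (Re z) / 2))"
        using tw0 [OF zS(1)] 3 by (simp add: d_def D_def q0)
      ultimately show ?thesis by blast
    qed
    then show "d z \<in> (\<phi> t \<circ> G) ` cball 0 1" using G(3) by (metis image_comp)
  next
    fix z assume z: "z \<in> square \<delta>" "Re z * Im z < 0"
    have zS: "\<bar>Re z\<bar> < 1" "\<bar>Im z\<bar> < 1" using sqS z(1) by (auto simp: S_def)
    have b: "\<bar>q (Re z)\<bar> < 1" "\<bar>q \<bar>Im z\<bar>\<bar> < 1" using qb zS by auto
    show "d z \<notin> (\<phi> t \<circ> G) ` cball 0 1"
    proof
      assume "d z \<in> (\<phi> t \<circ> G) ` cball 0 1"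
      then have "d z \<in> \<phi> t ` sector (n t) (real j - 1/2) (real j + 1/2)" using G(3) by (metis image_comp)
      then obtain a where a: "a \<in> sector (n t) (real j - 1/2) (real j + 1/2)" "\<phi> t (D z) = \<phi> t a" by (auto simp: d_def)
      have "Im z \<noteq> 0" using z(2) by auto
      then have "0 < q \<bar>Im z\<bar>" using qpos [of "\<bar>Im z\<bar>"] zS by simp
      then have "norm (D z) < 1" using nD [of z] sqS z(1) by auto
      moreover have "norm a \<le> 1" using a(1) sector_subset_cball by fastforce
      ultimately have "D z = a" using tile_unique [OF t(1,1) _ _ a(2)] by blast
      then have Ds: "D z \<in> sector (n t) (real j - 1/2) (real j + 1/2)" using a(1) by simp
      consider "Re z < 0" "0 < Im z" | "0 < Re z" "Im z < 0" using z(2) by (auto simp: mult_less_0_iff)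
      then show False
      proof cases
        case 1
        have "0 < - q (Re z)" using qpos [of "- Re z"] qm [of "Re z"] zS 1 by (simp add: abs_less_iff)
        then show False
          using cone_no [of "1 - q (Im z)" "real j + 1/2 - q (Re z) / 2"] Ds 1 b by (simp add: D_def abs_less_iff)
      next
        case 2
        have "0 < q (Re z)" using qpos [of "Re z"] zS 2 by simp
        then show False
          using cone_no [of "1 - q (- Im z)" "real j - 1/2 - q (Re z) / 2"] Ds 2 b by (simp add: D_def abs_less_iff)
      qed
    qed
  qed
  have nbhd: "closed_disk_nbhd X ?w (d ` square \<delta>)"
    unfolding closed_disk_nbhd_def
  proof (intro conjI)
    show "d ` square \<delta> \<subseteq> topspace X" using dc' by (auto simp: continuous_map_def)
    let ?U = "{z. \<bar>Re z\<bar> < \<delta>} \<inter> {z. \<bar>Im z\<bar> < \<delta>}"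
    have U: "open ?U" by (intro open_Int open_Collect_less continuous_intros)
    have sub: "?U \<subseteq> square \<delta>" by (auto simp: square_def)
    have "openin X (d ` ?U)"
      using closed_surface_invariance_of_domain [OF X U] dc' d_inj' sub
        continuous_map_from_subtopology_mono inj_on_subset by blast
    then have "d ` ?U \<subseteq> X interior_of (d ` square \<delta>)"
      using sub by (intro interior_of_maximal image_mono)
    moreover have "?w \<in> d ` ?U" using d0 \<delta> by (intro image_eqI [of _ _ 0]) auto
    ultimately show "?w \<in> X interior_of (d ` square \<delta>)" by blast
    have "homeomorphic_map (top_of_set (square \<delta>)) (subtopology X (d ` square \<delta>)) d"
    proof (rule continuous_imp_homeomorphic_map)
      show "continuous_map (top_of_set (square \<delta>)) (subtopology X (d ` square \<delta>)) d"
        using dc' by (simp add: continuous_map_in_subtopology)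
      show "compact_space (top_of_set (square \<delta>))" using compact_square by (simp add: compact_space_subtopology)
      show "Hausdorff_space (subtopology X (d ` square \<delta>))" using Haus by (rule Hausdorff_space_subtopology)
      show "d ` topspace (top_of_set (square \<delta>)) = topspace (subtopology X (d ` square \<delta>))"
        using dc' by (auto simp: continuous_map_def)
    qed (use d_inj' in simp)
    then have h1: "top_of_set (square \<delta>) homeomorphic_space subtopology X (d ` square \<delta>)"
      by (rule homeomorphic_map_imp_homeomorphic_space)
    have "interior (square \<delta>) \<noteq> {}"
      using interior_maximal [OF sub U] \<delta> by (metis (mono_tags, lifting) Int_iff abs_zero empty_iff mem_Collect_eq subsetD zero_complex.simps(1) zero_complex.simps(2))
    then have "square \<delta> homeomorphic cball (0::complex) 1"
      using homeomorphic_convex_compact_cball [OF convex_square compact_square] by simp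
    then obtain f g where fg: "homeomorphism (square \<delta>) (cball (0::complex) 1) f g" unfolding homeomorphic_def by blast
    then have "homeomorphic_maps (top_of_set (square \<delta>)) (top_of_set (cball (0::complex) 1)) f g"
      by (auto simp: homeomorphism_def homeomorphic_maps_def continuous_map_in_subtopology)
    then have "top_of_set (square \<delta>) homeomorphic_space top_of_set (cball (0::complex) 1)"
      unfolding homeomorphic_space_def by blast
    then show "subtopology X (d ` square \<delta>) homeomorphic_space top_of_set (cball (0::complex) 1)"
      using h1 homeomorphic_space_sym homeomorphic_space_trans by blast
  qed
  show ?thesis
    using mb nbhd sqN cl by (intro exI [of _ "d ` square \<delta>"]) auto
qed

text \<open>Inside a closed sector only points of the outer arc can be identified, and among these
  only its two ends, under the twist \<open>Tw\<close>. Without the twist the polygon map is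
  injective on the whole closed disk.\<close>

theorem subdivision_tile_types:
  assumes deg: "\<And>v. v \<in> V \<Longrightarrow> 3 \<le> degree V E v" and n2: "\<And>t. t \<in> T \<Longrightarrow> 2 \<le> n t"
    and u: "u \<in> tiles X subV subE"
  defines "W \<equiv> {\<phi> t 0 | t. t \<in> T}"
  shows "type_Q X subV subE V W u \<or> type_Q' X subV subE V W u"
proof -
  obtain t j where t: "t \<in> T" "j < n t" and utj: "u = piece t j"
    using u unfolding tiles_sub by blast
  have t2: "2 \<le> n t" using n2 t by blast
  obtain G where G: "continuous_on (cball 0 1) G" "inj_on G (cball 0 1)"
    "G ` cball 0 1 = sector (n t) (real j - 1/2) (real j + 1/2)"
    "G ` ball 0 1 = ball 0 1 \<inter> wedge (n t) (real j - 1/2) (real j + 1/2)"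
    "\<And>s. \<lbrakk>0 \<le> s; s \<le> 1\<rbrakk> \<Longrightarrow> G (boundary_point 4 s) = boundary_point (n t) (real j + s/2)"
    "\<And>s. \<lbrakk>0 \<le> s; s \<le> 1\<rbrakk> \<Longrightarrow> G (boundary_point 4 (- s)) = boundary_point (n t) (real j - s/2)"
    "\<And>s. \<lbrakk>0 \<le> s; s \<le> 1\<rbrakk> \<Longrightarrow> G (boundary_point 4 (2 - s)) = polar (n t) s (real j + 1/2)"
    "\<And>s. \<lbrakk>0 \<le> s; s \<le> 1\<rbrakk> \<Longrightarrow> G (boundary_point 4 (2 + s)) = polar (n t) s (real j - 1/2)"
    and pm: "polygon_map X subV subE (piece t j) 4 (\<phi> t \<circ> G)"
    by (rule piece_polygon [OF t t2], rule that)
  let ?\<psi> = "\<phi> t \<circ> G" and ?p = "pred_mod (n t) j"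
  have p: "?p < n t" using pred_mod(1) [OF t(2)] .
  have n0: "0 < n t" using n_pos [OF t(1)] .
  have b3: "boundary_point 4 3 = boundary_point 4 (- 1)"
    using boundary_point_add_period [of 4 "- 1"] by simp
  have corners: "corner 4 ?\<psi> 0 = \<phi> t (boundary_point (n t) (real j))" "corner 4 ?\<psi> 1 = \<gamma> (bside t j) (1/2)"
    "corner 4 ?\<psi> 2 = \<phi> t 0" "corner 4 ?\<psi> 3 = \<gamma> (bside t ?p) (1/2)"
    using G(5) [of 0] G(5) [of 1] G(6) [of 1] G(7) [of 0] side_mid [OF t] side_mid [OF t(1) p] b3
      pred_mod(2) [OF t(2), of "1/2"]
    by (simp_all add: corner_def add.commute)
  have mid: "\<gamma> e (1/2) \<in> subV - (V \<union> W) \<and> degree subV subE (\<gamma> e (1/2)) = 4" if e: "e \<in> E" for e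
  proof -
    have "\<gamma> e (1/2) \<notin> W"
      using inside_not_graph [of _ 0] edge_mem [OF e, of "1/2"] e by (force simp: W_def)
    then show ?thesis
      using degree_mid [OF e] edge_V(1) [OF e, of "1/2"] e by (auto simp: subV_def)
  qed
  have eE: "bside t j \<in> E" "bside t ?p \<in> E" using bside t p by blast+
  have vB: "corner 4 ?\<psi> 0 \<in> V" using side_vertex [OF t] corners by simp
  have wW: "corner 4 ?\<psi> 2 \<in> W" using corners t by (auto simp: W_def)
  define Tw where "Tw \<longleftrightarrow> bside t ?p = bside t j \<and>
    (\<forall>s\<in>{0..1}. \<phi> t (boundary_point (n t) (real j + s)) = \<phi> t (boundary_point (n t) (real j - 1 + s)))"
  have Gi: "G (boundary_point 4 1) = boundary_point (n t) (real j + 1/2)" "G (boundary_point 4 3) = boundary_point (n t) (real j - 1/2)"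
    using G(5) [of 1] G(6) [of 1] b3 by simp_all
  have inj: "x = y \<or> ({x, y} = {boundary_point 4 1, boundary_point 4 3} \<and> Tw)"
    if xy: "x \<in> cball 0 1" "y \<in> cball 0 1" "?\<psi> x = ?\<psi> y" for x y
  proof -
    have sec: "G x \<in> sector (n t) (real j - 1/2) (real j + 1/2)" "G y \<in> sector (n t) (real j - 1/2) (real j + 1/2)"
      using G(3) xy by blast+
    then have nn: "norm (G x) \<le> 1" "norm (G y) \<le> 1" using sector_subset_cball by fastforce+
    show ?thesis
    proof (cases "norm (G x) < 1 \<or> norm (G y) < 1")
      case True
      then have "G x = G y"
      proof
        assume "norm (G x) < 1"
        from tile_unique [OF t(1,1) this nn(2)] show ?thesis using xy(3) by simp
      next
        assume "norm (G y) < 1"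
        from tile_unique [OF t(1,1) this nn(1)] show ?thesis using xy(3) by simp
      qed
      then show ?thesis using inj_onD [OF G(2)] xy by blast
    next
      case False
      obtain r a where a: "0 \<le> r" "real j - 1/2 \<le> a" "a \<le> real j + 1/2" "G x = polar (n t) r a"
        using sec(1) by (auto simp: sector_def)
      obtain r' b where b: "0 \<le> r'" "real j - 1/2 \<le> b" "b \<le> real j + 1/2" "G y = polar (n t) r' b"
        using sec(2) by (auto simp: sector_def)
      have r: "r = 1" "r' = 1" using False nn a b by auto
      have GG: "G x = boundary_point (n t) (real j + (a - real j))" "G y = boundary_point (n t) (real j + (b - real j))"
        using a b r by simp_all
      have eq: "\<phi> t (boundary_point (n t) (real j + (a - real j))) = \<phi> t (boundary_point (n t) (real j + (b - real j)))"
        using xy(3) GG by simp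
      have "\<bar>a - real j\<bar> \<le> 1/2" "\<bar>b - real j\<bar> \<le> 1/2" using a(2,3) b(2,3) by linarith+
      from arc_cases [OF t this deg [OF side_vertex [OF t]] eq]
      consider "a = b" | "{a - real j, b - real j} = {1/2, - 1/2}" Tw
        unfolding Tw_def by auto
      then show ?thesis
      proof cases
        case 1
        then have "G x = G y" using a b r by simp
        then show ?thesis using inj_onD [OF G(2)] xy by blast
      next
        case 2
        then consider "a - real j = 1/2" "b - real j = - 1/2" | "a - real j = - 1/2" "b - real j = 1/2"
          by (auto simp: doubleton_eq_iff)
        then have "{G x, G y} = {G (boundary_point 4 1), G (boundary_point 4 3)}"
        proof cases
          case 1
          then have "a = real j + 1/2" "b = real j - 1/2" by linarith+
          then show ?thesis unfolding Gi using a(4) b(4) r by simp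
        next
          case 2
          then have "a = real j - 1/2" "b = real j + 1/2" by linarith+
          then show ?thesis unfolding Gi using a(4) b(4) r by (simp add: insert_commute)
        qed
        then have "{x, y} = {boundary_point 4 1, boundary_point 4 3}"
          using xy inj_onD [OF G(2)] by (auto simp: doubleton_eq_iff)
        then show ?thesis using 2 by blast
      qed
    qed
  qed
  show ?thesis
  proof (cases Tw)
    case False
    have "inj_on ?\<psi> (sphere 0 1)"
      using inj False by (auto intro!: inj_onI)
    then have "type_Q X subV subE V W u"
      unfolding type_Q_def utj
      using pm vB wW mid [OF eE(1)] mid [OF eE(2)] corners
      by (intro exI [of _ ?\<psi>]) simp
    then show ?thesis ..
  next
    case True
    then have w: "corner 4 ?\<psi> 3 = corner 4 ?\<psi> 1" using corners by (simp add: Tw_def)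
    have wm: "corner 4 ?\<psi> 1 = \<phi> t (boundary_point (n t) (real j + 1/2))"
      using corners side_mid [OF t] by simp
    have bi: "boundary_point 4 1 = \<i>" "boundary_point 4 3 = - \<i>"
    proof -
      have "2 * pi * 1 / real 4 = pi/2" by simp
      then show b1: "boundary_point 4 1 = \<i>" by (simp add: boundary_point_def)
      show "boundary_point 4 3 = - \<i>" unfolding b3 cnj_boundary_point [symmetric] b1 by simp
    qed
    have "\<exists>D. closed_disk_nbhd X (corner 4 ?\<psi> 1) D \<and> D \<subseteq> N \<and> moebius_band (subtopology X (X closure_of u \<union> D))"
      if N: "openin X N" "corner 4 ?\<psi> 1 \<in> N" for N
      unfolding wm utj
    proof (rule twisted_moebius [OF t t2 _ G(1-3,5-8)])
      show "\<phi> t (boundary_point (n t) (real j + s)) = \<phi> t (boundary_point (n t) (real j - 1 + s))" if "0 \<le> s" "s \<le> 1" for s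
        using True that by (simp add: Tw_def)
      show "x = y \<or> {x, y} = {\<i>, - \<i>}" if "x \<in> cball 0 1" "y \<in> cball 0 1" "(\<phi> t \<circ> G) x = (\<phi> t \<circ> G) y" for x y
        using inj [OF that] bi by auto
      show "continuous_map (top_of_set (cball 0 1)) X (\<phi> t \<circ> G)" by (rule polygon_mapD(2) [OF pm])
    qed (use N wm in auto)
    then have nb: "\<forall>N. openin X N \<and> corner 4 ?\<psi> 1 \<in> N \<longrightarrow> (\<exists>D. closed_disk_nbhd X (corner 4 ?\<psi> 1) D \<and> D \<subseteq> N \<and>
        moebius_band (subtopology X (X closure_of u \<union> D)))"
      by blast
    have sp: "\<forall>x\<in>sphere 0 1. \<forall>y\<in>sphere 0 1. ?\<psi> x = ?\<psi> y \<longrightarrow> x = y \<or> {x, y} = {boundary_point 4 1, boundary_point 4 3}"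
      using inj subsetD [OF sphere_cball] by meson
    have m: "corner 4 ?\<psi> 1 \<in> subV - (V \<union> W)" "degree subV subE (corner 4 ?\<psi> 1) = 4"
      using mid [OF eE(1)] corners by simp_all
    have "type_Q' X subV subE V W u"
      unfolding type_Q'_def
      by (rule exI [of _ ?\<psi>], rule exI [of _ "corner 4 ?\<psi> 1"], intro conjI)
        (fact pm [folded utj] vB wW refl w m sp nb)+
    then show ?thesis ..
  qed
qed

end

section \<open>Quadrilaterals with labels\<close>

definition sgb :: "bool \<Rightarrow> real" where
  "sgb b = (if b then 1 else - 1)"

lemma sgb_Not [simp]: "sgb (\<not> b) = - sgb b"
  by (simp add: sgb_def)

text \<open>A quadrilateral \<open>t\<close> has two flags \<open>(t, b)\<close>: one for each of the two unlabelled corners, the corner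
  \<open>1\<close> for \<open>b = True\<close> and the corner \<open>3\<close> for \<open>b = False\<close>. At the flag meet an edge \<open>cE\<close> from
  \<open>\<circ>\<close> and an edge \<open>aE\<close> from \<open>\<bullet>\<close>; all edges are parametrised from the labelled end.\<close>
locale labelled_quadrilaterals = polygon_family X V E \<gamma> "\<lambda>_. 4" \<psi>
  for X :: "'a topology" and V E \<gamma> \<psi> +
  fixes B W :: "'a set"
  assumes BW: "B \<subseteq> V" "W \<subseteq> V" "B \<inter> W = {}"
    and deg: "\<And>v. v \<in> V \<Longrightarrow> 3 \<le> degree V E v"
    and corner0: "\<And>t. t \<in> T \<Longrightarrow> \<psi> t (boundary_point 4 0) \<in> B"
    and corner2: "\<And>t. t \<in> T \<Longrightarrow> \<psi> t (boundary_point 4 2) \<in> W"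
    and corner13: "\<And>t. t \<in> T \<Longrightarrow> \<psi> t (boundary_point 4 1) \<in> V - (B \<union> W)"
      "\<And>t. t \<in> T \<Longrightarrow> \<psi> t (boundary_point 4 3) \<in> V - (B \<union> W)"
    and degree13: "\<And>t. t \<in> T \<Longrightarrow> degree V E (\<psi> t (boundary_point 4 1)) = 4"
      "\<And>t. t \<in> T \<Longrightarrow> degree V E (\<psi> t (boundary_point 4 3)) = 4"
    and sides_ne: "\<And>t. t \<in> T \<Longrightarrow> bside t 1 \<noteq> bside t 2"
    and orient: "\<And>e. e \<in> E \<Longrightarrow> \<gamma> e 0 \<in> B \<union> W" "\<And>e. e \<in> E \<Longrightarrow> \<gamma> e 1 \<notin> B \<union> W"
begin

definition cE :: "'a set \<times> bool \<Rightarrow> 'a set" where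
  "cE f = bside (fst f) (if snd f then 1 else 2)"

definition aE :: "'a set \<times> bool \<Rightarrow> 'a set" where
  "aE f = bside (fst f) (if snd f then 0 else 3)"

definition wV :: "'a set \<times> bool \<Rightarrow> 'a" where
  "wV f = \<psi> (fst f) (boundary_point 4 (sgb (snd f)))"

definition F :: "('a set \<times> bool) set" where
  "F = T \<times> UNIV"

definition c2 :: "'a set \<Rightarrow> 'a" where
  "c2 t = \<psi> t (boundary_point 4 2)"

lemma F_iff [simp]: "(t, b) \<in> F \<longleftrightarrow> t \<in> T" and fst_F: "f \<in> F \<Longrightarrow> fst f \<in> T"
  by (auto simp: F_def)

lemma finite_F: "finite F"
  unfolding F_def using finite_T by simp

lemma cE_in: "f \<in> F \<Longrightarrow> cE f \<in> E" and aE_in: "f \<in> F \<Longrightarrow> aE f \<in> E"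
  unfolding cE_def aE_def by (auto intro!: bside fst_F)

lemma bp4_m1: "boundary_point 4 (- 1) = boundary_point 4 3"
  using boundary_point_add_period [of 4 "- 1"] by simp

lemma wV_unlabelled: "f \<in> F \<Longrightarrow> wV f \<in> V - (B \<union> W)" and degree_wV: "f \<in> F \<Longrightarrow> degree V E (wV f) = 4"
  using corner13 [OF fst_F] degree13 [OF fst_F] unfolding wV_def sgb_def by (auto simp: bp4_m1)

text \<open>Edges are parametrised from their labelled end, so the label of the first corner of a
  side decides its direction.\<close>

lemma side_oriented:
  assumes t: "t \<in> T" "j < 4" and s: "0 \<le> s" "s \<le> 1"
  shows "\<psi> t (boundary_point 4 (real j)) \<in> B \<union> W \<Longrightarrow> \<psi> t (boundary_point 4 (real j + s)) = \<gamma> (bside t j) s"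
    "\<psi> t (boundary_point 4 (real j)) \<notin> B \<union> W \<Longrightarrow> \<psi> t (boundary_point 4 (real j + s)) = \<gamma> (bside t j) (1 - s)"
proof -
  have e: "bside t j \<in> E" using bside [OF t] .
  have 1: "\<psi> t (boundary_point 4 (real j)) = \<gamma> (bside t j) 0 \<and> \<psi> t (boundary_point 4 (real j + s)) = \<gamma> (bside t j) s \<or>
        \<psi> t (boundary_point 4 (real j)) = \<gamma> (bside t j) 1 \<and> \<psi> t (boundary_point 4 (real j + s)) = \<gamma> (bside t j) (1 - s)"
    using corner_sides(1) [OF t]
  proof
    assume *: "\<forall>s\<in>{0..1}. \<psi> t (boundary_point 4 (real j + s)) = \<gamma> (bside t j) s"
    then show ?thesis using bspec [OF *, of 0] bspec [OF *, of s] s by simp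
  next
    assume *: "\<forall>s\<in>{0..1}. \<psi> t (boundary_point 4 (real j + s)) = \<gamma> (bside t j) (1 - s)"
    then show ?thesis using bspec [OF *, of 0] bspec [OF *, of s] s by simp
  qed
  show "\<psi> t (boundary_point 4 (real j)) \<in> B \<union> W \<Longrightarrow> \<psi> t (boundary_point 4 (real j + s)) = \<gamma> (bside t j) s"
    "\<psi> t (boundary_point 4 (real j)) \<notin> B \<union> W \<Longrightarrow> \<psi> t (boundary_point 4 (real j + s)) = \<gamma> (bside t j) (1 - s)"
    using 1 orient [OF e] by metis+
qed

lemma cE_param:
  assumes f: "f \<in> F" and s: "0 \<le> s" "s \<le> 1"
  shows "\<psi> (fst f) (boundary_point 4 (2 - sgb (snd f) * s)) = \<gamma> (cE f) s"
proof -
  have t: "fst f \<in> T" using fst_F [OF f] .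
  show ?thesis
  proof (cases "snd f")
    case True
    then show ?thesis
      using side_oriented(2) [OF t, of 1 "1 - s"] corner13(1) [OF t] s by (simp add: cE_def sgb_def)
  next
    case False
    then show ?thesis
      using side_oriented(1) [OF t, of 2 s] corner2 [OF t] s by (simp add: cE_def sgb_def)
  qed
qed

lemma aE_param:
  assumes f: "f \<in> F" and s: "0 \<le> s" "s \<le> 1"
  shows "\<psi> (fst f) (boundary_point 4 (sgb (snd f) * s)) = \<gamma> (aE f) s"
proof -
  have t: "fst f \<in> T" using fst_F [OF f] .
  show ?thesis
  proof (cases "snd f")
    case True
    then show ?thesis
      using side_oriented(1) [OF t, of 0 s] corner0 [OF t] s by (simp add: aE_def sgb_def)
  next
    case False
    have "boundary_point 4 (- s) = boundary_point 4 (3 + (1 - s))"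
      using boundary_point_add_period [of 4 "- s"] by simp
    then show ?thesis
      using side_oriented(2) [OF t, of 3 "1 - s"] corner13(2) [OF t] s False by (simp add: aE_def sgb_def)
  qed
qed

lemma cE_0: "f \<in> F \<Longrightarrow> \<gamma> (cE f) 0 = c2 (fst f)"
  using cE_param [of f 0] by (simp add: c2_def)

lemma cE_0_W: "f \<in> F \<Longrightarrow> \<gamma> (cE f) 0 \<in> W"
  using cE_0 [of f] corner2 [of "fst f"] fst_F [of f] by (simp add: c2_def)

lemma cE_1: "f \<in> F \<Longrightarrow> \<gamma> (cE f) 1 = wV f"
proof -
  assume f: "f \<in> F"
  have "2 - sgb (snd f) * 1 = sgb (snd f) \<or> (2 - sgb (snd f) * 1 = 3 \<and> sgb (snd f) = - 1)"
    by (auto simp: sgb_def)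
  then show ?thesis using cE_param [OF f, of 1] bp4_m1 by (auto simp: wV_def)
qed

lemma aE_0: "f \<in> F \<Longrightarrow> \<gamma> (aE f) 0 \<in> B"
  using aE_param [of f 0] corner0 [of "fst f"] fst_F [of f] by simp

lemma aE_1: "f \<in> F \<Longrightarrow> \<gamma> (aE f) 1 = wV f"
  using aE_param [of f 1] by (simp add: wV_def)

lemma edge_flag:
  assumes e: "e \<in> E"
  obtains f where "f \<in> F" "e = cE f \<or> e = aE f"
proof -
  obtain t j where tj: "(t, j) \<in> sides e" using sides_nonempty [OF e] by auto
  then have t: "t \<in> T" "j < 4" "bside t j = e" by (auto simp: sides_def)
  from t(2) consider "j = 0" | "j = 1" | "j = 2" | "j = 3" by linarith
  then show ?thesis
  proof cases
    case 1 then show ?thesis using that [of "(t, True)"] t by (simp add: aE_def)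
  next
    case 2 then show ?thesis using that [of "(t, True)"] t by (simp add: cE_def)
  next
    case 3 then show ?thesis using that [of "(t, False)"] t by (simp add: cE_def)
  next
    case 4 then show ?thesis using that [of "(t, False)"] t by (simp add: aE_def)
  qed
qed

lemma cE_flag:
  assumes "e \<in> E" "\<gamma> e 0 \<in> W"
  obtains f where "f \<in> F" "e = cE f"
  using edge_flag [OF assms(1)] assms(2) aE_0 BW(3) by (metis disjoint_iff)

lemma aE_flag:
  assumes "e \<in> E" "\<gamma> e 0 \<in> B"
  obtains f where "f \<in> F" "e = aE f"
  using edge_flag [OF assms(1)] assms(2) cE_0_W BW(3) by (metis disjoint_iff)

lemma edge_vertices: "e \<in> E \<Longrightarrow> e \<inter> V = {\<gamma> e 0, \<gamma> e 1}"
proof -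
  assume e: "e \<in> E"
  have "x = \<gamma> e 0 \<or> x = \<gamma> e 1" if h: "x \<in> e" "x \<in> V" for x
  proof -
    obtain s where s: "0 \<le> s" "s \<le> 1" "x = \<gamma> e s" using edge_cases [OF e h(1)] by metis
    have "\<not> (0 < s \<and> s < 1)"
    proof
      assume "0 < s \<and> s < 1"
      then have "\<gamma> e s \<notin> V" using edge_V(1) [OF e] by blast
      then show False using h(2) s(3) by blast
    qed
    then have "s = 0 \<or> s = 1" using s by linarith
    then show ?thesis using s(3) by auto
  qed
  then show ?thesis using edge_mem [OF e, of 0] edge_mem [OF e, of 1] edge_V(2,3) [OF e] by auto
qed

text \<open>There are no loops: one end of each edge is labelled and the other is not.\<close>

lemma degree_eq: "v \<in> V \<Longrightarrow> degree V E v = card {e \<in> E. v \<in> e}"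
proof -
  assume v: "v \<in> V"
  have "{e \<in> E. e \<inter> V = {v}} = {}"
  proof -
    have False if "e \<in> E" "e \<inter> V = {v}" for e
    proof -
      have "\<gamma> e 0 = \<gamma> e 1" using edge_vertices [OF that(1)] that(2) by auto
      then show False using orient [OF that(1)] by simp
    qed
    then show ?thesis by blast
  qed
  then show ?thesis by (simp only: degree_def card.empty add_0_right)
qed

text \<open>Flags along \<open>e\<close> correspond to sides along \<open>e\<close>: the label of
  \<open>\<gamma> e 0\<close> tells whether these are the sides \<open>1\<close>, \<open>2\<close>
  at the \<circ>-corner or the sides \<open>0\<close>, \<open>3\<close> at the \<bullet>-corner, and
  the number of the side then tells the flag.\<close>

lemma card_flags_eq:
  assumes e: "e \<in> E"
  shows "\<gamma> e 0 \<in> W \<Longrightarrow> card {f \<in> F. cE f = e} = 2" "\<gamma> e 0 \<in> B \<Longrightarrow> card {f \<in> F. aE f = e} = 2"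
proof -
  have lab: "\<gamma> (bside t j) 0 \<in> (if j = 1 \<or> j = 2 then W else B)" if "t \<in> T" "j < 4" for t j
  proof -
    from that(2) consider "j = 0" | "j = 1" | "j = 2" | "j = 3" by linarith
    then show ?thesis
    proof cases
      case 1 then show ?thesis using aE_0 [of "(t, True)"] that by (simp add: aE_def)
    next
      case 2 then show ?thesis using cE_0_W [of "(t, True)"] that by (simp add: cE_def)
    next
      case 3 then show ?thesis using cE_0_W [of "(t, False)"] that by (simp add: cE_def)
    next
      case 4 then show ?thesis using aE_0 [of "(t, False)"] that by (simp add: aE_def)
    qed
  qed
  have sd: "\<gamma> e 0 \<in> (if j = 1 \<or> j = 2 then W else B) \<and> j < 4 \<and> t \<in> T \<and> bside t j = e" if "(t, j) \<in> sides e" for t j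
    using that lab [of t j] by (auto simp: sides_def)
  show "card {f \<in> F. cE f = e} = 2" if "\<gamma> e 0 \<in> W"
  proof -
    have "bij_betw (\<lambda>(t, b). (t, if b then 1 else 2::nat)) {f \<in> F. cE f = e} (sides e)"
      unfolding bij_betw_def
    proof
      show "inj_on (\<lambda>(t, b). (t, if b then 1 else 2::nat)) {f \<in> F. cE f = e}"
        by (auto simp: inj_on_def split: if_splits)
      show "(\<lambda>(t, b). (t, if b then 1 else 2::nat)) ` {f \<in> F. cE f = e} = sides e"
      proof (intro equalityI subsetI)
        fix p assume "p \<in> (\<lambda>(t, b). (t, if b then 1 else 2::nat)) ` {f \<in> F. cE f = e}"
        then show "p \<in> sides e" by (auto simp: sides_def cE_def)
      next
        fix p assume p: "p \<in> sides e"
        obtain t j where tj: "p = (t, j)" by (metis surj_pair)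
        have s: "\<gamma> e 0 \<in> (if j = 1 \<or> j = 2 then W else B)" "t \<in> T" "bside t j = e"
          using sd [of t j] p unfolding tj by blast+
        have "\<gamma> e 0 \<notin> B" using \<open>\<gamma> e 0 \<in> W\<close> BW(3) by blast
        then have "j = 1 \<or> j = 2" using s(1) by presburger
        then show "p \<in> (\<lambda>(t, b). (t, if b then 1 else 2::nat)) ` {f \<in> F. cE f = e}"
          using tj s(2,3) by (intro image_eqI [of _ _ "(t, j = 1)"]) (auto simp: cE_def)
      qed
    qed
    from bij_betw_same_card [OF this] show ?thesis unfolding card_sides [OF e] .
  qed
  show "card {f \<in> F. aE f = e} = 2" if "\<gamma> e 0 \<in> B"
  proof -
    have "bij_betw (\<lambda>(t, b). (t, if b then 0 else 3::nat)) {f \<in> F. aE f = e} (sides e)"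
      unfolding bij_betw_def
    proof
      show "inj_on (\<lambda>(t, b). (t, if b then 0 else 3::nat)) {f \<in> F. aE f = e}"
        by (auto simp: inj_on_def split: if_splits)
      show "(\<lambda>(t, b). (t, if b then 0 else 3::nat)) ` {f \<in> F. aE f = e} = sides e"
      proof (intro equalityI subsetI)
        fix p assume "p \<in> (\<lambda>(t, b). (t, if b then 0 else 3::nat)) ` {f \<in> F. aE f = e}"
        then show "p \<in> sides e" by (auto simp: sides_def aE_def)
      next
        fix p assume p: "p \<in> sides e"
        obtain t j where tj: "p = (t, j)" by (metis surj_pair)
        have s: "\<gamma> e 0 \<in> (if j = 1 \<or> j = 2 then W else B)" "j < 4" "t \<in> T" "bside t j = e"
          using sd [of t j] p unfolding tj by blast+
        have "\<gamma> e 0 \<notin> W" using \<open>\<gamma> e 0 \<in> B\<close> BW(3) by blast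
        then have "j \<noteq> 1" "j \<noteq> 2" using s(1) by auto
        then have "j = 0 \<or> j = 3" using s(2) by linarith
        then show "p \<in> (\<lambda>(t, b). (t, if b then 0 else 3::nat)) ` {f \<in> F. aE f = e}"
          using tj s by (intro image_eqI [of _ _ "(t, j = 0)"]) (auto simp: aE_def)
      qed
    qed
    from bij_betw_same_card [OF this] show ?thesis unfolding card_sides [OF e] .
  qed
qed

text \<open>\<open>\<alpha>\<close> passes to the other flag of the same tile,
  \<open>\<beta>\<close> across the edge from \<circ>. Both are involutions of \<open>F\<close>
  without fixed points; the choice in \<open>\<beta>\<close> is unique since exactly two flags share
  the edge.\<close>

definition \<alpha> :: "'a set \<times> bool \<Rightarrow> 'a set \<times> bool" where
  "\<alpha> f = (fst f, \<not> snd f)"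

definition \<beta> :: "'a set \<times> bool \<Rightarrow> 'a set \<times> bool" where
  "\<beta> f = (SOME g. g \<in> F \<and> cE g = cE f \<and> g \<noteq> f)"

lemma \<alpha>: "f \<in> F \<Longrightarrow> \<alpha> f \<in> F" "\<alpha> (\<alpha> f) = f" "\<alpha> f \<noteq> f" "fst (\<alpha> f) = fst f" "fst g = fst f \<Longrightarrow> g = f \<or> g = \<alpha> f"
  by (auto simp: \<alpha>_def F_def prod_eq_iff)

lemma
  assumes f: "f \<in> F"
  shows \<beta>: "\<beta> f \<in> F" "cE (\<beta> f) = cE f" "\<beta> f \<noteq> f"
    and \<beta>_unique: "\<And>g. \<lbrakk>g \<in> F; cE g = cE f\<rbrakk> \<Longrightarrow> g = f \<or> g = \<beta> f"
proof -
  have "card {g \<in> F. cE g = cE f} = 2"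
    using card_flags_eq(1) [OF cE_in [OF f] cE_0_W [OF f]] .
  then obtain x y where xy: "{g \<in> F. cE g = cE f} = {x, y}" "x \<noteq> y" by (auto simp: card_2_iff)
  then have "f = x \<or> f = y" using f by blast
  then have "\<exists>g. g \<in> F \<and> cE g = cE f \<and> g \<noteq> f" using xy by blast
  from someI_ex [OF this] show b: "\<beta> f \<in> F" "cE (\<beta> f) = cE f" "\<beta> f \<noteq> f"
    unfolding \<beta>_def by auto
  fix g assume "g \<in> F" "cE g = cE f"
  then have "g \<in> {x, y}" "\<beta> f \<in> {x, y}" "f \<in> {x, y}" using xy(1) b f by blast+
  then show "g = f \<or> g = \<beta> f" using b(3) by auto
qed

lemma \<beta>_\<beta>: "f \<in> F \<Longrightarrow> \<beta> (\<beta> f) = f"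
  using \<beta> [of f] \<beta> [of "\<beta> f"] \<beta>_unique [of "\<beta> f" f] by metis

lemma wV_\<beta>: "f \<in> F \<Longrightarrow> wV (\<beta> f) = wV f"
  using cE_1 \<beta> by metis

lemma c2_\<beta>: "f \<in> F \<Longrightarrow> c2 (fst (\<beta> f)) = c2 (fst f)"
  using cE_0 \<beta> by metis

text \<open>Otherwise the two corners at the flags \<open>f\<close> and \<open>\<beta> f\<close> would fill up a neighbourhood of a vertex of
  degree \<open>4\<close>.\<close>
lemma aE_\<beta>:
  assumes f: "f \<in> F"
  shows "aE (\<beta> f) \<noteq> aE f"
proof
  assume a: "aE (\<beta> f) = aE f"
  \<comment> \<open>Corner \<open>3\<close> has position \<open>- 1\<close>, so a flag sits at
    position \<open>sgb b\<close>; from there \<open>sgb b\<close> points to corner \<open>2\<close>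
    and \<open>- sgb b\<close> to corner \<open>0\<close>.\<close>
  define k :: "bool \<Rightarrow> nat" where "k b = (if b then 1 else 3)" for b
  have k: "boundary_point 4 (real (k b) + x) = boundary_point 4 (sgb b + x)" "k b < 4" "k b = k b' \<longleftrightarrow> b = b'" for b b' x
    using boundary_point_add_period [of 4 "- 1 + x"] by (auto simp: k_def sgb_def add.commute add.left_commute)
  let ?K = "(\<lambda>f. (fst f, k (snd f))) ` {f, \<beta> f}"
  have gF: "g \<in> F" "cE g = cE f" "aE g = aE f" "wV g = wV f" if "g \<in> {f, \<beta> f}" for g
    using that f \<beta> [OF f] a wV_\<beta> [OF f] by auto
  have halves: "\<psi> (fst g) (boundary_point 4 (real (k (snd g)) + sgb (snd g) * s)) = \<gamma> (cE f) (1 - s)"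
       "\<psi> (fst g) (boundary_point 4 (real (k (snd g)) - sgb (snd g) * s)) = \<gamma> (aE f) (1 - s)"
    if "g \<in> {f, \<beta> f}" "0 < s" "s < 1" for g s
  proof -
    have "boundary_point 4 (real (k (snd g)) + sgb (snd g) * s) = boundary_point 4 (2 - sgb (snd g) * (1 - s))"
      unfolding k(1) using boundary_point_add_period [of 4 "- 1 - s"] by (auto simp: sgb_def)
    then show "\<psi> (fst g) (boundary_point 4 (real (k (snd g)) + sgb (snd g) * s)) = \<gamma> (cE f) (1 - s)"
      using cE_param [OF gF(1) [OF that(1)], of "1 - s"] gF(2) [OF that(1)] that by simp
    have "boundary_point 4 (real (k (snd g)) - sgb (snd g) * s) = boundary_point 4 (sgb (snd g) * (1 - s))"
      using k(1) [of "snd g" "- sgb (snd g) * s"] by (simp add: algebra_simps)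
    then show "\<psi> (fst g) (boundary_point 4 (real (k (snd g)) - sgb (snd g) * s)) = \<gamma> (aE f) (1 - s)"
      using aE_param [OF gF(1) [OF that(1)], of "1 - s"] gF(3) [OF that(1)] that by simp
  qed
  have ex: "e = cE f \<or> e = aE f" if e: "e \<in> E" "wV f \<in> e" for e
  proof -
    obtain t j s where s: "(t, j) \<in> ?K" "s \<noteq> 0" "- 1/2 < s" "s < 1/2" "\<psi> t (boundary_point 4 (real j + s)) \<in> e"
    proof (rule corner_fan [of ?K "wV f" e])
      show "t \<in> T \<and> j < 4 \<and> \<psi> t (boundary_point 4 (real j)) = wV f" if "(t, j) \<in> ?K" for t j
      proof -
        obtain g where g: "g \<in> {f, \<beta> f}" "t = fst g" "j = k (snd g)" using \<open>(t, j) \<in> ?K\<close> by blast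
        then show ?thesis
          using gF [OF g(1)] fst_F k(2) k(1) [of "snd g" 0] by (auto simp: wV_def)
      qed
      show "\<exists>t' j' \<epsilon>'. (t', j') \<in> ?K \<and> (\<epsilon>' = 1 \<or> \<epsilon>' = - 1) \<and> (t', j', \<epsilon>') \<noteq> (t, j, \<epsilon>) \<and>
          (\<forall>s. 0 < s \<and> s < 1/2 \<longrightarrow> \<psi> t (boundary_point 4 (real j + \<epsilon> * s)) = \<psi> t' (boundary_point 4 (real j' + \<epsilon>' * s)))"
        if tj: "(t, j) \<in> ?K" and \<epsilon>: "\<epsilon> = 1 \<or> \<epsilon> = - 1" for t j and \<epsilon> :: real
      proof -
        obtain g where g: "g \<in> {f, \<beta> f}" "t = fst g" "j = k (snd g)" using tj by blast
        define g' where "g' = (if g = f then \<beta> f else f)"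
        have g': "g' \<in> {f, \<beta> f}" "g' \<noteq> g"
          using g(1) \<beta>(3) [OF f] by (auto simp: g'_def)
        have ne: "(fst g', k (snd g')) \<noteq> (t, j)" using g g'(2) k(3) by (auto simp: prod_eq_iff)
        have "\<epsilon> = sgb (snd g) \<or> \<epsilon> = - sgb (snd g)" using \<epsilon> by (auto simp: sgb_def)
        then show ?thesis
        proof
          assume e: "\<epsilon> = sgb (snd g)"
          have "\<forall>s. 0 < s \<and> s < 1/2 \<longrightarrow> \<psi> t (boundary_point 4 (real j + \<epsilon> * s)) =
              \<psi> (fst g') (boundary_point 4 (real (k (snd g')) + sgb (snd g') * s))"
            unfolding g(2,3) e using halves(1) [OF g(1)] halves(1) [OF g'(1)] by simp
          moreover have "sgb (snd g') = 1 \<or> sgb (snd g') = - 1" by (simp add: sgb_def)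
          moreover have "(fst g', k (snd g'), sgb (snd g')) \<noteq> (t, j, \<epsilon>)" using ne by blast
          moreover have "(fst g', k (snd g')) \<in> ?K" using g'(1) by (rule imageI)
          ultimately show ?thesis by blast
        next
          assume e: "\<epsilon> = - sgb (snd g)"
          have "\<forall>s. 0 < s \<and> s < 1/2 \<longrightarrow> \<psi> t (boundary_point 4 (real j + \<epsilon> * s)) =
              \<psi> (fst g') (boundary_point 4 (real (k (snd g')) + - sgb (snd g') * s))"
            unfolding g(2,3) e using halves(2) [OF g(1)] halves(2) [OF g'(1)] by simp
          moreover have "- sgb (snd g') = 1 \<or> - sgb (snd g') = - 1" by (simp add: sgb_def)
          moreover have "(fst g', k (snd g'), - sgb (snd g')) \<noteq> (t, j, \<epsilon>)" using ne by blast
          moreover have "(fst g', k (snd g')) \<in> ?K" using g'(1) by (rule imageI)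
          ultimately show ?thesis by blast
        qed
      qed
    qed (use e in auto)
    obtain g where g: "g \<in> {f, \<beta> f}" "t = fst g" "j = k (snd g)" using s(1) by blast
    define s' where "s' = \<bar>s\<bar>"
    have s': "0 < s'" "s' < 1" using s by (auto simp: s'_def)
    have "s = sgb (snd g) * s' \<or> s = - sgb (snd g) * s'" by (auto simp: s'_def sgb_def)
    then have "\<psi> t (boundary_point 4 (real j + s)) = \<gamma> (cE f) (1 - s') \<or> \<psi> t (boundary_point 4 (real j + s)) = \<gamma> (aE f) (1 - s')"
      using halves [OF g(1) s'] g(2,3) by auto
    then show ?thesis
    proof
      assume h: "\<psi> t (boundary_point 4 (real j + s)) = \<gamma> (cE f) (1 - s')"
      then show ?thesis
        using edge_unique [OF e(1) cE_in [OF f] s(5)] edge_mem [OF cE_in [OF f], of "1 - s'"] edge_V(1) [OF cE_in [OF f], of "1 - s'"] s'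
        by simp
    next
      assume h: "\<psi> t (boundary_point 4 (real j + s)) = \<gamma> (aE f) (1 - s')"
      then show ?thesis
        using edge_unique [OF e(1) aE_in [OF f] s(5)] edge_mem [OF aE_in [OF f], of "1 - s'"] edge_V(1) [OF aE_in [OF f], of "1 - s'"] s'
        by simp
    qed
  qed
  then have "{e \<in> E. wV f \<in> e} \<subseteq> {cE f, aE f}" by blast
  then have "card {e \<in> E. wV f \<in> e} \<le> card {cE f, aE f}" by (intro card_mono) auto
  also have "\<dots> \<le> 2" by (simp add: card_insert_if)
  finally have "degree V E (wV f) \<le> 2" using degree_eq wV_unlabelled [OF f] by simp
  then show False using degree_wV [OF f] by simp
qed

text \<open>Double counting of the flags at \<open>wV f\<close>: each edge from \<bullet> and each
  edge from \<circ> that ends there carries two of them, so both kinds are equally many. Degree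
  \<open>4\<close> leaves two of each, and \<open>aE f\<close>, \<open>aE (\<beta> f)\<close> are
  different.\<close>

lemma edges_at_w:
  assumes f: "f \<in> F"
  shows "{e \<in> E. \<gamma> e 0 \<in> B \<and> \<gamma> e 1 = wV f} = {aE f, aE (\<beta> f)}"
proof -
  let ?w = "wV f"
  let ?B = "{e \<in> E. \<gamma> e 0 \<in> B \<and> \<gamma> e 1 = ?w}" and ?C = "{e \<in> E. \<gamma> e 0 \<in> W \<and> \<gamma> e 1 = ?w}"
  have fin: "finite E" using graph by (simp add: embedded_graph_def)
  have w: "?w \<in> V" "?w \<notin> B \<union> W" using wV_unlabelled [OF f] by auto
  have "{e \<in> E. ?w \<in> e} = ?B \<union> ?C"
  proof -
    have iff: "?w \<in> e \<longleftrightarrow> \<gamma> e 1 = ?w" if e: "e \<in> E" for e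
    proof
      assume "?w \<in> e"
      then have "?w \<in> {\<gamma> e 0, \<gamma> e 1}" using edge_vertices [OF e] w(1) by blast
      moreover have "\<gamma> e 0 \<noteq> ?w" using orient(1) [OF e] w(2) by metis
      ultimately show "\<gamma> e 1 = ?w" by simp
    next
      assume "\<gamma> e 1 = ?w"
      then show "?w \<in> e" using edge_mem [OF e, of 1] by simp
    qed
    show ?thesis
    proof (intro equalityI subsetI)
      fix e assume "e \<in> {e \<in> E. ?w \<in> e}"
      then show "e \<in> ?B \<union> ?C" using iff [of e] orient(1) [of e] by simp
    next
      fix e assume "e \<in> ?B \<union> ?C"
      then show "e \<in> {e \<in> E. ?w \<in> e}" using iff [of e] by auto
    qed
  qed
  moreover have "card {e \<in> E. ?w \<in> e} = 4"
    using degree_wV [OF f] degree_eq [OF w(1)] by simp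
  moreover have "?B \<inter> ?C = {}" using BW(3) by blast
  ultimately have 4: "card ?B + card ?C = 4"
    using fin by (simp add: card_Un_disjoint)
  let ?F = "{g \<in> F. wV g = ?w}"
  have "?F = (\<Union>e\<in>?B. {g \<in> F. aE g = e})"
    using aE_in aE_0 aE_1 by auto
  moreover have "card (\<Union>e\<in>?B. {g \<in> F. aE g = e}) = (\<Sum>e\<in>?B. card {g \<in> F. aE g = e})"
    using fin finite_F by (intro card_UN_disjoint) auto
  moreover have "(\<Sum>e\<in>?B. card {g \<in> F. aE g = e}) = (\<Sum>e\<in>?B. 2)"
    using card_flags_eq(2) by (intro sum.cong) auto
  ultimately have b: "card ?F = 2 * card ?B" by simp
  have "?F = (\<Union>e\<in>?C. {g \<in> F. cE g = e})"
    using cE_in cE_0_W cE_1 by auto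
  moreover have "card (\<Union>e\<in>?C. {g \<in> F. cE g = e}) = (\<Sum>e\<in>?C. card {g \<in> F. cE g = e})"
    using fin finite_F by (intro card_UN_disjoint) auto
  moreover have "(\<Sum>e\<in>?C. card {g \<in> F. cE g = e}) = (\<Sum>e\<in>?C. 2)"
    using card_flags_eq(1) by (intro sum.cong) auto
  ultimately have "card ?F = 2 * card ?C" by simp
  then have "card ?B = 2" using b 4 by simp
  moreover have "{aE f, aE (\<beta> f)} \<subseteq> ?B"
    using aE_in aE_0 aE_1 f \<beta> [OF f] wV_\<beta> [OF f] by auto
  moreover have "card {aE f, aE (\<beta> f)} = 2" using aE_\<beta> [OF f] by auto
  ultimately show ?thesis
    using fin card_subset_eq [of ?B "{aE f, aE (\<beta> f)}"] by simp
qed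

section \<open>Edges of the reconstructed tiling\<close>

definition join :: "'a set \<times> bool \<Rightarrow> real \<Rightarrow> 'a" where
  "join f s = (if s \<le> 1/2 then \<gamma> (aE f) (2 * s) else \<gamma> (aE (\<beta> f)) (2 - 2 * s))"

definition jE :: "'a set \<times> bool \<Rightarrow> 'a set" where
  "jE f = aE f \<union> aE (\<beta> f)"

definition E0 :: "'a set set" where
  "E0 = jE ` F"

lemma join_image:
  assumes f: "f \<in> F"
  shows "join f ` {0..1/2} = aE f" "join f ` {1/2..1} = aE (\<beta> f)" "join f ` {0..1} = jE f"
proof -
  note b = \<beta> [OF f]
  have "join f ` {0..1/2} = \<gamma> (aE f) ` (\<lambda>s. 2 * s) ` {0..1/2}"
    unfolding image_image by (intro image_cong) (auto simp: join_def)
  also have "(\<lambda>s. 2 * s) ` {0..1/2} = {0..1::real}"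
    by (auto intro!: image_eqI [of _ _ "x/2" for x])
  finally show 1: "join f ` {0..1/2} = aE f" using edge(2) [OF aE_in [OF f]] by simp
  have mid: "\<gamma> (aE f) 1 = \<gamma> (aE (\<beta> f)) 1" using aE_1 f b wV_\<beta> by simp
  have "join f ` {1/2..1} = \<gamma> (aE (\<beta> f)) ` (\<lambda>s. 2 - 2 * s) ` {1/2..1}"
    unfolding image_image
  proof (intro image_cong refl)
    fix s :: real assume "s \<in> {1/2..1}"
    then consider "s = 1/2" | "1/2 < s" by fastforce
    then show "join f s = \<gamma> (aE (\<beta> f)) (2 - 2 * s)"
    proof cases
      case 1
      show ?thesis unfolding 1 join_def using mid by simp
    qed (simp add: join_def)
  qed
  also have "(\<lambda>s. 2 - 2 * s) ` {1/2..1} = {0..1::real}"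
    by (auto intro!: image_eqI [of _ _ "1 - x/2" for x])
  finally show 2: "join f ` {1/2..1} = aE (\<beta> f)" using edge(2) [OF aE_in [OF b(1)]] by simp
  have "{0..1} = {0..1/2} \<union> {1/2..1::real}" by auto
  then show "join f ` {0..1} = jE f" using 1 2 by (metis image_Un jE_def)
qed

lemma join_mid: "f \<in> F \<Longrightarrow> join f (1/2) = wV f"
  using aE_1 by (simp add: join_def)

lemma jE_vertices: "f \<in> F \<Longrightarrow> jE f \<inter> V = {\<gamma> (aE f) 0, \<gamma> (aE (\<beta> f)) 0, wV f}"
  using edge_vertices aE_in \<beta> aE_1 wV_\<beta> unfolding jE_def by (auto simp: Int_Un_distrib2)

text \<open>One joined edge uses up all edges from \<bullet> at its middle, so joined edges
  correspond to unlabelled vertices.\<close>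

lemma jE_eq_iff:
  assumes "f \<in> F" "g \<in> F"
  shows "jE f = jE g \<longleftrightarrow> wV f = wV g"
proof
  assume "jE f = jE g"
  then have "wV f \<in> {\<gamma> (aE g) 0, \<gamma> (aE (\<beta> g)) 0, wV g}"
    using jE_vertices [OF assms(1)] jE_vertices [OF assms(2)] by (metis insertI1 insert_commute)
  then show "wV f = wV g"
    using wV_unlabelled [OF assms(1)] aE_0 [OF assms(2)] aE_0 [OF \<beta>(1) [OF assms(2)]] by (metis DiffE UnCI insertE singletonD)
next
  assume "wV f = wV g"
  then have "{aE f, aE (\<beta> f)} = {aE g, aE (\<beta> g)}"
    using edges_at_w [OF assms(1)] edges_at_w [OF assms(2)] by simp
  then show "jE f = jE g" unfolding jE_def by (metis Union_insert Sup_insert ccpo_Sup_singleton)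
qed

text \<open>Injectivity across the middle comes from \<open>aE (\<beta> f) \<noteq> aE f\<close>.
  The halves may share their labelled end, and the joined edge is then a loop.\<close>

lemma join_path:
  assumes f: "f \<in> F"
  shows "edge_path X B (join f)"
proof -
  note b = \<beta> [OF f]
  let ?a = "aE f" and ?b = "aE (\<beta> f)"
  have aE': "?a \<in> E" "?b \<in> E" using aE_in f b by auto
  have mid: "\<gamma> ?a 1 = \<gamma> ?b 1" using aE_1 f b wV_\<beta> by simp
  have pa: "continuous_map (top_of_set {0..1}) X (\<gamma> ?a)" "continuous_map (top_of_set {0..1}) X (\<gamma> ?b)"
    using edge(1) [OF aE'(1)] edge(1) [OF aE'(2)] by (auto simp: edge_path_def pathin_def)
  have pin: "pathin X (join f)"
    unfolding pathin_def join_def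
  proof (rule continuous_map_cases_le)
    have "continuous_map (top_of_set {x \<in> {0..1}. x \<le> 1/2}) (top_of_set {0..1::real}) (\<lambda>s. 2 * s)"
      by (auto simp: continuous_map_in_subtopology intro!: continuous_intros)
    note c = continuous_map_compose [OF this pa(1)]
    have st: "subtopology (top_of_set {0..1}) {x \<in> topspace (top_of_set {0..1}). x \<le> 1/2} = top_of_set {x \<in> {0..1::real}. x \<le> 1/2}"
      unfolding topspace_euclidean_subtopology subtopology_subtopology by (rule arg_cong [of _ _ top_of_set]) auto
    show "continuous_map (subtopology (top_of_set {0..1}) {x \<in> topspace (top_of_set {0..1}). x \<le> 1/2}) X (\<lambda>s. \<gamma> ?a (2 * s))"
      using c by (simp only: st o_def)
    have "continuous_map (top_of_set {x \<in> {0..1}. 1/2 \<le> x}) (top_of_set {0..1::real}) (\<lambda>s. 2 - 2 * s)"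
      by (auto simp: continuous_map_in_subtopology intro!: continuous_intros)
    note c = continuous_map_compose [OF this pa(2)]
    have st: "subtopology (top_of_set {0..1}) {x \<in> topspace (top_of_set {0..1}). 1/2 \<le> x} = top_of_set {x \<in> {0..1::real}. 1/2 \<le> x}"
      unfolding topspace_euclidean_subtopology subtopology_subtopology by (rule arg_cong [of _ _ top_of_set]) auto
    show "continuous_map (subtopology (top_of_set {0..1}) {x \<in> topspace (top_of_set {0..1}). 1/2 \<le> x}) X (\<lambda>s. \<gamma> ?b (2 - 2 * s))"
      using c by (simp only: st o_def)
    show "\<gamma> ?a (2 * s) = \<gamma> ?b (2 - 2 * s)" if "s \<in> topspace (top_of_set {0..1})" "s = 1/2" for s
      unfolding that(2) using mid by simp
  qed (auto intro!: continuous_intros)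
  have nv: "join f s \<notin> V" if "0 < s" "s < 1" "s \<noteq> 1/2" for s
    using edge_V(1) [OF aE'(1), of "2 * s"] edge_V(1) [OF aE'(2), of "2 - 2 * s"] that by (auto simp: join_def)
  have inj: "inj_on (join f) {0<..<1}"
  proof (rule inj_onI)
    have main: "s = s'" if "0 < s" "s \<le> s'" "s' < 1" "join f s = join f s'" for s s'
    proof -
      consider "s' < 1/2" | "s = 1/2" "s' = 1/2" | "s = 1/2" "s' > 1/2" | "s < 1/2" "s' = 1/2" | "1/2 < s" | "s < 1/2" "1/2 < s'"
        using that by linarith
      then show ?thesis
      proof cases
        case 1
        then show ?thesis using that edge_inj [OF aE'(1), of "2 * s" "2 * s'"] by (simp add: join_def)
      next
        case 3
        then have "join f s' = wV f" using that(4) join_mid [OF f] by metis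
        then show ?thesis using nv [of s'] 3 that wV_unlabelled [OF f] by simp
      next
        case 4
        then have "join f s = wV f" using that(4) join_mid [OF f] by metis
        then show ?thesis using nv [of s] 4 that wV_unlabelled [OF f] by simp
      next
        case 5
        then show ?thesis using that edge_inj [OF aE'(2), of "2 - 2 * s" "2 - 2 * s'"] by (simp add: join_def)
      next
        case 6
        then have "\<gamma> ?a (2 * s) = \<gamma> ?b (2 - 2 * s')" using that by (simp add: join_def)
        then have "?a = ?b"
          using edge_unique [OF aE' edge_mem [OF aE'(1), of "2 * s"]] edge_mem [OF aE'(2), of "2 - 2 * s'"]
            edge_V(1) [OF aE'(1), of "2 * s"] 6 that by simp
        then show ?thesis using aE_\<beta> [OF f] by simp
      qed simp
    qed
    fix s s' assume "s \<in> {0<..<1::real}" "s' \<in> {0<..<1}" "join f s = join f s'"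
    then show "s = s'" using main [of s s'] main [of s' s] by (cases "s \<le> s'") auto
  qed
  have nB: "join f s \<notin> B" if "0 < s" "s < 1" for s
  proof (cases "s = 1/2")
    case True
    show ?thesis unfolding True join_mid [OF f] using wV_unlabelled [OF f] by simp
  qed (use nv [OF that] BW(1) in auto)
  have "join f ` {0<..<1} \<inter> B = {}" using nB by auto
  moreover have "join f 0 \<in> B" "join f 1 \<in> B"
    using aE_0 [OF f] aE_0 [OF b(1)] by (simp_all add: join_def)
  ultimately show ?thesis using pin inj by (simp only: edge_path_def)
qed

text \<open>Distinct joined edges have distinct middles and no half in common, so they can meet only
  in their \<bullet>-ends.\<close>

lemma embedded_E0: "embedded_graph X B E0"
  unfolding embedded_graph_def
proof (intro conjI ballI impI)
  show "finite B" "B \<subseteq> topspace X"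
    using BW(1) graph finite_subset by (auto simp: embedded_graph_def)
  show "finite E0" unfolding E0_def using finite_F by simp
  show "\<exists>g. edge_path X B g \<and> e = g ` {0..1}" if "e \<in> E0" for e
    using that join_path join_image(3) unfolding E0_def by blast
  fix e e' assume e: "e \<in> E0" "e' \<in> E0" "e \<noteq> e'"
  then obtain f g where fg: "f \<in> F" "g \<in> F" "e = jE f" "e' = jE g" unfolding E0_def by blast
  have ne: "wV f \<noteq> wV g" using e(3) fg jE_eq_iff by blast
  show "e \<inter> e' \<subseteq> B"
  proof
    fix x assume x: "x \<in> e \<inter> e'"
    show "x \<in> B"
    proof (cases "x \<in> V")
      case True
      then have "x \<in> {\<gamma> (aE f) 0, \<gamma> (aE (\<beta> f)) 0, wV f}" "x \<in> {\<gamma> (aE g) 0, \<gamma> (aE (\<beta> g)) 0, wV g}"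
        using x fg jE_vertices by blast+
      then show ?thesis
        using ne aE_0 [OF fg(1)] aE_0 [OF fg(2)] aE_0 [OF \<beta>(1) [OF fg(1)]] aE_0 [OF \<beta>(1) [OF fg(2)]]
        by (metis insertE singletonD)
    next
      case False
      obtain a where a: "a \<in> F" "x \<in> aE a" "wV a = wV f" using x fg \<beta>(1) wV_\<beta> unfolding jE_def by blast
      obtain a' where a': "a' \<in> F" "x \<in> aE a'" "wV a' = wV g" using x fg \<beta>(1) wV_\<beta> unfolding jE_def by blast
      have "aE a = aE a'" using edge_unique [OF aE_in [OF a(1)] aE_in [OF a'(1)] a(2) a'(2) False] .
      then have "wV a = wV a'" using aE_1 a(1) a'(1) by metis
      then show ?thesis using ne a a' by simp
    qed
  qed
qed

text \<open>Every old edge at \<open>v\<close> is half of a joined edge. A joined edge accounts for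
  one of them, or for two if it is a loop at \<open>v\<close>, which the second summand of
  \<open>degree\<close> makes up for.\<close>

lemma degree_E0:
  assumes v: "v \<in> B"
  shows "3 \<le> degree B E0 v"
proof -
  have fin: "finite E" "finite E0" using graph embedded_E0 by (auto simp: embedded_graph_def)
  let ?A = "{e \<in> E. v \<in> e}"
  have "3 \<le> card ?A" using deg [of v] degree_eq [of v] v BW(1) by auto
  let ?D = "{d \<in> E0. v \<in> d}"
  have A0: "\<gamma> e 0 = v" if "e \<in> ?A" for e
  proof -
    have e: "e \<in> E" "v \<in> e" using that by auto
    then have "v \<in> {\<gamma> e 0, \<gamma> e 1}" using edge_vertices [OF e(1)] v BW(1) by blast
    moreover have "\<gamma> e 1 \<noteq> v" using orient(2) [OF e(1)] v by auto
    ultimately show ?thesis by simp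
  qed
  have "?A \<subseteq> (\<Union>d\<in>?D. {e \<in> ?A. e \<subseteq> d})"
  proof
    fix e assume e: "e \<in> ?A"
    then obtain f where f: "f \<in> F" "e = aE f" using aE_flag [of e] A0 [OF e] v by blast
    then have "jE f \<in> ?D" "e \<subseteq> jE f" using e by (auto simp: E0_def jE_def)
    then show "e \<in> (\<Union>d\<in>?D. {e \<in> ?A. e \<subseteq> d})" using e by blast
  qed
  then have "card ?A \<le> card (\<Union>d\<in>?D. {e \<in> ?A. e \<subseteq> d})"
    using fin by (intro card_mono) auto
  also have "\<dots> \<le> (\<Sum>d\<in>?D. card {e \<in> ?A. e \<subseteq> d})"
    using fin by (intro card_UN_le) auto
  also have "\<dots> \<le> (\<Sum>d\<in>?D. 1 + (if d \<inter> B = {v} then 1 else 0))"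
  proof (rule sum_mono)
    fix d assume d: "d \<in> ?D"
    then obtain f where f: "f \<in> F" "d = jE f" by (auto simp: E0_def)
    note aE' = aE_in [OF f(1)] aE_in [OF \<beta>(1) [OF f(1)]]
    have sub: "{e \<in> ?A. e \<subseteq> d} \<subseteq> {aE f, aE (\<beta> f)}"
    proof
      fix e assume e: "e \<in> {e \<in> ?A. e \<subseteq> d}"
      then have "\<gamma> e (1/2) \<in> d" "e \<in> E" using edge_mem [of e "1/2"] by auto
      then show "e \<in> {aE f, aE (\<beta> f)}"
        using edge_unique [OF \<open>e \<in> E\<close> aE'(1), of "\<gamma> e (1/2)"] edge_unique [OF \<open>e \<in> E\<close> aE'(2), of "\<gamma> e (1/2)"]
          edge_V(1) [OF \<open>e \<in> E\<close>, of "1/2"] edge_mem [OF \<open>e \<in> E\<close>, of "1/2"] f(2) by (auto simp: jE_def)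
    qed
    show "card {e \<in> ?A. e \<subseteq> d} \<le> 1 + (if d \<inter> B = {v} then 1 else 0)"
    proof (cases "aE f \<in> ?A \<and> aE (\<beta> f) \<in> ?A")
      case True
      have "d \<inter> B = {v}"
      proof -
        have "d \<inter> B = (d \<inter> V) \<inter> B" using BW(1) by blast
        also have "\<dots> = {v}"
          using jE_vertices [OF f(1)] f(2) A0 [of "aE f"] A0 [of "aE (\<beta> f)"] True v wV_unlabelled [OF f(1)] by auto
        finally show ?thesis .
      qed
      moreover have "card {e \<in> ?A. e \<subseteq> d} \<le> card {aE f, aE (\<beta> f)}" using sub by (intro card_mono) auto
      moreover have "card {aE f, aE (\<beta> f)} \<le> 2" by (simp add: card_insert_if)
      ultimately show ?thesis by simp
    next
      case False
      then obtain a where "{e \<in> ?A. e \<subseteq> d} \<subseteq> {a}" using sub by blast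
      then have "card {e \<in> ?A. e \<subseteq> d} \<le> card {a}" by (intro card_mono) auto
      then show ?thesis by simp
    qed
  qed
  also have "\<dots> = card ?D + card {d \<in> ?D. d \<inter> B = {v}}"
  proof -
    have "(\<Sum>d\<in>?D. if d \<inter> B = {v} then 1 else 0) = card {d \<in> ?D. d \<inter> B = {v}}"
      using fin sum.inter_filter [of ?D "\<lambda>_. 1::nat" "\<lambda>d. d \<inter> B = {v}"] by simp
    moreover have "(\<Sum>d\<in>?D. 1) = card ?D" by simp
    ultimately show ?thesis by (simp only: sum.distrib)
  qed
  also have "{d \<in> ?D. d \<inter> B = {v}} = {d \<in> E0. d \<inter> B = {v}}" by blast
  finally show ?thesis using \<open>3 \<le> card ?A\<close> by (simp add: degree_def)
qed

end

section \<open>The disk around a labelled vertex\<close>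

text \<open>The orbit of a point under a permutation of a finite set; the least period makes the
  points of one round distinct.\<close>

lemma funpow_period_exists:
  assumes S: "finite S" "x \<in> S" and f: "\<And>y. y \<in> S \<Longrightarrow> f y \<in> S" and inj: "inj_on f S"
  obtains n where "0 < n" "(f ^^ n) x = x" "inj_on (\<lambda>i. (f ^^ i) x) {..<n}"
proof -
  have in_S: "(f ^^ k) y \<in> S" if "y \<in> S" for k y
    using that f by (induction k) auto
  have cancel: "y = z" if "y \<in> S" "z \<in> S" "(f ^^ k) y = (f ^^ k) z" for k y z
    using that
  proof (induction k)
    case (Suc k)
    then have "(f ^^ k) y = (f ^^ k) z"
      using inj in_S by (metis funpow.simps(2) inj_on_eq_iff o_apply)
    then show ?case using Suc by blast
  qed simp
  have returns: "(f ^^ (j - i)) x = x" if "i < j" "(f ^^ i) x = (f ^^ j) x" for i j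
  proof -
    have "(f ^^ j) x = (f ^^ i) ((f ^^ (j - i)) x)"
      using that(1) by (metis funpow_add le_add_diff_inverse less_imp_le o_apply)
    then show ?thesis using cancel [of "(f ^^ (j - i)) x" x i] in_S S(2) that(2) by metis
  qed
  have "\<not> inj (\<lambda>i. (f ^^ i) x)"
  proof
    assume "inj (\<lambda>i. (f ^^ i) x)"
    moreover have "range (\<lambda>i. (f ^^ i) x) \<subseteq> S" using in_S S(2) by blast
    ultimately show False using S(1) by (metis finite_imageD finite_subset infinite_UNIV_nat)
  qed
  then obtain i j where "i < j" "(f ^^ i) x = (f ^^ j) x"
    unfolding inj_on_def by (metis linorder_neqE_nat)
  then have ex: "\<exists>k. 0 < k \<and> (f ^^ k) x = x" using returns [of i j] by (intro exI [of _ "j - i"]) simp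
  define n where "n = (LEAST k. 0 < k \<and> (f ^^ k) x = x)"
  have n: "0 < n" "(f ^^ n) x = x" using LeastI_ex [OF ex] by (auto simp: n_def)
  have False if "i < j" "j < n" "(f ^^ i) x = (f ^^ j) x" for i j
  proof -
    have "0 < j - i" "(f ^^ (j - i)) x = x" using returns [OF that(1,3)] that by auto
    then have "n \<le> j - i" unfolding n_def by (intro Least_le) simp
    then show False using that by simp
  qed
  then have "inj_on (\<lambda>i. (f ^^ i) x) {..<n}"
    unfolding inj_on_def by (metis lessThan_iff linorder_neqE_nat)
  then show ?thesis using that n by blast
qed

context labelled_quadrilaterals
begin

text \<open>One step around a \<circ>-vertex: through the tile to its other flag, then across the
  edge into the next tile.\<close>

definition \<sigma> :: "'a set \<times> bool \<Rightarrow> 'a set \<times> bool" where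
  "\<sigma> f = \<beta> (\<alpha> f)"

lemma \<sigma>_in: "f \<in> F \<Longrightarrow> \<sigma> f \<in> F"
  unfolding \<sigma>_def using \<alpha>(1) \<beta>(1) by blast

lemma funpow_\<sigma>_in: "f \<in> F \<Longrightarrow> (\<sigma> ^^ k) f \<in> F"
  by (induction k) (auto intro: \<sigma>_in)

lemma inj_\<sigma>: "inj_on \<sigma> F"
  unfolding inj_on_def \<sigma>_def using \<alpha>(1,2) \<beta>_\<beta> by metis

text \<open>The dihedral group generated by \<open>\<alpha>\<close> and \<open>\<beta>\<close> acts without fixed points of the reflections,
  so that going around a vertex one does not return to the same tile with the opposite orientation.\<close>
lemma funpow_\<sigma>_neq_\<alpha>: "f \<in> F \<Longrightarrow> (\<sigma> ^^ m) f \<noteq> \<alpha> f"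
proof (induction m arbitrary: f rule: less_induct)
  case (less m)
  note a = \<alpha>(1) [OF less.prems]
  consider "m = 0" | "m = 1" | k where "m = Suc (Suc k)"
    by (metis One_nat_def not0_implies_Suc)
  then show ?case
  proof cases
    case 1
    then show ?thesis using \<alpha>(3) [of f] by (metis funpow_0)
  next
    case 2
    then show ?thesis using \<beta>(3) [OF a] by (simp add: \<sigma>_def)
  next
    case 3
    let ?g = "(\<sigma> ^^ k) (\<sigma> f)"
    have g: "?g \<in> F" "\<sigma> f \<in> F" using funpow_\<sigma>_in \<sigma>_in less.prems by blast+
    have "(\<sigma> ^^ m) f = \<beta> (\<alpha> ?g)"
    proof -
      have "(\<sigma> ^^ m) f = \<sigma> (\<sigma> ((\<sigma> ^^ k) f))" unfolding 3 by simp
      also have "\<dots> = \<sigma> ?g" by (simp only: funpow_swap1 [of \<sigma> k f])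
      finally show ?thesis by (simp only: \<sigma>_def [of ?g])
    qed
    \<comment> \<open>Conjugation by one step: reaching the opposite flag of \<open>f\<close> after
      \<open>m\<close> steps would mean reaching that of \<open>\<sigma> f\<close> after
      \<open>m - 2\<close> steps.\<close>
    moreover have "\<beta> (\<alpha> ?g) \<noteq> \<alpha> f"
    proof
      assume "\<beta> (\<alpha> ?g) = \<alpha> f"
      then have "\<beta> (\<beta> (\<alpha> ?g)) = \<beta> (\<alpha> f)" by (rule arg_cong)
      also have "\<dots> = \<sigma> f" by (rule \<sigma>_def [symmetric])
      finally have "\<alpha> ?g = \<sigma> f" unfolding \<beta>_\<beta> [OF \<alpha>(1) [OF g(1)]] .
      then have "\<alpha> (\<alpha> ?g) = \<alpha> (\<sigma> f)" by (rule arg_cong)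
      then have "?g = \<alpha> (\<sigma> f)" unfolding \<alpha>(2) .
      moreover have "k < m" using 3 by simp
      ultimately show False using less.IH [OF _ g(2)] by metis
    qed
    ultimately show ?thesis by metis
  qed
qed

text \<open>Tiles are mirrored for \<open>snd f\<close>, so that all tiles around a vertex are read
  in the same direction: the edges of \<open>f\<close> lie at positions \<open>- s\<close> and
  \<open>2 + s\<close>, those of \<open>\<alpha> f\<close> at \<open>s\<close> and
  \<open>2 - s\<close>.\<close>

definition \<Psi> :: "'a set \<times> bool \<Rightarrow> complex \<Rightarrow> 'a" where
  "\<Psi> f z = \<psi> (fst f) (if snd f then cnj z else z)"

lemma \<Psi>_boundary_point: "\<Psi> f (boundary_point 4 x) = \<psi> (fst f) (boundary_point 4 (- sgb (snd f) * x))"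
  using cnj_polar [of 4 1 x] by (simp add: \<Psi>_def sgb_def)

lemma \<Psi>_sides:
  assumes f: "f \<in> F" and s: "0 \<le> s" "s \<le> 1"
  shows "\<Psi> f (boundary_point 4 s) = \<gamma> (aE (\<alpha> f)) s" "\<Psi> f (boundary_point 4 (- s)) = \<gamma> (aE f) s"
    "\<Psi> f (boundary_point 4 (2 - s)) = \<gamma> (cE (\<alpha> f)) s" "\<Psi> f (boundary_point 4 (2 + s)) = \<gamma> (cE f) s"
proof -
  have a: "fst (\<alpha> f) = fst f" "snd (\<alpha> f) = (\<not> snd f)" by (auto simp: \<alpha>_def)
  show "\<Psi> f (boundary_point 4 s) = \<gamma> (aE (\<alpha> f)) s" "\<Psi> f (boundary_point 4 (- s)) = \<gamma> (aE f) s"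
    using aE_param [OF \<alpha>(1) [OF f] s] aE_param [OF f s] by (auto simp: \<Psi>_boundary_point a)
  have "boundary_point 4 (- sgb (snd f) * (2 - s)) = boundary_point 4 (2 + sgb (snd f) * s)"
    using boundary_point_add_period [of 4 "s - 2"] by (auto simp: sgb_def algebra_simps)
  then show "\<Psi> f (boundary_point 4 (2 - s)) = \<gamma> (cE (\<alpha> f)) s"
    using cE_param [OF \<alpha>(1) [OF f] s] by (simp add: \<Psi>_boundary_point a)
  have "boundary_point 4 (- sgb (snd f) * (2 + s)) = boundary_point 4 (2 - sgb (snd f) * s)"
    using boundary_point_add_period [of 4 "- s - 2"] by (auto simp: sgb_def algebra_simps)
  then show "\<Psi> f (boundary_point 4 (2 + s)) = \<gamma> (cE f) s"
    using cE_param [OF f s] by (simp add: \<Psi>_boundary_point)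
qed

lemma continuous_\<Psi>:
  assumes f: "f \<in> F"
  shows "continuous_map (top_of_set (cball 0 1)) X (\<Psi> f)"
proof -
  have "continuous_map (top_of_set (cball 0 1)) (top_of_set (cball 0 1)) (\<lambda>z. if snd f then cnj z else z)"
    by (cases "snd f") (auto simp: continuous_map_in_subtopology intro!: continuous_intros)
  from continuous_map_compose [OF this continuous_\<phi> [OF fst_F [OF f]]]
  show ?thesis by (simp add: o_def \<Psi>_def [abs_def])
qed

lemma \<Psi>_image: "f \<in> F \<Longrightarrow> \<Psi> f ` ball 0 1 = fst f"
proof -
  assume f: "f \<in> F"
  have "(\<lambda>z. if snd f then cnj z else z) ` ball 0 1 = ball (0::complex) 1"
  proof (cases "snd f")
    case True
    have "z \<in> cnj ` ball 0 1" if "z \<in> ball 0 1" for z :: complex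
      using that by (intro image_eqI [of _ _ "cnj z"]) auto
    then show ?thesis using True by auto
  qed simp
  moreover have "\<Psi> f ` ball 0 1 = \<psi> (fst f) ` (\<lambda>z. if snd f then cnj z else z) ` ball 0 1"
    by (simp add: image_image \<Psi>_def)
  ultimately show ?thesis using tile_image [OF fst_F [OF f]] by simp
qed

lemma \<Psi>_inj: "\<lbrakk>f \<in> F; norm z < 1; norm w < 1; \<Psi> f z = \<Psi> f w\<rbrakk> \<Longrightarrow> z = w"
  using \<phi>_inj [OF fst_F [of f], of "if snd f then cnj z else z" "if snd f then cnj w else w"]
  by (auto simp: \<Psi>_def split: if_splits)

text \<open>The open star of a \<circ>-vertex, which is to become a tile of the reconstructed
  tiling.\<close>

definition star :: "'a \<Rightarrow> 'a set" where
  "star c = {c} \<union> \<Union>{\<gamma> e ` {0<..<1} | e. e \<in> E \<and> \<gamma> e 0 = c} \<union> \<Union>{t \<in> T. c2 t = c}"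

end

text \<open>One round of \<open>\<sigma>\<close> about the \<circ>-vertex of \<open>f0\<close>, with
  a fixed sector map for each step. Sector maps are available for \<open>2 \<le> n\<close>, which is
  itself derived inside the locale; hence the guard.\<close>

locale vertex_disk = labelled_quadrilaterals X V E \<gamma> \<psi> B W
  for X :: "'a topology" and V E \<gamma> \<psi> B W +
  fixes f0 :: "'a set \<times> bool" and n :: nat and G :: "nat \<Rightarrow> complex \<Rightarrow> complex"
  assumes f0: "f0 \<in> F"
    and period: "0 < n" "(\<sigma> ^^ n) f0 = f0" "inj_on (\<lambda>i. (\<sigma> ^^ i) f0) {..<n}"
    and G: "\<And>i. 2 \<le> n \<Longrightarrow> continuous_on (cball 0 1) (G i)" "\<And>i. 2 \<le> n \<Longrightarrow> inj_on (G i) (cball 0 1)"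
      "\<And>i. 2 \<le> n \<Longrightarrow> G i ` cball 0 1 = sector n (real i - 1/2) (real i + 1/2)"
      "\<And>i. 2 \<le> n \<Longrightarrow> G i ` ball 0 1 = ball 0 1 \<inter> wedge n (real i - 1/2) (real i + 1/2)"
      "\<And>i s. \<lbrakk>2 \<le> n; 0 \<le> s; s \<le> 1\<rbrakk> \<Longrightarrow> G i (boundary_point 4 s) = boundary_point n (real i + s/2)"
      "\<And>i s. \<lbrakk>2 \<le> n; 0 \<le> s; s \<le> 1\<rbrakk> \<Longrightarrow> G i (boundary_point 4 (- s)) = boundary_point n (real i - s/2)"
      "\<And>i s. \<lbrakk>2 \<le> n; 0 \<le> s; s \<le> 1\<rbrakk> \<Longrightarrow> G i (boundary_point 4 (2 - s)) = polar n s (real i + 1/2)"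
      "\<And>i s. \<lbrakk>2 \<le> n; 0 \<le> s; s \<le> 1\<rbrakk> \<Longrightarrow> G i (boundary_point 4 (2 + s)) = polar n s (real i - 1/2)"
begin

definition fl :: "nat \<Rightarrow> 'a set \<times> bool" where
  "fl i = (\<sigma> ^^ i) f0"

definition c :: 'a where
  "c = c2 (fst f0)"

definition nx :: "nat \<Rightarrow> nat" where
  "nx i = (if Suc i = n then 0 else Suc i)"

lemma fl_F: "fl i \<in> F"
  unfolding fl_def using funpow_\<sigma>_in f0 by blast

lemma fl_add: "fl (i + k) = (\<sigma> ^^ k) (fl i)"
  by (simp add: fl_def funpow_add [of k i, unfolded add.commute [of k i]])

lemma nx: "i < n \<Longrightarrow> nx i < n"
  using period(1) by (auto simp: nx_def)

lemma fl_nx: "i < n \<Longrightarrow> fl (nx i) = \<beta> (\<alpha> (fl i))"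
proof -
  have "fl (nx i) = fl (Suc i)" using period(2) by (auto simp: nx_def fl_def simp del: funpow.simps)
  then show ?thesis by (simp add: fl_def \<sigma>_def)
qed

lemma cE_nx: "i < n \<Longrightarrow> cE (fl (nx i)) = cE (\<alpha> (fl i))"
  using fl_nx \<beta>(2) \<alpha>(1) fl_F by metis

lemma nx_pred: "i < n \<Longrightarrow> pred_mod n i < n" "i < n \<Longrightarrow> nx (pred_mod n i) = i"
  by (auto simp: nx_def pred_mod_def)

lemma polar_nx: "i < n \<Longrightarrow> polar n r (real (nx i) - s) = polar n r (real i + 1 - s)"
proof -
  assume i: "i < n"
  have "pred_mod n (nx i) = i" using i by (auto simp: nx_def pred_mod_def)
  then show ?thesis using pred_mod(3) [OF nx [OF i]] by simp
qed

lemma polar_half: "i < n \<Longrightarrow> polar n r (real i + 1/2) = polar n r (real (nx i) - 1/2)"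
proof -
  assume i: "i < n"
  have "real i + 1 - 1/2 = real i + 1/2" by simp
  then show ?thesis using polar_nx [OF i, of r "1/2"] by metis
qed

lemma c2_fl: "c2 (fst (fl i)) = c"
proof (induction i)
  case (Suc i)
  have "fl (Suc i) = \<beta> (\<alpha> (fl i))" by (simp add: fl_def \<sigma>_def)
  then show ?case using Suc c2_\<beta> [OF \<alpha>(1) [OF fl_F [of i]]] by (simp add: \<alpha>(4))
qed (simp add: c_def fl_def)

lemma fl_inj: "\<lbrakk>i < n; j < n; fl i = fl j\<rbrakk> \<Longrightarrow> i = j"
  using period(3) by (auto simp: inj_on_def fl_def)

text \<open>A tile met twice would be met with its two opposite flags, which the dihedral argument
  excludes.\<close>

lemma fst_fl_inj:
  assumes "i < n" "j < n" "fst (fl i) = fst (fl j)"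
  shows "i = j"
proof -
  have "fl i \<noteq> \<alpha> (fl j)" if "j \<le> i" for i j
    using funpow_\<sigma>_neq_\<alpha> [OF fl_F [of j], of "i - j"] fl_add [of j "i - j"] that by simp
  then have "fl i \<noteq> \<alpha> (fl j)" using \<alpha>(2) by (metis linear)
  then show ?thesis using \<alpha>(5) [of "fl i" "fl j"] assms fl_inj by metis
qed

text \<open>With period \<open>1\<close> the two edges from \<circ> of one tile would coincide,
  against \<open>sides_ne\<close>.\<close>

lemma n_ge_2: "2 \<le> n"
proof (rule ccontr)
  assume "\<not> 2 \<le> n"
  then have "n = 1" using period(1) by simp
  then have "nx 0 = 0" unfolding nx_def by simp
  then have "cE (fl 0) = cE (\<alpha> (fl 0))" using cE_nx [OF period(1)] by metis
  then show False
    using sides_ne(1) [OF fst_F [OF fl_F [of 0]]] by (auto simp: cE_def \<alpha>_def split: if_splits)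
qed

lemmas G' = G [OF n_ge_2]

lemma cE_fl_inj:
  assumes "i < n" "j < n" "cE (fl i) = cE (fl j)"
  shows "i = j"
proof -
  let ?p = "pred_mod n i"
  have p: "?p < n" "fl i = \<beta> (\<alpha> (fl ?p))" using nx_pred [OF assms(1)] fl_nx by metis+
  have "fl j = fl i \<or> fl j = \<beta> (fl i)" using \<beta>_unique [OF fl_F fl_F] assms(3) by metis
  then show ?thesis
  proof
    \<comment> \<open>\<open>\<beta>\<close> undoes the last crossing, so \<open>fl j\<close> would
      be the opposite flag of the preceding tile.\<close>
    assume "fl j = \<beta> (fl i)"
    then have h: "fl j = \<alpha> (fl ?p)" using p(2) \<beta>_\<beta> [OF \<alpha>(1) [OF fl_F]] by metis
    then have "j = ?p" using fst_fl_inj [OF assms(2) p(1)] \<alpha>(4) by metis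
    then show ?thesis using h \<alpha>(3) by metis
  qed (use fl_inj assms in metis)
qed

text \<open>The tile of \<open>fl i\<close>, carried from the standard quadrilateral to the
  \<open>i\<close>-th sector of an \<open>n\<close>-gon.\<close>

definition H :: "nat \<Rightarrow> complex \<Rightarrow> 'a" where
  "H i z = \<Psi> (fl i) (the_inv_into (cball 0 1) (G i) z)"

abbreviation S :: "nat \<Rightarrow> complex set" where
  "S i \<equiv> sector n (real i - 1/2) (real i + 1/2)"

abbreviation C :: "nat \<Rightarrow> complex set" where
  "C i \<equiv> wedge n (real i - 1/2) (real i + 1/2)"

lemma H_G: "z \<in> cball 0 1 \<Longrightarrow> H i (G i z) = \<Psi> (fl i) z"
  using the_inv_into_f_f [OF G'(2)] by (simp add: H_def)

lemma continuous_H: "continuous_map (top_of_set (S i)) X (H i)"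
proof -
  have "continuous_on (S i) (the_inv_into (cball 0 1) (G i))"
    using continuous_on_inv_into [OF G'(1) compact_cball G'(2)] G'(3) by metis
  moreover have "the_inv_into (cball 0 1) (G i) \<in> S i \<rightarrow> cball 0 1"
    using the_inv_into_into [OF G'(2) _ order_refl] G'(3) [of i] by auto
  ultimately have "continuous_map (top_of_set (S i)) (top_of_set (cball 0 1)) (the_inv_into (cball 0 1) (G i))"
    by (simp add: continuous_map_in_subtopology image_subset_iff_funcset)
  from continuous_map_compose [OF this continuous_\<Psi> [OF fl_F]]
  show ?thesis by (simp add: o_def H_def [abs_def])
qed

lemma H_values:
  assumes i: "i < n" and s: "0 \<le> s" "s \<le> 1"
  shows "H i (polar n s (real i + 1/2)) = \<gamma> (cE (fl (nx i))) s" "H i (polar n s (real i - 1/2)) = \<gamma> (cE (fl i)) s"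
    "H i (boundary_point n (real i + s/2)) = \<gamma> (aE (\<alpha> (fl i))) s"
    "H i (boundary_point n (real i - s/2)) = \<gamma> (aE (fl i)) s"
proof -
  have b: "boundary_point 4 x \<in> cball 0 1" for x by (simp add: boundary_point_def)
  show "H i (polar n s (real i + 1/2)) = \<gamma> (cE (fl (nx i))) s"
    using H_G [OF b] G'(7) [OF s] \<Psi>_sides(3) [OF fl_F s] cE_nx [OF i] by metis
  show "H i (polar n s (real i - 1/2)) = \<gamma> (cE (fl i)) s"
    using H_G [OF b] G'(8) [OF s] \<Psi>_sides(4) [OF fl_F s] by metis
  show "H i (boundary_point n (real i + s/2)) = \<gamma> (aE (\<alpha> (fl i))) s"
    using H_G [OF b] G'(5) [OF s] \<Psi>_sides(1) [OF fl_F s] by metis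
  show "H i (boundary_point n (real i - s/2)) = \<gamma> (aE (fl i)) s"
    using H_G [OF b] G'(6) [OF s] \<Psi>_sides(2) [OF fl_F s] by metis
qed

lemma sector_cases:
  assumes i: "i < n" and z: "z \<in> S i"
  obtains "z = 0" "H i z = c" | "z \<in> C i"
    | r k where "0 < r" "r \<le> 1" "k < n" "z = polar n r (real k - 1/2)" "H i z = \<gamma> (cE (fl k)) r"
proof -
  obtain r s where rs: "z = polar n r s" "0 \<le> r" "r \<le> 1" "real i - 1/2 \<le> s" "s \<le> real i + 1/2"
    using z by (auto simp: sector_def)
  consider "r = 0" | "0 < r" "real i - 1/2 < s" "s < real i + 1/2" | "0 < r" "s = real i - 1/2" | "0 < r" "s = real i + 1/2"
    using rs by linarith
  then show ?thesis
  proof cases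
    case 1
    then have "z = 0" "z = polar n 0 (real i - 1/2)" using rs(1) by (auto simp: polar_def)
    then show ?thesis using that(1) H_values(2) [OF i, of 0] cE_0 [OF fl_F] c2_fl by simp
  next
    case 2
    then show ?thesis using that(2) wedgeI rs(1) by metis
  next
    case 3
    then show ?thesis using that(3) [of r i] rs H_values(2) [OF i, of r] i by simp
  next
    case 4
    then show ?thesis using that(3) [of r "nx i"] rs H_values(1) [OF i, of r] nx [OF i] polar_half [OF i, of r] by metis
  qed
qed

lemma polar_half_notin_C: "\<lbrakk>k < n; 0 \<le> r\<rbrakk> \<Longrightarrow> polar n r (real k - 1/2) \<notin> C j"
  using polar_half_notin_wedge [OF period(1)] polar_half nx_pred by metis

lemma zero_notin_C: "0 \<notin> C j"
proof
  assume "0 \<in> C j"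
  then obtain r s where "0 = polar n r s" "0 < r" unfolding wedge_def by blast
  then show False using norm_polar [of n r s] by simp
qed

lemma polar_half_inj:
  assumes "0 < r" "0 \<le> r'" "k < n" "k' < n" "polar n r (real k - 1/2) = polar n r' (real k' - 1/2)"
  shows "r = r'" "k = k'"
proof -
  have "r = r'" "boundary_point n (real k - 1/2) = boundary_point n (real k' - 1/2)"
    using assms polar_eq_iff by metis+
  then show "r = r'" "k = k'"
    using boundary_point_inj [OF period(1), of "real k - 1/2" "real k' - 1/2"] assms(3,4) by auto
qed

text \<open>Different closed sectors meet only in radii and the center, where the values are given
  by \<open>cE (fl k)\<close> and by \<open>c\<close> and do not depend on the sector.\<close>

lemma H_agree:
  assumes i: "i < n" "z \<in> S i" and j: "j < n" "z \<in> S j"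
  shows "H i z = H j z"
  using i
proof (cases rule: sector_cases)
  case 1
  then show ?thesis
    using zero_notin_C [of j] norm_polar by (cases rule: sector_cases [OF j]) (auto simp: polar_def boundary_point_def)
next
  case 2
  show ?thesis
    using j
  proof (cases rule: sector_cases)
    case 1
    then show ?thesis using 2 zero_notin_C by metis
  next
    case c2: 2
    then show ?thesis using 2 wedge_half_disjoint period(1) i j by metis
  next
    case (3 r k)
    then show ?thesis using 2 polar_half_notin_C [of k r] by (metis less_imp_le)
  qed
next
  case (3 r k)
  show ?thesis
    using j
  proof (cases rule: sector_cases)
    case 1
    then show ?thesis using 3 by (auto simp: polar_def boundary_point_def)
  next
    case 2
    then show ?thesis using 3 polar_half_notin_C [of k r] by (metis less_imp_le)
  next
    case c3: (3 r' k')
    then show ?thesis using 3 polar_half_inj [of r r' k k'] by (metis less_imp_le)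
  qed
qed

lemma sector_exists:
  assumes "z \<in> cball 0 1"
  obtains i where "i < n" "z \<in> S i"
proof -
  obtain r j t where "0 \<le> r" "r \<le> 1" "j < n" "- 1/2 \<le> t" "t < 1/2" "z = polar n r (real j + t)"
    using polar_cball_exists [OF period(1) assms] by metis
  then show ?thesis using that [of j] sectorI [of r "real j - 1/2" "real j + t" "real j + 1/2" n] by simp
qed

definition \<Phi> :: "complex \<Rightarrow> 'a" where
  "\<Phi> z = H (SOME i. i < n \<and> z \<in> S i) z"

lemma \<Phi>_eq: "\<lbrakk>i < n; z \<in> S i\<rbrakk> \<Longrightarrow> \<Phi> z = H i z"
proof -
  assume i: "i < n" "z \<in> S i"
  let ?i = "SOME i. i < n \<and> z \<in> S i"
  have "?i < n \<and> z \<in> S ?i" by (rule someI [of _ i]) (use i in simp)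
  then show ?thesis unfolding \<Phi>_def using H_agree i by blast
qed

lemma continuous_\<Phi>: "continuous_map (top_of_set (cball 0 1)) X \<Phi>"
proof (rule pasting_lemma_closed [of "{..<n}" _ S X H])
  show "closedin (top_of_set (cball 0 1)) (S i)" for i
    using compact_sector sector_subset_cball by (intro closed_subset) (auto simp: compact_imp_closed)
  show "continuous_map (subtopology (top_of_set (cball 0 1)) (S i)) X (H i)" for i
  proof -
    have "subtopology (top_of_set (cball 0 1)) (S i) = top_of_set (S i)"
      unfolding subtopology_subtopology using sector_subset_cball by (rule arg_cong [of _ _ top_of_set, OF Int_absorb1])
    then show ?thesis using continuous_H by simp
  qed
  show "H i x = H j x" if "i \<in> {..<n}" "j \<in> {..<n}" "x \<in> topspace (top_of_set (cball 0 1)) \<inter> S i \<inter> S j" for i j x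
    using that by (intro H_agree) simp_all
  show "\<exists>j. j \<in> {..<n} \<and> x \<in> S j \<and> \<Phi> x = H j x" if x: "x \<in> topspace (top_of_set (cball 0 1))" for x
  proof -
    have "x \<in> cball 0 1" using x by simp
    then show ?thesis
    proof (rule sector_exists)
      fix j assume "j < n" "x \<in> S j"
      then show ?thesis using \<Phi>_eq [of j x] by (intro exI [of _ j] conjI) simp_all
    qed
  qed
qed simp

lemma \<Phi>_values:
  assumes i: "i < n" and s: "0 \<le> s" "s \<le> 1"
  shows "\<Phi> (polar n s (real i + 1/2)) = \<gamma> (cE (fl (nx i))) s" "\<Phi> (polar n s (real i - 1/2)) = \<gamma> (cE (fl i)) s"
    "\<Phi> (boundary_point n (real i + s/2)) = \<gamma> (aE (\<alpha> (fl i))) s"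
    "\<Phi> (boundary_point n (real i - s/2)) = \<gamma> (aE (fl i)) s"
proof -
  have S: "polar n r (real i + x) \<in> S i" if "0 \<le> r" "r \<le> 1" "- 1/2 \<le> x" "x \<le> 1/2" for r x
    using that by (intro sectorI) auto
  show "\<Phi> (polar n s (real i + 1/2)) = \<gamma> (cE (fl (nx i))) s" "\<Phi> (polar n s (real i - 1/2)) = \<gamma> (cE (fl i)) s"
    using \<Phi>_eq [OF i S, of s "1/2"] \<Phi>_eq [OF i S, of s "- 1/2"] H_values(1,2) [OF i s] s by auto
  show "\<Phi> (boundary_point n (real i + s/2)) = \<gamma> (aE (\<alpha> (fl i))) s" "\<Phi> (boundary_point n (real i - s/2)) = \<gamma> (aE (fl i)) s"
    using \<Phi>_eq [OF i S, of 1 "s/2"] \<Phi>_eq [OF i S, of 1 "- s/2"] H_values(3,4) [OF i s] s by auto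
qed

lemma \<Phi>_0: "\<Phi> 0 = c"
  using \<Phi>_values(2) [OF period(1), of 0] cE_0 [OF fl_F [of 0]] c2_fl by (simp add: polar_def)

lemma c_V: "c \<in> V" "c \<in> W"
  using corner2 [OF fst_F [OF f0]] BW(2) by (auto simp: c_def c2_def)

lemma \<Phi>_cases:
  assumes z: "norm z < 1"
  obtains "z = 0" "\<Phi> z = c"
    | i y where "i < n" "norm y < 1" "z = G i y" "\<Phi> z = \<Psi> (fl i) y" "\<Phi> z \<in> fst (fl i)"
    | r i where "0 < r" "r < 1" "i < n" "z = polar n r (real i - 1/2)" "\<Phi> z = \<gamma> (cE (fl i)) r"
proof -
  have "z \<in> cball 0 1" using z by simp
  then obtain i where i: "i < n" "z \<in> S i" using sector_exists by metis
  show ?thesis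
    using i
  proof (cases rule: sector_cases)
    case 1
    then show ?thesis using that(1) \<Phi>_0 by simp
  next
    case 2
    then have "z \<in> G i ` ball 0 1" unfolding G'(4) using z by simp
    then obtain y where y: "norm y < 1" "z = G i y" by auto
    have h: "\<Phi> z = \<Psi> (fl i) y" using \<Phi>_eq [OF i] H_G [of y i] y by simp
    moreover have "\<Psi> (fl i) y \<in> fst (fl i)" using \<Psi>_image [OF fl_F [of i]] y(1) by (metis imageI mem_ball_0)
    ultimately show ?thesis using that(2) i(1) y by metis
  next
    case (3 r k)
    then have "r < 1" using z by simp
    then show ?thesis using 3 that(3) \<Phi>_eq [OF i] by metis
  qed
qed

lemma radial_image:
  assumes "i < n" "0 < r" "r < 1"
  shows "\<gamma> (cE (fl i)) r \<in> cE (fl i)" "\<gamma> (cE (fl i)) r \<notin> V"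
  using edge_mem [OF cE_in [OF fl_F]] edge_V(1) [OF cE_in [OF fl_F]] assms by auto

lemma tile_not_graph: "x \<in> fst (fl i) \<Longrightarrow> x \<notin> V \<and> x \<notin> cE (fl j)"
  using tile_subset(2) [OF fst_F [OF fl_F [of i]]] cE_in [OF fl_F [of j]] by blast

text \<open>The center, open radii and open sectors go to a vertex, to open edges and to tiles,
  which are disjoint; and the edges and the tiles of one round are distinct.\<close>

lemma inj_\<Phi>: "inj_on \<Phi> (ball 0 1)"
proof (rule inj_onI)
  fix z w :: complex assume "z \<in> ball 0 1" "w \<in> ball 0 1" and eq: "\<Phi> z = \<Phi> w"
  then have z: "norm z < 1" and w: "norm w < 1" by auto
  show "z = w"
    using z
  proof (cases rule: \<Phi>_cases)
    case 1
    show ?thesis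
      using w
    proof (cases rule: \<Phi>_cases)
      case 1
      then show ?thesis using \<open>z = 0\<close> by simp
    next
      case (2 i y)
      then show ?thesis using 1 tile_not_graph c_V eq by metis
    next
      case (3 r i)
      then show ?thesis using 1 radial_image(2) [of i r] c_V eq by metis
    qed
  next
    case z2: (2 i y)
    show ?thesis
      using w
    proof (cases rule: \<Phi>_cases)
      case 1
      then show ?thesis using z2 tile_not_graph c_V eq by metis
    next
      case (2 j y')
      have "fst (fl i) = fst (fl j)"
        using tile_disjoint [OF fst_F [OF fl_F] fst_F [OF fl_F]] z2(5) 2(5) eq by metis
      then have "i = j" using fst_fl_inj z2(1) 2(1) by blast
      then have "y = y'" using \<Psi>_inj [OF fl_F z2(2) 2(2)] z2(4) 2(4) eq by metis
      then show ?thesis using z2(3) 2(3) \<open>i = j\<close> by metis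
    next
      case (3 r j)
      then show ?thesis using z2(5) tile_not_graph radial_image(1) [of j r] eq by metis
    qed
  next
    case z3: (3 r i)
    note zr = radial_image [OF z3(3,1,2)]
    show ?thesis
      using w
    proof (cases rule: \<Phi>_cases)
      case 1
      then show ?thesis using z3 zr(2) c_V eq by metis
    next
      case (2 j y')
      then show ?thesis using z3(5) tile_not_graph zr(1) eq by metis
    next
      case (3 r' j)
      note wr = radial_image [OF 3(3,1,2)]
      have eq': "\<gamma> (cE (fl i)) r = \<gamma> (cE (fl j)) r'" using eq z3(5) 3(5) by metis
      have "cE (fl i) = cE (fl j)"
        by (rule edge_unique [OF cE_in [OF fl_F] cE_in [OF fl_F] zr(1)]) (use eq' wr zr in auto)
      then have ij: "i = j" using cE_fl_inj z3(3) 3(3) by blast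
      have "r = r'" using edge_inj [OF cE_in [OF fl_F [of i]] z3(1,2) 3(1,2)] eq' ij by simp
      then show ?thesis using z3(4) 3(4) ij by simp
    qed
  qed
qed

lemma \<Phi>_image: "\<Phi> ` ball 0 1 = {c} \<union> (\<Union>i<n. \<gamma> (cE (fl i)) ` {0<..<1}) \<union> (\<Union>i<n. fst (fl i))"
proof (intro equalityI subsetI)
  fix x assume "x \<in> \<Phi> ` ball 0 1"
  then obtain z where z: "norm z < 1" "x = \<Phi> z" by auto
  show "x \<in> {c} \<union> (\<Union>i<n. \<gamma> (cE (fl i)) ` {0<..<1}) \<union> (\<Union>i<n. fst (fl i))"
    using z(1)
  proof (cases rule: \<Phi>_cases)
    case (3 r i)
    then have "x \<in> \<gamma> (cE (fl i)) ` {0<..<1}" using z(2) by auto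
    then show ?thesis using 3(3) by blast
  qed (use z(2) in auto)
next
  fix x assume "x \<in> {c} \<union> (\<Union>i<n. \<gamma> (cE (fl i)) ` {0<..<1}) \<union> (\<Union>i<n. fst (fl i))"
  then consider "x = c" | i r where "i < n" "0 < r" "r < 1" "x = \<gamma> (cE (fl i)) r" | i where "i < n" "x \<in> fst (fl i)"
    by auto
  then show "x \<in> \<Phi> ` ball 0 1"
  proof cases
    case 1
    then show ?thesis using \<Phi>_0 by (intro image_eqI [of _ _ 0]) auto
  next
    case (2 i r)
    then show ?thesis using \<Phi>_values(2) [of i r] by (intro image_eqI [of _ _ "polar n r (real i - 1/2)"]) auto
  next
    case (3 i)
    then obtain y where y: "y \<in> ball 0 1" "x = \<Psi> (fl i) y" using \<Psi>_image [OF fl_F [of i]] by blast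
    have "G i y \<in> ball 0 1 \<inter> C i" using G'(4) [of i] y(1) by blast
    moreover have "G i y \<in> S i" using G'(3) [of i] y(1) by (metis imageI ball_subset_cball subsetD)
    ultimately show ?thesis
      using \<Phi>_eq [OF 3(1), of "G i y"] H_G [of y i] y by (intro image_eqI [of _ _ "G i y"]) auto
  qed
qed

lemma open_\<Phi>:
  assumes "open U" "U \<subseteq> ball 0 1"
  shows "openin X (\<Phi> ` U)"
proof (rule closed_surface_invariance_of_domain [OF X assms(1)])
  have "U \<subseteq> cball 0 1" using assms(2) ball_subset_cball by (rule order_trans)
  then show "continuous_map (top_of_set U) X \<Phi>"
    by (rule continuous_map_from_subtopology_mono [OF continuous_\<Phi>])
  show "inj_on \<Phi> U" using inj_\<Phi> assms(2) by (rule inj_on_subset)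
qed

lemma homeomorphic_\<Phi>: "homeomorphic_map (top_of_set (ball 0 1)) (subtopology X (\<Phi> ` ball 0 1)) \<Phi>"
proof (rule bijective_open_imp_homeomorphic_map)
  have D: "\<Phi> ` ball 0 1 \<subseteq> topspace X" using openin_subset [OF open_\<Phi> [OF open_ball order_refl]] .
  show "continuous_map (top_of_set (ball 0 1)) (subtopology X (\<Phi> ` ball 0 1)) \<Phi>"
    using continuous_map_from_subtopology_mono [OF continuous_\<Phi> ball_subset_cball]
    by (auto simp: continuous_map_in_subtopology)
  show "open_map (top_of_set (ball 0 1)) (subtopology X (\<Phi> ` ball 0 1)) \<Phi>"
    unfolding open_map_def
  proof (intro allI impI)
    fix U :: "complex set" assume "openin (top_of_set (ball 0 1)) U"
    then have "open U" "U \<subseteq> ball 0 1" using openin_open_eq [of "ball 0 1" U] by auto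
    then show "openin (subtopology X (\<Phi> ` ball 0 1)) (\<Phi> ` U)"
      unfolding openin_subtopology using open_\<Phi> [of U] by (intro exI [of _ "\<Phi> ` U"]) auto
  qed
  show "\<Phi> ` topspace (top_of_set (ball 0 1)) = topspace (subtopology X (\<Phi> ` ball 0 1))"
    using D by auto
  show "inj_on \<Phi> (topspace (top_of_set (ball 0 1)))" using inj_\<Phi> by simp
qed

text \<open>The image of the open disk is open and contains \<open>c\<close>, so every tile with its
  \<circ>-corner at \<open>c\<close> enters it and belongs to this round: there is no second fan of
  tiles at the same vertex.\<close>

lemma tile_at_c:
  assumes t: "t \<in> T" "c2 t = c"
  obtains i where "i < n" "t = fst (fl i)"
proof -
  have "\<exists>y\<in>ball 0 1 \<inter> UNIV. \<psi> t y \<in> \<Phi> ` ball 0 1"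
  proof (rule continuous_map_near_point [OF continuous_\<phi> [OF t(1)] open_\<Phi> [OF open_ball order_refl]])
    show "\<psi> t (boundary_point 4 2) \<in> \<Phi> ` ball 0 1" using \<Phi>_image t(2) by (simp add: c2_def)
    show "boundary_point 4 2 \<in> closure (ball 0 1)" by (simp add: boundary_point_def)
  qed (auto simp: boundary_point_def)
  then obtain y where y: "norm y < 1" "\<psi> t y \<in> \<Phi> ` ball 0 1" by auto
  have x: "\<psi> t y \<in> t" using tile_iff [OF t(1)] y(1) by simp
  then have "\<psi> t y \<notin> V" "\<psi> t y \<notin> \<Union>E" using tile_subset(2) [OF t(1)] by blast+
  then have "\<psi> t y \<noteq> c" using c_V(1) by metis
  moreover have "\<psi> t y \<notin> (\<Union>i<n. \<gamma> (cE (fl i)) ` {0<..<1})"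
  proof
    assume "\<psi> t y \<in> (\<Union>i<n. \<gamma> (cE (fl i)) ` {0<..<1})"
    then obtain i r where "i < n" "0 < r" "r < 1" "\<psi> t y = \<gamma> (cE (fl i)) r" by auto
    then have "\<psi> t y \<in> cE (fl i)" using radial_image(1) by metis
    then show False using \<open>\<psi> t y \<notin> \<Union>E\<close> cE_in [OF fl_F] by blast
  qed
  ultimately obtain i where "i < n" "\<psi> t y \<in> fst (fl i)" using y(2) unfolding \<Phi>_image by blast
  then show ?thesis using that tile_disjoint [OF t(1) fst_F [OF fl_F] x] by metis
qed

lemma flag_at_c:
  assumes f: "f \<in> F" "c2 (fst f) = c"
  obtains i where "i < n" "cE f = cE (fl i)"
proof -
  obtain i where i: "i < n" "fst f = fst (fl i)" using tile_at_c [OF fst_F [OF f(1)] f(2)] by metis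
  then have "f = fl i \<or> f = \<alpha> (fl i)" using \<alpha>(5) by blast
  then show ?thesis using that i(1) cE_nx [OF i(1)] nx [OF i(1)] by metis
qed

lemma edge_at_c: "{e \<in> E. \<gamma> e 0 = c} = (\<lambda>i. cE (fl i)) ` {..<n}"
proof (intro equalityI subsetI)
  fix e assume "e \<in> {e \<in> E. \<gamma> e 0 = c}"
  then have e: "e \<in> E" "\<gamma> e 0 = c" by auto
  then obtain f where f: "f \<in> F" "e = cE f" using cE_flag c_V(2) by metis
  then have "c2 (fst f) = c" using cE_0 e(2) by metis
  then obtain i where "i < n" "cE f = cE (fl i)" using flag_at_c [OF f(1)] by metis
  then show "e \<in> (\<lambda>i. cE (fl i)) ` {..<n}" using f(2) by blast
next
  fix e assume "e \<in> (\<lambda>i. cE (fl i)) ` {..<n}"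
  then obtain i where "e = cE (fl i)" by blast
  then show "e \<in> {e \<in> E. \<gamma> e 0 = c}" using cE_in [OF fl_F [of i]] cE_0 [OF fl_F [of i]] c2_fl by simp
qed

text \<open>All edges at \<open>c\<close> are images of the \<open>n\<close> radii, and the degree
  of \<open>c\<close> is at least \<open>3\<close>.\<close>

lemma n_ge_3: "3 \<le> n"
proof -
  have "{e \<in> E. c \<in> e} \<subseteq> {e \<in> E. \<gamma> e 0 = c}"
  proof
    fix e assume "e \<in> {e \<in> E. c \<in> e}"
    then have e: "e \<in> E" "c \<in> e" by auto
    then have "c \<in> {\<gamma> e 0, \<gamma> e 1}" using edge_vertices [OF e(1)] c_V(1) by blast
    moreover have "c \<noteq> \<gamma> e 1" using orient(2) [OF e(1)] c_V(2) by auto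
    ultimately show "e \<in> {e \<in> E. \<gamma> e 0 = c}" using e(1) by simp
  qed
  then have "card {e \<in> E. c \<in> e} \<le> card ((\<lambda>i. cE (fl i)) ` {..<n})"
    unfolding edge_at_c by (intro card_mono) auto
  also have "\<dots> \<le> n" using card_image_le [of "{..<n}" "\<lambda>i. cE (fl i)"] by simp
  finally show ?thesis using deg [OF c_V(1)] degree_eq [OF c_V(1)] by simp
qed

lemma star_eq: "star c = \<Phi> ` ball 0 1"
proof -
  have "\<Union>{\<gamma> e ` {0<..<1} | e. e \<in> E \<and> \<gamma> e 0 = c} = (\<Union>e\<in>{e \<in> E. \<gamma> e 0 = c}. \<gamma> e ` {0<..<1})" by blast
  also have "\<dots> = (\<Union>i<n. \<gamma> (cE (fl i)) ` {0<..<1})" unfolding edge_at_c by simp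
  moreover have "\<Union>{t \<in> T. c2 t = c} = (\<Union>i<n. fst (fl i))"
  proof (intro equalityI subsetI)
    fix x assume "x \<in> \<Union>{t \<in> T. c2 t = c}"
    then obtain t where t: "t \<in> T" "c2 t = c" "x \<in> t" by blast
    then obtain i where "i < n" "t = fst (fl i)" using tile_at_c by metis
    then show "x \<in> (\<Union>i<n. fst (fl i))" using t(3) by blast
  next
    fix x assume "x \<in> (\<Union>i<n. fst (fl i))"
    then obtain i where "x \<in> fst (fl i)" by blast
    then show "x \<in> \<Union>{t \<in> T. c2 t = c}" using fst_F [OF fl_F [of i]] c2_fl [of i] by blast
  qed
  ultimately show ?thesis unfolding star_def \<Phi>_image by simp
qed

text \<open>A side of the \<open>n\<close>-gon passes from one sector to the next at its middle:
  half of it is the edge from \<bullet> of one flag, the other half that of the flag across, run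
  backwards.\<close>

lemma side_\<Phi>:
  assumes i: "i < n" and s: "0 \<le> s" "s \<le> 1"
  shows "side n \<Phi> i s = join (\<alpha> (fl i)) s"
proof (cases "s \<le> 1/2")
  case True
  then show ?thesis using \<Phi>_values(3) [OF i, of "2 * s"] s by (simp add: side_def join_def)
next
  case False
  have "boundary_point n (real i + s) = boundary_point n (real (nx i) - (2 - 2 * s)/2)"
  proof -
    have "real i + 1 - (2 - 2 * s)/2 = real i + s" by (simp add: field_simps)
    then show ?thesis using polar_nx [OF i, of 1 "(2 - 2 * s)/2"] unfolding polar_1 by metis
  qed
  then show ?thesis
    using False \<Phi>_values(4) [OF nx [OF i], of "2 - 2 * s"] s fl_nx [OF i] by (simp add: side_def join_def)
qed

lemma polygon_\<Phi>: "polygon_map X B E0 (star c) n \<Phi>"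
  unfolding polygon_map_def star_eq
proof (intro conjI allI impI)
  fix j assume j: "j < n"
  have F: "\<alpha> (fl j) \<in> F" using \<alpha>(1) fl_F by blast
  have eq: "\<And>s. \<lbrakk>0 \<le> s; s \<le> 1\<rbrakk> \<Longrightarrow> side n \<Phi> j s = join (\<alpha> (fl j)) s" using side_\<Phi> [OF j] by blast
  show "edge_path X B (side n \<Phi> j)" using edge_path_cong(1) [OF join_path [OF F] eq] .
  show "side n \<Phi> j ` {0..1} \<in> E0"
    using edge_path_cong(2) [OF join_path [OF F] eq] join_image(3) [OF F] F by (simp add: E0_def)
qed (use period(1) continuous_\<Phi> homeomorphic_\<Phi> in auto)

lemma radius_\<Phi>: "i < n \<Longrightarrow> \<Phi> ` closed_segment 0 (boundary_point n (real i + 1/2)) = cE (fl (nx i))"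
proof -
  assume i: "i < n"
  have "\<Phi> ` closed_segment 0 (boundary_point n (real i + 1/2)) = \<gamma> (cE (fl (nx i))) ` {0..1}"
    unfolding closed_segment_polar using \<Phi>_values(1) [OF i] by (auto simp: image_iff) (metis atLeastAtMost_iff)+
  then show ?thesis using edge(2) [OF cE_in [OF fl_F]] by simp
qed

lemma side_\<Phi>_image: "i < n \<Longrightarrow> side n \<Phi> i ` {0..1} = jE (\<alpha> (fl i))" "i < n \<Longrightarrow> side n \<Phi> i (1/2) = wV (\<alpha> (fl i))"
proof -
  assume i: "i < n"
  have F: "\<alpha> (fl i) \<in> F" using \<alpha>(1) fl_F by blast
  show "side n \<Phi> i (1/2) = wV (\<alpha> (fl i))" using side_\<Phi> [OF i, of "1/2"] join_mid [OF F] by simp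
  have "side n \<Phi> i ` {0..1} = join (\<alpha> (fl i)) ` {0..1}" using side_\<Phi> [OF i] by (intro image_cong) auto
  then show "side n \<Phi> i ` {0..1} = jE (\<alpha> (fl i))" using join_image(3) [OF F] by simp
qed

lemma star_disk:
  "3 \<le> n" "polygon_map X B E0 (star c) n \<Phi>" "\<Phi> 0 = c" "openin X (star c)" "connectedin X (star c)"
  "\<And>i. i < n \<Longrightarrow> \<exists>f\<in>F. \<Phi> ` closed_segment 0 (boundary_point n (real i + 1/2)) = cE f \<and>
     side n \<Phi> i ` {0..1} = jE f \<and> side n \<Phi> i (1/2) = wV f"
  "\<And>f. \<lbrakk>f \<in> F; c2 (fst f) = c\<rbrakk> \<Longrightarrow> \<exists>i<n. \<Phi> ` closed_segment 0 (boundary_point n (real i + 1/2)) = cE f"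
proof -
  show "3 \<le> n" "polygon_map X B E0 (star c) n \<Phi>" "\<Phi> 0 = c"
    using n_ge_3 polygon_\<Phi> \<Phi>_0 by auto
  show "openin X (star c)" unfolding star_eq by (rule open_\<Phi>) auto
  have "connectedin (top_of_set (cball 0 1)) (ball (0::complex) 1)"
    by (auto simp: connectedin_subtopology connectedin_iff_connected)
  then show "connectedin X (star c)"
    unfolding star_eq using connectedin_continuous_map_image [OF continuous_\<Phi>] by blast
  show "\<exists>f\<in>F. \<Phi> ` closed_segment 0 (boundary_point n (real i + 1/2)) = cE f \<and>
     side n \<Phi> i ` {0..1} = jE f \<and> side n \<Phi> i (1/2) = wV f" if "i < n" for i
    using radius_\<Phi> [OF that] cE_nx [OF that] side_\<Phi>_image [OF that] \<alpha>(1) [OF fl_F [of i]] by metis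
  show "\<exists>i<n. \<Phi> ` closed_segment 0 (boundary_point n (real i + 1/2)) = cE f" if f: "f \<in> F" "c2 (fst f) = c" for f
  proof -
    obtain j where "j < n" "cE f = cE (fl j)" using flag_at_c [OF f] by metis
    then show ?thesis using radius_\<Phi> [of "pred_mod n j"] nx_pred [of j] by metis
  qed
qed

end

section \<open>The reconstructed tiling\<close>

context labelled_quadrilaterals
begin

lemma edge_at_W:
  assumes c: "c \<in> W"
  obtains f where "f \<in> F" "c2 (fst f) = c"
proof -
  have cV: "c \<in> V" using c BW(2) by blast
  then have "card {e \<in> E. c \<in> e} \<noteq> 0" using deg [OF cV] degree_eq [OF cV] by simp
  then obtain e where e: "e \<in> E" "c \<in> e" by (metis (mono_tags, lifting) card.empty empty_Collect_eq)
  then have "c \<in> {\<gamma> e 0, \<gamma> e 1}" using edge_vertices [OF e(1)] cV by blast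
  moreover have "c \<noteq> \<gamma> e 1" using orient(2) [OF e(1)] c by auto
  ultimately have e0: "\<gamma> e 0 = c" by simp
  obtain f where f: "f \<in> F" "e = cE f" using cE_flag [OF e(1)] e0 c by metis
  then show ?thesis using that [of f] cE_0 [of f] e0 by metis
qed

text \<open>All that is needed of a disk, freed from the locale: the radii are the edges from
  \<open>c\<close>, and each side is the joined edge through the unlabelled end of its
  radius.\<close>

lemma disk_exists:
  assumes c: "c \<in> W"
  shows "\<exists>n \<phi>. 3 \<le> n \<and> polygon_map X B E0 (star c) n \<phi> \<and> \<phi> 0 = c \<and> openin X (star c) \<and> connectedin X (star c) \<and>
    (\<forall>i<n. \<exists>f\<in>F. \<phi> ` closed_segment 0 (boundary_point n (real i + 1/2)) = cE f \<and>
      side n \<phi> i ` {0..1} = jE f \<and> side n \<phi> i (1/2) = wV f) \<and>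
    (\<forall>f\<in>F. c2 (fst f) = c \<longrightarrow> (\<exists>i<n. \<phi> ` closed_segment 0 (boundary_point n (real i + 1/2)) = cE f))"
proof -
  obtain f where f: "f \<in> F" "c2 (fst f) = c" using edge_at_W [OF c] by metis
  obtain n where n: "0 < n" "(\<sigma> ^^ n) f = f" "inj_on (\<lambda>i. (\<sigma> ^^ i) f) {..<n}"
    using funpow_period_exists [OF finite_F f(1) \<sigma>_in inj_\<sigma>] by metis
  \<comment> \<open>The implication reproduces the guard of the locale, as \<open>2 \<le> n\<close>
    is not known at this point.\<close>
  define Q where "Q G i \<longleftrightarrow> (2 \<le> n \<longrightarrow> continuous_on (cball 0 1) G \<and> inj_on G (cball 0 1) \<and>
      G ` cball 0 1 = sector n (real i - 1/2) (real i + 1/2) \<and>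
      G ` ball 0 1 = ball 0 1 \<inter> wedge n (real i - 1/2) (real i + 1/2) \<and>
      (\<forall>s. 0 \<le> s \<and> s \<le> 1 \<longrightarrow> G (boundary_point 4 s) = boundary_point n (real i + s/2)) \<and>
      (\<forall>s. 0 \<le> s \<and> s \<le> 1 \<longrightarrow> G (boundary_point 4 (- s)) = boundary_point n (real i - s/2)) \<and>
      (\<forall>s. 0 \<le> s \<and> s \<le> 1 \<longrightarrow> G (boundary_point 4 (2 - s)) = polar n s (real i + 1/2)) \<and>
      (\<forall>s. 0 \<le> s \<and> s \<le> 1 \<longrightarrow> G (boundary_point 4 (2 + s)) = polar n s (real i - 1/2)))" for G and i :: nat
  have "\<exists>G. Q G i" for i
  proof (cases "2 \<le> n")
    case True
    show ?thesis
      unfolding Q_def by (rule sector_map_exists [OF True, of "real i"]) blast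
  qed (simp add: Q_def)
  then have "\<forall>i. \<exists>G. Q G i" by blast
  from choice [OF this] obtain G where "\<forall>i. Q (G i) i" by blast
  note G = this [unfolded Q_def]
  interpret D: vertex_disk X V E \<gamma> \<psi> B W f n G
  proof
    show "f \<in> F" "0 < n" "(\<sigma> ^^ n) f = f" "inj_on (\<lambda>i. (\<sigma> ^^ i) f) {..<n}"
      using f n by auto
  qed (use G in blast)+
  have Dc: "D.c = c" unfolding D.c_def f(2) ..
  show ?thesis
    by (rule exI [of _ n], rule exI [of _ D.\<Phi>], intro conjI allI ballI impI)
      (use D.star_disk [unfolded Dc] in metis)+
qed

lemma star_cases:
  assumes "x \<in> star c" "c \<in> W"
  obtains "x = c" "x \<in> W" | e where "e \<in> E" "\<gamma> e 0 = c" "x \<in> e" "x \<notin> V"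
    | t where "t \<in> T" "c2 t = c" "x \<in> t" "x \<notin> V" "x \<notin> \<Union>E"
proof -
  consider "x = c" | e where "e \<in> E" "\<gamma> e 0 = c" "x \<in> \<gamma> e ` {0<..<1}" | t where "t \<in> T" "c2 t = c" "x \<in> t"
    using assms unfolding star_def by blast
  then show ?thesis
  proof cases
    case 1
    then show ?thesis using that(1) assms(2) by simp
  next
    case (2 e)
    then obtain s where "0 < s" "s < 1" "x = \<gamma> e s" by auto
    then show ?thesis using that(2) [of e] 2 edge_mem [of e s] edge_V(1) [of e s] by simp
  next
    case (3 t)
    then have "x \<notin> V" "x \<notin> \<Union>E" using tile_subset(2) [of t] by blast+
    then show ?thesis using that(3) 3 by metis
  qed
qed

lemma star_disjoint:
  assumes "x \<in> star c" "x \<in> star d" "c \<in> W" "d \<in> W"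
  shows "c = d"
  using assms(1,3)
proof (cases rule: star_cases)
  case 1
  show ?thesis
    using assms(2,4) by (cases rule: star_cases) (use 1 BW(2) in blast)+
next
  case (2 e)
  show ?thesis
    using assms(2,4)
  proof (cases rule: star_cases)
    case 1
    then show ?thesis using 2(4) BW(2) by blast
  next
    case (2 e')
    then show ?thesis using edge_unique \<open>e \<in> E\<close> \<open>x \<in> e\<close> \<open>\<gamma> e 0 = c\<close> by metis
  next
    case (3 t)
    then show ?thesis using 2 by blast
  qed
next
  case (3 t)
  show ?thesis
    using assms(2,4)
  proof (cases rule: star_cases)
    case 1
    then show ?thesis using 3(4) BW(2) by blast
  next
    case (2 e')
    then show ?thesis using 3 by blast
  next
    case (3 t')
    then show ?thesis using tile_disjoint \<open>t \<in> T\<close> \<open>x \<in> t\<close> \<open>c2 t = c\<close> by metis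
  qed
qed

lemma aE_subset_E0: "f \<in> F \<Longrightarrow> aE f \<subseteq> \<Union>E0"
  unfolding E0_def jE_def by blast

lemma E0_cases:
  assumes "x \<in> \<Union>E0"
  obtains f where "f \<in> F" "x \<in> aE f"
  using assms \<beta>(1) unfolding E0_def jE_def by blast

lemma unlabelled_flag:
  assumes x: "x \<in> V - (B \<union> W)"
  obtains f where "f \<in> F" "wV f = x"
proof -
  have xV: "x \<in> V" using x by blast
  then have "card {e \<in> E. x \<in> e} \<noteq> 0" using deg [OF xV] degree_eq [OF xV] by simp
  then obtain e where e: "e \<in> E" "x \<in> e" by (metis (mono_tags, lifting) card.empty empty_Collect_eq)
  then have "x \<in> {\<gamma> e 0, \<gamma> e 1}" using edge_vertices [OF e(1)] xV by blast
  moreover have "x \<noteq> \<gamma> e 0" using orient(1) [OF e(1)] x by auto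
  ultimately have e1: "\<gamma> e 1 = x" by simp
  obtain f where f: "f \<in> F" "e = cE f \<or> e = aE f" using edge_flag [OF e(1)] by metis
  then have "wV f = x" using cE_1 [of f] aE_1 [of f] e1 by metis
  then show ?thesis using that f(1) by blast
qed

text \<open>An edge from \<circ> lies in a star except for its unlabelled end, and an edge from
  \<bullet> lies in the new graph; every unlabelled vertex is the end of an edge from
  \<bullet>.\<close>

lemma Union_star: "\<Union>(star ` W) = topspace X - (B \<union> \<Union>E0)"
proof (intro equalityI subsetI)
  fix x assume "x \<in> \<Union>(star ` W)"
  then obtain c where c: "c \<in> W" "x \<in> star c" by blast
  have "openin X (star c)" using disk_exists [OF c(1)] by blast
  then have "x \<in> topspace X" using openin_subset c(2) by blast
  moreover have "x \<notin> B \<and> x \<notin> \<Union>E0"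
    using c(2,1)
  proof (cases rule: star_cases)
    case 1
    then have "x \<notin> B" using BW(3) by blast
    moreover have "x \<notin> \<Union>E0"
    proof
      assume "x \<in> \<Union>E0"
      then obtain f where f: "f \<in> F" "x \<in> aE f" using E0_cases by metis
      then have "x \<in> {\<gamma> (aE f) 0, wV f}"
        using edge_vertices [OF aE_in [OF f(1)]] aE_1 [OF f(1)] 1(2) BW(2) by blast
      then show False using aE_0 [OF f(1)] wV_unlabelled [OF f(1)] 1(2) \<open>x \<notin> B\<close> by blast
    qed
    ultimately show ?thesis by blast
  next
    case (2 e)
    have "x \<notin> \<Union>E0"
    proof
      assume "x \<in> \<Union>E0"
      then obtain f where f: "f \<in> F" "x \<in> aE f" using E0_cases by metis
      have "aE f = e" using edge_unique [OF aE_in [OF f(1)] 2(1) f(2) 2(3,4)] .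
      then have "c \<in> B" using aE_0 [OF f(1)] 2(2) by simp
      then show False using c(1) BW(3) by blast
    qed
    then show ?thesis using 2(4) BW(1) by blast
  next
    case (3 t)
    then show ?thesis using BW(1) E0_cases [of x] aE_in by blast
  qed
  ultimately show "x \<in> topspace X - (B \<union> \<Union>E0)" by blast
next
  fix x assume x: "x \<in> topspace X - (B \<union> \<Union>E0)"
  have wit: "x \<in> \<Union>(star ` W)" if "c \<in> W" "x \<in> star c" for c
    using that by blast
  show "x \<in> \<Union>(star ` W)"
  proof (cases "x \<in> V")
    case True
    have "x \<in> W"
    proof (rule ccontr)
      assume "x \<notin> W"
      then have "x \<in> V - (B \<union> W)" using True x by blast
      then obtain f where f: "f \<in> F" "wV f = x" using unlabelled_flag by metis
      then have "x \<in> aE f" using edge_mem [OF aE_in [OF f(1)], of 1] aE_1 [OF f(1)] by simp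
      then show False using aE_subset_E0 [OF f(1)] x by blast
    qed
    then show ?thesis using wit [of x] by (simp add: star_def)
  next
    case xV: False
    show ?thesis
    proof (cases "x \<in> \<Union>E")
      case True
      then obtain e where e: "e \<in> E" "x \<in> e" by blast
      obtain f where f: "f \<in> F" "e = cE f \<or> e = aE f" using edge_flag [OF e(1)] by metis
      have ecE: "e = cE f" using f aE_subset_E0 [OF f(1)] x e(2) by blast
      obtain s where s: "0 < s" "s < 1" "x = \<gamma> e s" using edge_cases_nonvertex [OF e xV] by metis
      have "x \<in> \<gamma> e ` {0<..<1}" using s by simp
      then have "x \<in> star (\<gamma> e 0)" using e(1) unfolding star_def by blast
      then show ?thesis using wit cE_0_W [OF f(1)] ecE by metis
    next
      case False
      then obtain t where t: "t \<in> T" "x \<in> t" using x xV Union_tiles by blast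
      then have "x \<in> star (c2 t)" unfolding star_def by blast
      then show ?thesis using wit corner2 [OF t(1)] unfolding c2_def by metis
    qed
  qed
qed

lemma tiles_E0: "tiles X B E0 = star ` W"
  unfolding tiles_def
proof (rule connected_components_of_eqI)
  show "openin X u" "connectedin X u" if "u \<in> star ` W" for u
    using that disk_exists by blast+
  show "u \<noteq> {}" if "u \<in> star ` W" for u
    using that by (auto simp: star_def)
  show "pairwise disjnt (star ` W)"
    using star_disjoint unfolding pairwise_def disjnt_def by blast
qed (rule Union_star)

theorem is_subdivision: "tiling X B E0" "quadrilateral_subdivision X B E0 V E"
proof -
  obtain N P where NP: "\<And>c. c \<in> W \<Longrightarrow> 3 \<le> N c \<and> polygon_map X B E0 (star c) (N c) (P c) \<and> P c 0 = c \<and>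
    (\<forall>i<N c. \<exists>f\<in>F. P c ` closed_segment 0 (boundary_point (N c) (real i + 1/2)) = cE f \<and>
      side (N c) (P c) i ` {0..1} = jE f \<and> side (N c) (P c) i (1/2) = wV f) \<and>
    (\<forall>f\<in>F. c2 (fst f) = c \<longrightarrow> (\<exists>i<N c. P c ` closed_segment 0 (boundary_point (N c) (real i + 1/2)) = cE f))"
    using disk_exists by metis
  show "tiling X B E0"
    unfolding tiling_def tiles_E0
  proof (intro conjI ballI)
    fix t assume "t \<in> star ` W"
    then obtain c where c: "c \<in> W" "t = star c" by blast
    then have p: "polygon_map X B E0 t (N c) (P c)" "3 \<le> N c" using NP by auto
    then show "\<exists>n\<ge>3. \<exists>\<phi>. polygon_map X B E0 t n \<phi>" by blast
    show "subtopology X t homeomorphic_space top_of_set (ball (0::complex) 1)"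
      using p(1) homeomorphic_map_imp_homeomorphic_space homeomorphic_space_sym unfolding polygon_map_def by blast
  qed (use embedded_E0 degree_E0 in auto)
  \<comment> \<open>Recovers the center from the star as a set, because parametrisations are indexed
    by tiles.\<close>
  define k where "k t = (SOME c. c \<in> W \<and> star c = t)" for t
  have k: "k (star c) = c" if c: "c \<in> W" for c
  proof -
    have "k (star c) \<in> W \<and> star (k (star c)) = star c"
      unfolding k_def by (rule someI [of _ c]) (use c in simp)
    moreover have "c \<in> star c" by (simp add: star_def)
    ultimately show ?thesis using star_disjoint [of c "k (star c)" c] c by metis
  qed
  \<comment> \<open>One flag for each joined edge: the flags at its middle give the same edge and
    the same middle, possibly in opposite directions.\<close>
  define r where "r e = (SOME f. f \<in> F \<and> jE f = e)" for e
  have r: "r (jE f) \<in> F" "jE (r (jE f)) = jE f" "wV (r (jE f)) = wV f" if f: "f \<in> F" for f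
  proof -
    have "r (jE f) \<in> F \<and> jE (r (jE f)) = jE f"
      unfolding r_def by (rule someI [of _ f]) (use f in simp)
    then show "r (jE f) \<in> F" "jE (r (jE f)) = jE f" "wV (r (jE f)) = wV f"
      using jE_eq_iff f by blast+
  qed
  show "quadrilateral_subdivision X B E0 V E"
    unfolding quadrilateral_subdivision_def tiles_E0
  proof (intro exI [of _ "\<lambda>e. join (r e)"] exI [of _ "\<lambda>t. N (k t)"] exI [of _ "\<lambda>t. P (k t)"] conjI ballI allI impI)
    fix e assume "e \<in> E0"
    then obtain f where f: "f \<in> F" "e = jE f" unfolding E0_def by blast
    show "edge_path X B (join (r e))" unfolding f(2) by (rule join_path [OF r(1) [OF f(1)]])
    show "join (r e) ` {0..1} = e" unfolding f(2) using join_image(3) [OF r(1) [OF f(1)]] r(2) [OF f(1)] by simp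
  next
    fix t assume "t \<in> star ` W"
    then obtain c where c: "c \<in> W" "t = star c" by blast
    have kt: "k t = c" using k c by blast
    show "polygon_map X B E0 t (N (k t)) (P (k t))" unfolding kt using NP c by blast
    fix j assume "j < N (k t)"
    then obtain f where f: "f \<in> F" "side (N c) (P c) j ` {0..1} = jE f" "side (N c) (P c) j (1/2) = wV f"
      using NP [OF c(1)] unfolding kt by metis
    show "side (N (k t)) (P (k t)) j (1/2) = join (r (side (N (k t)) (P (k t)) j ` {0..1})) (1/2)"
      unfolding kt f(2,3) join_mid [OF r(1) [OF f(1)]] r(3) [OF f(1)] ..
  next
    show "V = B \<union> {join (r e) (1/2) | e. e \<in> E0} \<union> {P (k t) 0 | t. t \<in> star ` W}" (is "_ = B \<union> ?M \<union> ?C")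
    proof -
      have "?C = W"
      proof (intro equalityI subsetI)
        fix x assume "x \<in> ?C"
        then obtain c where c: "c \<in> W" "x = P (k (star c)) 0" by blast
        then show "x \<in> W" using k [OF c(1)] NP [OF c(1)] by simp
      next
        fix x assume "x \<in> W"
        then have "x = P (k (star x)) 0" "star x \<in> star ` W" using k NP by simp_all
        then show "x \<in> ?C" by blast
      qed
      moreover have "?M = V - (B \<union> W)"
      proof (intro equalityI subsetI)
        fix x assume "x \<in> ?M"
        then obtain f where f: "f \<in> F" "x = join (r (jE f)) (1/2)" unfolding E0_def by blast
        then have "x = wV f" using join_mid [OF r(1) [OF f(1)]] r(3) [OF f(1)] by simp
        then show "x \<in> V - (B \<union> W)" using wV_unlabelled [OF f(1)] by simp
      next
        fix x assume "x \<in> V - (B \<union> W)"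
        then obtain f where f: "f \<in> F" "wV f = x" using unlabelled_flag by metis
        then have "x = join (r (jE f)) (1/2)" using join_mid [OF r(1) [OF f(1)]] r(3) [OF f(1)] by simp
        then show "x \<in> ?M" using f(1) unfolding E0_def by blast
      qed
      ultimately show ?thesis using BW by blast
    qed
  next
    let ?R = "\<lambda>t j. P (k t) ` closed_segment 0 (boundary_point (N (k t)) (real j + 1/2))"
    show "E = {join (r e) ` {0..1/2} | e. e \<in> E0} \<union> {join (r e) ` {1/2..1} | e. e \<in> E0} \<union>
        {?R t j | t j. t \<in> star ` W \<and> j < N (k t)}" (is "_ = ?L1 \<union> ?L2 \<union> ?L3")
    proof (intro equalityI subsetI)
      fix e assume e: "e \<in> E"
      obtain f where f: "f \<in> F" "e = cE f \<or> e = aE f" using edge_flag [OF e] by metis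
      from f(2) show "e \<in> ?L1 \<union> ?L2 \<union> ?L3"
      proof
        assume ecE: "e = cE f"
        let ?c = "c2 (fst f)"
        have c: "?c \<in> W" using cE_0_W [OF f(1)] cE_0 [OF f(1)] by simp
        then obtain i where "i < N ?c" "P ?c ` closed_segment 0 (boundary_point (N ?c) (real i + 1/2)) = cE f"
          using NP [OF c] f(1) by blast
        then have "i < N (k (star ?c))" "e = ?R (star ?c) i" unfolding k [OF c] ecE by auto
        then show ?thesis using c by blast
      next
        assume eaE: "e = aE f"
        \<comment> \<open>The chosen flag need not be \<open>f\<close>, but the edges from \<bullet>
          at their common vertex are just the two halves of its joined edge.\<close>
        let ?g = "r (jE f)"
        have "e \<in> {e \<in> E. \<gamma> e 0 \<in> B \<and> \<gamma> e 1 = wV ?g}"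
          using e eaE aE_0 [OF f(1)] aE_1 [OF f(1)] r(3) [OF f(1)] by simp
        then have "e = aE ?g \<or> e = aE (\<beta> ?g)" unfolding edges_at_w [OF r(1) [OF f(1)]] by blast
        moreover have "jE f \<in> E0" using f(1) unfolding E0_def by blast
        ultimately show ?thesis using join_image(1,2) [OF r(1) [OF f(1)]] by blast
      qed
    next
      fix e assume "e \<in> ?L1 \<union> ?L2 \<union> ?L3"
      then consider f where "f \<in> F" "e = join (r (jE f)) ` {0..1/2} \<or> e = join (r (jE f)) ` {1/2..1}"
        | c j where "c \<in> W" "j < N (k (star c))" "e = ?R (star c) j"
        unfolding E0_def by blast
      then show "e \<in> E"
      proof cases
        case (1 f)
        then show ?thesis
          using join_image(1,2) [OF r(1) [OF 1(1)]] aE_in r(1) [OF 1(1)] \<beta>(1) by metis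
      next
        case (2 c j)
        then obtain f where "f \<in> F" "e = cE f" using NP [OF 2(1)] unfolding k [OF 2(1)] by metis
        then show ?thesis using cE_in by blast
      qed
    qed
  qed
qed

end

section \<open>The two directions of the equivalence\<close>

lemma polygon_4_sides_neq:
  assumes inj: "\<forall>x\<in>sphere 0 1. \<forall>y\<in>sphere 0 1. \<phi> x = \<phi> y \<longrightarrow> x = y \<or> {x, y} = {boundary_point 4 1, boundary_point 4 3}"
    and jk: "j < 4" "k < 4" "j \<noteq> k"
  shows "side 4 \<phi> j ` {0..1} \<noteq> side 4 \<phi> k ` {0..1}"
proof
  assume eq: "side 4 \<phi> j ` {0..1} = side 4 \<phi> k ` {0..1}"
  \<comment> \<open>The middle of a side is identified with no other boundary point, as only the
    corners \<open>1\<close> and \<open>3\<close> may be.\<close>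
  have "side 4 \<phi> j (1/2) \<in> side 4 \<phi> k ` {0..1}" unfolding eq [symmetric] by simp
  then obtain s where s: "0 \<le> s" "s \<le> 1" "\<phi> (boundary_point 4 (real j + 1/2)) = \<phi> (boundary_point 4 (real k + s))"
    by (auto simp: side_def)
  have "boundary_point 4 x \<in> sphere 0 1" for x by (simp add: boundary_point_def)
  then have "boundary_point 4 (real j + 1/2) \<in> {boundary_point 4 (real k + s), boundary_point 4 1, boundary_point 4 3}"
    using inj s(3) by blast
  then obtain x where x: "x \<in> {real k + s, 1, 3}" "boundary_point 4 (real j + 1/2) = boundary_point 4 x" by blast
  have j: "real j \<le> 3" "real k \<le> 3" using jk by linarith+
  have "real j + 1/2 = x"
    by (rule boundary_point_inj [of 4]) (use x j s in auto)
  then consider "real j + 1/2 = real k + s" | "real j + 1/2 = 1" | "real j + 1/2 = 3" using x(1) by blast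
  then show False
  proof cases
    case 1
    then have "real j < real k + 1" "real k < real j + 1" using s by linarith+
    then show False using jk(3) by linarith
  next
    case 2
    then have "2 * real j = 1" by linarith
    then have "real (2 * j) = real 1" by simp
    then have "2 * j = 1" by (simp only: of_nat_eq_iff)
    then show False by presburger
  next
    case 3
    then have "2 * real j = 5" by linarith
    then have "real (2 * j) = real 5" by simp
    then have "2 * j = 5" by (simp only: of_nat_eq_iff)
    then show False by presburger
  qed
qed

text \<open>What the two types share, so that the reconstruction makes no case distinction: type
  \<open>Q\<close> is the case in which the permitted identification of corners \<open>1\<close> and
  \<open>3\<close> does not occur.\<close>

lemma type_Q_or_Q':
  assumes "type_Q X V E B W t \<or> type_Q' X V E B W t"
  shows "\<exists>\<phi>. polygon_map X V E t 4 \<phi> \<and> corner 4 \<phi> 0 \<in> B \<and> corner 4 \<phi> 2 \<in> W \<and>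
    corner 4 \<phi> 1 \<in> V - (B \<union> W) \<and> corner 4 \<phi> 3 \<in> V - (B \<union> W) \<and>
    degree V E (corner 4 \<phi> 1) = 4 \<and> degree V E (corner 4 \<phi> 3) = 4 \<and>
    (\<forall>x\<in>sphere 0 1. \<forall>y\<in>sphere 0 1. \<phi> x = \<phi> y \<longrightarrow> x = y \<or> {x, y} = {boundary_point 4 1, boundary_point 4 3})"
  using assms
proof
  assume "type_Q X V E B W t"
  then obtain \<phi> where "polygon_map X V E t 4 \<phi>" "inj_on \<phi> (sphere 0 1)" "corner 4 \<phi> 0 \<in> B" "corner 4 \<phi> 2 \<in> W"
      "\<forall>j\<in>{1, 3}. corner 4 \<phi> j \<in> V - (B \<union> W) \<and> degree V E (corner 4 \<phi> j) = 4"
    unfolding type_Q_def by blast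
  then show ?thesis by (intro exI [of _ \<phi>]) (auto simp: inj_on_def)
next
  assume "type_Q' X V E B W t"
  then show ?thesis unfolding type_Q'_def by (elim exE conjE, intro exI conjI; (assumption | simp))
qed

text \<open>Edges are parametrised from their labelled ends before the polygon maps are normalised,
  since normalised sides follow the given parametrisation. Such a direction exists because labelled
  and unlabelled corners of a tile alternate.\<close>

lemma labelling_imp_subdivision:
  assumes X: "closed_surface X" and q: "quadrilateral_tiling X V E"
    and BW: "B \<subseteq> V" "W \<subseteq> V" "B \<inter> W = {}"
    and types: "\<And>t. t \<in> tiles X V E \<Longrightarrow> type_Q X V E B W t \<or> type_Q' X V E B W t"
  shows "\<exists>V0 E0. tiling X V0 E0 \<and> quadrilateral_subdivision X V0 E0 V E"
proof -
  have graph: "embedded_graph X V E" and deg: "\<And>v. v \<in> V \<Longrightarrow> 3 \<le> degree V E v"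
    using q by (auto simp: quadrilateral_tiling_def tiling_def)
  obtain \<phi> where \<phi>: "\<And>t. t \<in> tiles X V E \<Longrightarrow> polygon_map X V E t 4 (\<phi> t) \<and> corner 4 (\<phi> t) 0 \<in> B \<and> corner 4 (\<phi> t) 2 \<in> W \<and>
    corner 4 (\<phi> t) 1 \<in> V - (B \<union> W) \<and> corner 4 (\<phi> t) 3 \<in> V - (B \<union> W) \<and>
    degree V E (corner 4 (\<phi> t) 1) = 4 \<and> degree V E (corner 4 (\<phi> t) 3) = 4 \<and>
    (\<forall>x\<in>sphere 0 1. \<forall>y\<in>sphere 0 1. \<phi> t x = \<phi> t y \<longrightarrow> x = y \<or> {x, y} = {boundary_point 4 1, boundary_point 4 3})"
    using type_Q_or_Q' [OF types] by metis
  have poly: "polygon_map X V E t 4 (\<phi> t)" if "t \<in> tiles X V E" for t using \<phi> that by blast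
  have "\<exists>g. (edge_path X V g \<and> g ` {0..1} = e) \<and> g 0 \<in> B \<union> W \<and> g 1 \<notin> B \<union> W" if e: "e \<in> E" for e
  proof -
    have "card {(t, j). t \<in> tiles X V E \<and> j < 4 \<and> side 4 (\<phi> t) j ` {0..1} = e} = 2"
      by (rule card_sides_eq_2 [OF X graph poly e])
    then have "{(t, j). t \<in> tiles X V E \<and> j < 4 \<and> side 4 (\<phi> t) j ` {0..1} = e} \<noteq> {}" by fastforce
    then obtain t j where t: "t \<in> tiles X V E" "j < 4" "side 4 (\<phi> t) j ` {0..1} = e" by blast
    let ?g = "side 4 (\<phi> t) j"
    have g: "edge_path X V ?g" using polygon_mapD(5) [OF poly [OF t(1)] t(2)] .
    have ends: "?g 0 = corner 4 (\<phi> t) j" "?g 1 = corner 4 (\<phi> t) (j + 1)"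
      by (simp_all add: side_def corner_def add.commute)
    have c4: "corner 4 (\<phi> t) 4 = corner 4 (\<phi> t) 0"
      using boundary_point_add_period [of 4 0] by (simp add: corner_def)
    have "j = 0 \<or> j = 2 \<or> j = 1 \<or> j = 3" using t(2) by linarith
    then have "?g 0 \<in> B \<union> W \<and> ?g 1 \<notin> B \<union> W \<or> ?g 1 \<in> B \<union> W \<and> ?g 0 \<notin> B \<union> W"
      unfolding ends using \<phi> [OF t(1)] c4 by (elim disjE) (auto simp: numeral_eq_Suc)
    then show ?thesis
    proof
      assume "?g 0 \<in> B \<union> W \<and> ?g 1 \<notin> B \<union> W"
      then show ?thesis using g t(3) by blast
    next
      assume "?g 1 \<in> B \<union> W \<and> ?g 0 \<notin> B \<union> W"
      then show ?thesis
        using edge_path_reverse [OF g] image_reverse_unit [of ?g] t(3)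
        by (intro exI [of _ "\<lambda>s. ?g (1 - s)"]) simp
    qed
  qed
  then obtain \<gamma> where \<gamma>: "\<And>e. e \<in> E \<Longrightarrow> (edge_path X V (\<gamma> e) \<and> \<gamma> e ` {0..1} = e) \<and> \<gamma> e 0 \<in> B \<union> W \<and> \<gamma> e 1 \<notin> B \<union> W"
    by metis
  obtain \<psi> where fam: "polygon_family X V E \<gamma> (\<lambda>_. 4) \<psi>"
    and sides: "\<And>t j. \<lbrakk>t \<in> tiles X V E; j < 4\<rbrakk> \<Longrightarrow> side 4 (\<psi> t) j ` {0..1} = side 4 (\<phi> t) j ` {0..1}"
    and corners: "\<And>t j. \<lbrakk>t \<in> tiles X V E; j < 4\<rbrakk> \<Longrightarrow> corner 4 (\<psi> t) j = corner 4 (\<phi> t) j"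
  proof (rule polygon_family_exists [OF X graph, of \<gamma> "\<lambda>_. 4" \<phi>])
    show "edge_path X V (\<gamma> e) \<and> \<gamma> e ` {0..1} = e" if "e \<in> E" for e using \<gamma> [OF that] by blast
  qed (use poly that in blast)+
  interpret P: polygon_family X V E \<gamma> "\<lambda>_. 4" \<psi> by (rule fam)
  have cor: "\<psi> t (boundary_point 4 (real j)) = corner 4 (\<phi> t) j" if "t \<in> tiles X V E" "j < 4" for t j
    using corners [OF that] by (simp add: corner_def)
  interpret L: labelled_quadrilaterals X V E \<gamma> \<psi> B W
  proof
    fix t assume t: "t \<in> tiles X V E"
    note c = cor [OF t, of 0] cor [OF t, of 1] cor [OF t, of 2] cor [OF t, of 3]
    show "\<psi> t (boundary_point 4 0) \<in> B" "\<psi> t (boundary_point 4 2) \<in> W"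
      "\<psi> t (boundary_point 4 1) \<in> V - (B \<union> W)" "\<psi> t (boundary_point 4 3) \<in> V - (B \<union> W)"
      "degree V E (\<psi> t (boundary_point 4 1)) = 4" "degree V E (\<psi> t (boundary_point 4 3)) = 4"
      using c \<phi> [OF t] by simp_all
    have inj: "\<forall>x\<in>sphere 0 1. \<forall>y\<in>sphere 0 1. \<phi> t x = \<phi> t y \<longrightarrow> x = y \<or> {x, y} = {boundary_point 4 1, boundary_point 4 3}"
      using \<phi> [OF t] by blast
    show "side 4 (\<psi> t) 1 ` {0..1} \<noteq> side 4 (\<psi> t) 2 ` {0..1}"
      using sides [OF t] polygon_4_sides_neq [OF inj, of 1 2] by simp
  qed (use BW deg \<gamma> in auto)
  show ?thesis using L.is_subdivision by blast
qed

text \<open>Normalising the polygon maps keeps the centers and, as the sides have the prescribed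
  middles, also the radii; so the subdivided graph of the normalised family is \<open>(V, E)\<close>
  itself.\<close>

lemma subdivision_imp_labelling:
  assumes X: "closed_surface X" and tl: "tiling X V0 E0" and sub: "quadrilateral_subdivision X V0 E0 V E"
  shows "\<exists>B W. B \<subseteq> V \<and> W \<subseteq> V \<and> B \<inter> W = {} \<and>
            (\<forall>t\<in>tiles X V E. type_Q X V E B W t \<or> type_Q' X V E B W t)"
proof -
  have graph: "embedded_graph X V0 E0" and deg: "\<And>v. v \<in> V0 \<Longrightarrow> 3 \<le> degree V0 E0 v"
    and ex3: "\<And>t. t \<in> tiles X V0 E0 \<Longrightarrow> \<exists>n\<ge>3. \<exists>\<phi>. polygon_map X V0 E0 t n \<phi>"
    using tl by (auto simp: tiling_def)
  obtain \<gamma> n \<phi> where edge: "\<forall>e\<in>E0. edge_path X V0 (\<gamma> e) \<and> \<gamma> e ` {0..1} = e"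
    and poly: "\<forall>t\<in>tiles X V0 E0. polygon_map X V0 E0 t (n t) (\<phi> t) \<and>
           (\<forall>j<n t. side (n t) (\<phi> t) j (1/2) = \<gamma> (side (n t) (\<phi> t) j ` {0..1}) (1/2))"
    and V: "V = V0 \<union> {\<gamma> e (1/2) | e. e \<in> E0} \<union> {\<phi> t 0 | t. t \<in> tiles X V0 E0}"
    and E: "E = {\<gamma> e ` {0..1/2} | e. e \<in> E0} \<union> {\<gamma> e ` {1/2..1} | e. e \<in> E0} \<union>
             {\<phi> t ` closed_segment 0 (boundary_point (n t) (real j + 1/2)) | t j.
                t \<in> tiles X V0 E0 \<and> j < n t}"
    using sub unfolding quadrilateral_subdivision_def by (elim exE conjE)
  have poly': "polygon_map X V0 E0 t (n t) (\<phi> t)" if "t \<in> tiles X V0 E0" for t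
    using poly that by blast
  have mid: "side (n t) (\<phi> t) j (1/2) = \<gamma> (side (n t) (\<phi> t) j ` {0..1}) (1/2)" if "t \<in> tiles X V0 E0" "j < n t" for t j
    using poly that by blast
  obtain \<phi>' where fam: "polygon_family X V0 E0 \<gamma> n \<phi>'"
    and center: "\<And>t. t \<in> tiles X V0 E0 \<Longrightarrow> \<phi>' t 0 = \<phi> t 0"
    and radii: "\<And>t j r. \<lbrakk>t \<in> tiles X V0 E0; j < n t;
        side (n t) (\<phi> t) j (1/2) = \<gamma> (side (n t) (\<phi> t) j ` {0..1}) (1/2); 0 \<le> r; r \<le> 1\<rbrakk> \<Longrightarrow>
        \<phi>' t (polar (n t) r (real j + 1/2)) = \<phi> t (polar (n t) r (real j + 1/2))"
  proof (rule polygon_family_exists [OF X graph, of \<gamma> n \<phi>])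
    show "edge_path X V0 (\<gamma> e) \<and> \<gamma> e ` {0..1} = e" if "e \<in> E0" for e using edge that by blast
  qed (use poly' that in blast)+
  interpret P: polygon_family X V0 E0 \<gamma> n \<phi>' by (rule fam)
  have n2: "2 \<le> n t" if t: "t \<in> tiles X V0 E0" for t
  proof -
    \<comment> \<open>The number of sides used in the subdivision equals the one that
      \<open>tiling\<close> provides, which is at least \<open>3\<close>.\<close>
    obtain m \<psi> where "3 \<le> m" "polygon_map X V0 E0 t m \<psi>" using ex3 [OF t] by blast
    then show ?thesis using polygon_map_sides_unique [OF X graph poly' t] by fastforce
  qed
  have VV: "V = P.subV"
    unfolding V P.subV_def using center by (intro arg_cong2 [of _ _ _ _ "(\<union>)"] refl) force
  have rad: "\<phi>' t ` closed_segment 0 (boundary_point (n t) (real j + 1/2)) = \<phi> t ` closed_segment 0 (boundary_point (n t) (real j + 1/2))"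
    if "t \<in> tiles X V0 E0" "j < n t" for t j
  proof (intro image_cong refl)
    fix z assume "z \<in> closed_segment 0 (boundary_point (n t) (real j + 1/2))"
    then obtain r where "0 \<le> r" "r \<le> 1" "z = polar (n t) r (real j + 1/2)" unfolding closed_segment_polar by blast
    then show "\<phi>' t z = \<phi> t z" using radii [OF that mid [OF that]] by metis
  qed
  have "{\<phi> t ` closed_segment 0 (boundary_point (n t) (real j + 1/2)) | t j. t \<in> tiles X V0 E0 \<and> j < n t} =
      {\<phi>' t ` closed_segment 0 (boundary_point (n t) (real j + 1/2)) | t j. t \<in> tiles X V0 E0 \<and> j < n t}"
    using rad by (intro Collect_cong) metis
  then have EE: "E = P.subE" unfolding E P.subE_def by (simp only:)
  let ?W = "{\<phi>' t 0 | t. t \<in> tiles X V0 E0}"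
  have "\<forall>t\<in>tiles X V E. type_Q X V E V0 ?W t \<or> type_Q' X V E V0 ?W t"
    unfolding VV EE using P.subdivision_tile_types [OF deg n2] by blast
  moreover have "V0 \<subseteq> V" "?W \<subseteq> V" unfolding VV P.subV_def by blast+
  moreover have "V0 \<inter> ?W = {}" using P.inside_not_graph [of _ 0] by fastforce
  ultimately show ?thesis by (intro exI [of _ V0] exI [of _ ?W] conjI)
qed

theorem theorem3p5:
  fixes X :: "'a topology" and V :: "'a set" and E :: "'a set set"
  assumes "closed_surface X" and "quadrilateral_tiling X V E"
  shows "(\<exists>V\<^sub>0 E\<^sub>0. tiling X V\<^sub>0 E\<^sub>0 \<and> quadrilateral_subdivision X V\<^sub>0 E\<^sub>0 V E) \<longleftrightarrow>
         (\<exists>B W. B \<subseteq> V \<and> W \<subseteq> V \<and> B \<inter> W = {} \<and>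
            (\<forall>t\<in>tiles X V E. type_Q X V E B W t \<or> type_Q' X V E B W t))"
proof
  assume "\<exists>V\<^sub>0 E\<^sub>0. tiling X V\<^sub>0 E\<^sub>0 \<and> quadrilateral_subdivision X V\<^sub>0 E\<^sub>0 V E"
  then obtain V0 E0 where "tiling X V0 E0" "quadrilateral_subdivision X V0 E0 V E" by blast
  then show "\<exists>B W. B \<subseteq> V \<and> W \<subseteq> V \<and> B \<inter> W = {} \<and>
      (\<forall>t\<in>tiles X V E. type_Q X V E B W t \<or> type_Q' X V E B W t)"
    by (rule subdivision_imp_labelling [OF assms(1)])
next
  assume "\<exists>B W. B \<subseteq> V \<and> W \<subseteq> V \<and> B \<inter> W = {} \<and>
      (\<forall>t\<in>tiles X V E. type_Q X V E B W t \<or> type_Q' X V E B W t)"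
  then obtain B W where BW: "B \<subseteq> V" "W \<subseteq> V" "B \<inter> W = {}"
    and types: "\<forall>t\<in>tiles X V E. type_Q X V E B W t \<or> type_Q' X V E B W t" by blast
  show "\<exists>V\<^sub>0 E\<^sub>0. tiling X V\<^sub>0 E\<^sub>0 \<and> quadrilateral_subdivision X V\<^sub>0 E\<^sub>0 V E"
    by (rule labelling_imp_subdivision [OF assms BW bspec [OF types]])
qed

end
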